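(* There exist universal constants $\mathbf{k}\ge 1$ and $\alpha\in(0,1)$ such that, with $$\eta(r):=e^{-\mathfrak{h}r^{-n}},\qquad \mathfrak{h}:=2^{n-1}|\ln\alpha|\left((\mathfrak{r}/4)^n+(\mathbf{D}\sqrt n)^n\right),\qquad q_V:=\mathbf{k}\,\vartheta_V\,(1+\kappa_V^{(1)}),$$ the following holds: for all $0<r<\mathfrak{r}/4$, all $x,y\in\Omega^{4r}$, all $V\in\mathscr{V}$ and all $u\in W^{2,p}(\Omega)$ satisfying $(-\Delta+V)u=0$ in $\Omega$ and $\|u\|_{L^2(\Omega)}=1$, $$\|u\|_{L^2(B(y,r))}\le[q_Vr^{-1}]^{1/(1-\alpha)}\,\|u\|_{L^2(B(x,r))}^{\eta(r)}.$$
   Context: $n\ge 3$ is an integer, $\Omega\subset\mathbb{R}^n$ is a bounded Lipschitz domain, $p:=2n/(n+2)$, $p':=2n/(n-2)$. For $r>0$, $\Omega^r:=\{x\in\Omega:\ \mathrm{dist}(x,\mathbb{R}^n\setminus\Omega)>r\}$. $0<\mathfrak{r}=\mathfrak{r}(\Omega)\le 1$ is a fixed constant such that $\Omega^r$ is nonempty and connected for all $0<r<\mathfrak{r}$ (such a constant exists). $Q$ is the smallest closed cube containing $\overline{\Omega}$ and $\mathbf{D}:=|Q|^{1/n}$. A universal constant depends on none of the data. $\sigma:=\sup\{\|w\|_{L^{p'}(\Omega)}:\ w\in H^1_0(\Omega),\ \|\nabla w\|_{L^2(\Omega)}=1\}$. Let $\Lambda:=\{\lambda>0:\ \mathrm{dist}(\lambda,\mathbb{N}+(n-2)/2)=1/2\}$.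 The constant $\vartheta=\vartheta(n)\ge 1$ is a fixed constant for which the (known, Jerison–Kenig) Carleman inequality $\||x|^{-\lambda}u\|_{L^{p'}(B)}\le\vartheta\||x|^{-\lambda}\Delta u\|_{L^p(B)}$ holds for every ball $B$ centered at $0$, every $\lambda\in\Lambda$ and every $u\in W^{2,p}(B)$ with $\mathrm{supp}(u)\subset B\setminus\{0\}$. For $V\in L^{n/2}(\Omega)$ put $\kappa_V:=\|V\|_{L^{n/2}(\Omega)}$, and $\mathscr{V}:=\{V\in L^{n/2}(\Omega):\ 2\sigma^2\kappa_V<1\ \text{and}\ \vartheta\kappa_V<1\}$. For $V\in\mathscr{V}$: $\mathbf{I}_V:=(1-2\sigma^2\kappa_V)^{-1/2}$, $\kappa_V^{(1)}:=2(1+\sigma)\mathbf{I}_V^2+2\sigma\sqrt{\kappa_V}\,\mathbf{I}_V+\sigma/\sqrt{1+\sigma^2}$, and $\vartheta_V:=\vartheta(1-\vartheta\kappa_V)^{-1}$. *)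

theory Defs
  imports "HOL-Analysis.Analysis"
begin

text \<open>
  The constants of the theorem are independent of the dimension, so the dimension \<open>n\<close> has to be
  quantified inside the statement and cannot be the cardinality of an index type.  Therefore
  \<open>\<real>\<^sup>n\<close> is the carrier \<open>{..<n} \<rightarrow>\<^sub>E UNIV\<close>, i.e. the underlying set of the product topology
  \<open>powertop_real {..<n}\<close> and of the product measure of \<open>n\<close> copies of \<open>lborel\<close>.  The metric is the
  explicit Euclidean one: the library's \<open>dist\<close> on \<open>nat \<Rightarrow> real\<close> is a different metric.
\<close>

definition Rn :: "nat \<Rightarrow> (nat \<Rightarrow> real) set" where
  "Rn n = {..<n} \<rightarrow>\<^sub>E UNIV"

definition leb :: "nat \<Rightarrow> (nat \<Rightarrow> real) measure" where
  "leb n = (\<Pi>\<^sub>M i\<in>{..<n}. lborel)"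

definition origin :: "nat \<Rightarrow> nat \<Rightarrow> real" where
  "origin n = (\<lambda>i\<in>{..<n}. 0)"

definition Rn_norm :: "nat \<Rightarrow> (nat \<Rightarrow> real) \<Rightarrow> real" where
  "Rn_norm n x = L2_set x {..<n}"

definition Rn_dist :: "nat \<Rightarrow> (nat \<Rightarrow> real) \<Rightarrow> (nat \<Rightarrow> real) \<Rightarrow> real" where
  "Rn_dist n x y = Rn_norm n (\<lambda>i. x i - y i)"

definition Rn_ball :: "nat \<Rightarrow> (nat \<Rightarrow> real) \<Rightarrow> real \<Rightarrow> (nat \<Rightarrow> real) set" where
  "Rn_ball n x r = {y \<in> Rn n. Rn_dist n x y < r}"


subsection \<open>Domains\<close>

text \<open>
  Near each boundary point \<open>z\<close> the set is, in the orthonormal frame \<open>e 0, \<dots>, e (n - 1)\<close> centred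
  at \<open>z\<close>, the part of a ball lying strictly above the graph of a Lipschitz function \<open>\<gamma>\<close> of the
  first \<open>n - 1\<close> coordinates.
\<close>

definition orthonormal_frame :: "nat \<Rightarrow> (nat \<Rightarrow> nat \<Rightarrow> real) \<Rightarrow> bool" where
  "orthonormal_frame n e \<longleftrightarrow>
     (\<forall>j<n. \<forall>k<n. (\<Sum>i<n. e j i * e k i) = (if j = k then 1 else 0))"

definition frame_coord ::
    "nat \<Rightarrow> (nat \<Rightarrow> nat \<Rightarrow> real) \<Rightarrow> (nat \<Rightarrow> real) \<Rightarrow> (nat \<Rightarrow> real) \<Rightarrow> nat \<Rightarrow> real" where
  "frame_coord n e z x j = (\<Sum>i<n. (x i - z i) * e j i)"

definition lipschitz_boundary :: "nat \<Rightarrow> (nat \<Rightarrow> real) set \<Rightarrow> bool" where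
  "lipschitz_boundary n \<Omega> \<longleftrightarrow>
     (\<forall>z \<in> powertop_real {..<n} frontier_of \<Omega>.
        \<exists>\<rho>>0. \<exists>e L \<gamma>. orthonormal_frame n e \<and>
          (\<forall>a\<in>Rn (n - 1). \<forall>b\<in>Rn (n - 1). \<bar>\<gamma> a - \<gamma> b\<bar> \<le> L * Rn_dist (n - 1) a b) \<and>
          \<Omega> \<inter> Rn_ball n z \<rho> =
            {x \<in> Rn_ball n z \<rho>.
               \<gamma> (restrict (frame_coord n e z x) {..<n - 1}) < frame_coord n e z x (n - 1)})"

definition bounded_lipschitz_domain :: "nat \<Rightarrow> (nat \<Rightarrow> real) set \<Rightarrow> bool" where
  "bounded_lipschitz_domain n \<Omega> \<longleftrightarrow>
     \<Omega> \<noteq> {} \<and> openin (powertop_real {..<n}) \<Omega> \<and> connectedin (powertop_real {..<n}) \<Omega> \<and>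
     (\<exists>R. \<forall>x\<in>\<Omega>. Rn_norm n x \<le> R) \<and> lipschitz_boundary n \<Omega>"

definition inner_part :: "nat \<Rightarrow> (nat \<Rightarrow> real) set \<Rightarrow> real \<Rightarrow> (nat \<Rightarrow> real) set" where
  "inner_part n \<Omega> r = {x \<in> \<Omega>. (INF y\<in>Rn n - \<Omega>. Rn_dist n x y) > r}"

definition closed_cube :: "nat \<Rightarrow> (nat \<Rightarrow> real) set \<Rightarrow> bool" where
  "closed_cube n Q \<longleftrightarrow> (\<exists>a s. s > 0 \<and> Q = {x \<in> Rn n. \<forall>i<n. a i \<le> x i \<and> x i \<le> a i + s})"

text \<open>The position of such a cube need not be unique, but its volume is.\<close>

definition smallest_cube :: "nat \<Rightarrow> (nat \<Rightarrow> real) set \<Rightarrow> (nat \<Rightarrow> real) set \<Rightarrow> bool" where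
  "smallest_cube n \<Omega> Q \<longleftrightarrow>
     closed_cube n Q \<and> powertop_real {..<n} closure_of \<Omega> \<subseteq> Q \<and>
     (\<forall>Q'. closed_cube n Q' \<and> powertop_real {..<n} closure_of \<Omega> \<subseteq> Q' \<longrightarrow>
        measure (leb n) Q \<le> measure (leb n) Q')"


subsection \<open>Lebesgue and Sobolev spaces\<close>

text \<open>
  Elements of \<open>L\<^sup>p(\<Omega>)\<close> are represented by Borel functions whose values outside \<open>\<Omega>\<close> are
  irrelevant.  The real number \<open>Lp_norm n p \<Omega> f\<close> is the norm only for members of \<open>L\<^sup>p(\<Omega>)\<close>; for
  other functions it is 0 by the convention for Bochner integrals.
\<close>

definition Lp :: "nat \<Rightarrow> real \<Rightarrow> (nat \<Rightarrow> real) set \<Rightarrow> ((nat \<Rightarrow> real) \<Rightarrow> real) set" where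
  "Lp n p \<Omega> = {f. set_borel_measurable (leb n) \<Omega> f \<and>
                  set_integrable (leb n) \<Omega> (\<lambda>x. \<bar>f x\<bar> powr p)}"

definition Lp_norm :: "nat \<Rightarrow> real \<Rightarrow> (nat \<Rightarrow> real) set \<Rightarrow> ((nat \<Rightarrow> real) \<Rightarrow> real) \<Rightarrow> real" where
  "Lp_norm n p \<Omega> f = (LINT x:\<Omega>|leb n. \<bar>f x\<bar> powr p) powr (1 / p)"

definition partial_deriv ::
    "nat \<Rightarrow> ((nat \<Rightarrow> real) \<Rightarrow> real) \<Rightarrow> (nat \<Rightarrow> real) \<Rightarrow> real" where
  "partial_deriv i f x = deriv (\<lambda>t. f (x(i := t))) (x i)"

primrec Ck :: "nat \<Rightarrow> nat \<Rightarrow> ((nat \<Rightarrow> real) \<Rightarrow> real) \<Rightarrow> bool" where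
  "Ck n 0 f \<longleftrightarrow> continuous_map (powertop_real {..<n}) euclideanreal f"
| "Ck n (Suc k) f \<longleftrightarrow> continuous_map (powertop_real {..<n}) euclideanreal f \<and>
     (\<forall>i<n. (\<forall>x\<in>Rn n. (\<lambda>t. f (x(i := t))) differentiable (at (x i))) \<and>
             Ck n k (partial_deriv i f))"

definition test_function :: "nat \<Rightarrow> (nat \<Rightarrow> real) set \<Rightarrow> ((nat \<Rightarrow> real) \<Rightarrow> real) \<Rightarrow> bool" where
  "test_function n \<Omega> \<phi> \<longleftrightarrow> (\<forall>k. Ck n k \<phi>) \<and>
     (\<exists>K. compactin (powertop_real {..<n}) K \<and> K \<subseteq> \<Omega> \<and> (\<forall>x\<in>Rn n - K. \<phi> x = 0))"

definition locally_integrable ::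
    "nat \<Rightarrow> (nat \<Rightarrow> real) set \<Rightarrow> ((nat \<Rightarrow> real) \<Rightarrow> real) \<Rightarrow> bool" where
  "locally_integrable n \<Omega> f \<longleftrightarrow>
     (\<forall>K. compactin (powertop_real {..<n}) K \<and> K \<subseteq> \<Omega> \<longrightarrow> set_integrable (leb n) K f)"

definition weak_partial ::
    "nat \<Rightarrow> (nat \<Rightarrow> real) set \<Rightarrow> nat \<Rightarrow> ((nat \<Rightarrow> real) \<Rightarrow> real) \<Rightarrow> ((nat \<Rightarrow> real) \<Rightarrow> real) \<Rightarrow> bool" where
  "weak_partial n \<Omega> i f g \<longleftrightarrow> locally_integrable n \<Omega> f \<and> locally_integrable n \<Omega> g \<and>
     (\<forall>\<phi>. test_function n \<Omega> \<phi> \<longrightarrow>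
        (LINT x:\<Omega>|leb n. f x * partial_deriv i \<phi> x) = - (LINT x:\<Omega>|leb n. g x * \<phi> x))"

primrec sobolev ::
    "nat \<Rightarrow> nat \<Rightarrow> real \<Rightarrow> (nat \<Rightarrow> real) set \<Rightarrow> ((nat \<Rightarrow> real) \<Rightarrow> real) set" where
  "sobolev n 0 p \<Omega> = Lp n p \<Omega>"
| "sobolev n (Suc k) p \<Omega> =
     {f \<in> Lp n p \<Omega>. \<forall>i<n. \<exists>g \<in> sobolev n k p \<Omega>. weak_partial n \<Omega> i f g}"

definition weak_gradient ::
    "nat \<Rightarrow> (nat \<Rightarrow> real) set \<Rightarrow> ((nat \<Rightarrow> real) \<Rightarrow> real) \<Rightarrow> (nat \<Rightarrow> (nat \<Rightarrow> real) \<Rightarrow> real) \<Rightarrow> bool" where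
  "weak_gradient n \<Omega> f g \<longleftrightarrow> (\<forall>i<n. weak_partial n \<Omega> i f (g i))"

definition weak_laplacian ::
    "nat \<Rightarrow> (nat \<Rightarrow> real) set \<Rightarrow> ((nat \<Rightarrow> real) \<Rightarrow> real) \<Rightarrow> ((nat \<Rightarrow> real) \<Rightarrow> real) \<Rightarrow> bool" where
  "weak_laplacian n \<Omega> f F \<longleftrightarrow>
     (\<exists>g h. weak_gradient n \<Omega> f g \<and> (\<forall>i<n. weak_partial n \<Omega> i (g i) (h i)) \<and>
            F = (\<lambda>x. \<Sum>i<n. h i x))"

text \<open>The closure of the test functions in \<open>H\<^sup>1(\<Omega>) = W\<^sup>1\<^sup>,\<^sup>2(\<Omega>)\<close>.\<close>

definition H10 :: "nat \<Rightarrow> (nat \<Rightarrow> real) set \<Rightarrow> ((nat \<Rightarrow> real) \<Rightarrow> real) set" where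
  "H10 n \<Omega> = {w \<in> sobolev n 1 2 \<Omega>. \<exists>g \<phi>.
     weak_gradient n \<Omega> w g \<and> (\<forall>i<n. g i \<in> Lp n 2 \<Omega>) \<and>
     (\<forall>m. test_function n \<Omega> (\<phi> m)) \<and>
     (\<lambda>m. Lp_norm n 2 \<Omega> (\<lambda>x. \<phi> m x - w x)) \<longlonglongrightarrow> 0 \<and>
     (\<forall>i<n. (\<lambda>m. Lp_norm n 2 \<Omega> (\<lambda>x. partial_deriv i (\<phi> m) x - g i x)) \<longlonglongrightarrow> 0)}"


subsection \<open>The constants\<close>

definition exp_p :: "nat \<Rightarrow> real" where
  "exp_p n = 2 * real n / (real n + 2)"

definition exp_p' :: "nat \<Rightarrow> real" where
  "exp_p' n = 2 * real n / (real n - 2)"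

definition sobolev_const :: "nat \<Rightarrow> (nat \<Rightarrow> real) set \<Rightarrow> real" where
  "sobolev_const n \<Omega> = Sup {Lp_norm n (exp_p' n) \<Omega> w | w g.
     w \<in> H10 n \<Omega> \<and> weak_gradient n \<Omega> w g \<and>
     Lp_norm n 2 \<Omega> (\<lambda>x. Rn_norm n (\<lambda>i. g i x)) = 1}"

definition carleman_exponents :: "nat \<Rightarrow> real set" where
  "carleman_exponents n = {l. l > 0 \<and> infdist l (range (\<lambda>m::nat. real m + (real n - 2) / 2)) = 1 / 2}"

text \<open>
  The support condition means that the essential support of \<open>u\<close> is a compact subset of the
  punctured ball; in particular \<open>u\<close> vanishes near the boundary of the ball.  The membership in the
  conclusion says that the left-hand side of the inequality is finite.
\<close>

definition carleman_const :: "nat \<Rightarrow> real \<Rightarrow> bool" where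
  "carleman_const n \<theta> \<longleftrightarrow>
     (\<forall>\<rho>>0. \<forall>l \<in> carleman_exponents n. \<forall>u \<in> sobolev n 2 (exp_p n) (Rn_ball n (origin n) \<rho>). \<forall>F K.
        weak_laplacian n (Rn_ball n (origin n) \<rho>) u F \<and>
        compactin (powertop_real {..<n}) K \<and> K \<subseteq> Rn_ball n (origin n) \<rho> - {origin n} \<and>
        (AE x in leb n. x \<in> Rn_ball n (origin n) \<rho> - K \<longrightarrow> u x = 0) \<longrightarrow>
        (\<lambda>x. Rn_norm n x powr (- l) * u x) \<in> Lp n (exp_p' n) (Rn_ball n (origin n) \<rho>) \<and>
        Lp_norm n (exp_p' n) (Rn_ball n (origin n) \<rho>) (\<lambda>x. Rn_norm n x powr (- l) * u x)
          \<le> \<theta> * Lp_norm n (exp_p n) (Rn_ball n (origin n) \<rho>) (\<lambda>x. Rn_norm n x powr (- l) * F x))"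

definition kappa :: "nat \<Rightarrow> (nat \<Rightarrow> real) set \<Rightarrow> ((nat \<Rightarrow> real) \<Rightarrow> real) \<Rightarrow> real" where
  "kappa n \<Omega> V = Lp_norm n (real n / 2) \<Omega> V"

definition potentials :: "nat \<Rightarrow> (nat \<Rightarrow> real) set \<Rightarrow> real \<Rightarrow> ((nat \<Rightarrow> real) \<Rightarrow> real) set" where
  "potentials n \<Omega> \<theta> = {V \<in> Lp n (real n / 2) \<Omega>.
     2 * (sobolev_const n \<Omega>)\<^sup>2 * kappa n \<Omega> V < 1 \<and> \<theta> * kappa n \<Omega> V < 1}"

definition I_const :: "nat \<Rightarrow> (nat \<Rightarrow> real) set \<Rightarrow> ((nat \<Rightarrow> real) \<Rightarrow> real) \<Rightarrow> real" where
  "I_const n \<Omega> V = (1 - 2 * (sobolev_const n \<Omega>)\<^sup>2 * kappa n \<Omega> V) powr (- 1 / 2)"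

definition kappa1 :: "nat \<Rightarrow> (nat \<Rightarrow> real) set \<Rightarrow> ((nat \<Rightarrow> real) \<Rightarrow> real) \<Rightarrow> real" where
  "kappa1 n \<Omega> V =
     2 * (1 + sobolev_const n \<Omega>) * (I_const n \<Omega> V)\<^sup>2
     + 2 * sobolev_const n \<Omega> * sqrt (kappa n \<Omega> V) * I_const n \<Omega> V
     + sobolev_const n \<Omega> / sqrt (1 + (sobolev_const n \<Omega>)\<^sup>2)"

definition theta_V ::
    "nat \<Rightarrow> (nat \<Rightarrow> real) set \<Rightarrow> real \<Rightarrow> ((nat \<Rightarrow> real) \<Rightarrow> real) \<Rightarrow> real" where
  "theta_V n \<Omega> \<theta> V = \<theta> / (1 - \<theta> * kappa n \<Omega> V)"

definition q_const ::
    "nat \<Rightarrow> (nat \<Rightarrow> real) set \<Rightarrow> real \<Rightarrow> real \<Rightarrow> ((nat \<Rightarrow> real) \<Rightarrow> real) \<Rightarrow> real" where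
  "q_const n \<Omega> \<theta> k V = k * theta_V n \<Omega> \<theta> V * (1 + kappa1 n \<Omega> V)"

definition h_const :: "nat \<Rightarrow> real \<Rightarrow> real \<Rightarrow> real \<Rightarrow> real" where
  "h_const n \<alpha> r\<^sub>0 D = 2 ^ (n - 1) * \<bar>ln \<alpha>\<bar> * ((r\<^sub>0 / 4) ^ n + (D * sqrt (real n)) ^ n)"

definition eta :: "nat \<Rightarrow> real \<Rightarrow> real \<Rightarrow> real \<Rightarrow> real \<Rightarrow> real" where
  "eta n \<alpha> r\<^sub>0 D r = exp (- h_const n \<alpha> r\<^sub>0 D / r ^ n)"

end

theory Submission
  imports Defs
begin

text \<open>
  A solution is mollified, so that only smooth functions have to be differentiated.  Testing the
  equation with the squared cutoff times the solution gives the Caccioppoli inequality, because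
  \<open>2 \<sigma>\<^sup>2 \<kappa> < 1\<close> absorbs the potential.  In the Carleman inequality for the solution times the cutoff of
  an annulus, \<open>\<theta> \<kappa> < 1\<close> absorbs the potential as well, and only commutator terms on the two layers where
  the cutoff varies remain; these are controlled by Caccioppoli.  Choosing the exponent well yields a
  three-ball inequality whose constant is linear in the dimension and whose exponent is a multiple
  of \<open>1 / n\<close>.  Taking an \<open>n\<close>-th root makes the constant universal.

  The inequality propagates along chains of balls with steps shorter than \<open>2 r\<close>.  A shortest chain meets
  each cell of diameter \<open>2 r\<close> of a cubic grid at most twice, so its length is smaller than the number
  of steps that \<open>\<eta>(r)\<close> allows for by a factor exponential in \<open>n\<close>.  This factor compensates the loss
  in the exponent.
\<close>

text \<open>Membership in \<open>sobolev n 2 (exp_p n)\<close> gives by definition only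
  integrability with exponent \<open>p = 2n/(n+2) < 2\<close>, too little for the product with the
  potential to lie in \<open>L^p\<close>. Local integrability with exponent \<open>p'\<close> is
  therefore obtained beforehand, from the same Carleman inequality with its pole placed outside the
  support: there the weight is bounded above and below. Mollifications then solve the equation up to
  an error tending to 0 in \<open>L^p\<close>, which is why the smooth estimates carry an error term
  whose constant is left unspecified. Absorption by means of \<open>sobolev_const\<close>
  presupposes that this supremum is finite; hence the Gagliardo-Nirenberg-Sobolev inequality. In the
  variable \<open>t = |x - z|^2 / r^2\<close> the three sets are \<open>t < 1\<close>,
  \<open>t < 9\<close> and \<open>t <= 15\<close>: a step shorter than \<open>2 r\<close> puts the
  next ball inside \<open>t < 9\<close>, and \<open>inner_part\<close> at \<open>4 r\<close> makes
  \<open>t <= 16\<close> available. The value \<open>1 / 80\<close> stems from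
  \<open>(3 / sqrt 10) ^ 40 <= 1 / 6\<close>, with a further factor 2 from balancing two powers. The
  root may be taken because all norms are at most 1.\<close>

abbreviation Rtop :: "nat \<Rightarrow> (nat \<Rightarrow> real) topology" where
  "Rtop n \<equiv> powertop_real {..<n}"

text \<open>Balls, cutoffs and kernels are built from the squared distance: unlike the distance it
  is a polynomial, so no smoothness question arises at the centre.\<close>

definition sq_dist :: "nat \<Rightarrow> (nat \<Rightarrow> real) \<Rightarrow> (nat \<Rightarrow> real) \<Rightarrow> real" where
  "sq_dist n z x = (\<Sum>i<n. (x i - z i)\<^sup>2)"

lemma topspace_Rtop [simp]: "topspace (Rtop n) = Rn n"
  by (simp add: Rn_def topspace_product_topology)

declare topspace_product_topology [simp del]

lemma space_leb [simp]: "space (leb n) = Rn n"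
  by (simp add: leb_def Rn_def space_PiM)

lemma Rn_upd [simp]: "x \<in> Rn n \<Longrightarrow> i < n \<Longrightarrow> x(i := t) \<in> Rn n"
  unfolding Rn_def by (auto simp: PiE_iff extensional_def)

lemma restrict_in_Rn [simp]: "restrict x {..<n} \<in> Rn n"
  unfolding Rn_def by auto

lemma restrict_Rn: "x \<in> Rn n \<Longrightarrow> restrict x {..<n} = x"
  unfolding Rn_def by (rule PiE_restrict)

lemma Rn_undef: "x \<in> Rn n \<Longrightarrow> \<not> k < n \<Longrightarrow> x k = undefined"
  unfolding Rn_def by (auto simp: PiE_iff extensional_def)

lemma PiE_Rn: "x \<in> Pi\<^sub>E {..<n} X \<longleftrightarrow> x \<in> Rn n \<and> (\<forall>i<n. x i \<in> X i)"
  unfolding Rn_def by (auto simp: PiE_iff)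

lemma sq_dist_nonneg [simp]: "0 \<le> sq_dist n z x"
  by (simp add: sq_dist_def sum_nonneg)

lemma sq_dist_commute: "sq_dist n z x = sq_dist n x z"
  by (simp add: sq_dist_def power2_commute)

lemma sq_dist_self [simp]: "sq_dist n z z = 0"
  by (simp add: sq_dist_def)

lemma Rn_dist_sq_dist: "Rn_dist n x y = sqrt (sq_dist n x y)"
  by (simp add: Rn_dist_def Rn_norm_def L2_set_def sq_dist_def power2_commute)

lemma Rn_dist_nonneg [simp]: "0 \<le> Rn_dist n x y"
  by (simp add: Rn_dist_sq_dist)

lemma Rn_dist_commute: "Rn_dist n x y = Rn_dist n y x"
  by (simp add: Rn_dist_sq_dist sq_dist_commute)

lemma Rn_dist_triangle: "Rn_dist n x z \<le> Rn_dist n x y + Rn_dist n y z"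
proof -
  have "Rn_dist n x z = L2_set (\<lambda>i. (x i - y i) + (y i - z i)) {..<n}"
    by (simp add: Rn_dist_def Rn_norm_def)
  also have "\<dots> \<le> Rn_dist n x y + Rn_dist n y z"
    unfolding Rn_dist_def Rn_norm_def by (rule L2_set_triangle_ineq)
  finally show ?thesis .
qed

lemma Rn_dist_self [simp]: "Rn_dist n x x = 0"
  by (simp add: Rn_dist_sq_dist)

lemma coord_le_sq_dist: "i < n \<Longrightarrow> (x i - z i)\<^sup>2 \<le> sq_dist n z x"
  unfolding sq_dist_def by (rule member_le_sum) auto

lemma coord_le_dist: "i < n \<Longrightarrow> \<bar>x i - z i\<bar> \<le> Rn_dist n z x"
  using real_sqrt_le_mono[OF coord_le_sq_dist, of i n x z] by (simp add: Rn_dist_sq_dist)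

lemma sq_dist_le_iff: "0 \<le> r \<Longrightarrow> sq_dist n z x \<le> r\<^sup>2 \<longleftrightarrow> Rn_dist n z x \<le> r"
  using real_sqrt_le_iff[of "sq_dist n z x" "r\<^sup>2"] by (simp add: Rn_dist_sq_dist)

lemma sq_dist_less_iff: "0 \<le> r \<Longrightarrow> sq_dist n z x < r\<^sup>2 \<longleftrightarrow> Rn_dist n z x < r"
  using real_sqrt_less_iff[of "sq_dist n z x" "r\<^sup>2"] by (simp add: Rn_dist_sq_dist)

section \<open>Topology and Borel measurability on the carrier \<open>Rn n\<close>\<close>

lemma continuous_map_restrict_Rn: "continuous_map euclidean (Rtop n) (\<lambda>x. restrict x {..<n})"
  by (auto simp: continuous_map_componentwise)

text \<open>Truncation maps the space of all sequences continuously onto the carrier, and the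
  carrier sits continuously in that space. Continuity for \<open>Rtop n\<close> thus becomes
  \<open>continuous_on UNIV\<close>, where sequential and Borel arguments are at hand.\<close>

lemma continuous_map_Rn_iff:
  "continuous_map (Rtop n) euclideanreal f \<longleftrightarrow> continuous_on UNIV (\<lambda>x. f (restrict x {..<n}))"
proof
  assume "continuous_map (Rtop n) euclideanreal f"
  with continuous_map_restrict_Rn have "continuous_map euclidean euclideanreal (f \<circ> (\<lambda>x. restrict x {..<n}))"
    by (rule continuous_map_compose)
  then show "continuous_on UNIV (\<lambda>x. f (restrict x {..<n}))"
    by (simp add: o_def)
next
  assume a: "continuous_on UNIV (\<lambda>x. f (restrict x {..<n}))"
  have "continuous_map (Rtop n) (powertop_real UNIV) (\<lambda>x. x)"
  proof (subst continuous_map_componentwise_UNIV, rule)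
    fix k
    show "continuous_map (Rtop n) euclideanreal (\<lambda>x. x k)"
    proof (cases "k < n")
      case True then show ?thesis by (auto intro: continuous_map_product_projection)
    next
      \<comment> \<open>Points of the carrier have the constant value \<open>undefined\<close> in
        every coordinate from \<open>n\<close> on.\<close>
      case False
      have "continuous_map (Rtop n) euclideanreal (\<lambda>x. undefined)" by simp
      then show ?thesis
        by (rule continuous_map_eq) (use False in \<open>simp add: Rn_undef\<close>)
    qed
  qed
  then have "continuous_map (Rtop n) euclidean (\<lambda>x. x)"
    by (simp add: euclidean_product_topology)
  moreover have "continuous_map euclidean euclideanreal (\<lambda>x. f (restrict x {..<n}))"
    using a by simp
  ultimately have "continuous_map (Rtop n) euclideanreal ((\<lambda>x. f (restrict x {..<n})) \<circ> (\<lambda>x. x))"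
    by (rule continuous_map_compose)
  then show "continuous_map (Rtop n) euclideanreal f"
    by (rule continuous_map_eq) (simp add: restrict_Rn)
qed

lemma measurable_id_leb: "(\<lambda>x. x) \<in> measurable (leb n) (PiM UNIV (\<lambda>_. borel))"
proof (rule measurable_PiM_single')
  fix i :: nat
  show "(\<lambda>x. x i) \<in> measurable (leb n) borel"
  proof (cases "i < n")
    case True then show ?thesis unfolding leb_def by measurable (auto simp: True)
  next
    case False
    have "(\<lambda>x. undefined::real) \<in> measurable (leb n) borel" by simp
    then show ?thesis
      by (rule measurable_cong[THEN iffD1, rotated])
         (use False in \<open>simp add: Rn_undef\<close>)
  qed
qed (auto simp: PiE_def)

lemma measurable_restrict_leb: "(\<lambda>x. x) \<in> measurable (leb n) borel"
  using measurable_id_leb[of n] sets_PiM_equal_borel measurable_cong_sets[OF refl, of _ borel] by blast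

lemma continuous_map_measurable:
  assumes "continuous_map (Rtop n) euclideanreal f"
  shows "f \<in> borel_measurable (leb n)"
proof -
  have "(\<lambda>x. f (restrict x {..<n})) \<in> borel_measurable borel"
    using assms by (simp add: continuous_map_Rn_iff borel_measurable_continuous_onI)
  from measurable_compose[OF measurable_restrict_leb this]
  show ?thesis by (rule measurable_cong[THEN iffD1, rotated]) (simp add: restrict_Rn)
qed

text \<open>The product topology is that of the Euclidean metric. A coordinate difference is at most
  the distance, so a small ball fits into an open box; the distance is at most the sum of the
  coordinate differences, so a box of half-side \<open>e / (n + 1)\<close> fits into the ball of
  radius \<open>e\<close>.\<close>

lemma openin_Rtop_iff: "openin (Rtop n) U \<longleftrightarrow> U \<subseteq> Rn n \<and>
    (\<forall>x\<in>U. \<exists>e>0. \<forall>y\<in>Rn n. Rn_dist n x y < e \<longrightarrow> y \<in> U)"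
proof (intro iffI conjI ballI)
  assume U: "openin (Rtop n) U"
  then show "U \<subseteq> Rn n" using openin_subset[OF U] by simp
  fix x assume x: "x \<in> U"
  from U x obtain X where X: "\<forall>i\<in>{..<n}. open (X i)" "x \<in> Pi\<^sub>E {..<n} X" "Pi\<^sub>E {..<n} X \<subseteq> U"
    unfolding openin_product_topology_alt by auto
  have "\<exists>e>0. \<forall>t. dist t (x i) < e \<longrightarrow> t \<in> X i" if "i < n" for i
    using X(1,2) that by (simp add: open_dist PiE_iff)
  then obtain e where e: "\<And>i. i < n \<Longrightarrow> e i > 0" "\<And>i t. i < n \<Longrightarrow> dist t (x i) < e i \<Longrightarrow> t \<in> X i"
    by metis
  \<comment> \<open>The inserted 1 keeps the minimum meaningful for \<open>n = 0\<close>.\<close>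
  define d where "d = Min (insert 1 (e ` {..<n}))"
  have d: "d > 0" unfolding d_def using e(1) by auto
  have de: "d \<le> e i" if "i < n" for i unfolding d_def using that by auto
  show "\<exists>e>0. \<forall>y\<in>Rn n. Rn_dist n x y < e \<longrightarrow> y \<in> U"
  proof (intro exI[of _ d] conjI ballI impI d)
    fix y assume y: "y \<in> Rn n" "Rn_dist n x y < d"
    have "y i \<in> X i" if "i < n" for i
      using e(2)[OF that] coord_le_dist[OF that, of y x] y(2) de[OF that] by (auto simp: dist_real_def)
    then show "y \<in> U" using X(3) y(1) PiE_Rn[of y n X] by blast
  qed
next
  assume a: "U \<subseteq> Rn n \<and> (\<forall>x\<in>U. \<exists>e>0. \<forall>y\<in>Rn n. Rn_dist n x y < e \<longrightarrow> y \<in> U)"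
  show "openin (Rtop n) U" unfolding openin_product_topology_alt
  proof
    fix x assume x: "x \<in> U"
    then obtain e where e: "e > 0" "\<And>y. y\<in>Rn n \<Longrightarrow> Rn_dist n x y < e \<Longrightarrow> y \<in> U" using a by blast
    define X where "X i = {x i - e / (n + 1) <..< x i + e / (n+1)}" for i
    have "y \<in> U" if y: "y \<in> Pi\<^sub>E {..<n} X" for y
    proof (rule e(2))
      show "y \<in> Rn n" using y by (auto simp: Rn_def PiE_iff)
      have "Rn_dist n x y \<le> (\<Sum>i<n. \<bar>x i - y i\<bar>)"
        unfolding Rn_dist_def Rn_norm_def by (rule L2_set_le_sum_abs)
      also have "\<dots> \<le> (\<Sum>i<n. e / (n+1))"
      proof (rule sum_mono)
        fix i assume "i \<in> {..<n}"
        then have "y i \<in> X i" using y by (auto simp: PiE_iff)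
        then show "\<bar>x i - y i\<bar> \<le> e / (n+1)" unfolding X_def greaterThanLessThan_iff by linarith
      qed
      also have "\<dots> < e" using e(1) by (simp add: field_simps)
      finally show "Rn_dist n x y < e" .
    qed
    moreover have "x \<in> Pi\<^sub>E {..<n} X" using a x e(1) by (auto simp: X_def Rn_def PiE_iff)
    ultimately show "\<exists>U'. finite {i \<in> {..<n}. U' i \<noteq> topspace euclideanreal} \<and> (\<forall>i\<in>{..<n}. openin euclideanreal (U' i)) \<and>
         x \<in> Pi\<^sub>E {..<n} U' \<and> Pi\<^sub>E {..<n} U' \<subseteq> U"
      by (intro exI[of _ X]) (auto simp: X_def)
  qed
qed

lemma openin_measurable:
  assumes "openin (Rtop n) U" shows "U \<in> sets (leb n)"
proof -
  have "openin euclidean {x \<in> topspace euclidean. restrict x {..<n} \<in> U}"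
    using continuous_map_restrict_Rn assms unfolding continuous_map_def by blast
  then have "{x. restrict x {..<n} \<in> U} \<in> sets borel" by auto
  from measurable_sets[OF measurable_restrict_leb this, of n]
  have "{x. restrict x {..<n} \<in> U} \<inter> Rn n \<in> sets (leb n)" by simp
  moreover have "{x. restrict x {..<n} \<in> U} \<inter> Rn n = U"
    using openin_subset[OF assms] by (auto simp: restrict_Rn)
  ultimately show ?thesis by simp
qed

lemma closedin_measurable:
  assumes "closedin (Rtop n) K" shows "K \<in> sets (leb n)"
proof -
  have "space (leb n) - (Rn n - K) \<in> sets (leb n)"
    using assms openin_measurable[of n "Rn n - K"] by (intro sets.compl_sets) (auto simp: closedin_def)
  moreover have "space (leb n) - (Rn n - K) = K" using assms by (auto simp: closedin_def)
  ultimately show ?thesis by simp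
qed

lemma compactin_Rtop_closed: "compactin (Rtop n) K \<Longrightarrow> closedin (Rtop n) K"
  by (rule compactin_imp_closedin) (auto simp: Hausdorff_space_product_topology)

text \<open>Heine-Borel: a bounded closed set is a closed part of a product of compact intervals,
  which is compact by Tychonoff.\<close>

lemma compactin_RtopI:
  assumes "closedin (Rtop n) K" and "\<And>x i. x \<in> K \<Longrightarrow> i < n \<Longrightarrow> \<bar>x i\<bar> \<le> R"
  shows "compactin (Rtop n) K"
proof (rule closed_compactin)
  show "compactin (Rtop n) (Pi\<^sub>E {..<n} (\<lambda>i. {-R..R}))"
    by (subst compactin_PiE) auto
  show "K \<subseteq> Pi\<^sub>E {..<n} (\<lambda>i. {-R..R})"
  proof
    fix x assume x: "x \<in> K"
    then have "x \<in> Rn n" using closedin_subset[OF assms(1)] by auto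
    then show "x \<in> Pi\<^sub>E {..<n} (\<lambda>i. {-R..R})" using assms(2)[OF x] by (simp add: PiE_Rn abs_le_iff minus_le_iff)
  qed
qed (rule assms)

lemma continuous_map_coord: "i < n \<Longrightarrow> continuous_map (Rtop n) euclideanreal (\<lambda>x. x i)"
  by (auto intro: continuous_map_product_projection)

lemma continuous_map_sq_dist: "continuous_map (Rtop n) euclideanreal (sq_dist n z)"
  unfolding sq_dist_def by (intro continuous_intros continuous_map_coord) auto

lemma sq_dist_measurable [measurable]: "sq_dist n z \<in> borel_measurable (leb n)"
  by (rule continuous_map_measurable[OF continuous_map_sq_dist])

text \<open>The last argument is the square of the radius, so that these balls are sublevel sets of
  \<open>sq_dist\<close>.\<close>

definition clball :: "nat \<Rightarrow> (nat \<Rightarrow> real) \<Rightarrow> real \<Rightarrow> (nat \<Rightarrow> real) set" where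
  "clball n z s = {x \<in> Rn n. sq_dist n z x \<le> s}"

lemma closedin_clball: "closedin (Rtop n) (clball n z s)"
proof -
  have "closedin (Rtop n) {x \<in> topspace (Rtop n). sq_dist n z x \<in> {..s}}"
    by (rule closedin_continuous_map_preimage[OF continuous_map_sq_dist]) auto
  then show ?thesis by (simp add: clball_def)
qed

lemma openin_sq_dist: "openin (Rtop n) {x \<in> Rn n. sq_dist n z x < s}"
proof -
  have "openin (Rtop n) {x \<in> topspace (Rtop n). sq_dist n z x \<in> {..<s}}"
    by (rule openin_continuous_map_preimage[OF continuous_map_sq_dist]) auto
  then show ?thesis by simp
qed

lemma compactin_clball: "compactin (Rtop n) (clball n z s)"
proof (rule compactin_RtopI[OF closedin_clball])
  define R where "R = (\<Sum>i<n. \<bar>z i\<bar>) + sqrt (max s 0)"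
  fix x i assume x: "x \<in> clball n z s" and i: "i < n"
  have "\<bar>x i - z i\<bar> \<le> sqrt s" using coord_le_dist[OF i, of x z] x
    by (auto simp: clball_def Rn_dist_sq_dist intro: order_trans)
  moreover have "sqrt s \<le> sqrt (max s 0)" by simp
  moreover have "\<bar>z i\<bar> \<le> (\<Sum>i<n. \<bar>z i\<bar>)" using i by (intro member_le_sum) auto
  ultimately show "\<bar>x i\<bar> \<le> R" unfolding R_def by linarith
qed

lemma Rn_ball_sq_dist: "0 < r \<Longrightarrow> Rn_ball n z r = {x \<in> Rn n. sq_dist n z x < r\<^sup>2}"
  by (auto simp: Rn_ball_def sq_dist_less_iff)

lemma openin_Rn_ball: "0 < r \<Longrightarrow> openin (Rtop n) (Rn_ball n z r)"
  by (simp add: Rn_ball_sq_dist openin_sq_dist)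

lemma Rn_ball_sets [measurable]: "Rn_ball n z r \<in> sets (leb n)"
proof (cases "0 < r")
  case True then show ?thesis by (intro openin_measurable openin_Rn_ball)
next
  case False
  then have "\<not> Rn_dist n z y < r" for y using Rn_dist_nonneg[of n z y] by linarith
  then have "Rn_ball n z r = {}" unfolding Rn_ball_def by simp
  then show ?thesis by simp
qed

lemma clball_sets [measurable]: "clball n z s \<in> sets (leb n)"
  by (intro closedin_measurable closedin_clball)

section \<open>Lebesgue measure of boxes and balls\<close>

interpretation leb_factors: product_sigma_finite "\<lambda>i::nat. lborel :: real measure"
  by standard

lemma sigma_finite_leb: "sigma_finite_measure (leb n)"
  unfolding leb_def by (rule leb_factors.sigma_finite) simp

lemma emeasure_leb_box:
  assumes "\<And>i. i < n \<Longrightarrow> a i \<le> b i"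
  shows "emeasure (leb n) (\<Pi>\<^sub>E i\<in>{..<n}. {a i..b i}) = ennreal (\<Prod>i<n. b i - a i)"
  proof -
  have "emeasure (leb n) (\<Pi>\<^sub>E i\<in>{..<n}. {a i..b i}) = (\<Prod>i<n. emeasure lborel {a i..b i})"
    unfolding leb_def by (subst leb_factors.emeasure_PiM) auto
  also have "\<dots> = (\<Prod>i<n. ennreal (b i - a i))"
    using assms by (intro prod.cong) auto
  also have "\<dots> = ennreal (\<Prod>i<n. b i - a i)"
    using assms by (intro prod_ennreal) auto
  finally show ?thesis .
qed

text \<open>The circumscribed cube is wasteful by a factor exponential in \<open>n\<close>. Only the
  \<open>n\<close>-th root of this volume enters a constant (see \<open>vol_Hoelder\<close>), and
  that root is the diameter.\<close>

lemma emeasure_clball_le: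
  assumes "0 \<le> s" shows "emeasure (leb n) (clball n z s) \<le> ennreal ((2 * sqrt s) ^ n)"
proof -
  have "clball n z s \<subseteq> (\<Pi>\<^sub>E i\<in>{..<n}. {z i - sqrt s..z i + sqrt s})"
  proof
    fix x assume x: "x \<in> clball n z s"
    have "\<bar>x i - z i\<bar> \<le> sqrt s" if "i < n" for i using coord_le_dist[OF that, of x z] x
      by (auto simp: clball_def Rn_dist_sq_dist intro: order_trans)
    then have "z i - sqrt s \<le> x i \<and> x i \<le> z i + sqrt s" if "i < n" for i
      using that by (fastforce simp: abs_le_iff)
    then show "x \<in> (\<Pi>\<^sub>E i\<in>{..<n}. {z i - sqrt s..z i + sqrt s})"
      using x by (simp add: clball_def PiE_Rn)
  qed
  then have "emeasure (leb n) (clball n z s) \<le> emeasure (leb n) (\<Pi>\<^sub>E i\<in>{..<n}. {z i - sqrt s..z i + sqrt s})"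
    by (rule emeasure_mono) (auto simp: leb_def intro: sets_PiM_I_finite)
  also have "\<dots> = ennreal ((2 * sqrt s) ^ n)"
    using assms by (subst emeasure_leb_box) auto
  finally show ?thesis .
qed

lemma emeasure_bounded_finite:
  assumes "A \<in> sets (leb n)" "A \<subseteq> clball n z s"
  shows "emeasure (leb n) A < \<infinity>"
proof -
  have "emeasure (leb n) A \<le> emeasure (leb n) (clball n z (max s 0))"
    by (rule emeasure_mono) (use assms in \<open>auto simp: clball_def intro: clball_sets[unfolded clball_def]\<close>)
  also have "\<dots> \<le> ennreal ((2 * sqrt (max s 0)) ^ n)" by (rule emeasure_clball_le) simp
  also have "\<dots> < \<infinity>" by simp
  finally show ?thesis .
qed

lemma inner_part_clball:
  assumes x: "x \<in> inner_part n \<Omega> s" and "0 < s"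
  shows "clball n x (s\<^sup>2) \<subseteq> \<Omega>"
proof
  fix y assume y: "y \<in> clball n x (s\<^sup>2)"
  show "y \<in> \<Omega>"
  proof (rule ccontr)
    assume "y \<notin> \<Omega>"
    then have "y \<in> Rn n - \<Omega>" using y by (simp add: clball_def)
    moreover have "bdd_below (Rn_dist n x ` (Rn n - \<Omega>))" by (rule bdd_belowI[of _ 0]) auto
    ultimately have "(INF y\<in>Rn n - \<Omega>. Rn_dist n x y) \<le> Rn_dist n x y" by (intro cINF_lower)
    then have "s < Rn_dist n x y" using x by (simp add: inner_part_def)
    then show False using y \<open>0 < s\<close> sq_dist_le_iff[of s n x y] by (simp add: clball_def)
  qed
qed

subsection \<open>Functions of class C^k\<close>

lemma deriv_upd:
  assumes "Ck n (Suc k) f" "x \<in> Rn n" "i < n"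
  shows "((\<lambda>t. f (x(i := t))) has_real_derivative partial_deriv i f (x(i := s))) (at s)"
proof -
  have "x(i := s) \<in> Rn n" using assms by simp
  then have "(\<lambda>t. f ((x(i := s))(i := t))) differentiable (at ((x(i := s)) i))"
    using assms(1,3) unfolding Ck.simps(2) by blast
  then have "(\<lambda>t. f (x(i := t))) differentiable (at s)" by simp
  then show ?thesis unfolding partial_deriv_def
    by (simp add: DERIV_deriv_iff_real_differentiable)
qed

lemma partial_deriv_eqI:
  assumes "((\<lambda>t. f (x(i := t))) has_real_derivative d) (at (x i))"
  shows "partial_deriv i f x = d"
  unfolding partial_deriv_def using assms by (rule DERIV_imp_deriv)

text \<open>Values off the carrier do not matter, because a coordinate line through a point of
  \<open>Rn n\<close> with direction below \<open>n\<close> stays in \<open>Rn n\<close>.\<close>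

lemma Ck_cong:
  "(\<And>x. x \<in> Rn n \<Longrightarrow> f x = g x) \<Longrightarrow> Ck n k f \<longleftrightarrow> Ck n k g"
proof (induction k arbitrary: f g)
  case 0
  then show ?case by (auto intro: continuous_map_eq simp: topspace_Rtop)
next
  case (Suc k)
  have "(\<lambda>t. f (x(i := t))) = (\<lambda>t. g (x(i := t)))" if "x \<in> Rn n" "i < n" for x i
    by (rule ext, rule Suc.prems[OF Rn_upd[OF that]])
  moreover have "Ck n k (partial_deriv i f) \<longleftrightarrow> Ck n k (partial_deriv i g)" if "i < n" for i
    by (rule Suc.IH) (use calculation that in \<open>simp add: partial_deriv_def\<close>)
  moreover have "continuous_map (Rtop n) euclideanreal f \<longleftrightarrow> continuous_map (Rtop n) euclideanreal g"
    using Suc.prems by (auto intro: continuous_map_eq)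
  ultimately show ?case by auto
qed

lemma Ck_SucI:
  assumes "continuous_map (Rtop n) euclideanreal f"
    and "\<And>i x. i < n \<Longrightarrow> x \<in> Rn n \<Longrightarrow> ((\<lambda>t. f (x(i := t))) has_real_derivative g i x) (at (x i))"
    and "\<And>i. i < n \<Longrightarrow> Ck n k (g i)"
  shows "Ck n (Suc k) f"
proof -
  have "Ck n k (partial_deriv i f)" if "i < n" for i
    by (subst Ck_cong[of n _ "g i"]) (use assms that in \<open>auto intro: partial_deriv_eqI\<close>)
  then show ?thesis using assms by (auto simp: real_differentiable_def)
qed

lemma Ck_cont: "Ck n k f \<Longrightarrow> continuous_map (Rtop n) euclideanreal f"
  by (cases k) auto

lemma Ck_Suc_imp: "Ck n (Suc k) f \<Longrightarrow> Ck n k f"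
proof (induction k arbitrary: f)
  case (Suc k)
  have "Ck n k (partial_deriv i f)" if "i < n" for i
  proof (rule Suc.IH)
    show "Ck n (Suc k) (partial_deriv i f)" using Suc.prems that by (subst (asm) Ck.simps) blast
  qed
  then show ?case using Suc.prems by auto
qed auto

lemma Ck_const: "Ck n k (\<lambda>x. c)"
proof (induction k arbitrary: c)
  case (Suc k)
  show ?case by (rule Ck_SucI[where g = "\<lambda>i x. 0"]) (use Suc in auto)
qed auto

lemma Ck_coord: "j < n \<Longrightarrow> Ck n k (\<lambda>x. x j)"
proof (cases k)
  case (Suc k')
  assume j: "j < n"
  have *: "((\<lambda>t. (x(i := t)) j) has_real_derivative (if i = j then 1 else 0)) (at s)"
    for i s and x :: "nat \<Rightarrow> real" by (cases "i = j") auto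
  show ?thesis unfolding Suc
    by (rule Ck_SucI[where g = "\<lambda>i x. if i = j then 1 else 0"])
       (use * in \<open>auto simp: Ck_const continuous_map_coord[OF j]\<close>)
qed (auto simp: continuous_map_coord)

lemma Ck_add:
  assumes "Ck n k f" "Ck n k g" shows "Ck n k (\<lambda>x. f x + g x)"
  using assms
proof (induction k arbitrary: f g)
  case (Suc k)
  show ?case
  proof (rule Ck_SucI[where g = "\<lambda>i x. partial_deriv i f x + partial_deriv i g x"])
    fix i x assume "i < n" "x \<in> Rn n"
    then show "((\<lambda>t. f (x(i := t)) + g (x(i := t))) has_real_derivative partial_deriv i f x + partial_deriv i g x) (at (x i))"
      using deriv_upd[OF Suc.prems(1), of x i "x i"] deriv_upd[OF Suc.prems(2), of x i "x i"]
      unfolding fun_upd_triv by (intro DERIV_add)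
  qed (use Suc Ck_cont in \<open>auto intro: continuous_map_add\<close>)
qed (auto intro: continuous_map_add)

lemma Ck_mult:
  assumes "Ck n k f" "Ck n k g" shows "Ck n k (\<lambda>x. f x * g x)"
  using assms
proof (induction k arbitrary: f g)
  case (Suc k)
  show ?case
  proof (rule Ck_SucI[where g = "\<lambda>i x. f x * partial_deriv i g x + partial_deriv i f x * g x"])
    fix i x assume i: "i < n" "x \<in> Rn n"
    have "((\<lambda>t. f (x(i := t)) * g (x(i := t))) has_real_derivative
       f (x(i := x i)) * partial_deriv i g (x(i := x i)) + partial_deriv i f (x(i := x i)) * g (x(i := x i))) (at (x i))"
      by (rule DERIV_mult'[OF deriv_upd[OF Suc.prems(1) i(2,1)] deriv_upd[OF Suc.prems(2) i(2,1)]])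
    then show "((\<lambda>t. f (x(i := t)) * g (x(i := t))) has_real_derivative f x * partial_deriv i g x + partial_deriv i f x * g x) (at (x i))"
      by simp
  next
    fix i assume "i < n"
    then show "Ck n k (\<lambda>x. f x * partial_deriv i g x + partial_deriv i f x * g x)"
      using Suc.prems Ck_Suc_imp[OF Suc.prems(1)] Ck_Suc_imp[OF Suc.prems(2)]
      by (intro Ck_add Suc.IH) auto
  qed (use Suc.prems Ck_cont in \<open>auto intro: continuous_map_real_mult\<close>)
qed (auto intro: continuous_map_real_mult)

definition smooth :: "nat \<Rightarrow> ((nat \<Rightarrow> real) \<Rightarrow> real) \<Rightarrow> bool" where
  "smooth n f \<longleftrightarrow> (\<forall>k. Ck n k f)"

lemma smooth_const: "smooth n (\<lambda>x. c)" by (simp add: smooth_def Ck_const)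
lemma smooth_coord: "j < n \<Longrightarrow> smooth n (\<lambda>x. x j)" by (simp add: smooth_def Ck_coord)
lemma smooth_add: "smooth n f \<Longrightarrow> smooth n g \<Longrightarrow> smooth n (\<lambda>x. f x + g x)"
  by (simp add: smooth_def Ck_add)
lemma smooth_mult: "smooth n f \<Longrightarrow> smooth n g \<Longrightarrow> smooth n (\<lambda>x. f x * g x)"
  by (simp add: smooth_def Ck_mult)
lemma smooth_diff: "smooth n f \<Longrightarrow> smooth n g \<Longrightarrow> smooth n (\<lambda>x. f x - g x)"
  using smooth_add[of n f "\<lambda>x. (-1) * g x"] smooth_mult[OF smooth_const[of n "-1"], of g] by simp
lemma smooth_sum: "(\<And>i. i \<in> A \<Longrightarrow> smooth n (f i)) \<Longrightarrow> smooth n (\<lambda>x. \<Sum>i\<in>A. f i x)"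
  by (induction A rule: infinite_finite_induct) (auto intro: smooth_const smooth_add)
lemma smooth_partial: "smooth n f \<Longrightarrow> i < n \<Longrightarrow> smooth n (partial_deriv i f)"
  unfolding smooth_def by (metis Ck.simps(2))
lemma smooth_cont: "smooth n f \<Longrightarrow> continuous_map (Rtop n) euclideanreal f"
  unfolding smooth_def using Ck_cont by blast
lemma smooth_measurable: "smooth n f \<Longrightarrow> f \<in> borel_measurable (leb n)"
  by (intro continuous_map_measurable smooth_cont)
lemma smooth_deriv:
  assumes "smooth n f" "x \<in> Rn n" "i < n"
  shows "((\<lambda>t. f (x(i := t))) has_real_derivative partial_deriv i f (x(i := s))) (at s)"
  using assms deriv_upd[of n 0] unfolding smooth_def by blast

lemma smooth_deriv':
  assumes "smooth n f" "x \<in> Rn n" "i < n"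
  shows "((\<lambda>t. f (x(i := t))) has_real_derivative partial_deriv i f x) (at (x i))"
  using smooth_deriv[OF assms, of "x i"] by simp

lemma partial_add:
  assumes "smooth n f" "smooth n g" "x \<in> Rn n" "i < n"
  shows "partial_deriv i (\<lambda>x. f x + g x) x = partial_deriv i f x + partial_deriv i g x"
  by (rule partial_deriv_eqI) (intro DERIV_add smooth_deriv'[where n = n] assms)

lemma partial_mult:
  assumes "smooth n f" "smooth n g" "x \<in> Rn n" "i < n"
  shows "partial_deriv i (\<lambda>x. f x * g x) x = f x * partial_deriv i g x + partial_deriv i f x * g x"
  by (rule partial_deriv_eqI)
     (use DERIV_mult'[OF smooth_deriv'[OF assms(1,3,4)] smooth_deriv'[OF assms(2,3,4)]] in simp)

lemma partial_cmult:
  assumes "smooth n g" "x \<in> Rn n" "i < n"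
  shows "partial_deriv i (\<lambda>x. c * g x) x = c * partial_deriv i g x"
  by (rule partial_deriv_eqI) (intro DERIV_cmult smooth_deriv'[where n = n] assms)

lemma partial_cong:
  assumes "\<And>x. x \<in> Rn n \<Longrightarrow> f x = g x" "x \<in> Rn n" "i < n"
  shows "partial_deriv i f x = partial_deriv i g x"
  using assms by (simp add: partial_deriv_def)

lemma partial_zero_open:
  assumes U: "openin (Rtop n) U" and z: "\<And>x. x \<in> U \<Longrightarrow> f x = c" and x: "x \<in> U" "i < n"
  shows "partial_deriv i f x = 0"
proof (rule partial_deriv_eqI)
  have xR: "x \<in> Rn n" using openin_subset[OF U] x by auto
  obtain e where e: "e > 0" "\<And>y. y \<in> Rn n \<Longrightarrow> Rn_dist n x y < e \<Longrightarrow> y \<in> U"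
    using U x unfolding openin_Rtop_iff by blast
  have "f (x(i := t)) = c" if "dist t (x i) < e" for t
  proof (rule z, rule e(2))
    have "sq_dist n x (x(i := t)) = (\<Sum>j<n. if j = i then (t - x i)\<^sup>2 else 0)"
      unfolding sq_dist_def by (rule sum.cong) auto
    also have "\<dots> = (t - x i)\<^sup>2" using x by simp
    finally show "Rn_dist n x (x(i := t)) < e" using that by (simp add: Rn_dist_sq_dist dist_real_def)
  qed (use xR x in auto)
  then have "\<forall>\<^sub>F t in nhds (x i). f (x(i := t)) = c"
    unfolding eventually_nhds_metric using e(1) by blast
  then show "((\<lambda>t. f (x(i := t))) has_real_derivative 0) (at (x i))"
    using DERIV_cong_ev[of "x i" "x i" "\<lambda>t. f (x(i := t))" "\<lambda>_. c" 0 0] by simp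
qed


subsection \<open>Smooth functions of one variable\<close>

text \<open>The derivative is asserted to exist instead of being written as \<open>deriv g\<close>;
  sums, products and affine substitutions can then name their derivative directly in an induction.
  \<open>smooth1_deriv\<close> returns to \<open>deriv\<close>.\<close>

primrec kdiff :: "nat \<Rightarrow> (real \<Rightarrow> real) \<Rightarrow> bool" where
  "kdiff 0 g \<longleftrightarrow> True"
| "kdiff (Suc k) g \<longleftrightarrow> (\<exists>g'. (\<forall>t. (g has_real_derivative g' t) (at t)) \<and> kdiff k g')"

definition smooth1 :: "(real \<Rightarrow> real) \<Rightarrow> bool" where
  "smooth1 g \<longleftrightarrow> (\<forall>k. kdiff k g)"

lemma kdiff_Suc_imp: "kdiff (Suc k) g \<Longrightarrow> kdiff k g"
proof (induction k arbitrary: g)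
  case (Suc k)
  then obtain g' where "\<forall>t. (g has_real_derivative g' t) (at t)" "kdiff (Suc k) g'"
    unfolding kdiff.simps(2)[of "Suc k"] by blast
  then show ?case using Suc.IH[of g'] unfolding kdiff.simps(2)[of k g] by blast
qed simp

lemma kdiff_add: "kdiff k f \<Longrightarrow> kdiff k g \<Longrightarrow> kdiff k (\<lambda>t. f t + g t)"
proof (induction k arbitrary: f g)
  case (Suc k)
  from Suc.prems obtain f' g' where
    "\<And>t. (f has_real_derivative f' t) (at t)" "kdiff k f'"
    "\<And>t. (g has_real_derivative g' t) (at t)" "kdiff k g'" by auto
  then show ?case using Suc.IH
    by (auto intro!: exI[of _ "\<lambda>t. f' t + g' t"] DERIV_add)
qed auto

lemma kdiff_const: "kdiff k (\<lambda>t. c)"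
  by (induction k arbitrary: c) (auto intro!: exI[of _ "\<lambda>_. 0"])

lemma kdiff_mult: "kdiff k f \<Longrightarrow> kdiff k g \<Longrightarrow> kdiff k (\<lambda>t. f t * g t)"
proof (induction k arbitrary: f g)
  case (Suc k)
  from Suc.prems obtain f' g' where
    "\<And>t. (f has_real_derivative f' t) (at t)" "kdiff k f'"
    "\<And>t. (g has_real_derivative g' t) (at t)" "kdiff k g'" by auto
  then show ?case using Suc.IH kdiff_Suc_imp[OF Suc.prems(1)] kdiff_Suc_imp[OF Suc.prems(2)]
    by (auto intro!: exI[of _ "\<lambda>t. f t * g' t + f' t * g t"] kdiff_add DERIV_mult')
qed auto

lemma kdiff_affine: "kdiff k g \<Longrightarrow> kdiff k (\<lambda>t. g (a * t + b))"
proof (induction k arbitrary: g)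
  case (Suc k)
  then obtain g' where g': "\<And>t. (g has_real_derivative g' t) (at t)" "kdiff k g'" by auto
  have "((\<lambda>t. g (a * t + b)) has_real_derivative g' (a * t + b) * a) (at t)" for t
    by (rule DERIV_chain2[OF g'(1)]) (auto intro!: derivative_eq_intros)
  then show ?case using kdiff_mult[OF Suc.IH[OF g'(2)] kdiff_const[of k a]]
    by (auto intro!: exI[of _ "\<lambda>t. g' (a * t + b) * a"])
qed auto

lemma smooth1_mult: "smooth1 f \<Longrightarrow> smooth1 g \<Longrightarrow> smooth1 (\<lambda>t. f t * g t)"
  by (simp add: smooth1_def kdiff_mult)

lemma smooth1_affine: "smooth1 g \<Longrightarrow> smooth1 (\<lambda>t. g (a * t + b))"
  by (simp add: smooth1_def kdiff_affine)

lemma smooth1_deriv: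
  assumes "smooth1 g"
  shows "(g has_real_derivative deriv g t) (at t)" "smooth1 (deriv g)"
proof -
  have d: "(g has_real_derivative deriv g t) (at t)" for t
    using assms unfolding smooth1_def by (metis DERIV_imp_deriv kdiff.simps(2))
  then show "(g has_real_derivative deriv g t) (at t)" .
  show "smooth1 (deriv g)" unfolding smooth1_def
  proof
    fix k
    obtain g' where "\<And>t. (g has_real_derivative g' t) (at t)" "kdiff k g'"
      using assms unfolding smooth1_def by (metis kdiff.simps(2))
    moreover from this have "deriv g = g'" using DERIV_imp_deriv by blast
    ultimately show "kdiff k (deriv g)" by simp
  qed
qed

lemma sm1I: "(\<And>t. (g has_real_derivative g' t) (at t)) \<Longrightarrow> smooth1 g' \<Longrightarrow> smooth1 g"
  unfolding smooth1_def by (metis kdiff.simps not0_implies_Suc)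

lemma smooth1_cont: "smooth1 g \<Longrightarrow> continuous_on A g"
  using smooth1_deriv(1) by (meson DERIV_isCont continuous_at_imp_continuous_on)

text \<open>The induction on the order of differentiability varies the outer function: by the chain
  rule a partial derivative is \<open>deriv g\<close> composed with \<open>p\<close>, times a smooth
  factor.\<close>

lemma smooth_comp:
  assumes "smooth1 g" "smooth n p" shows "smooth n (\<lambda>x. g (p x))"
proof -
  have "Ck n k (\<lambda>x. g (p x))" for k
    using assms(1)
  proof (induction k arbitrary: g)
    case 0
    have "continuous_map (Rtop n) euclideanreal (g \<circ> p)"
      using smooth_cont[OF assms(2)] smooth1_cont[OF 0, of UNIV] by (intro continuous_map_compose) auto
    then show ?case by (simp add: o_def)
  next
    case (Suc k)
    have "continuous_map (Rtop n) euclideanreal (g \<circ> p)"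
      using smooth_cont[OF assms(2)] smooth1_cont[OF Suc.prems, of UNIV] by (intro continuous_map_compose) auto
    then have c: "continuous_map (Rtop n) euclideanreal (\<lambda>x. g (p x))" by (simp add: o_def)
    show ?case
    proof (rule Ck_SucI[OF c, where g = "\<lambda>i x. deriv g (p x) * partial_deriv i p x"])
      fix i x assume i: "i < n" "x \<in> Rn n"
      show "((\<lambda>t. g (p (x(i := t)))) has_real_derivative deriv g (p x) * partial_deriv i p x) (at (x i))"
        by (rule DERIV_chain2[OF _ smooth_deriv'[OF assms(2) i(2,1)]]) (simp add: smooth1_deriv Suc.prems)
    next
      fix i assume "i < n"
      then show "Ck n k (\<lambda>x. deriv g (p x) * partial_deriv i p x)"
        using Suc.IH[OF smooth1_deriv(2)[OF Suc.prems]] smooth_partial[OF assms(2)]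
        by (auto intro!: Ck_mult simp: smooth_def)
    qed
  qed
  then show ?thesis by (simp add: smooth_def)
qed

lemma partial_comp:
  assumes "smooth1 g" "smooth n p" "i < n" "x \<in> Rn n"
  shows "partial_deriv i (\<lambda>x. g (p x)) x = deriv g (p x) * partial_deriv i p x"
  by (rule partial_deriv_eqI, rule DERIV_chain2[OF _ smooth_deriv'[OF assms(2,4,3)]])
     (simp add: smooth1_deriv assms)

lemma smooth_sq_dist: "smooth n (sq_dist n z)"
  unfolding sq_dist_def power2_eq_square
  by (intro smooth_sum smooth_mult smooth_diff smooth_const smooth_coord) auto

lemma partial_sq_dist:
  assumes "i < n" shows "partial_deriv i (sq_dist n z) x = 2 * (x i - z i)"
proof (rule partial_deriv_eqI)
  have "sq_dist n z (x(i := t)) = (t - z i)\<^sup>2 + (\<Sum>j\<in>{..<n}-{i}. (x j - z j)\<^sup>2)" for t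
    unfolding sq_dist_def using assms by (subst sum.remove[of _ i]) (auto intro!: sum.cong)
  then show "((\<lambda>t. sq_dist n z (x(i := t))) has_real_derivative 2 * (x i - z i)) (at (x i))"
    by (auto intro!: derivative_eq_intros)
qed


text \<open>The functions \<open>P(1/t) exp (-1/t)\<close> for \<open>t > 0\<close>, extended by zero, are closed under derivation.\<close>

definition flat :: "real poly \<Rightarrow> real \<Rightarrow> real" where
  "flat P t = (if t > 0 then poly P (1 / t) * exp (- 1 / t) else 0)"

lemma poly_exp_tendsto: "((\<lambda>s. poly P s * exp (- s)) \<longlongrightarrow> (0::real)) at_top"
proof -
  have "((\<lambda>s. \<Sum>i\<le>degree P. coeff P i * (s ^ i / exp s)) \<longlongrightarrow> (\<Sum>i\<le>degree P. coeff P i * 0)) at_top"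
    by (intro tendsto_intros tendsto_power_div_exp_0)
  then show ?thesis by (simp add: poly_altdef sum_distrib_left sum_distrib_right exp_minus divide_inverse algebra_simps)
qed

text \<open>For \<open>t > 0\<close> the derivative of \<open>P(1/t) exp (-1/t)\<close> is
  \<open>(1/t)^2 (P - P')(1/t) exp (-1/t)\<close>, so on polynomials differentiation acts as
  \<open>P\<close> to \<open>X^2 (P - P')\<close>, and \<open>[:0,0,1:]\<close> is
  \<open>X^2\<close>.\<close>

lemma flat_deriv: "(flat P has_real_derivative flat ([:0,0,1:] * (P - pderiv P)) t) (at t)"
proof -
  consider "t > 0" | "t < 0" | "t = 0" by linarith
  then show ?thesis
  proof cases
    case 1
    have "((\<lambda>t. poly P (1 / t) * exp (- 1 / t)) has_real_derivative
        flat ([:0,0,1:] * (P - pderiv P)) t) (at t)"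
      using 1 by (auto intro!: derivative_eq_intros DERIV_chain2[OF poly_DERIV]
        simp: flat_def field_simps power2_eq_square)
    then show ?thesis
      by (rule has_field_derivative_transform_within_open[where S="{0<..}"]) (use 1 in \<open>auto simp: flat_def\<close>)
  next
    case 2
    have "((\<lambda>t. 0) has_real_derivative flat ([:0,0,1:] * (P - pderiv P)) t) (at t)"
      using 2 by (simp add: flat_def)
    then show ?thesis
      by (rule has_field_derivative_transform_within_open[where S="{..<0}"]) (use 2 in \<open>auto simp: flat_def\<close>)
  next
    case 3
    have "((\<lambda>h. (flat P (0 + h) - flat P 0) / h) \<longlongrightarrow> 0) (at 0)"
    proof (rule filterlim_split_at)
      have "((\<lambda>h. 0::real) \<longlongrightarrow> 0) (at_left (0::real))" by simp
      then show "((\<lambda>h. (flat P (0 + h) - flat P 0) / h) \<longlongrightarrow> 0) (at_left 0)"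
        by (rule Lim_transform_eventually) (auto simp: flat_def eventually_at_filter)
      \<comment> \<open>At 0 the right difference quotient is again of the form
        \<open>Q(s) exp (-s)\<close> with \<open>s = 1 / h\<close> and \<open>Q = X P\<close>, and
        decays as \<open>s\<close> grows.\<close>
      have "((\<lambda>h. poly (pCons 0 P) (inverse h) * exp (- inverse h)) \<longlongrightarrow> 0) (at_right 0)"
        by (rule filterlim_compose[OF poly_exp_tendsto filterlim_inverse_at_top_right])
      then show "((\<lambda>h. (flat P (0 + h) - flat P 0) / h) \<longlongrightarrow> 0) (at_right 0)"
        by (rule Lim_transform_eventually) (auto simp: flat_def eventually_at_filter divide_inverse)
    qed
    then show ?thesis using 3 by (simp add: DERIV_def flat_def)
  qed
qed

lemma flat_smooth1: "smooth1 (flat P)"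
proof -
  have "kdiff k (flat P)" for k
    by (induction k arbitrary: P) (auto intro!: exI flat_deriv)
  then show ?thesis by (simp add: smooth1_def)
qed

lemma flat1: "flat 1 t = (if t > 0 then exp (- 1 / t) else 0)"
  by (simp add: flat_def)

lemma flat1_nonneg: "0 \<le> flat 1 t" and flat1_pos: "0 < t \<Longrightarrow> 0 < flat 1 t"
  and flat1_zero: "t \<le> 0 \<Longrightarrow> flat 1 t = 0"
  by (auto simp: flat1)

text \<open>The normalised primitive of the bump \<open>exp (-1/t) exp (-1/(1-t))\<close>, which is
  positive inside the unit interval and vanishes outside.\<close>

lemma smooth_step_exists:
  "\<exists>S. smooth1 S \<and> (\<forall>t. 0 \<le> S t \<and> S t \<le> 1) \<and> (\<forall>t\<le>0. S t = 0) \<and> (\<forall>t\<ge>1. S t = 1)"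
proof -
  define b where "b t = flat 1 t * flat 1 (1 - t)" for t :: real
  have sb: "smooth1 b" unfolding b_def
    using smooth1_mult[OF flat_smooth1[of 1] smooth1_affine[OF flat_smooth1[of 1], of "-1" 1]] by (simp add: algebra_simps)
  have b0: "0 \<le> b t" for t by (simp add: b_def flat1_nonneg)
  have bz: "b t = 0" if "t \<le> 0 \<or> 1 \<le> t" for t using that by (auto simp: b_def flat1_zero)
  have bi: "b integrable_on {x..y}" for x y
    by (rule integrable_continuous_real) (rule smooth1_cont[OF sb])
  \<comment> \<open>Integration starts to the left of the support, so that the fundamental theorem
    applies at 0 as well; further left \<open>G\<close> is constantly 0.\<close>
  define G where "G t = integral {-1..t} b" for t
  define I where "I = integral {0..1} b"
  have Gd: "(G has_real_derivative b t) (at t)" if "t > -1" for t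
  proof -
    have "(G has_real_derivative b t) (at t within {-1..t+1})" unfolding G_def
      by (rule integral_has_real_derivative) (use that smooth1_cont[OF sb] in auto)
    then show ?thesis using that by (simp add: at_within_Icc_at)
  qed
  have G0: "G t = 0" if "t \<le> 0" for t
    unfolding G_def using that by (intro integral_unique has_integral_is_0) (auto simp: bz)
  have Gd': "(G has_real_derivative b t) (at t)" for t
  proof (cases "t > -1")
    case False
    have "((\<lambda>t. 0) has_real_derivative b t) (at t)" using False by (simp add: bz)
    then show ?thesis
      by (rule has_field_derivative_transform_within_open[where S="{..<0}"]) (use False G0 in auto)
  qed (rule Gd)
  have smG: "smooth1 G" by (rule sm1I[OF Gd' sb])
  have mono: "G s \<le> G t" if "s \<le> t" for s t
    by (rule DERIV_nonneg_imp_nondecreasing[OF that]) (use Gd' b0 in blast)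
  have G1: "G t = I" if "t \<ge> 1" for t
  proof -
    have "G t = integral {-1..0} b + integral {0..t} b"
      unfolding G_def using that bi by (intro Henstock_Kurzweil_Integration.integral_combine[symmetric]) auto
    also have "integral {0..t} b = integral {0..1} b + integral {1..t} b"
      using that bi by (intro Henstock_Kurzweil_Integration.integral_combine[symmetric]) auto
    also have "integral {-1..0} b = 0" by (intro integral_unique has_integral_is_0) (auto simp: bz)
    also have "integral {1..t} b = 0" by (intro integral_unique has_integral_is_0) (auto simp: bz)
    finally show ?thesis by (simp add: I_def)
  qed
  \<comment> \<open>Otherwise the nondecreasing \<open>G\<close> would be constant on the unit
    interval, and its derivative \<open>b\<close> would vanish at \<open>1/2\<close>.\<close>
  have "I > 0"
  proof (rule ccontr)
    assume "\<not> I > 0"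
    then have "G t = 0" if "t \<le> 1" "t \<ge> 0" for t using mono[OF that(1)] mono[OF that(2)] G1[of 1] G0[of 0] by simp
    then have "((\<lambda>t. 0) has_real_derivative b (1/2)) (at (1/2))"
      using has_field_derivative_transform_within_open[OF Gd'[of "1/2"], of "{0<..<1}" "\<lambda>_. 0"] by auto
    then have "b (1/2) = 0" using DERIV_unique[OF _ DERIV_const] by blast
    then show False by (simp add: b_def flat1)
  qed
  then have "smooth1 (\<lambda>t. (1 / I) * G t)"
    using smooth1_mult[OF _ smG, of "\<lambda>_. 1 / I"] kdiff_const by (auto simp: smooth1_def)
  moreover have "0 \<le> G t \<and> G t \<le> I" for t
    using mono[of "min t 0" t] mono[of t "max t 1"] G0[of "min t 0"] G1[of "max t 1"] by auto
  ultimately show ?thesis using \<open>I > 0\<close> G0 G1 by (intro exI[of _ "\<lambda>t. (1 / I) * G t"]) auto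
qed

subsection \<open>Hoelder and Minkowski inequalities\<close>

text \<open>Lebesgue spaces over a whole measure space. A domain is encoded by multiplying the
  function with its indicator (\<open>Lp_memLq\<close>, \<open>Lp_norm_normLq\<close>), so functions
  on different domains can be added and compared.\<close>

definition memLq :: "'a measure \<Rightarrow> real \<Rightarrow> ('a \<Rightarrow> real) \<Rightarrow> bool" where
  "memLq M q f \<longleftrightarrow> f \<in> borel_measurable M \<and> integrable M (\<lambda>x. \<bar>f x\<bar> powr q)"

definition normLq :: "'a measure \<Rightarrow> real \<Rightarrow> ('a \<Rightarrow> real) \<Rightarrow> real" where
  "normLq M q f = (LINT x|M. \<bar>f x\<bar> powr q) powr (1 / q)"

lemma normLq_nonneg [simp]: "0 \<le> normLq M q f"
  by (simp add: normLq_def)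

lemma normLq_powr: "0 < q \<Longrightarrow> normLq M q f powr q = (LINT x|M. \<bar>f x\<bar> powr q)"
  by (simp add: normLq_def powr_powr)

lemma memLq_meas: "memLq M q f \<Longrightarrow> f \<in> borel_measurable M"
  by (simp add: memLq_def)

lemma normLq_leI:
  assumes "0 < q" "0 \<le> A" "(LINT x|M. \<bar>f x\<bar> powr q) \<le> A powr q"
  shows "normLq M q f \<le> A"
proof -
  have "normLq M q f \<le> (A powr q) powr (1 / q)"
    unfolding normLq_def using assms by (intro powr_mono2) auto
  then show ?thesis using assms by (simp add: powr_powr)
qed

lemma memLq_mono:
  assumes "0 < q" "memLq M q g" "f \<in> borel_measurable M" "AE x in M. \<bar>f x\<bar> \<le> \<bar>g x\<bar>"
  shows "memLq M q f" "normLq M q f \<le> normLq M q g"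
proof -
  have ae: "AE x in M. \<bar>f x\<bar> powr q \<le> \<bar>g x\<bar> powr q"
    using assms(4) by eventually_elim (use assms(1) in \<open>auto intro: powr_mono2\<close>)
  have m: "(\<lambda>x. \<bar>f x\<bar> powr q) \<in> borel_measurable M" using assms(3) by measurable
  show "memLq M q f" unfolding memLq_def
    using assms(2,3) m ae by (auto simp: memLq_def intro: Bochner_Integration.integrable_bound[of M "\<lambda>x. \<bar>g x\<bar> powr q"])
  then show "normLq M q f \<le> normLq M q g"
    unfolding normLq_def using assms ae by (intro powr_mono2 integral_mono_AE integral_nonneg_AE) (auto simp: memLq_def)
qed

lemma normLq_cong:
  assumes "\<And>x. x \<in> space M \<Longrightarrow> \<bar>f x\<bar> = \<bar>g x\<bar>"
  shows "normLq M q f = normLq M q g"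
  unfolding normLq_def using assms by (simp cong: Bochner_Integration.integral_cong)

lemma memLq_cong:
  assumes "\<And>x. x \<in> space M \<Longrightarrow> f x = g x"
  shows "memLq M q f \<longleftrightarrow> memLq M q g"
  unfolding memLq_def using assms by (auto cong: Bochner_Integration.integrable_cong measurable_cong)

lemma memLq_zero [simp]: "0 < q \<Longrightarrow> memLq M q (\<lambda>x. 0)" and normLq_zero [simp]: "normLq M q (\<lambda>x. 0) = 0"
  by (auto simp: memLq_def normLq_def)

lemma normLq_zero_AE:
  assumes "0 < q" "memLq M q f" "normLq M q f = 0" shows "AE x in M. f x = 0"
proof -
  have "(LINT x|M. \<bar>f x\<bar> powr q) = 0" using assms(3) by (simp add: normLq_def)
  then have "AE x in M. \<bar>f x\<bar> powr q = 0"
    using assms(1,2) by (subst (asm) integral_nonneg_eq_0_iff_AE) (auto simp: memLq_def)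
  then show ?thesis by eventually_elim simp
qed

lemma memLq_cmult: assumes "memLq M q f" shows "memLq M q (\<lambda>x. c * f x)"
  using assms unfolding memLq_def by (auto simp: abs_mult powr_mult)

lemma normLq_cmult: assumes "0 < q" shows "normLq M q (\<lambda>x. c * f x) = \<bar>c\<bar> * normLq M q f"
proof -
  have "(LINT x|M. \<bar>c * f x\<bar> powr q) = \<bar>c\<bar> powr q * (LINT x|M. \<bar>f x\<bar> powr q)"
    by (simp add: abs_mult powr_mult)
  then show ?thesis using assms by (simp add: normLq_def powr_mult powr_powr)
qed

lemma normLq_minus: "normLq M q (\<lambda>x. - f x) = normLq M q f"
  by (simp add: normLq_def)

lemma normLq_abs: "normLq M q (\<lambda>x. \<bar>f x\<bar>) = normLq M q f"
  by (simp add: normLq_def)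

lemma memLq_abs: "memLq M q f \<Longrightarrow> memLq M q (\<lambda>x. \<bar>f x\<bar>)"
  by (auto simp: memLq_def)

text \<open>Normalising by a number strictly larger than the norm avoids the division by a zero
  norm; \<open>le_of_forall_gt\<close> later lets that number decrease to the norm.\<close>

lemma normalized_integral_le_1:
  assumes "0 < q" "memLq M q f" "normLq M q f < A"
  shows "integrable M (\<lambda>x. (\<bar>f x\<bar> / A) powr q)" "(LINT x|M. (\<bar>f x\<bar> / A) powr q) \<le> 1"
proof -
  have A: "0 < A" using assms(3) normLq_nonneg[of M q f] by linarith
  have eq: "(\<lambda>x. (\<bar>f x\<bar> / A) powr q) = (\<lambda>x. \<bar>f x\<bar> powr q / A powr q)"
    using A by (simp add: powr_divide)
  show "integrable M (\<lambda>x. (\<bar>f x\<bar> / A) powr q)" unfolding eq using assms by (auto simp: memLq_def)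
  have "(LINT x|M. \<bar>f x\<bar> powr q) \<le> A powr q"
    using assms A by (subst normLq_powr[symmetric]) (auto intro: powr_mono2)
  then show "(LINT x|M. (\<bar>f x\<bar> / A) powr q) \<le> 1"
    unfolding eq using A by (simp add: divide_le_eq)
qed

lemma le_of_forall_gt:
  fixes X :: real
  assumes "\<And>A. a < A \<Longrightarrow> X \<le> A" shows "X \<le> a"
  using assms by (meson dense_ge)

lemma young_powr:
  fixes x y :: real
  assumes "0 \<le> x" "0 \<le> y" "0 < \<alpha>" "0 < \<beta>" "\<alpha> + \<beta> = 1"
  shows "x powr \<alpha> * y powr \<beta> \<le> \<alpha> * x + \<beta> * y"
  using assms Youngs_inequality_0[of \<alpha> \<beta> x y] by (cases "x = 0 \<or> y = 0") auto

text \<open>If one of the arguments is zero, the claim reduces to \<open>c powr q <= c\<close> for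
  \<open>c\<close> between 0 and 1; otherwise it is convexity on the positive half-line.\<close>

lemma powr_convex_nonneg:
  fixes x y :: real
  assumes "1 \<le> q" "0 \<le> x" "0 \<le> y" "0 \<le> t" "t \<le> 1"
  shows "((1 - t) * x + t * y) powr q \<le> (1 - t) * x powr q + t * y powr q"
proof -
  have scale: "(c * w) powr q \<le> c * w powr q" if "0 \<le> c" "c \<le> 1" "0 \<le> w" for c w :: real
  proof (cases "c = 0")
    case False
    then have "c powr q \<le> c powr 1" using that assms(1) by (intro powr_mono') auto
    then have "c powr q * w powr q \<le> c * w powr q" using that False by (intro mult_right_mono) auto
    then show ?thesis using that by (simp add: powr_mult)
  qed auto
  show ?thesis
  proof (cases "x = 0 \<or> y = 0")
    case True then show ?thesis using scale[of t y] scale[of "1 - t" x] assms by auto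
  next
    case False
    then show ?thesis using convex_onD[OF powr_convex[OF assms(1)], of t x y] assms by auto
  qed
qed

text \<open>Young's inequality with weights \<open>s / a\<close> and \<open>s / b\<close>, which add
  up to 1, is applied pointwise to the normalised functions. The exponent \<open>s\<close> may be
  any positive number with the stated relation.\<close>

theorem Hoelder:
  assumes ab: "0 < a" "0 < b" "0 < s" "1 / s = 1 / a + 1 / b" and f: "memLq M a f" and g: "memLq M b g"
  shows "memLq M s (\<lambda>x. f x * g x)" "normLq M s (\<lambda>x. f x * g x) \<le> normLq M a f * normLq M b g"
proof -
  have [measurable]: "f \<in> borel_measurable M" "g \<in> borel_measurable M" using f g by (auto simp: memLq_def)
  have sum1: "s / a + s / b = 1"
    using arg_cong[OF ab(4), of "\<lambda>w. s * w"] ab(3) by (simp add: distrib_left)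
  have key: "integrable M (\<lambda>x. \<bar>f x * g x\<bar> powr s) \<and> (LINT x|M. \<bar>f x * g x\<bar> powr s) \<le> (A * B) powr s"
    if A: "normLq M a f < A" and B: "normLq M b g < B" for A B
  proof -
    have A0: "0 < A" "0 < B" using A B normLq_nonneg[of M a f] normLq_nonneg[of M b g] by linarith+
    note nf = normalized_integral_le_1[OF ab(1) f A] and ng = normalized_integral_le_1[OF ab(2) g B]
    define h where "h x = (A * B) powr s * (s / a * (\<bar>f x\<bar> / A) powr a + s / b * (\<bar>g x\<bar> / B) powr b)" for x
    have hi: "integrable M h" unfolding h_def using nf ng by auto
    have le: "\<bar>f x * g x\<bar> powr s \<le> h x" for x
    proof -
      have "\<bar>f x * g x\<bar> powr s = (A * B) powr s * (((\<bar>f x\<bar> / A) powr a) powr (s / a) * ((\<bar>g x\<bar> / B) powr b) powr (s / b))"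
        using A0 ab by (simp add: powr_powr abs_mult powr_mult powr_divide)
      also have "\<dots> \<le> h x" unfolding h_def
        by (intro mult_left_mono young_powr) (use ab sum1 A0 in auto)
      finally show ?thesis .
    qed
    have i: "integrable M (\<lambda>x. \<bar>f x * g x\<bar> powr s)"
      by (rule Bochner_Integration.integrable_bound[OF hi]) (use le in \<open>auto intro!: AE_I2 intro: order_trans[OF _ abs_ge_self]\<close>)
    have "(LINT x|M. \<bar>f x * g x\<bar> powr s) \<le> (LINT x|M. h x)"
      by (intro integral_mono i hi le)
    also have "\<dots> = (A * B) powr s * (s / a * (LINT x|M. (\<bar>f x\<bar> / A) powr a) + s / b * (LINT x|M. (\<bar>g x\<bar> / B) powr b))"
      unfolding h_def using nf ng by simp
    also have "\<dots> \<le> (A * B) powr s * (s / a * 1 + s / b * 1)"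
      using nf ng ab A0 by (intro mult_left_mono add_mono) auto
    finally show ?thesis using i sum1 by simp
  qed
  show "memLq M s (\<lambda>x. f x * g x)" unfolding memLq_def
    using key[of "normLq M a f + 1" "normLq M b g + 1"] by auto
  have *: "normLq M s (\<lambda>x. f x * g x) \<le> A * B" if A: "normLq M a f < A" and B: "normLq M b g < B" for A B
  proof (rule normLq_leI[OF ab(3)])
    show "0 \<le> A * B" using A B normLq_nonneg[of M a f] normLq_nonneg[of M b g] by (intro mult_nonneg_nonneg) linarith+
  qed (use key[OF A B] in auto)
  \<comment> \<open>The two normalising constants are lowered to the norms one after the other, each
    time dividing by the other, positive factor.\<close>
  have **: "normLq M s (\<lambda>x. f x * g x) \<le> A * normLq M b g" if A: "normLq M a f < A" for A
  proof -
    have A0: "0 < A" using A normLq_nonneg[of M a f] by linarith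
    have "normLq M s (\<lambda>x. f x * g x) / A \<le> normLq M b g"
      by (rule le_of_forall_gt) (use *[OF A] A0 in \<open>simp add: field_simps\<close>)
    then show ?thesis using A0 by (simp add: field_simps)
  qed
  have "normLq M s (\<lambda>x. f x * g x) \<le> normLq M b g * normLq M a f"
  proof (cases "normLq M b g = 0")
    case True then show ?thesis using **[of "normLq M a f + 1"] by simp
  next
    case False
    then have B0: "0 < normLq M b g" using normLq_nonneg[of M b g] by linarith
    have "normLq M s (\<lambda>x. f x * g x) / normLq M b g \<le> normLq M a f"
      by (rule le_of_forall_gt) (use ** B0 in \<open>simp add: field_simps\<close>)
    then show ?thesis using B0 by (simp add: field_simps)
  qed
  then show "normLq M s (\<lambda>x. f x * g x) \<le> normLq M a f * normLq M b g" by (simp add: mult.commute)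
qed

text \<open>The sum of the absolute values is \<open>A + B\<close> times a convex combination of the
  normalised functions, with weights \<open>A / (A + B)\<close> and \<open>B / (A + B)\<close>;
  convexity of the power does the rest.\<close>

theorem Minkowski:
  assumes q: "1 \<le> q" and f: "memLq M q f" and g: "memLq M q g"
  shows "memLq M q (\<lambda>x. f x + g x)" "normLq M q (\<lambda>x. f x + g x) \<le> normLq M q f + normLq M q g"
proof -
  have [measurable]: "f \<in> borel_measurable M" "g \<in> borel_measurable M" using f g by (auto simp: memLq_def)
  have q0: "0 < q" using q by simp
  have key: "integrable M (\<lambda>x. \<bar>f x + g x\<bar> powr q) \<and> (LINT x|M. \<bar>f x + g x\<bar> powr q) \<le> (A + B) powr q"
    if A: "normLq M q f < A" and B: "normLq M q g < B" for A B
  proof -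
    have A0: "0 < A" "0 < B" using A B normLq_nonneg[of M q f] normLq_nonneg[of M q g] by linarith+
    note nf = normalized_integral_le_1[OF q0 f A] and ng = normalized_integral_le_1[OF q0 g B]
    define t where "t = B / (A + B)"
    have t: "0 \<le> t" "t \<le> 1" "1 - t = A / (A + B)" using A0 by (auto simp: t_def field_simps)
    define h where "h x = (A + B) powr q * ((1 - t) * (\<bar>f x\<bar> / A) powr q + t * (\<bar>g x\<bar> / B) powr q)" for x
    have hi: "integrable M h" unfolding h_def using nf ng by auto
    have le: "\<bar>f x + g x\<bar> powr q \<le> h x" for x
    proof -
      have "\<bar>f x + g x\<bar> \<le> \<bar>f x\<bar> + \<bar>g x\<bar>" by simp
      also have "\<dots> = (A + B) * ((1 - t) * (\<bar>f x\<bar> / A) + t * (\<bar>g x\<bar> / B))"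
        unfolding t(3) unfolding t_def using A0 by (simp add: distrib_left)
      finally have "\<bar>f x + g x\<bar> powr q \<le> ((A + B) * ((1 - t) * (\<bar>f x\<bar> / A) + t * (\<bar>g x\<bar> / B))) powr q"
        using q0 by (intro powr_mono2) auto
      also have "\<dots> = (A + B) powr q * ((1 - t) * (\<bar>f x\<bar> / A) + t * (\<bar>g x\<bar> / B)) powr q"
        using A0 t by (simp add: powr_mult)
      also have "\<dots> \<le> h x" unfolding h_def
        using A0 t q by (intro mult_left_mono powr_convex_nonneg) auto
      finally show ?thesis .
    qed
    have i: "integrable M (\<lambda>x. \<bar>f x + g x\<bar> powr q)"
      by (rule Bochner_Integration.integrable_bound[OF hi]) (use le in \<open>auto intro!: AE_I2 intro: order_trans[OF _ abs_ge_self]\<close>)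
    have "(LINT x|M. \<bar>f x + g x\<bar> powr q) \<le> (LINT x|M. h x)"
      by (intro integral_mono i hi le)
    also have "\<dots> = (A + B) powr q * ((1 - t) * (LINT x|M. (\<bar>f x\<bar> / A) powr q) + t * (LINT x|M. (\<bar>g x\<bar> / B) powr q))"
      unfolding h_def using nf ng by simp
    also have "\<dots> \<le> (A + B) powr q * ((1 - t) * 1 + t * 1)"
      using nf ng t A0 by (intro mult_left_mono add_mono) auto
    finally show ?thesis using i by simp
  qed
  show "memLq M q (\<lambda>x. f x + g x)" unfolding memLq_def
    using key[of "normLq M q f + 1" "normLq M q g + 1"] by auto
  have "normLq M q (\<lambda>x. f x + g x) \<le> normLq M q f + normLq M q g + e" if "0 < e" for e
  proof (rule normLq_leI[OF q0])
    show "(LINT x|M. \<bar>f x + g x\<bar> powr q) \<le> (normLq M q f + normLq M q g + e) powr q"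
      using key[of "normLq M q f + e / 2" "normLq M q g + e / 2"] that by (auto simp: algebra_simps)
  qed (use that in \<open>auto intro!: add_nonneg_nonneg\<close>)
  then show "normLq M q (\<lambda>x. f x + g x) \<le> normLq M q f + normLq M q g" by (rule field_le_epsilon)
qed

lemma memLq_diff: assumes "1 \<le> q" "memLq M q f" "memLq M q g" shows "memLq M q (\<lambda>x. f x - g x)"
  using Minkowski(1)[OF assms(1,2) memLq_cmult[OF assms(3), of "-1"]] by simp

lemma normLq_diff_le: assumes "1 \<le> q" "memLq M q f" "memLq M q g" shows "normLq M q (\<lambda>x. f x - g x) \<le> normLq M q f + normLq M q g"
  using Minkowski(2)[OF assms(1,2) memLq_cmult[OF assms(3), of "-1"]] normLq_minus[of M q g] by simp

lemma normLq_diff_commute: "normLq M q (\<lambda>x. f x - g x) = normLq M q (\<lambda>x. g x - f x)"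
  using normLq_minus[of M q "\<lambda>x. f x - g x"] by simp

lemma normLq_le_add_diff:
  assumes "1 \<le> q" "memLq M q f" "memLq M q g" shows "normLq M q f \<le> normLq M q g + normLq M q (\<lambda>x. f x - g x)"
  using Minkowski(2)[OF assms(1,3) memLq_diff[OF assms]] by simp

lemma memLq_sum: assumes "1 \<le> q" "\<And>i. i \<in> A \<Longrightarrow> memLq M q (f i)" shows "memLq M q (\<lambda>x. \<Sum>i\<in>A. f i x)"
  using assms(2) by (induction A rule: infinite_finite_induct) (use assms(1) in \<open>auto intro: Minkowski(1)\<close>)

lemma normLq_sum_le:
  assumes "1 \<le> q" "\<And>i. i \<in> A \<Longrightarrow> memLq M q (f i)"
  shows "normLq M q (\<lambda>x. \<Sum>i\<in>A. f i x) \<le> (\<Sum>i\<in>A. normLq M q (f i))"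
  using assms(2)
proof (induction A rule: infinite_finite_induct)
  case (insert i A)
  have "normLq M q (\<lambda>x. \<Sum>i\<in>insert i A. f i x) = normLq M q (\<lambda>x. f i x + (\<Sum>i\<in>A. f i x))" using insert by simp
  also have "\<dots> \<le> normLq M q (f i) + normLq M q (\<lambda>x. \<Sum>i\<in>A. f i x)"
    using insert by (intro Minkowski(2) assms(1) memLq_sum) auto
  finally show ?case using insert by auto
qed auto

lemma normLq_tendsto:
  assumes "1 \<le> q" "\<And>m. memLq M q (f m)" "memLq M q g" "(\<lambda>m. normLq M q (\<lambda>x. f m x - g x)) \<longlonglongrightarrow> 0"
  shows "(\<lambda>m. normLq M q (f m)) \<longlonglongrightarrow> normLq M q g"
proof -
  have "\<bar>normLq M q (f m) - normLq M q g\<bar> \<le> normLq M q (\<lambda>x. f m x - g x)" for m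
    using normLq_le_add_diff[OF assms(1,2,3), of m] normLq_le_add_diff[OF assms(1,3,2), of m]
      normLq_diff_commute[of M q "f m" g] by linarith
  then have "(\<lambda>m. normLq M q (f m) - normLq M q g) \<longlonglongrightarrow> 0"
    by (intro tendsto_rabs_zero_cancel[OF tendsto_sandwich[OF _ _ tendsto_const assms(4)]]) auto
  then show ?thesis by (simp add: LIM_zero_iff)
qed

text \<open>Convergence in \<open>L^q\<close> is convergence of the \<open>q\<close>-th powers of
  the differences in \<open>L^1\<close>, which holds almost everywhere along a subsequence.\<close>

lemma memLq_subseq_AE:
  assumes "1 \<le> q" "\<And>m. memLq M q (\<lambda>x. f m x - g x)" "(\<lambda>m. normLq M q (\<lambda>x. f m x - g x)) \<longlonglongrightarrow> 0"
  shows "\<exists>r. strict_mono (r :: nat \<Rightarrow> nat) \<and> (AE x in M. (\<lambda>m. f (r m) x) \<longlonglongrightarrow> g x)"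
proof -
  have q0: "0 < q" using assms by simp
  have "(\<lambda>m. normLq M q (\<lambda>x. f m x - g x) powr q) \<longlonglongrightarrow> 0 powr q"
    using q0 by (intro tendsto_powr' assms tendsto_const) auto
  then have "(\<lambda>m. LINT x|M. norm (\<bar>f m x - g x\<bar> powr q)) \<longlonglongrightarrow> 0"
    using q0 by (simp add: normLq_powr)
  then obtain r :: "nat \<Rightarrow> nat" where r: "strict_mono r" "AE x in M. (\<lambda>m. \<bar>f (r m) x - g x\<bar> powr q) \<longlonglongrightarrow> 0"
    using tendsto_L1_AE_subseq[of M "\<lambda>m x. \<bar>f m x - g x\<bar> powr q"] assms(2) by (auto simp: memLq_def)
  from r(2) have "AE x in M. (\<lambda>m. f (r m) x) \<longlonglongrightarrow> g x"
  proof eventually_elim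
    case (elim x)
    have "(\<lambda>m. (\<bar>f (r m) x - g x\<bar> powr q) powr (1 / q)) \<longlonglongrightarrow> 0 powr (1 / q)"
      using q0 by (intro tendsto_powr' elim tendsto_const) auto
    then have "(\<lambda>m. \<bar>f (r m) x - g x\<bar>) \<longlonglongrightarrow> 0" using q0 by (simp add: powr_powr)
    then have "(\<lambda>m. f (r m) x - g x) \<longlonglongrightarrow> 0" by (rule tendsto_rabs_zero_cancel)
    then show ?case by (simp add: LIM_zero_iff)
  qed
  then show ?thesis using r(1) by blast
qed

text \<open>Improves integrability: approximations converging only in a weaker norm, but bounded in
  the stronger one, have a limit in the stronger space. Used with exponent \<open>p'\<close> for the
  Sobolev constant and for the solution.\<close>

lemma Fatou_memLq:
  assumes q: "0 < q" and f: "\<And>m. memLq M q (f m)" and b: "\<And>m. normLq M q (f m) \<le> C"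
    and g: "g \<in> borel_measurable M" and lim: "AE x in M. (\<lambda>m. f m x) \<longlonglongrightarrow> g x"
  shows "memLq M q g" "normLq M q g \<le> C"
proof -
  have C: "0 \<le> C" using b[of 0] normLq_nonneg[of M q "f 0"] by linarith
  have [measurable]: "f m \<in> borel_measurable M" for m using f by (auto simp: memLq_def)
  have "(\<integral>\<^sup>+x. ennreal (\<bar>g x\<bar> powr q) \<partial>M) = (\<integral>\<^sup>+x. liminf (\<lambda>m. ennreal (\<bar>f m x\<bar> powr q)) \<partial>M)"
  proof (rule nn_integral_cong_AE, use lim in eventually_elim)
    case (elim x)
    have "(\<lambda>m. \<bar>f m x\<bar> powr q) \<longlonglongrightarrow> \<bar>g x\<bar> powr q"
      using q by (intro tendsto_powr' tendsto_rabs elim tendsto_const) auto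
    then have "(\<lambda>m. ennreal (\<bar>f m x\<bar> powr q)) \<longlonglongrightarrow> ennreal (\<bar>g x\<bar> powr q)"
      by (rule tendsto_ennrealI)
    then show ?case using lim_imp_Liminf[OF sequentially_bot] by metis
  qed
  also have "\<dots> \<le> liminf (\<lambda>m. \<integral>\<^sup>+x. ennreal (\<bar>f m x\<bar> powr q) \<partial>M)"
    by (rule nn_integral_liminf) auto
  also have "\<dots> \<le> liminf (\<lambda>m. ennreal (C powr q))"
  proof (rule Liminf_mono, rule always_eventually, rule)
    fix m
    have "(\<integral>\<^sup>+x. ennreal (\<bar>f m x\<bar> powr q) \<partial>M) = ennreal (LINT x|M. \<bar>f m x\<bar> powr q)"
      using f by (intro nn_integral_eq_integral) (auto simp: memLq_def)
    also have "\<dots> \<le> ennreal (C powr q)"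
      unfolding normLq_powr[OF q, symmetric] using b q by (intro ennreal_leI powr_mono2) auto
    finally show "(\<integral>\<^sup>+x. ennreal (\<bar>f m x\<bar> powr q) \<partial>M) \<le> ennreal (C powr q)" .
  qed
  also have "\<dots> = ennreal (C powr q)" by (simp add: Liminf_const)
  finally have le: "(\<integral>\<^sup>+x. ennreal (\<bar>g x\<bar> powr q) \<partial>M) \<le> ennreal (C powr q)" .
  have i: "integrable M (\<lambda>x. \<bar>g x\<bar> powr q)"
    by (rule integrableI_nonneg) (use g le le_less_trans[OF le] in auto)
  then show "memLq M q g" using g by (simp add: memLq_def)
  have "ennreal (LINT x|M. \<bar>g x\<bar> powr q) \<le> ennreal (C powr q)"
    using le i by (subst nn_integral_eq_integral[symmetric]) auto
  then have "(LINT x|M. \<bar>g x\<bar> powr q) \<le> C powr q" by (simp add: ennreal_le_iff)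
  then show "normLq M q g \<le> C" by (rule normLq_leI[OF q C])
qed

lemma memLq_indicator:
  assumes "A \<in> sets M" "emeasure M A < \<infinity>" "0 < q"
  shows "memLq M q (indicator A)" "normLq M q (indicator A) = measure M A powr (1 / q)"
proof -
  have eq: "(\<lambda>x. \<bar>indicator A x\<bar> powr q) = (indicator A :: _ \<Rightarrow> real)"
    using assms by (auto simp: indicator_def)
  show "memLq M q (indicator A)" unfolding memLq_def eq using assms by auto
  show "normLq M q (indicator A) = measure M A powr (1 / q)" unfolding normLq_def eq using assms
    by (simp add: sets.Int_space_eq2)
qed

lemma normLq_2: "(normLq M 2 f)\<^sup>2 = (LINT x|M. (f x)\<^sup>2)"
  by (simp add: normLq_def powr_half_sqrt)

lemma memLq_2: "memLq M 2 f \<longleftrightarrow> f \<in> borel_measurable M \<and> integrable M (\<lambda>x. (f x)\<^sup>2)"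
  by (simp add: memLq_def)

lemma integral_abs_le_normLq:
  assumes "memLq M 1 f" shows "integrable M f" "\<bar>LINT x|M. f x\<bar> \<le> normLq M 1 f"
proof -
  show "integrable M f" using assms by (auto simp: memLq_def intro: integrable_norm_cancel)
  show "\<bar>LINT x|M. f x\<bar> \<le> normLq M 1 f"
    using integral_norm_bound[of M f] by (simp add: normLq_def)
qed

subsection \<open>Compactly supported smooth functions\<close>

lemma compactin_bounded:
  assumes "compactin (Rtop n) K" shows "\<exists>R. \<forall>x\<in>K. \<forall>i<n. \<bar>x i\<bar> \<le> R"
proof -
  have "\<exists>R. \<forall>x\<in>K. \<bar>x i\<bar> \<le> R" if "i < n" for i
  proof -
    have "compact ((\<lambda>x. x i) ` K)"
      using image_compactin[OF assms continuous_map_coord[OF that]] by simp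
    then show ?thesis using compact_imp_bounded bounded_iff by (force simp: bounded_real)
  qed
  then obtain R where R: "\<And>i x. i < n \<Longrightarrow> x \<in> K \<Longrightarrow> \<bar>x i\<bar> \<le> R i" by metis
  have "\<bar>x i\<bar> \<le> (\<Sum>i<n. \<bar>R i\<bar>)" if "x \<in> K" "i < n" for x i
  proof -
    have "\<bar>x i\<bar> \<le> \<bar>R i\<bar>" using R[OF that(2,1)] by linarith
    also have "\<dots> \<le> (\<Sum>i<n. \<bar>R i\<bar>)" using that by (intro member_le_sum) auto
    finally show ?thesis .
  qed
  then show ?thesis by blast
qed

lemma compactin_subset_clball:
  assumes "compactin (Rtop n) K" shows "\<exists>s. K \<subseteq> clball n z s"
proof -
  have "compact (sq_dist n z ` K)" using image_compactin[OF assms continuous_map_sq_dist] by simp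
  then obtain s where "\<forall>x\<in>K. \<bar>sq_dist n z x\<bar> \<le> s"
    using compact_imp_bounded by (force simp: bounded_real)
  moreover have "K \<subseteq> Rn n" using compactin_subset_topspace[OF assms] by simp
  ultimately show ?thesis by (intro exI[of _ s]) (auto simp: clball_def)
qed

lemma compactin_finite_measure:
  assumes "compactin (Rtop n) K" shows "K \<in> sets (leb n)" "emeasure (leb n) K < \<infinity>"
proof -
  show s: "K \<in> sets (leb n)" by (intro closedin_measurable compactin_Rtop_closed assms)
  obtain r where "K \<subseteq> clball n (origin n) r" using compactin_subset_clball[OF assms] by blast
  then show "emeasure (leb n) K < \<infinity>" by (rule emeasure_bounded_finite[OF s])
qed

text \<open>In contrast to \<open>test_function\<close> the compact set is a parameter, so that one
  set follows a function through products, derivatives and translations.\<close>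

definition csmooth :: "nat \<Rightarrow> (nat \<Rightarrow> real) set \<Rightarrow> ((nat \<Rightarrow> real) \<Rightarrow> real) \<Rightarrow> bool" where
  "csmooth n K f \<longleftrightarrow> smooth n f \<and> compactin (Rtop n) K \<and> (\<forall>x\<in>Rn n - K. f x = 0)"

lemma test_function_csmooth: "test_function n \<Omega> f \<longleftrightarrow> (\<exists>K\<subseteq>\<Omega>. csmooth n K f)"
  by (auto simp: test_function_def csmooth_def smooth_def)

lemma csmooth_smooth: "csmooth n K f \<Longrightarrow> smooth n f" and csmooth_compact: "csmooth n K f \<Longrightarrow> compactin (Rtop n) K"
  and csmooth_zero: "csmooth n K f \<Longrightarrow> x \<in> Rn n \<Longrightarrow> x \<notin> K \<Longrightarrow> f x = 0"
  by (auto simp: csmooth_def)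

lemma csmooth_mult: "csmooth n K f \<Longrightarrow> smooth n g \<Longrightarrow> csmooth n K (\<lambda>x. g x * f x)"
  by (auto simp: csmooth_def intro: smooth_mult)

lemma csmooth_mult2: "csmooth n K f \<Longrightarrow> smooth n g \<Longrightarrow> csmooth n K (\<lambda>x. f x * g x)"
  by (auto simp: csmooth_def intro: smooth_mult)

lemma csmooth_partial:
  assumes "csmooth n K f" "i < n" shows "csmooth n K (partial_deriv i f)"
proof -
  have "openin (Rtop n) (Rn n - K)" using compactin_Rtop_closed[OF csmooth_compact[OF assms(1)]] by (simp add: closedin_def)
  then have "partial_deriv i f x = 0" if "x \<in> Rn n - K" for x
    by (rule partial_zero_open[where c = 0]) (use assms that csmooth_zero in auto)
  then show ?thesis using assms by (auto simp: csmooth_def intro: smooth_partial)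
qed

lemma csmooth_bounded: assumes "csmooth n K f" shows "\<exists>B\<ge>0. \<forall>x\<in>Rn n. \<bar>f x\<bar> \<le> B"
proof -
  have "compact (f ` K)"
    using image_compactin[OF csmooth_compact[OF assms] smooth_cont[OF csmooth_smooth[OF assms]]] by simp
  then obtain s where "\<forall>x\<in>K. \<bar>f x\<bar> \<le> s"
    using compact_imp_bounded by (force simp: bounded_real)
  then have "\<forall>x\<in>Rn n. \<bar>f x\<bar> \<le> max s 0" using csmooth_zero[OF assms] by (metis abs_zero max.coboundedI1 max.coboundedI2 order_refl)
  then show ?thesis by (intro exI[of _ "max s 0"]) auto
qed

lemma csmooth_meas: "csmooth n K f \<Longrightarrow> f \<in> borel_measurable (leb n)"
  by (intro smooth_measurable csmooth_smooth)

lemma csmooth_integrable: assumes "csmooth n K f" shows "integrable (leb n) f"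
proof -
  obtain B where "\<forall>x\<in>Rn n. \<bar>f x\<bar> \<le> B" using csmooth_bounded[OF assms] by blast
  then show ?thesis
    using compactin_finite_measure[OF csmooth_compact[OF assms]] csmooth_zero[OF assms] csmooth_meas[OF assms]
    by (intro integrableI_bounded_set[where A = K and B = B]) auto
qed

lemma csmooth_memLq: assumes "csmooth n K f" "0 < q" shows "memLq (leb n) q f"
proof -
  obtain B where "\<forall>x\<in>Rn n. \<bar>f x\<bar> \<le> B" using csmooth_bounded[OF assms(1)] by blast
  then have "\<bar>f x\<bar> powr q \<le> B powr q" if "x \<in> Rn n" for x
    using that assms(2) by (auto intro: powr_mono2)
  then have "integrable (leb n) (\<lambda>x. \<bar>f x\<bar> powr q)"
    using compactin_finite_measure[OF csmooth_compact[OF assms(1)]] csmooth_zero[OF assms(1)] csmooth_meas[OF assms(1)] assms(2)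
    by (intro integrableI_bounded_set[where A = K and B = "B powr q"]) auto
  then show ?thesis using csmooth_meas[OF assms(1)] by (simp add: memLq_def)
qed


subsection \<open>Integration by parts\<close>

lemma leb_insert: "i < n \<Longrightarrow> leb n = Pi\<^sub>M (insert i ({..<n} - {i})) (\<lambda>_. lborel)"
  by (simp add: leb_def insert_absorb)

lemma upd_in_Rn:
  assumes "x \<in> space (Pi\<^sub>M ({..<n} - {i}) (\<lambda>_. lborel :: real measure))" "i < n"
  shows "x(i := t) \<in> Rn n"
  using assms by (auto simp: space_PiM Rn_def PiE_iff extensional_def)

lemma line_integral_zero:
  fixes h h' :: "real \<Rightarrow> real"
  assumes d: "\<And>t. (h has_real_derivative h' t) (at t)" and c: "\<And>t. isCont h' t"
    and z: "\<And>t. \<bar>t\<bar> > R \<Longrightarrow> h t = 0"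
  shows "(\<integral>t. h' t \<partial>lborel) = 0"
proof -
  define S where "S = \<bar>R\<bar> + 1"
  have h'z: "h' t = 0" if "\<bar>t\<bar> > R" for t
  proof -
    have "open {t::real. \<bar>t\<bar> > R}" by (intro open_Collect_less continuous_intros)
    then have "((\<lambda>t. 0) has_real_derivative h' t) (at t)"
      using has_field_derivative_transform_within_open[OF d[of t], of "{t. \<bar>t\<bar> > R}" "\<lambda>_. 0"] z that by auto
    then show ?thesis using DERIV_unique[OF _ DERIV_const] by blast
  qed
  have "(\<integral>t. h' t \<partial>lborel) = (\<integral>t. h' t * indicator {-S..S} t \<partial>lborel)"
    by (intro Bochner_Integration.integral_cong refl) (auto simp: indicator_def S_def intro!: h'z)
  also have "\<dots> = h S - h (-S)"
    by (rule integral_FTC_Icc_real) (use d c in \<open>auto simp: S_def\<close>)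
  also have "\<dots> = 0" using z[of S] z[of "-S"] by (simp add: S_def)
  finally show ?thesis .
qed

text \<open>Fubini with the variable \<open>i\<close> innermost; on each line in that direction the
  fundamental theorem of calculus gives 0 by compact support.\<close>

lemma integral_partial_zero:
  assumes "csmooth n K f" "i < n" shows "(\<integral>x. partial_deriv i f x \<partial>leb n) = 0"
proof -
  note p = csmooth_partial[OF assms]
  obtain R where R: "\<And>x i. x \<in> K \<Longrightarrow> i < n \<Longrightarrow> \<bar>x i\<bar> \<le> R" using compactin_bounded[OF csmooth_compact[OF assms(1)]] by blast
  have "(\<integral>x. partial_deriv i f x \<partial>leb n) =
     (\<integral>x. (\<integral>t. partial_deriv i f (x(i := t)) \<partial>lborel) \<partial>(Pi\<^sub>M ({..<n} - {i}) (\<lambda>_. lborel)))"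
    unfolding leb_insert[OF assms(2)]
    by (rule leb_factors.product_integral_insert) (use csmooth_integrable[OF p] leb_insert[OF assms(2)] in auto)
  also have "\<dots> = (\<integral>x. 0 \<partial>(Pi\<^sub>M ({..<n} - {i}) (\<lambda>_. lborel :: real measure)))"
  proof (rule Bochner_Integration.integral_cong[OF refl])
    fix x assume x: "x \<in> space (Pi\<^sub>M ({..<n} - {i}) (\<lambda>_. lborel :: real measure))"
    \<comment> \<open>A point of the product over the other indices has no \<open>i\<close>-th
      coordinate; filling in 0 gives a point of the carrier on the same line.\<close>
    define y where "y = x(i := 0)"
    have y: "y \<in> Rn n" unfolding y_def by (rule upd_in_Rn[OF x assms(2)])
    have eq: "x(i := t) = y(i := t)" for t by (simp add: y_def)
    show "(\<integral>t. partial_deriv i f (x(i := t)) \<partial>lborel) = 0" unfolding eq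
    proof (rule line_integral_zero[where R = R])
      fix t show "((\<lambda>t. f (y(i := t))) has_real_derivative partial_deriv i f (y(i := t))) (at t)"
        by (rule smooth_deriv[OF csmooth_smooth[OF assms(1)] y assms(2)])
      show "isCont (\<lambda>t. partial_deriv i f (y(i := t))) t"
        by (rule DERIV_isCont[OF smooth_deriv[OF csmooth_smooth[OF p] y assms(2)]])
    next
      fix t :: real assume "R < \<bar>t\<bar>"
      then have "y(i := t) \<notin> K" using R[of "y(i := t)" i] assms(2) by auto
      then show "f (y(i := t)) = 0" using csmooth_zero[OF assms(1)] y assms(2) by auto
    qed
  qed
  finally show ?thesis by simp
qed

lemma integration_by_parts:
  assumes "csmooth n K f" "smooth n g" "i < n"
  shows "(\<integral>x. f x * partial_deriv i g x \<partial>leb n) = - (\<integral>x. partial_deriv i f x * g x \<partial>leb n)"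
proof -
  note i1 = csmooth_integrable[OF csmooth_mult2[OF assms(1) smooth_partial[OF assms(2,3)]]]
  note i2 = csmooth_integrable[OF csmooth_mult2[OF csmooth_partial[OF assms(1,3)] assms(2)]]
  have "0 = (\<integral>x. partial_deriv i (\<lambda>x. f x * g x) x \<partial>leb n)"
    using integral_partial_zero[OF csmooth_mult2[OF assms(1,2)] assms(3)] by simp
  also have "\<dots> = (\<integral>x. f x * partial_deriv i g x + partial_deriv i f x * g x \<partial>leb n)"
    by (rule Bochner_Integration.integral_cong[OF refl])
       (use partial_mult[OF csmooth_smooth[OF assms(1)] assms(2) _ assms(3)] in simp)
  also have "\<dots> = (\<integral>x. f x * partial_deriv i g x \<partial>leb n) + (\<integral>x. partial_deriv i f x * g x \<partial>leb n)"
    using i1 i2 by (rule Bochner_Integration.integral_add)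
  finally show ?thesis by simp
qed

section \<open>The Laplacian, and smooth functions as members of the Lebesgue and Sobolev
  classes\<close>

definition laplacian :: "nat \<Rightarrow> ((nat \<Rightarrow> real) \<Rightarrow> real) \<Rightarrow> (nat \<Rightarrow> real) \<Rightarrow> real" where
  "laplacian n f x = (\<Sum>i<n. partial_deriv i (partial_deriv i f) x)"

lemma smooth_laplacian: "smooth n f \<Longrightarrow> smooth n (laplacian n f)"
  unfolding laplacian_def by (intro smooth_sum smooth_partial) auto

lemma csmooth_laplacian: assumes "csmooth n K f" shows "csmooth n K (laplacian n f)"
  unfolding csmooth_def
proof (intro conjI ballI)
  fix x assume "x \<in> Rn n - K"
  then show "laplacian n f x = 0" unfolding laplacian_def
    using csmooth_zero[OF csmooth_partial[OF csmooth_partial[OF assms]]] by (intro sum.neutral) auto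
qed (use assms smooth_laplacian in \<open>auto simp: csmooth_def\<close>)

lemma csmooth_weak_partial:
  assumes f: "csmooth n K f" and i: "i < n" and O: "\<Omega> \<in> sets (leb n)"
  shows "weak_partial n \<Omega> i f (partial_deriv i f)"
  unfolding weak_partial_def
proof (intro conjI allI impI)
  have "locally_integrable n \<Omega> g" if "csmooth n K g" for g
    unfolding locally_integrable_def set_integrable_def
  proof (intro allI impI integrable_mult_indicator[OF _ csmooth_integrable[OF that]])
    fix K assume "compactin (Rtop n) K \<and> K \<subseteq> \<Omega>"
    then show "K \<in> sets (leb n)" by (intro compactin_finite_measure(1)) auto
  qed
  then show "locally_integrable n \<Omega> f" "locally_integrable n \<Omega> (partial_deriv i f)"
    using f csmooth_partial[OF f i] by auto
  fix \<phi> assume "test_function n \<Omega> \<phi>"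
  then obtain L where L: "L \<subseteq> \<Omega>" "csmooth n L \<phi>" by (auto simp: test_function_csmooth)
  \<comment> \<open>The test function vanishes off a subset of \<open>\<Omega>\<close>, so the
    integral over \<open>\<Omega>\<close> is one over the whole space; \<open>f\<close> itself may
    live anywhere.\<close>
  have z: "(LINT x:\<Omega>|leb n. h x * \<psi> x) = (\<integral>x. h x * \<psi> x \<partial>leb n)" if "csmooth n L \<psi>" for h \<psi>
    unfolding set_lebesgue_integral_def
    by (rule Bochner_Integration.integral_cong[OF refl])
       (use csmooth_zero[OF that] L(1) in \<open>auto simp: indicator_def\<close>)
  show "(LINT x:\<Omega>|leb n. f x * partial_deriv i \<phi> x) = - (LINT x:\<Omega>|leb n. partial_deriv i f x * \<phi> x)"
    unfolding z[OF csmooth_partial[OF L(2) i]] z[OF L(2)]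
    by (rule integration_by_parts[OF f csmooth_smooth[OF L(2)] i])
qed

lemma set_measurable_times:
  fixes f :: "'a \<Rightarrow> real"
  assumes "f \<in> borel_measurable M" "\<Omega> \<in> sets M"
  shows "set_borel_measurable M \<Omega> f"
proof -
  note [measurable] = assms
  show ?thesis unfolding set_borel_measurable_def by measurable
qed

lemma memLq_imp_Lp:
  assumes "memLq (leb n) q f" "\<Omega> \<in> sets (leb n)"
  shows "f \<in> Lp n q \<Omega>"
  using assms integrable_mult_indicator[of \<Omega> "leb n" "\<lambda>x. \<bar>f x\<bar> powr q"] unfolding Lp_def memLq_def
  by (auto intro!: set_measurable_times simp: set_integrable_def)

lemma csmooth_sobolev:
  assumes "csmooth n K f" "0 < q" "\<Omega> \<in> sets (leb n)"
  shows "f \<in> sobolev n k q \<Omega>"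
  using assms(1)
proof (induction k arbitrary: f)
  case 0 then show ?case using memLq_imp_Lp[OF csmooth_memLq] assms by auto
next
  case (Suc k)
  have "\<exists>g\<in>sobolev n k q \<Omega>. weak_partial n \<Omega> i f g" if "i < n" for i
    using Suc.IH[OF csmooth_partial[OF Suc.prems that]] csmooth_weak_partial[OF Suc.prems that assms(3)] by blast
  then show ?case using memLq_imp_Lp[OF csmooth_memLq[OF Suc.prems assms(2)] assms(3)] by simp
qed

lemma Lp_norm_normLq:
  "0 < q \<Longrightarrow> Lp_norm n q A f = normLq (leb n) q (\<lambda>x. indicator A x * f x)"
  unfolding Lp_norm_def normLq_def set_lebesgue_integral_def
  by (intro arg_cong2[where f = "(powr)"] Bochner_Integration.integral_cong) (auto simp: indicator_def)

lemma Lp_norm_eq_normLq: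
  assumes "0 < q" "\<And>x. x \<in> Rn n \<Longrightarrow> x \<notin> A \<Longrightarrow> f x = 0"
  shows "Lp_norm n q A f = normLq (leb n) q f"
  unfolding Lp_norm_normLq[OF assms(1)] by (rule normLq_cong) (use assms(2) in \<open>auto simp: indicator_def\<close>)

lemma Lp_memLq:
  assumes "0 < q" "A \<in> sets (leb n)"
  shows "f \<in> Lp n q A \<longleftrightarrow> memLq (leb n) q (\<lambda>x. indicator A x * f x)"
proof -
  have "(\<lambda>x. indicator A x * \<bar>f x\<bar> powr q) = (\<lambda>x. \<bar>indicator A x * f x\<bar> powr q)"
    using assms by (auto simp: indicator_def)
  then show ?thesis by (simp add: Lp_def memLq_def set_borel_measurable_def set_integrable_def)
qed


subsection \<open>Translations\<close>

definition shift :: "nat \<Rightarrow> (nat \<Rightarrow> real) \<Rightarrow> (nat \<Rightarrow> real) \<Rightarrow> nat \<Rightarrow> real" where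
  "shift n z x = (\<lambda>i\<in>{..<n}. x i + z i)"

lemma shift_Rn [simp]: "shift n z x \<in> Rn n"
  by (simp add: shift_def)

lemma shift_apply [simp]: "i < n \<Longrightarrow> shift n z x i = x i + z i"
  by (simp add: shift_def)

lemma shift_upd: "i < n \<Longrightarrow> shift n z (x(i := t)) = (shift n z x)(i := t + z i)"
  by (auto simp: shift_def)

lemma sq_dist_shift: "sq_dist n z (shift n z x) = sq_dist n (origin n) x"
  unfolding sq_dist_def by (rule sum.cong) (auto simp: origin_def)

lemma continuous_map_shift: "continuous_map (Rtop n) (Rtop n) (shift n z)"
  unfolding continuous_map_componentwise
proof (intro conjI ballI)
  show "shift n z ` topspace (Rtop n) \<subseteq> extensional {..<n}" by (auto simp: shift_def)
  fix k assume "k \<in> {..<n}"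
  then show "continuous_map (Rtop n) euclideanreal (\<lambda>x. shift n z x k)"
    by (simp add: continuous_map_add continuous_map_coord)
qed

lemma smooth_shift:
  assumes "smooth n f" shows "smooth n (\<lambda>x. f (shift n z x))"
proof -
  have "Ck n k (\<lambda>x. f (shift n z x))" for k
    using assms
  proof (induction k arbitrary: f)
    case 0
    show ?case using continuous_map_compose[OF continuous_map_shift smooth_cont[OF 0], of z] by (simp add: o_def)
  next
    case (Suc k)
    show ?case
    proof (rule Ck_SucI[where g = "\<lambda>i x. partial_deriv i f (shift n z x)"])
      show "continuous_map (Rtop n) euclideanreal (\<lambda>x. f (shift n z x))"
        using continuous_map_compose[OF continuous_map_shift smooth_cont[OF Suc.prems], of z] by (simp add: o_def)
      fix i x assume i: "i < n" "x \<in> Rn n"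
      have "((\<lambda>t. f ((shift n z x)(i := t + z i))) has_real_derivative partial_deriv i f ((shift n z x)(i := x i + z i)) * 1) (at (x i))"
        by (rule DERIV_chain2[of "\<lambda>s. f ((shift n z x)(i := s))" _ "\<lambda>t. t + z i"])
           (auto intro!: derivative_eq_intros smooth_deriv[OF Suc.prems _ i(1)])
      moreover have "(shift n z x)(i := x i + z i) = shift n z x" using i by (auto simp: shift_def)
      ultimately show "((\<lambda>t. f (shift n z (x(i := t)))) has_real_derivative partial_deriv i f (shift n z x)) (at (x i))"
        using shift_upd[OF i(1)] by simp
    next
      fix i assume "i < n"
      then show "Ck n k (\<lambda>x. partial_deriv i f (shift n z x))"
        by (intro Suc.IH smooth_partial Suc.prems)
    qed
  qed
  then show ?thesis by (simp add: smooth_def)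
qed

lemma partial_shift:
  assumes "smooth n f" "i < n" "x \<in> Rn n"
  shows "partial_deriv i (\<lambda>x. f (shift n z x)) x = partial_deriv i f (shift n z x)"
proof (rule partial_deriv_eqI)
  have "((\<lambda>t. f ((shift n z x)(i := t + z i))) has_real_derivative partial_deriv i f ((shift n z x)(i := x i + z i)) * 1) (at (x i))"
    by (rule DERIV_chain2[of "\<lambda>s. f ((shift n z x)(i := s))" _ "\<lambda>t. t + z i"])
       (auto intro!: derivative_eq_intros smooth_deriv[OF assms(1) _ assms(2)])
  moreover have "(shift n z x)(i := x i + z i) = shift n z x" using assms by (auto simp: shift_def)
  ultimately show "((\<lambda>t. f (shift n z (x(i := t)))) has_real_derivative partial_deriv i f (shift n z x)) (at (x i))"
    using shift_upd[OF assms(2)] by simp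
qed

lemma laplacian_shift:
  assumes "smooth n f" "x \<in> Rn n"
  shows "laplacian n (\<lambda>x. f (shift n z x)) x = laplacian n f (shift n z x)"
  unfolding laplacian_def
proof (rule sum.cong[OF refl])
  fix i assume "i \<in> {..<n}" then have i: "i < n" by simp
  have "partial_deriv i (partial_deriv i (\<lambda>x. f (shift n z x))) x = partial_deriv i (\<lambda>x. partial_deriv i f (shift n z x)) x"
    by (rule partial_cong[OF _ assms(2) i]) (rule partial_shift[OF assms(1) i])
  also have "\<dots> = partial_deriv i (partial_deriv i f) (shift n z x)"
    by (rule partial_shift[OF smooth_partial[OF assms(1) i] i assms(2)])
  finally show "partial_deriv i (partial_deriv i (\<lambda>x. f (shift n z x))) x = partial_deriv i (partial_deriv i f) (shift n z x)" .
qed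

lemma measurable_shift [measurable]: "shift n z \<in> measurable (leb n) (leb n)"
  unfolding leb_def shift_def by measurable

text \<open>A product measure is determined by its values on boxes, and there the claim is
  translation invariance of Lebesgue measure on the line in each factor.\<close>

lemma distr_shift: "distr (leb n) (leb n) (shift n z) = leb n"
proof -
  have "distr (leb n) (leb n) (shift n z) = Pi\<^sub>M {..<n} (\<lambda>_. lborel)"
  proof (rule leb_factors.PiM_eqI)
    fix A :: "nat \<Rightarrow> real set" assume A: "\<And>i. i \<in> {..<n} \<Longrightarrow> A i \<in> sets lborel"
    have pre: "shift n z -` Pi\<^sub>E {..<n} A \<inter> space (leb n) = Pi\<^sub>E {..<n} (\<lambda>i. (+) (z i) -` A i)"
      by (rule set_eqI) (simp add: PiE_Rn add.commute conj_commute)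
    have m: "(+) (z i) -` A i \<in> sets borel" if "i < n" for i
      using measurable_sets[of "(+) (z i)" borel borel "A i"] A that by simp
    have "emeasure (distr (leb n) (leb n) (shift n z)) (Pi\<^sub>E {..<n} A) = emeasure (leb n) (Pi\<^sub>E {..<n} (\<lambda>i. (+) (z i) -` A i))"
      unfolding pre[symmetric] using A
      by (intro emeasure_distr measurable_shift) (auto simp: leb_def intro!: sets_PiM_I_finite)
    also have "\<dots> = (\<Prod>i<n. emeasure lborel ((+) (z i) -` A i))"
      unfolding leb_def using m by (subst leb_factors.emeasure_PiM) auto
    also have "\<dots> = (\<Prod>i<n. emeasure lborel (A i))"
    proof (rule prod.cong[OF refl])
      fix i assume i: "i \<in> {..<n}"
      have "emeasure lborel (A i) = emeasure (distr lborel borel ((+) (z i))) (A i)" by (simp add: lborel_distr_plus)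
      also have "\<dots> = emeasure lborel ((+) (z i) -` A i)" using A[OF i] by (subst emeasure_distr) auto
      finally show "emeasure lborel ((+) (z i) -` A i) = emeasure lborel (A i)" by simp
    qed
    finally show "emeasure (distr (leb n) (leb n) (shift n z)) (Pi\<^sub>E {..<n} A) = (\<Prod>i<n. emeasure lborel (A i))" .
  qed (auto simp: leb_def)
  then show ?thesis by (simp add: leb_def)
qed

lemma integral_shift:
  assumes "f \<in> borel_measurable (leb n)"
  shows "(\<integral>x. f (shift n z x) \<partial>leb n) = (\<integral>x. (f x :: real) \<partial>leb n)"
  using integral_distr[OF measurable_shift[of n z] assms] by (simp add: distr_shift)

lemma normLq_shift:
  assumes "f \<in> borel_measurable (leb n)"
  shows "normLq (leb n) q (\<lambda>x. f (shift n z x)) = normLq (leb n) q f"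
  unfolding normLq_def using integral_shift[of "\<lambda>x. \<bar>f x\<bar> powr q" n z] assms by simp

lemma csmooth_shift:
  assumes "csmooth n K f"
  shows "csmooth n {x \<in> Rn n. shift n z x \<in> K} (\<lambda>x. f (shift n z x))"
  unfolding csmooth_def
proof (intro conjI ballI)
  show "smooth n (\<lambda>x. f (shift n z x))" by (intro smooth_shift csmooth_smooth[OF assms])
  obtain R where R: "\<And>x i. x \<in> K \<Longrightarrow> i < n \<Longrightarrow> \<bar>x i\<bar> \<le> R" using compactin_bounded[OF csmooth_compact[OF assms]] by blast
  show "compactin (Rtop n) {x \<in> Rn n. shift n z x \<in> K}"
  proof (rule compactin_RtopI[where R = "\<bar>R\<bar> + (\<Sum>i<n. \<bar>z i\<bar>)"])
    have "closedin (Rtop n) {x \<in> topspace (Rtop n). shift n z x \<in> K}"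
      by (intro closedin_continuous_map_preimage[OF continuous_map_shift] compactin_Rtop_closed csmooth_compact[OF assms])
    then show "closedin (Rtop n) {x \<in> Rn n. shift n z x \<in> K}" by simp
    fix x i assume a: "x \<in> {x \<in> Rn n. shift n z x \<in> K}" "i < n"
    then have "\<bar>x i + z i\<bar> \<le> R" using R[of "shift n z x" i] by simp
    moreover have "\<bar>z i\<bar> \<le> (\<Sum>i<n. \<bar>z i\<bar>)" using a by (intro member_le_sum) auto
    ultimately show "\<bar>x i\<bar> \<le> \<bar>R\<bar> + (\<Sum>i<n. \<bar>z i\<bar>)" by linarith
  qed
qed (use csmooth_zero[OF assms] in auto)


subsection \<open>The Carleman inequality for smooth functions\<close>

definition weight :: "nat \<Rightarrow> (nat \<Rightarrow> real) \<Rightarrow> real \<Rightarrow> (nat \<Rightarrow> real) \<Rightarrow> real" where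
  "weight n z l x = Rn_dist n z x powr (- l)"

lemma Rn_dist_measurable [measurable]: "Rn_dist n z \<in> borel_measurable (leb n)"
  unfolding Rn_dist_sq_dist by measurable

lemma weight_measurable [measurable]: "weight n z l \<in> borel_measurable (leb n)"
  unfolding weight_def by measurable

lemma weight_nonneg [simp]: "0 \<le> weight n z l x"
  by (simp add: weight_def)

lemma weight_le: "0 \<le> l \<Longrightarrow> 0 < d \<Longrightarrow> d \<le> Rn_dist n z x \<Longrightarrow> weight n z l x \<le> d powr (- l)"
  unfolding weight_def by (intro powr_mono2') auto

lemma weight_ge: "0 \<le> l \<Longrightarrow> 0 < Rn_dist n z x \<Longrightarrow> Rn_dist n z x \<le> d \<Longrightarrow> d powr (- l) \<le> weight n z l x"
  unfolding weight_def by (intro powr_mono2') auto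

lemma weight_csmooth_memLq:
  assumes "csmooth n K f" "0 < d" "\<And>x. x \<in> K \<Longrightarrow> d \<le> Rn_dist n z x" "0 \<le> l" "0 < q"
  shows "memLq (leb n) q (\<lambda>x. weight n z l x * f x)"
proof (rule memLq_mono(1)[OF assms(5) memLq_cmult[OF csmooth_memLq[OF assms(1,5)], of "d powr (-l)"]])
  show "AE x in leb n. \<bar>weight n z l x * f x\<bar> \<le> \<bar>d powr (- l) * f x\<bar>"
  proof (rule AE_I2)
    fix x assume "x \<in> space (leb n)"
    then show "\<bar>weight n z l x * f x\<bar> \<le> \<bar>d powr (- l) * f x\<bar>"
      using csmooth_zero[OF assms(1), of x] weight_le[OF assms(4,2) assms(3), of x]
      by (cases "x \<in> K") (auto simp: abs_mult intro!: mult_right_mono)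
  qed
qed (use csmooth_meas[OF assms(1)] in measurable)

text \<open>The reciprocal identities are the Hoelder relations used below: from \<open>L^2\<close>
  to \<open>L^p\<close> and from \<open>L^p'\<close> to \<open>L^2\<close> on bounded sets at the
  cost of the \<open>n\<close>-th root of the volume, multiplication by a potential in
  \<open>L^(n/2)\<close>, and duality.\<close>

lemma exp_p_props:
  assumes "3 \<le> n"
  shows "1 \<le> exp_p n" "2 < exp_p' n" "0 < exp_p n" "0 < exp_p' n"
    "1 / exp_p n = 1 / 2 + 1 / real n" "1 / 2 = 1 / exp_p' n + 1 / real n"
    "1 / exp_p n = 1 / (real n / 2) + 1 / exp_p' n" "1 / 1 = 1 / exp_p n + 1 / exp_p' n"
  using assms by (auto simp: exp_p_def exp_p'_def field_simps)

text \<open>\<open>carleman_const\<close> speaks of balls about the origin. A translation moves the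
  pole to \<open>z\<close>, and the ball is chosen so large that it contains the translated support;
  staying at distance \<open>d\<close> from \<open>z\<close> keeps the support away from the
  pole.\<close>

lemma carleman_smooth:
  assumes C: "carleman_const n \<theta>" and l: "l \<in> carleman_exponents n" and n: "3 \<le> n"
    and W: "csmooth n K W" and d: "0 < d" "\<And>x. x \<in> K \<Longrightarrow> d \<le> Rn_dist n z x"
  shows "normLq (leb n) (exp_p' n) (\<lambda>x. weight n z l x * W x)
      \<le> \<theta> * normLq (leb n) (exp_p n) (\<lambda>x. weight n z l x * laplacian n W x)"
proof -
  define K' where "K' = {x \<in> Rn n. shift n z x \<in> K}"
  define U where "U x = W (shift n z x)" for x
  have U: "csmooth n K' U" unfolding K'_def U_def by (rule csmooth_shift[OF W])
  obtain s where s: "K \<subseteq> clball n z s" using compactin_subset_clball[OF csmooth_compact[OF W]] by blast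
  define \<rho> where "\<rho> = sqrt \<bar>s\<bar> + 1"
  have rho: "0 < \<rho>" "\<bar>s\<bar> < \<rho>\<^sup>2"
    by (auto simp: \<rho>_def power2_eq_square algebra_simps intro!: add_nonneg_pos add_pos_nonneg)
  define B where "B = Rn_ball n (origin n) \<rho>"
  have dist: "Rn_norm n x = Rn_dist n z (shift n z x)" for x
    unfolding Rn_dist_sq_dist sq_dist_shift by (simp add: Rn_norm_def L2_set_def sq_dist_def origin_def)
  have KB: "K' \<subseteq> B - {origin n}"
  proof
    fix x assume x: "x \<in> K'"
    then have "sq_dist n z (shift n z x) \<le> s" using s by (auto simp: K'_def clball_def)
    then have "sq_dist n (origin n) x < \<rho>\<^sup>2" using rho by (simp add: sq_dist_shift)
    moreover have "0 < Rn_norm n x" using d x by (force simp: dist K'_def)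
    then have "x \<noteq> origin n" by (auto simp: Rn_norm_def L2_set_def origin_def)
    ultimately show "x \<in> B - {origin n}" using x rho(1) by (auto simp: B_def Rn_ball_sq_dist K'_def)
  qed
  have Bs: "B \<in> sets (leb n)" unfolding B_def by measurable
  note ep = exp_p_props[OF n]
  have weak: "weak_laplacian n B U (laplacian n U)"
    unfolding weak_laplacian_def weak_gradient_def
  proof (intro exI conjI allI impI)
    show "weak_partial n B i U (partial_deriv i U)" if "i < n" for i
      by (rule csmooth_weak_partial[OF U that Bs])
    show "weak_partial n B i (partial_deriv i U) (partial_deriv i (partial_deriv i U))" if "i < n" for i
      by (rule csmooth_weak_partial[OF csmooth_partial[OF U that] that Bs])
  qed (simp add: laplacian_def fun_eq_iff)
  have sob: "U \<in> sobolev n 2 (exp_p n) B" by (rule csmooth_sobolev[OF U ep(3) Bs])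
  have ae: "AE x in leb n. x \<in> B - K' \<longrightarrow> U x = 0" using csmooth_zero[OF U] by (auto simp: B_def Rn_ball_def)
  have main: "Lp_norm n (exp_p' n) B (\<lambda>x. Rn_norm n x powr (- l) * U x)
          \<le> \<theta> * Lp_norm n (exp_p n) B (\<lambda>x. Rn_norm n x powr (- l) * laplacian n U x)"
    using C[unfolded carleman_const_def, rule_format, OF rho(1) l, of U "laplacian n U" K'] sob weak KB ae csmooth_compact[OF U]
    unfolding B_def by blast
  have "Lp_norm n (exp_p' n) B (\<lambda>x. Rn_norm n x powr (- l) * U x) = normLq (leb n) (exp_p' n) (\<lambda>x. Rn_norm n x powr (- l) * U x)"
    by (rule Lp_norm_eq_normLq) (use ep KB csmooth_zero[OF U] in auto)
  also have "\<dots> = normLq (leb n) (exp_p' n) (\<lambda>x. (\<lambda>y. weight n z l y * W y) (shift n z x))"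
    by (simp add: dist weight_def U_def)
  also have "\<dots> = normLq (leb n) (exp_p' n) (\<lambda>x. weight n z l x * W x)"
    by (rule normLq_shift) (use csmooth_meas[OF W] in measurable)
  finally have e1: "Lp_norm n (exp_p' n) B (\<lambda>x. Rn_norm n x powr (- l) * U x) = normLq (leb n) (exp_p' n) (\<lambda>x. weight n z l x * W x)" .
  have "Lp_norm n (exp_p n) B (\<lambda>x. Rn_norm n x powr (- l) * laplacian n U x) = normLq (leb n) (exp_p n) (\<lambda>x. Rn_norm n x powr (- l) * laplacian n U x)"
    by (rule Lp_norm_eq_normLq) (use ep KB csmooth_zero[OF csmooth_laplacian[OF U]] in auto)
  also have "\<dots> = normLq (leb n) (exp_p n) (\<lambda>x. (\<lambda>y. weight n z l y * laplacian n W y) (shift n z x))"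
    by (rule normLq_cong) (simp add: dist weight_def U_def[abs_def] laplacian_shift[OF csmooth_smooth[OF W]])
  also have "\<dots> = normLq (leb n) (exp_p n) (\<lambda>x. weight n z l x * laplacian n W x)"
    by (rule normLq_shift) (use csmooth_meas[OF csmooth_laplacian[OF W]] in measurable)
  finally show ?thesis using main e1 by simp
qed

subsection \<open>The Gagliardo-Nirenberg-Sobolev inequality\<close>

lemma measurable_extend: "(\<lambda>x. x(n := t)) \<in> measurable (leb n) (leb (Suc n))"
  unfolding leb_def lessThan_Suc by (rule measurable_fun_upd[where J = "{..<n}"]) auto

lemma nn_leb_Suc:
  assumes "f \<in> borel_measurable (leb (Suc n))"
  shows "(\<integral>\<^sup>+x. f x \<partial>leb (Suc n)) = (\<integral>\<^sup>+t. (\<integral>\<^sup>+x. f (x(n := t)) \<partial>leb n) \<partial>lborel)"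
    and "(\<integral>\<^sup>+x. f x \<partial>leb (Suc n)) = (\<integral>\<^sup>+x. (\<integral>\<^sup>+t. f (x(n := t)) \<partial>lborel) \<partial>leb n)"
  using leb_factors.product_nn_integral_insert_rev[of "{..<n}" n f] leb_factors.product_nn_integral_insert[of "{..<n}" n f] assms
  by (simp_all add: leb_def lessThan_Suc)

lemma extend_Rn: "x \<in> Rn n \<Longrightarrow> x(n := t) \<in> Rn (Suc n)"
  unfolding Rn_def by (auto simp: PiE_iff extensional_def)

text \<open>The situation of Gagliardo's lemma: \<open>U\<close> is dominated by the integral of
  \<open>G\<close> along every coordinate line. For \<open>U\<close> a power of a smooth function,
  \<open>G\<close> comes from its gradient. Integrals take values in \<open>ennreal\<close>, so no
  integrability has to be known in advance.\<close>

definition line_bound :: "nat \<Rightarrow> ((nat \<Rightarrow> real) \<Rightarrow> real) \<Rightarrow> ((nat \<Rightarrow> real) \<Rightarrow> real) \<Rightarrow> bool" where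
  "line_bound n U G \<longleftrightarrow> U \<in> borel_measurable (leb n) \<and> G \<in> borel_measurable (leb n) \<and>
     (\<forall>x\<in>Rn n. 0 \<le> U x) \<and>
     (\<forall>x\<in>Rn n. \<forall>i<n. ennreal (U x) \<le> (\<integral>\<^sup>+t. ennreal (G (x(i := t))) \<partial>lborel))"

lemma line_bound_slice:
  assumes "line_bound (Suc n) U G"
  shows "line_bound n (\<lambda>x. U (x(n := t))) (\<lambda>x. G (x(n := t)))"
  unfolding line_bound_def
proof (intro conjI ballI allI impI)
  note a = assms[unfolded line_bound_def]
  show "(\<lambda>x. U (x(n := t))) \<in> borel_measurable (leb n)" "(\<lambda>x. G (x(n := t))) \<in> borel_measurable (leb n)"
    using a by (auto intro: measurable_compose[OF measurable_extend])
  fix x i assume x: "x \<in> Rn n"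
  show "0 \<le> U (x(n := t))" using a extend_Rn[OF x] by auto
  assume i: "i < n"
  have "ennreal (U (x(n := t))) \<le> (\<integral>\<^sup>+s. ennreal (G ((x(n := t))(i := s))) \<partial>lborel)"
    using a extend_Rn[OF x] i by auto
  also have "\<dots> = (\<integral>\<^sup>+s. ennreal (G ((x(i := s))(n := t))) \<partial>lborel)"
    using i by (subst fun_upd_twist) auto
  finally show "ennreal (U (x(n := t))) \<le> (\<integral>\<^sup>+s. ennreal (G ((x(i := s))(n := t))) \<partial>lborel)" .
qed

text \<open>Adds a dimension without changing the exponent. Bounding \<open>U\<close> along the last
  coordinate shows that every slice of \<open>U\<close> has mass at most the total mass of
  \<open>G\<close>; the estimate in dimension \<open>n\<close> holds on each slice with this common
  bound, and is integrated over the slices.\<close>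

lemma GNS_step:
  assumes IH: "\<And>U G C'. line_bound n U G \<Longrightarrow> 0 < C' \<Longrightarrow> (\<integral>\<^sup>+x. U x \<partial>leb n) \<le> ennreal C' \<Longrightarrow>
        (\<integral>\<^sup>+x. ennreal (U x powr (1 + 1 / n)) \<partial>leb n) \<le> (\<integral>\<^sup>+x. G x \<partial>leb n) * ennreal (C' powr (1 / n))"
    and UG: "line_bound (Suc n) U G" and C: "0 < C" "(\<integral>\<^sup>+x. G x \<partial>leb (Suc n)) \<le> ennreal C"
  shows "(\<integral>\<^sup>+x. ennreal (U x powr (1 + 1 / n)) \<partial>leb (Suc n)) \<le> (\<integral>\<^sup>+x. G x \<partial>leb (Suc n)) * ennreal (C powr (1 / n))"
proof -
  have [measurable]: "U \<in> borel_measurable (leb (Suc n))" "G \<in> borel_measurable (leb (Suc n))"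
    using UG by (auto simp: line_bound_def)
  have slice: "(\<integral>\<^sup>+x. U (x(n := t)) \<partial>leb n) \<le> ennreal C" for t
  proof -
    have "(\<integral>\<^sup>+x. U (x(n := t)) \<partial>leb n) \<le> (\<integral>\<^sup>+x. (\<integral>\<^sup>+s. ennreal (G (x(n := s))) \<partial>lborel) \<partial>leb n)"
    proof (rule nn_integral_mono)
      fix x assume "x \<in> space (leb n)"
      then have "x(n := t) \<in> Rn (Suc n)" by (simp add: extend_Rn)
      then have "ennreal (U (x(n := t))) \<le> (\<integral>\<^sup>+s. ennreal (G ((x(n := t))(n := s))) \<partial>lborel)"
        using UG unfolding line_bound_def by blast
      then show "ennreal (U (x(n := t))) \<le> (\<integral>\<^sup>+s. ennreal (G (x(n := s))) \<partial>lborel)" by simp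
    qed
    also have "\<dots> = (\<integral>\<^sup>+x. G x \<partial>leb (Suc n))" by (rule nn_leb_Suc(2)[symmetric]) measurable
    finally show ?thesis using C(2) by (rule order_trans)
  qed
  have "(\<integral>\<^sup>+x. ennreal (U x powr (1 + 1 / n)) \<partial>leb (Suc n)) =
      (\<integral>\<^sup>+t. (\<integral>\<^sup>+x. ennreal (U (x(n := t)) powr (1 + 1 / n)) \<partial>leb n) \<partial>lborel)"
    by (rule nn_leb_Suc(1)) measurable
  also have "\<dots> \<le> (\<integral>\<^sup>+t. (\<integral>\<^sup>+x. G (x(n := t)) \<partial>leb n) * ennreal (C powr (1 / n)) \<partial>lborel)"
    by (intro nn_integral_mono IH line_bound_slice UG C slice)
  also have "\<dots> = (\<integral>\<^sup>+t. (\<integral>\<^sup>+x. G (x(n := t)) \<partial>leb n) \<partial>lborel) * ennreal (C powr (1 / n))"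
  proof (rule nn_integral_multc)
    have m: "(\<lambda>p. (snd p)(n := fst p)) \<in> measurable (borel \<Otimes>\<^sub>M leb n) (leb (Suc n))"
      unfolding leb_def lessThan_Suc by (rule measurable_fun_upd[where J = "{..<n}"]) auto
    have "(\<lambda>(t, x). ennreal (G (x(n := t)))) \<in> borel_measurable (borel \<Otimes>\<^sub>M leb n)"
      using measurable_compose[OF m, of "\<lambda>x. ennreal (G x)" borel] by (simp add: case_prod_beta')
    then show "(\<lambda>t. \<integral>\<^sup>+x. ennreal (G (x(n := t))) \<partial>leb n) \<in> borel_measurable lborel"
      using sigma_finite_measure.borel_measurable_nn_integral[OF sigma_finite_leb[of n]] by simp
  qed
  also have "(\<integral>\<^sup>+t. (\<integral>\<^sup>+x. G (x(n := t)) \<partial>leb n) \<partial>lborel) = (\<integral>\<^sup>+x. G x \<partial>leb (Suc n))"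
    by (rule nn_leb_Suc(1)[symmetric]) measurable
  finally show ?thesis .
qed

text \<open>Gagliardo's inequality in dimension \<open>n\<close> has exponent \<open>n / (n - 1)\<close>; the induction runs over the
  weaker exponent \<open>1 + 1 / n\<close>, interpolated with \<open>L\<^sup>1\<close>, which also makes sense for \<open>n = 1\<close>.\<close>

lemma GNS_induct:
  "line_bound (Suc m) U G \<Longrightarrow> 0 < C' \<Longrightarrow> (\<integral>\<^sup>+x. U x \<partial>leb (Suc m)) \<le> ennreal C' \<Longrightarrow>
     (\<integral>\<^sup>+x. ennreal (U x powr (1 + 1 / Suc m)) \<partial>leb (Suc m)) \<le> (\<integral>\<^sup>+x. G x \<partial>leb (Suc m)) * ennreal (C' powr (1 / Suc m))"
proof (induction m arbitrary: U G C')
  case 0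
  have [measurable]: "U \<in> borel_measurable (leb (Suc 0))" "G \<in> borel_measurable (leb (Suc 0))"
    using 0 by (auto simp: line_bound_def)
  have UG: "ennreal (U x) \<le> (\<integral>\<^sup>+x. G x \<partial>leb (Suc 0))" if "x \<in> Rn (Suc 0)" for x
  proof -
    have "ennreal (U x) \<le> (\<integral>\<^sup>+t. ennreal (G (x(0 := t))) \<partial>lborel)"
      using 0(1) that by (auto simp: line_bound_def)
    \<comment> \<open>In dimension 1 there is only one coordinate line: all other coordinates are
      \<open>undefined\<close>.\<close>
    also have "\<dots> = (\<integral>\<^sup>+t. ennreal (G ((\<lambda>_. undefined)(0 := t))) \<partial>lborel)"
    proof -
      have "x(0 := t) = (\<lambda>_. undefined)(0 := t)" for t
        using that by (auto simp: Rn_undef)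
      then show ?thesis by simp
    qed
    also have "\<dots> = (\<integral>\<^sup>+x. G x \<partial>leb (Suc 0))"
      by (subst nn_leb_Suc(2), measurable) (simp add: leb_def PiM_empty nn_integral_count_space_finite fun_upd_def)
    finally show ?thesis .
  qed
  have "(\<integral>\<^sup>+x. ennreal (U x powr (1 + 1 / Suc 0)) \<partial>leb (Suc 0)) \<le> (\<integral>\<^sup>+x. (\<integral>\<^sup>+x. G x \<partial>leb (Suc 0)) * ennreal (U x) \<partial>leb (Suc 0))"
  proof (rule nn_integral_mono)
    fix x assume "x \<in> space (leb (Suc 0))"
    then have x: "x \<in> Rn (Suc 0)" by simp
    then have "0 \<le> U x" using 0(1) by (auto simp: line_bound_def)
    then have "ennreal (U x powr (1 + 1 / Suc 0)) = ennreal (U x) * ennreal (U x)"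
      by (simp add: power2_eq_square ennreal_mult)
    also have "\<dots> \<le> (\<integral>\<^sup>+x. G x \<partial>leb (Suc 0)) * ennreal (U x)" by (intro mult_right_mono UG x) auto
    finally show "ennreal (U x powr (1 + 1 / Suc 0)) \<le> (\<integral>\<^sup>+x. G x \<partial>leb (Suc 0)) * ennreal (U x)" .
  qed
  also have "\<dots> = (\<integral>\<^sup>+x. G x \<partial>leb (Suc 0)) * (\<integral>\<^sup>+x. ennreal (U x) \<partial>leb (Suc 0))"
    by (rule nn_integral_cmult) measurable
  also have "\<dots> \<le> (\<integral>\<^sup>+x. G x \<partial>leb (Suc 0)) * ennreal (C' powr (1 / Suc 0))"
    using 0(2,3) by (intro mult_left_mono) auto
  finally show ?case .
next
  case (Suc m)
  define n where "n = Suc m"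
  define N where "N = leb (Suc n)"
  have n0: "0 < n" by (simp add: n_def)
  have UG: "line_bound (Suc n) U G" using Suc.prems by (simp add: n_def)
  have [measurable]: "U \<in> borel_measurable N" "G \<in> borel_measurable N"
    using UG by (auto simp: line_bound_def N_def)
  have U0: "0 \<le> U x" if "x \<in> space N" for x using UG that by (auto simp: line_bound_def N_def)
  have CU: "(\<integral>\<^sup>+x. U x \<partial>N) \<le> ennreal C'" using Suc.prems(3) by (simp add: N_def n_def)
  note C' = Suc.prems(2)
  have step: "(\<integral>\<^sup>+x. ennreal (U x powr (1 + 1 / n)) \<partial>N) \<le> (\<integral>\<^sup>+x. G x \<partial>N) * ennreal (C powr (1 / n))"
    if "0 < C" "(\<integral>\<^sup>+x. G x \<partial>N) \<le> ennreal C" for C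
    unfolding N_def by (rule GNS_step[OF _ UG that[unfolded N_def]]) (use Suc.IH in \<open>simp add: n_def\<close>)
  have "(\<integral>\<^sup>+x. ennreal (U x powr (1 + 1 / Suc n)) \<partial>N) \<le> (\<integral>\<^sup>+x. G x \<partial>N) * ennreal (C' powr (1 / Suc n))"
  proof (cases "\<integral>\<^sup>+x. G x \<partial>N")
    case top
    then show ?thesis using C' by (simp add: ennreal_top_mult)
  next
    case (real g)
    show ?thesis
    proof (cases "g = 0")
      \<comment> \<open>Interpolation would divide by \<open>g\<close>. If \<open>G\<close> has mass
        0, then \<open>U\<close> vanishes almost everywhere.\<close>
      case True
      have "(\<integral>\<^sup>+x. ennreal (U x powr (1 + 1 / n)) \<partial>N) \<le> 0" using step[of 1] real True by simp
      then have "(\<integral>\<^sup>+x. ennreal (U x powr (1 + 1 / n)) \<partial>N) = 0" by simp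
      then have "AE x in N. ennreal (U x powr (1 + 1 / n)) = 0"
        by (subst (asm) nn_integral_0_iff_AE) measurable
      then have "AE x in N. U x = 0"
        by eventually_elim (metis ennreal_eq_0_iff powr_eq_0_iff powr_ge_zero antisym)
      then have "AE x in N. ennreal (U x powr (1 + 1 / Suc n)) = 0" by eventually_elim simp
      then have "(\<integral>\<^sup>+x. ennreal (U x powr (1 + 1 / Suc n)) \<partial>N) = 0"
        by (subst nn_integral_0_iff_AE) measurable
      then show ?thesis by simp
    next
      case False
      then have g: "0 < g" using real by simp
      \<comment> \<open>The interpolation weight:
        \<open>1 + 1/(n+1) = (1 - s) * 1 + s * (1 + 1/n)\<close>. The two endpoints are the mass of
        \<open>U\<close>, bounded by \<open>C'\<close>, and the lifted estimate, bounded by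
        \<open>D = g powr (1 + 1/n)\<close>, whose power \<open>s\<close> is
        \<open>g\<close>.\<close>
      define s where "s = real n / (real n + 1)"
      have "1 + 1 / real n = (real n + 1) / real n" using n0 by (simp add: field_simps)
      moreover have "real n + 1 \<noteq> 0" by linarith
      ultimately have s4: "s * (1 + 1 / n) = 1" using n0 by (simp add: s_def)
      have s: "0 < s" "0 < 1 - s" "1 - s = 1 / (real n + 1)" "s * (1 + 1 / n) = 1"
        using n0 s4 by (simp_all add: s_def field_simps)
      define D where "D = g powr (1 + 1 / n)"
      have D: "0 < D" using g by (simp add: D_def)
      have Ds: "D powr s = g" using g s(4) by (simp add: D_def powr_powr mult.commute)
      have le1: "(\<integral>\<^sup>+x. ennreal (U x powr (1 + 1 / n)) \<partial>N) \<le> ennreal D"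
        using step[OF g] real g by (simp add: D_def powr_add ennreal_mult)
      define c where "c = C' powr (1 - s) * g"
      have c: "0 < c" using C' g by (simp add: c_def)
      have pt: "U x powr (1 + 1 / Suc n) \<le> c * ((1 - s) / C') * U x + c * (s / D) * U x powr (1 + 1 / n)"
        if "x \<in> space N" for x
      proof -
        have u: "0 \<le> U x" by (rule U0[OF that])
        have "U x powr (1 + 1 / Suc n) = U x powr (1 - s) * U x powr 1"
          using s by (subst powr_add[symmetric]) (simp add: add.commute)
        also have "U x powr 1 = (U x powr (1 + 1 / n)) powr s"
          using s(4) u by (simp add: powr_powr mult.commute)
        also have "U x powr (1 - s) * (U x powr (1 + 1 / n)) powr s = c * ((U x / C') powr (1 - s) * (U x powr (1 + 1 / n) / D) powr s)"
          using u C' D g by (simp add: powr_divide c_def Ds)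
        also have "\<dots> \<le> c * ((1 - s) * (U x / C') + s * (U x powr (1 + 1 / n) / D))"
          using c s u C' D by (intro mult_left_mono young_powr) auto
        finally show ?thesis by (simp add: algebra_simps)
      qed
      have "(\<integral>\<^sup>+x. ennreal (U x powr (1 + 1 / Suc n)) \<partial>N)
          \<le> (\<integral>\<^sup>+x. ennreal (c * ((1 - s) / C')) * ennreal (U x) + ennreal (c * (s / D)) * ennreal (U x powr (1 + 1 / n)) \<partial>N)"
      proof (rule nn_integral_mono)
        fix x assume x: "x \<in> space N"
        have "ennreal (U x powr (1 + 1 / Suc n)) \<le> ennreal (c * ((1 - s) / C') * U x + c * (s / D) * U x powr (1 + 1 / n))"
          by (intro ennreal_leI pt x)
        also have "\<dots> = ennreal (c * ((1 - s) / C')) * ennreal (U x) + ennreal (c * (s / D)) * ennreal (U x powr (1 + 1 / n))"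
          using U0[OF x] c s C' D by (simp add: ennreal_mult[symmetric] ennreal_plus[symmetric] del: ennreal_plus)
        finally show "ennreal (U x powr (1 + 1 / Suc n)) \<le> \<dots>" .
      qed
      also have "\<dots> = ennreal (c * ((1 - s) / C')) * (\<integral>\<^sup>+x. U x \<partial>N) + ennreal (c * (s / D)) * (\<integral>\<^sup>+x. ennreal (U x powr (1 + 1 / n)) \<partial>N)"
        by (simp add: nn_integral_add nn_integral_cmult)
      also have "\<dots> \<le> ennreal (c * ((1 - s) / C')) * ennreal C' + ennreal (c * (s / D)) * ennreal D"
        by (intro add_mono mult_left_mono CU le1) auto
      also have "\<dots> = ennreal (c * ((1 - s) / C') * C' + c * (s / D) * D)"
        using c s C' D by (simp add: ennreal_mult[symmetric] ennreal_plus[symmetric] del: ennreal_plus)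
      also have "c * ((1 - s) / C') * C' + c * (s / D) * D = c * (1 - s) + c * s" using C' D by simp
      also have "\<dots> = c" by (simp add: algebra_simps)
      also have "ennreal c = ennreal g * ennreal (C' powr (1 / Suc n))"
        using g s(3) by (simp add: c_def ennreal_mult[symmetric] mult.commute add.commute)
      finally show ?thesis using real by simp
    qed
  qed
  then show ?case by (simp add: N_def n_def)
qed

text \<open>One further slicing step after the induction gives, in dimension \<open>n + 1\<close>,
  the full exponent \<open>(n + 1) / n\<close>.\<close>

lemma GNS:
  assumes UG: "line_bound (Suc n) U G" and n: "0 < n" and C: "0 < C" "(\<integral>\<^sup>+x. G x \<partial>leb (Suc n)) \<le> ennreal C"
  shows "(\<integral>\<^sup>+x. ennreal (U x powr (1 + 1 / n)) \<partial>leb (Suc n)) \<le> ennreal (C powr (1 + 1 / n))"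
proof -
  obtain m where m: "n = Suc m" using n by (cases n) auto
  have "(\<integral>\<^sup>+x. ennreal (U x powr (1 + 1 / n)) \<partial>leb (Suc n)) \<le> (\<integral>\<^sup>+x. G x \<partial>leb (Suc n)) * ennreal (C powr (1 / n))"
    using GNS_induct[of m] by (intro GNS_step[OF _ UG C]) (simp add: m)
  also have "\<dots> \<le> ennreal C * ennreal (C powr (1 / n))" by (intro mult_right_mono C) auto
  also have "\<dots> = ennreal (C powr (1 + 1 / n))" using C(1) by (simp add: powr_add ennreal_mult)
  finally show ?thesis .
qed

lemma abs_powr_deriv:
  fixes t :: real assumes g: "2 < g"
  shows "((\<lambda>t. \<bar>t\<bar> powr g) has_real_derivative g * (t * \<bar>t\<bar> powr (g - 2))) (at t)"
proof -
  have sq: "\<bar>t\<bar> powr g = t * (t * \<bar>t\<bar> powr (g - 2))" for t :: real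
  proof (cases "t = 0")
    case False
    have "\<bar>t\<bar> powr g = \<bar>t\<bar> powr (2 + (g - 2))" by simp
    also have "\<dots> = \<bar>t\<bar> powr 2 * \<bar>t\<bar> powr (g - 2)" by (rule powr_add)
    also have "\<bar>t\<bar> powr 2 = t * t" using False by (simp add: power2_eq_square)
    finally show ?thesis by (simp add: mult.assoc)
  qed auto
  consider "t > 0" | "t < 0" | "t = 0" by linarith
  then show ?thesis
  proof cases
    case 1
    have "((\<lambda>t. t powr g) has_real_derivative g * t powr (g - 1)) (at t)"
      using 1 by (rule has_real_derivative_powr)
    moreover have "t powr (g - 1) = t powr 1 * t powr (g - 2)" by (subst powr_add[symmetric]) (simp add: algebra_simps)
    ultimately have "((\<lambda>t. t powr g) has_real_derivative g * (t * \<bar>t\<bar> powr (g - 2))) (at t)" using 1 by simp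
    then show ?thesis
      by (rule has_field_derivative_transform_within_open[where S = "{0<..}"]) (use 1 in auto)
  next
    case 2
    have "((\<lambda>t. (- t) powr g) has_real_derivative g * (- t) powr (g - 1) * (-1)) (at t)"
      using 2 by (auto intro!: derivative_eq_intros DERIV_chain2[OF has_real_derivative_powr])
    moreover have "(-t) powr (g - 1) = (-t) powr 1 * (-t) powr (g - 2)" by (subst powr_add[symmetric]) (simp add: algebra_simps)
    ultimately have "((\<lambda>t. (-t) powr g) has_real_derivative g * (t * \<bar>t\<bar> powr (g - 2))) (at t)" using 2 by simp
    then show ?thesis
      by (rule has_field_derivative_transform_within_open[where S = "{..<0}"]) (use 2 in auto)
  next
    case 3
    have "((\<lambda>h. h * \<bar>h\<bar> powr (g - 2)) \<longlongrightarrow> 0 * 0) (at (0::real))"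
      using g by (intro tendsto_mult tendsto_zero_powrI[where b = "g - 2"] tendsto_rabs_zero tendsto_ident_at tendsto_const) auto
    then have "((\<lambda>h. (\<bar>0 + h\<bar> powr g - \<bar>0\<bar> powr g) / h) \<longlongrightarrow> 0 * 0) (at (0::real))"
      by (rule Lim_transform_eventually) (auto simp: eventually_at_filter sq)
    then show ?thesis using 3 by (simp add: DERIV_def)
  qed
qed

definition grad_norm :: "nat \<Rightarrow> ((nat \<Rightarrow> real) \<Rightarrow> real) \<Rightarrow> (nat \<Rightarrow> real) \<Rightarrow> real" where
  "grad_norm n f x = sqrt (\<Sum>i<n. (partial_deriv i f x)\<^sup>2)"

lemma grad_norm_nonneg [simp]: "0 \<le> grad_norm n f x"
  by (simp add: grad_norm_def sum_nonneg)

lemma grad_norm_sq: "(grad_norm n f x)\<^sup>2 = (\<Sum>i<n. (partial_deriv i f x)\<^sup>2)"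
  by (simp add: grad_norm_def sum_nonneg)

lemma partial_le_grad_norm: "i < n \<Longrightarrow> \<bar>partial_deriv i f x\<bar> \<le> grad_norm n f x"
  unfolding grad_norm_def by (intro real_le_rsqrt) (auto intro: member_le_sum)

lemma grad_norm_meas: assumes "smooth n f" shows "grad_norm n f \<in> borel_measurable (leb n)"
proof -
  have [measurable]: "partial_deriv i f \<in> borel_measurable (leb n)" if "i \<in> {..<n}" for i
    using that by (auto intro: smooth_measurable smooth_partial assms)
  show ?thesis unfolding grad_norm_def by measurable
qed

lemma csmooth_memLq_grad_norm: assumes "csmooth n K f" shows "memLq (leb n) 2 (grad_norm n f)"
  unfolding memLq_2 grad_norm_sq
  using grad_norm_meas[OF csmooth_smooth[OF assms]] csmooth_memLq[OF csmooth_partial[OF assms], of _ 2] by (auto simp: memLq_2)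

lemma line_ftc:
  fixes h h' :: "real \<Rightarrow> real"
  assumes d: "\<And>t. (h has_real_derivative h' t) (at t)" and c: "\<And>t. isCont h' t"
    and z: "\<And>t. \<bar>t\<bar> > R \<Longrightarrow> h t = 0"
  shows "ennreal \<bar>h s\<bar> \<le> (\<integral>\<^sup>+t. ennreal \<bar>h' t\<bar> \<partial>lborel)"
proof -
  define A where "A = - (\<bar>R\<bar> + 1 + \<bar>s\<bar>)"
  have As: "A \<le> s" "h A = 0" using z[of A] by (auto simp: A_def)
  have i: "integrable lborel (\<lambda>t. h' t * indicator {A..s} t)"
    using borel_integrable_atLeastAtMost[of A s h'] c by (simp add: mult.commute)
  have "h s = (\<integral>t. h' t * indicator {A..s} t \<partial>lborel)"
    using integral_FTC_Icc_real[OF As(1), of h h'] d c As by auto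
  then have "ennreal \<bar>h s\<bar> \<le> (\<integral>\<^sup>+t. ennreal (norm (h' t * indicator {A..s} t)) \<partial>lborel)"
    using integral_norm_bound_ennreal[OF i] by simp
  also have "\<dots> \<le> (\<integral>\<^sup>+t. ennreal \<bar>h' t\<bar> \<partial>lborel)"
    by (intro nn_integral_mono ennreal_leI) (auto simp: indicator_def)
  finally show ?thesis .
qed

lemma sobolev_line_bound:
  assumes f: "csmooth n K f" and g: "2 < g"
  shows "line_bound n (\<lambda>x. \<bar>f x\<bar> powr g) (\<lambda>x. g * \<bar>f x\<bar> powr (g - 1) * grad_norm n f x)"
  unfolding line_bound_def
proof (intro conjI ballI allI impI)
  have [measurable]: "f \<in> borel_measurable (leb n)" "grad_norm n f \<in> borel_measurable (leb n)"
    using csmooth_meas[OF f] grad_norm_meas[OF csmooth_smooth[OF f]] by auto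
  show "(\<lambda>x. \<bar>f x\<bar> powr g) \<in> borel_measurable (leb n)"
    "(\<lambda>x. g * \<bar>f x\<bar> powr (g - 1) * grad_norm n f x) \<in> borel_measurable (leb n)" by measurable
  fix x i assume x: "x \<in> Rn n" and i: "i < n"
  obtain R where R: "\<And>x i. x \<in> K \<Longrightarrow> i < n \<Longrightarrow> \<bar>x i\<bar> \<le> R" using compactin_bounded[OF csmooth_compact[OF f]] by blast
  define u where "u t = f (x(i := t))" for t
  define u' where "u' t = partial_deriv i f (x(i := t))" for t
  have ud: "(u has_real_derivative u' t) (at t)" for t
    unfolding u_def u'_def by (rule smooth_deriv[OF csmooth_smooth[OF f] x i])
  have u'c: "isCont u' t" for t unfolding u'_def
    by (rule DERIV_isCont[OF smooth_deriv[OF csmooth_smooth[OF csmooth_partial[OF f i]] x i]])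
  have "ennreal \<bar>\<bar>u (x i)\<bar> powr g\<bar> \<le> (\<integral>\<^sup>+t. ennreal \<bar>g * (u t * \<bar>u t\<bar> powr (g - 2)) * u' t\<bar> \<partial>lborel)"
  proof (rule line_ftc[where R = R and h = "\<lambda>t. \<bar>u t\<bar> powr g" and s = "x i"])
    fix t
    show "((\<lambda>t. \<bar>u t\<bar> powr g) has_real_derivative g * (u t * \<bar>u t\<bar> powr (g - 2)) * u' t) (at t)"
      by (rule DERIV_chain2[OF abs_powr_deriv[OF g] ud])
    have "isCont u t" using ud by (rule DERIV_isCont)
    then show "isCont (\<lambda>t. g * (u t * \<bar>u t\<bar> powr (g - 2)) * u' t) t"
      using u'c[of t] g unfolding isCont_def by (intro tendsto_intros tendsto_powr') auto
  next
    fix t :: real assume "R < \<bar>t\<bar>"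
    then have "x(i := t) \<notin> K" using R[of "x(i := t)" i] i by auto
    then show "\<bar>u t\<bar> powr g = 0" unfolding u_def using csmooth_zero[OF f] x i by auto
  qed
  also have "\<dots> \<le> (\<integral>\<^sup>+t. ennreal (g * \<bar>f (x(i := t))\<bar> powr (g - 1) * grad_norm n f (x(i := t))) \<partial>lborel)"
  proof (intro nn_integral_mono ennreal_leI)
    fix t
    have "\<bar>u t\<bar> * \<bar>u t\<bar> powr (g - 2) = \<bar>u t\<bar> powr (g - 1)"
      using powr_add[of "\<bar>u t\<bar>" 1 "g - 2"] by (simp add: algebra_simps)
    then have "\<bar>g * (u t * \<bar>u t\<bar> powr (g - 2)) * u' t\<bar> = g * \<bar>u t\<bar> powr (g - 1) * \<bar>u' t\<bar>"
      using g by (simp add: abs_mult)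
    also have "\<dots> \<le> g * \<bar>u t\<bar> powr (g - 1) * grad_norm n f (x(i := t))"
      unfolding u'_def using g i by (intro mult_left_mono partial_le_grad_norm) auto
    finally show "\<bar>g * (u t * \<bar>u t\<bar> powr (g - 2)) * u' t\<bar> \<le> g * \<bar>f (x(i := t))\<bar> powr (g - 1) * grad_norm n f (x(i := t))"
      by (simp add: u_def)
  qed
  finally show "ennreal (\<bar>f x\<bar> powr g) \<le> (\<integral>\<^sup>+t. ennreal (g * \<bar>f (x(i := t))\<bar> powr (g - 1) * grad_norm n f (x(i := t))) \<partial>lborel)"
    by (simp add: u_def)
qed auto

text \<open>Gagliardo's estimate is applied to the power \<open>g = 2(n-1)/(n-2)\<close> of
  \<open>|f|\<close>. This \<open>g\<close> makes both \<open>g n/(n-1)\<close> and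
  \<open>2(g-1)\<close> equal to \<open>p'\<close>, so with \<open>X\<close> the integral of
  \<open>|f|^p'\<close> the Cauchy-Schwarz inequality yields
  \<open>X <= (g X^(1/2) Y)^(n/(n-1))\<close>, and a power of \<open>X\<close> cancels.\<close>

lemma sobolev_csmooth:
  assumes n: "3 \<le> n" and f: "csmooth n K f"
  shows "normLq (leb n) (exp_p' n) f \<le> 2 * (real n - 1) / (real n - 2) * normLq (leb n) 2 (grad_norm n f)"
proof -
  define g where "g = 2 * (real n - 1) / (real n - 2)"
  define p where "p = exp_p' n"
  define X where "X = (\<integral>x. \<bar>f x\<bar> powr p \<partial>leb n)"
  define Y where "Y = normLq (leb n) 2 (grad_norm n f)"
  have g: "2 < g" using n by (simp add: g_def field_simps)
  have p: "2 < p" "0 < p" using exp_p_props[OF n] by (auto simp: p_def)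
  have e1: "(g - 1) * 2 = p" using n by (simp add: g_def p_def exp_p'_def field_simps)
  define m where "m = n - 1"
  have m: "n = Suc m" "0 < m" "real m = real n - 1" using n by (auto simp: m_def)
  have "1 + 1 / real m = real n / (real n - 1)" unfolding m(3) using n by (simp add: field_simps)
  then have "g * (1 + 1 / m) = (2 * (real n - 1) * real n) / ((real n - 2) * (real n - 1))"
    by (simp add: g_def)
  also have "\<dots> = ((real n - 1) * (2 * real n)) / ((real n - 1) * (real n - 2))" by (simp only: mult_ac)
  also have "\<dots> = p" unfolding p_def exp_p'_def using n by (subst mult_divide_mult_cancel_left) auto
  finally have e2: "g * (1 + 1 / m) = p" .
  have X0: "0 \<le> X" by (simp add: X_def)
  have Y0: "0 \<le> Y" by (simp add: Y_def)
  have L1: "memLq (leb n) 2 (\<lambda>x. \<bar>f x\<bar> powr (g - 1))"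
  proof -
    have "memLq (leb n) p f" by (rule csmooth_memLq[OF f p(2)])
    then show ?thesis using e1 by (auto simp: memLq_def powr_powr)
  qed
  have N1: "normLq (leb n) 2 (\<lambda>x. \<bar>f x\<bar> powr (g - 1)) = X powr (1 / 2)"
    using e1 by (simp add: normLq_def X_def powr_powr)
  note H = Hoelder[of 2 2 1, OF _ _ _ _ L1 csmooth_memLq_grad_norm[OF f]]
  define I where "I = (\<integral>x. g * \<bar>f x\<bar> powr (g - 1) * grad_norm n f x \<partial>leb n)"
  have Hi: "integrable (leb n) (\<lambda>x. g * (\<bar>f x\<bar> powr (g - 1) * grad_norm n f x))"
    using integral_abs_le_normLq(1)[OF H(1)] by simp
  then have Hi': "integrable (leb n) (\<lambda>x. g * \<bar>f x\<bar> powr (g - 1) * grad_norm n f x)" by (simp add: mult.assoc)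
  have "I = g * (\<integral>x. \<bar>f x\<bar> powr (g - 1) * grad_norm n f x \<partial>leb n)"
    unfolding I_def by (simp add: mult.assoc)
  also have "\<dots> \<le> g * (X powr (1 / 2) * Y)"
    using H(2) integral_abs_le_normLq(2)[OF H(1)] g unfolding N1 Y_def by (intro mult_left_mono) auto
  finally have I: "I \<le> g * (X powr (1 / 2) * Y)" .
  have nnI: "(\<integral>\<^sup>+x. ennreal (g * \<bar>f x\<bar> powr (g - 1) * grad_norm n f x) \<partial>leb n) = ennreal I"
    unfolding I_def using Hi' g by (intro nn_integral_eq_integral) auto
  \<comment> \<open>\<open>GNS\<close> wants a positive bound; \<open>e\<close> is sent to 0
    afterwards.\<close>
  have bound: "X \<le> (g * (X powr (1 / 2) * Y) + e) powr (1 + 1 / m)" if e: "0 < e" for e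
  proof -
    define C where "C = g * (X powr (1 / 2) * Y) + e"
    have C: "0 < C" using e g Y0 by (auto simp: C_def intro!: add_nonneg_pos mult_nonneg_nonneg)
    have "(\<integral>\<^sup>+x. ennreal ((\<bar>f x\<bar> powr g) powr (1 + 1 / m)) \<partial>leb (Suc m)) \<le> ennreal (C powr (1 + 1 / m))"
    proof (rule GNS[OF _ m(2) C])
      show "line_bound (Suc m) (\<lambda>x. \<bar>f x\<bar> powr g) (\<lambda>x. g * \<bar>f x\<bar> powr (g - 1) * grad_norm n f x)"
        using sobolev_line_bound[OF f g] m(1) by simp
      show "(\<integral>\<^sup>+x. ennreal (g * \<bar>f x\<bar> powr (g - 1) * grad_norm n f x) \<partial>leb (Suc m)) \<le> ennreal C"
        using nnI I e unfolding m(1)[symmetric] by (simp add: C_def ennreal_leI)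
    qed
    then have "(\<integral>\<^sup>+x. ennreal (\<bar>f x\<bar> powr p) \<partial>leb n) \<le> ennreal (C powr (1 + 1 / m))"
      using e2 m(1) by (simp add: powr_powr)
    moreover have "(\<integral>\<^sup>+x. ennreal (\<bar>f x\<bar> powr p) \<partial>leb n) = ennreal X"
      unfolding X_def using csmooth_memLq[OF f p(2)] by (intro nn_integral_eq_integral) (auto simp: memLq_def)
    ultimately show ?thesis by (simp add: C_def ennreal_le_iff)
  qed
  have "((\<lambda>e. (g * (X powr (1 / 2) * Y) + e) powr (1 + 1 / m)) \<longlongrightarrow> (g * (X powr (1 / 2) * Y) + 0) powr (1 + 1 / m)) (at_right 0)"
    using m(2) g Y0 by (intro tendsto_powr' tendsto_intros) (auto simp: add_pos_nonneg eventually_at_filter intro!: always_eventually)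
  moreover have "\<forall>\<^sub>F e in at_right 0. X \<le> (g * (X powr (1 / 2) * Y) + e) powr (1 + 1 / m)"
    using bound by (auto simp: eventually_at_filter)
  ultimately have lim: "X \<le> (g * (X powr (1 / 2) * Y)) powr (1 + 1 / m)"
    using tendsto_lowerbound[of _ _ "at_right (0::real)" X] by (auto simp: trivial_limit_at_right_real)
  have "X powr (1 / p) \<le> g * Y"
  proof (cases "X = 0")
    case True then show ?thesis using g Y0 by simp
  next
    case False
    then have Xp: "0 < X" using X0 by simp
    \<comment> \<open>\<open>a = (n-1)/n\<close>, and what remains after cancelling the square root
      of \<open>X\<close> is the exponent \<open>a - 1/2 = (n-2)/(2n) = 1/p'\<close>.\<close>
    define a where "a = 1 / (1 + 1 / real m)"
    have "0 < 1 + 1 / real m" by (intro add_pos_nonneg) auto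
    then have a: "0 < a" "(1 + 1 / m) * a = 1" by (auto simp: a_def)
    have "X powr a \<le> ((g * (X powr (1 / 2) * Y)) powr (1 + 1 / m)) powr a"
      using lim X0 a by (intro powr_mono2) auto
    also have "\<dots> = g * (X powr (1 / 2) * Y)"
      using a(2) g Y0 by (simp add: powr_powr)
    finally have "X powr a \<le> X powr (1 / 2) * (g * Y)" by (simp add: mult_ac)
    moreover have "X powr a = X powr (1 / 2) * X powr (a - 1 / 2)" by (simp flip: powr_add)
    ultimately have "X powr (a - 1 / 2) \<le> g * Y" using Xp by simp
    moreover have "a - 1 / 2 = 1 / p"
      unfolding a_def m(3) p_def exp_p'_def using n by (simp add: field_simps)
    ultimately show ?thesis by simp
  qed
  then show ?thesis by (simp add: normLq_def X_def Y_def p_def g_def)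
qed

subsection \<open>Convolution with a radial kernel\<close>

text \<open>Along any sequence of increments the difference quotients are, by the mean value
  theorem, values of the derivative at intermediate points. Once the increments are below 1 these
  points lie where \<open>w\<close> dominates, and dominated convergence applies.\<close>

lemma DERIV_integral:
  fixes \<phi> \<phi>' :: "real \<Rightarrow> 'a \<Rightarrow> real"
  assumes i: "\<And>t. integrable M (\<phi> t)" and m: "\<phi>' t0 \<in> borel_measurable M"
    and d: "\<And>t y. y \<in> space M \<Longrightarrow> ((\<lambda>t. \<phi> t y) has_real_derivative \<phi>' t y) (at t)"
    and b: "\<And>t y. y \<in> space M \<Longrightarrow> \<bar>t - t0\<bar> \<le> 1 \<Longrightarrow> \<bar>\<phi>' t y\<bar> \<le> w y" and w: "integrable M w"
  shows "((\<lambda>t. \<integral>y. \<phi> t y \<partial>M) has_real_derivative (\<integral>y. \<phi>' t0 y \<partial>M)) (at t0)"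
  unfolding DERIV_def
proof (subst tendsto_at_iff_sequentially, intro allI impI)
  fix X :: "nat \<Rightarrow> real" assume X: "\<forall>k. X k \<in> UNIV - {0}" "X \<longlonglongrightarrow> 0"
  have "\<forall>\<^sub>F k in sequentially. \<bar>X k\<bar> < 1"
    using tendstoD[OF X(2), of 1] by simp
  then obtain N where N: "\<And>k. k \<ge> N \<Longrightarrow> \<bar>X k\<bar> < 1" by (auto simp: eventually_sequentially)
  define s where "s k y = (\<phi> (t0 + X (k + N)) y - \<phi> t0 y) / X (k + N)" for k y
  have "(\<lambda>k. \<integral>y. s k y \<partial>M) \<longlonglongrightarrow> (\<integral>y. \<phi>' t0 y \<partial>M)"
  proof (rule integral_dominated_convergence[where w = w])
    show "s k \<in> borel_measurable M" for k
    proof -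
      have [measurable]: "\<phi> t \<in> borel_measurable M" for t using i by auto
      show ?thesis unfolding s_def by measurable
    qed
    show "AE y in M. (\<lambda>k. s k y) \<longlonglongrightarrow> \<phi>' t0 y"
    proof (rule AE_I2)
      fix y assume y: "y \<in> space M"
      have "(\<lambda>h. (\<phi> (t0 + h) y - \<phi> t0 y) / h) \<midarrow>0\<rightarrow> \<phi>' t0 y" using d[OF y, of t0] by (simp add: DERIV_def)
      moreover have "filterlim (\<lambda>k. X (k + N)) (at 0) sequentially"
        using LIMSEQ_ignore_initial_segment[OF X(2), of N] X(1) by (auto simp: filterlim_at)
      ultimately show "(\<lambda>k. s k y) \<longlonglongrightarrow> \<phi>' t0 y" unfolding s_def by (rule filterlim_compose)
    qed
    show "AE y in M. norm (s k y) \<le> w y" for k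
    proof (rule AE_I2)
      fix y assume y: "y \<in> space M"
      define h where "h = X (k + N)"
      have h: "h \<noteq> 0" "\<bar>h\<bar> \<le> 1" using X(1) N[of "k + N"] by (auto simp: h_def)
      have "\<exists>z. \<bar>z - t0\<bar> \<le> 1 \<and> \<phi> (t0 + h) y - \<phi> t0 y = h * \<phi>' z y"
      proof (cases "h > 0")
        case True
        then obtain z where "t0 < z" "z < t0 + h" "\<phi> (t0 + h) y - \<phi> t0 y = (t0 + h - t0) * \<phi>' z y"
          using MVT2[of t0 "t0 + h" "\<lambda>t. \<phi> t y" "\<lambda>t. \<phi>' t y"] d[OF y] by auto
        then show ?thesis using h by (intro exI[of _ z]) auto
      next
        case False
        then have "h < 0" using h by simp
        then obtain z where "t0 + h < z" "z < t0" "\<phi> t0 y - \<phi> (t0 + h) y = (t0 - (t0 + h)) * \<phi>' z y"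
          using MVT2[of "t0 + h" t0 "\<lambda>t. \<phi> t y" "\<lambda>t. \<phi>' t y"] d[OF y] by auto
        then show ?thesis using h by (intro exI[of _ z]) auto
      qed
      then obtain z where z: "\<bar>z - t0\<bar> \<le> 1" "\<phi> (t0 + h) y - \<phi> t0 y = h * \<phi>' z y" by blast
      then have "s k y = \<phi>' z y" using h by (simp add: s_def h_def)
      then show "norm (s k y) \<le> w y" using b[OF y z(1)] by simp
    qed
  qed (use m w in auto)
  moreover have "(\<integral>y. s k y \<partial>M) = ((\<integral>y. \<phi> (t0 + X (k + N)) y \<partial>M) - (\<integral>y. \<phi> t0 y \<partial>M)) / X (k + N)" for k
    unfolding s_def using i by simp
  ultimately have "(\<lambda>k. ((\<integral>y. \<phi> (t0 + X (k + N)) y \<partial>M) - (\<integral>y. \<phi> t0 y \<partial>M)) / X (k + N)) \<longlonglongrightarrow> (\<integral>y. \<phi>' t0 y \<partial>M)"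
    by simp
  then show "((\<lambda>h. ((\<integral>y. \<phi> (t0 + h) y \<partial>M) - (\<integral>y. \<phi> t0 y \<partial>M)) / h) \<circ> X) \<longlonglongrightarrow> (\<integral>y. \<phi>' t0 y \<partial>M)"
    unfolding o_def by (rule LIMSEQ_offset)
qed

text \<open>Bounded support keeps the class closed under multiplication by coordinates, which is
  what differentiating a kernel in \<open>|x - y|^2\<close> produces.\<close>

definition bsupp_integrable :: "nat \<Rightarrow> ((nat \<Rightarrow> real) \<Rightarrow> real) \<Rightarrow> bool" where
  "bsupp_integrable n f \<longleftrightarrow> integrable (leb n) f \<and> (\<exists>K. compactin (Rtop n) K \<and> (\<forall>x\<in>Rn n - K. f x = 0))"

lemma coord_meas: "i < n \<Longrightarrow> (\<lambda>x. x i) \<in> borel_measurable (leb n)"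
  by (intro continuous_map_measurable continuous_map_coord)

lemma bsupp_integrable_coord:
  assumes f: "bsupp_integrable n f" and i: "i < n" shows "bsupp_integrable n (\<lambda>y. y i * f y)"
proof -
  from f obtain K where K: "compactin (Rtop n) K" "\<forall>x\<in>Rn n - K. f x = 0" "integrable (leb n) f"
    by (auto simp: bsupp_integrable_def)
  obtain R where R: "\<forall>x\<in>K. \<forall>i<n. \<bar>x i\<bar> \<le> R" using compactin_bounded[OF K(1)] by blast
  have "integrable (leb n) (\<lambda>y. y i * f y)"
  proof (rule Bochner_Integration.integrable_bound[of _ "\<lambda>y. R * f y"])
    show "AE y in leb n. norm (y i * f y) \<le> norm (R * f y)"
    proof (rule AE_I2)
      fix y assume "y \<in> space (leb n)"
      then show "norm (y i * f y) \<le> norm (R * f y)"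
        using K(2) R i by (cases "y \<in> K") (force simp: abs_mult intro!: mult_right_mono)+
    qed
  qed (use K coord_meas[OF i] in auto)
  then show ?thesis using K by (auto simp: bsupp_integrable_def)
qed

text \<open>For \<open>g\<close> vanishing on negative numbers the kernel lives on the ball of
  squared radius \<open>e\<close> about \<open>x\<close>. Writing it as a function of
  \<open>e\<close> minus the squared distance reduces its smoothness to that of
  \<open>g\<close>.\<close>

definition radial_conv :: "nat \<Rightarrow> (real \<Rightarrow> real) \<Rightarrow> real \<Rightarrow> ((nat \<Rightarrow> real) \<Rightarrow> real) \<Rightarrow> (nat \<Rightarrow> real) \<Rightarrow> real" where
  "radial_conv n g e f x = (\<integral>y. g (e - sq_dist n x y) * f y \<partial>leb n)"

lemma kernel_bounded:
  assumes "smooth1 g" "\<And>t. t < 0 \<Longrightarrow> g t = 0"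
  shows "\<exists>B\<ge>0. \<forall>t\<le>e. \<bar>g t\<bar> \<le> B"
proof -
  have "compact (g ` {0..max e 0})" by (intro compact_continuous_image smooth1_cont assms) auto
  then obtain B where B: "\<forall>t\<in>{0..max e 0}. \<bar>g t\<bar> \<le> B"
    using compact_imp_bounded by (force simp: bounded_real)
  have "\<bar>g t\<bar> \<le> max B 0" if "t \<le> e" for t
  proof (cases "t < 0")
    case False
    then have "\<bar>g t\<bar> \<le> B" using B that by auto
    then show ?thesis by simp
  qed (simp add: assms)
  then show ?thesis by (intro exI[of _ "max B 0"]) auto
qed

lemma kernel_meas:
  assumes "smooth1 g" shows "(\<lambda>y. g (e - sq_dist n x y)) \<in> borel_measurable (leb n)"
proof -
  have "g \<in> borel_measurable borel" by (intro borel_measurable_continuous_onI smooth1_cont assms)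
  then show ?thesis by measurable
qed

lemma radial_conv_integrable:
  assumes g: "smooth1 g" "\<And>t. t < 0 \<Longrightarrow> g t = 0" and f: "integrable (leb n) f"
  shows "integrable (leb n) (\<lambda>y. g (e - sq_dist n x y) * f y)"
proof -
  obtain B where B: "B \<ge> 0" "\<And>t. t \<le> e \<Longrightarrow> \<bar>g t\<bar> \<le> B" using kernel_bounded[OF g] by blast
  show ?thesis
  proof (rule Bochner_Integration.integrable_bound[of _ "\<lambda>y. B * f y"])
    show "AE y in leb n. norm (g (e - sq_dist n x y) * f y) \<le> norm (B * f y)"
      using B by (intro AE_I2) (auto simp: abs_mult intro!: mult_right_mono)
  qed (use f kernel_meas[OF g(1)] in auto)
qed

lemma radial_conv_continuous:
  assumes g: "smooth1 g" "\<And>t. t < 0 \<Longrightarrow> g t = 0" and f: "integrable (leb n) f"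
  shows "continuous_map (Rtop n) euclideanreal (radial_conv n g e f)"
proof -
  obtain B where B: "B \<ge> 0" "\<And>t. t \<le> e \<Longrightarrow> \<bar>g t\<bar> \<le> B" using kernel_bounded[OF g] by blast
  have "continuous_on UNIV (radial_conv n g e f)"
  proof (rule continuous_on_sequentiallyI)
    fix u :: "nat \<Rightarrow> nat \<Rightarrow> real" and a assume u: "u \<longlonglongrightarrow> a"
    show "(\<lambda>k. radial_conv n g e f (u k)) \<longlonglongrightarrow> radial_conv n g e f a"
      unfolding radial_conv_def
    proof (rule integral_dominated_convergence[where w = "\<lambda>y. B * \<bar>f y\<bar>"])
      have "continuous_on UNIV (\<lambda>x. g (e - sq_dist n x y))" for y
        by (rule continuous_on_compose2[OF smooth1_cont[OF g(1), of UNIV]])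
           (auto simp: sq_dist_def intro!: continuous_intros)
      then have "(\<lambda>k. g (e - sq_dist n (u k) y)) \<longlonglongrightarrow> g (e - sq_dist n a y)" for y
        by (rule continuous_on_tendsto_compose[OF _ u]) auto
      then show "AE y in leb n. (\<lambda>k. g (e - sq_dist n (u k) y) * f y) \<longlonglongrightarrow> g (e - sq_dist n a y) * f y"
        by (intro AE_I2 tendsto_mult tendsto_const)
      show "AE y in leb n. norm (g (e - sq_dist n (u k) y) * f y) \<le> B * \<bar>f y\<bar>" for k
        using B by (intro AE_I2) (auto simp: abs_mult intro!: mult_right_mono)
    qed (use f kernel_meas[OF g(1)] in auto)
  qed
  moreover have "radial_conv n g e f (restrict x {..<n}) = radial_conv n g e f x" for x
    unfolding radial_conv_def sq_dist_def by simp
  ultimately show ?thesis by (simp add: continuous_map_Rn_iff)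
qed

lemma deriv_zero_neg:
  assumes "smooth1 g" "\<And>t. t < 0 \<Longrightarrow> g t = 0" "t < 0" shows "deriv g t = 0"
proof -
  have "((\<lambda>t. 0) has_real_derivative deriv g t) (at t)"
    using has_field_derivative_transform_within_open[OF smooth1_deriv(1)[OF assms(1), of t], of "{..<0}" "\<lambda>_. 0"] assms by auto
  then show ?thesis using DERIV_unique[OF _ DERIV_const] by blast
qed

lemma radial_conv_deriv:
  assumes g: "smooth1 g" "\<And>t. t < 0 \<Longrightarrow> g t = 0" and f: "bsupp_integrable n f" and x: "x \<in> Rn n" and i: "i < n"
  shows "((\<lambda>t. radial_conv n g e f (x(i := t))) has_real_derivative
      (\<integral>y. deriv g (e - sq_dist n x y) * (-2 * (x i - y i)) * f y \<partial>leb n)) (at (x i))"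
proof -
  from f obtain K where K: "compactin (Rtop n) K" "\<forall>x\<in>Rn n - K. f x = 0" "integrable (leb n) f"
    by (auto simp: bsupp_integrable_def)
  obtain R where R: "\<forall>x\<in>K. \<forall>i<n. \<bar>x i\<bar> \<le> R" using compactin_bounded[OF K(1)] by blast
  note g' = smooth1_deriv(2)[OF g(1)] deriv_zero_neg[OF g]
  obtain B where B: "B \<ge> 0" "\<And>t. t \<le> e \<Longrightarrow> \<bar>deriv g t\<bar> \<le> B" using kernel_bounded[OF g'] by blast
  define \<phi> where "\<phi> t y = g (e - sq_dist n (x(i := t)) y) * f y" for t y
  define \<phi>' where "\<phi>' t y = deriv g (e - sq_dist n (x(i := t)) y) * (-2 * (t - y i)) * f y" for t y
  define L where "L = B * (2 * (\<bar>x i\<bar> + 1 + \<bar>R\<bar>))"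
  have "((\<lambda>t. \<integral>y. \<phi> t y \<partial>leb n) has_real_derivative (\<integral>y. \<phi>' (x i) y \<partial>leb n)) (at (x i))"
  proof (rule DERIV_integral)
    show "integrable (leb n) (\<phi> t)" for t unfolding \<phi>_def by (rule radial_conv_integrable[OF g K(3)])
    have [measurable]: "f \<in> borel_measurable (leb n)" "(\<lambda>y. y i) \<in> borel_measurable (leb n)"
      "(\<lambda>y. deriv g (e - sq_dist n (x(i := x i)) y)) \<in> borel_measurable (leb n)"
      using K(3) coord_meas[OF i] kernel_meas[OF g'(1)] by auto
    show "\<phi>' (x i) \<in> borel_measurable (leb n)" unfolding \<phi>'_def by measurable
    show "((\<lambda>t. \<phi> t y) has_real_derivative \<phi>' t y) (at t)" if "y \<in> space (leb n)" for t y
    proof -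
      have "sq_dist n (x(i := t)) y = (y i - t)\<^sup>2 + (\<Sum>j\<in>{..<n}-{i}. (y j - x j)\<^sup>2)" for t
        unfolding sq_dist_def using i by (subst sum.remove[of _ i]) (auto intro!: sum.cong)
      then have "((\<lambda>t. e - sq_dist n (x(i := t)) y) has_real_derivative -2 * (t - y i)) (at t)"
        by (auto intro!: derivative_eq_intros)
      then have "((\<lambda>t. g (e - sq_dist n (x(i := t)) y)) has_real_derivative deriv g (e - sq_dist n (x(i := t)) y) * (-2 * (t - y i))) (at t)"
        by (rule DERIV_chain2[OF smooth1_deriv(1)[OF g(1)]])
      then show ?thesis unfolding \<phi>_def \<phi>'_def by (rule DERIV_cmult_right)
    qed
    show "integrable (leb n) (\<lambda>y. L * \<bar>f y\<bar>)" using K(3) by auto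
    show "\<bar>\<phi>' t y\<bar> \<le> L * \<bar>f y\<bar>" if y: "y \<in> space (leb n)" and t: "\<bar>t - x i\<bar> \<le> 1" for t y
    proof (cases "y \<in> K")
      case True
      then have "\<bar>y i\<bar> \<le> R" using R i by auto
      then have "\<bar>t - y i\<bar> \<le> \<bar>x i\<bar> + 1 + \<bar>R\<bar>" using t by linarith
      then have "\<bar>-2 * (t - y i)\<bar> \<le> 2 * (\<bar>x i\<bar> + 1 + \<bar>R\<bar>)" unfolding abs_mult by simp
      moreover have "\<bar>deriv g (e - sq_dist n (x(i := t)) y)\<bar> \<le> B" by (rule B(2)) simp
      ultimately show ?thesis unfolding \<phi>'_def L_def abs_mult using B(1) by (intro mult_mono) auto
    qed (use y K(2) in \<open>simp add: \<phi>'_def\<close>)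
  qed
  then show ?thesis by (simp add: \<phi>_def \<phi>'_def radial_conv_def)
qed

text \<open>A partial derivative is \<open>-2 x_i (g' conv f) + 2 (g' conv (y_i f))\<close>, again
  built from such convolutions. Hence the induction on the order varies both the profile and the
  function.\<close>

lemma radial_conv_smooth:
  assumes g: "smooth1 g" "\<And>t. t < 0 \<Longrightarrow> g t = 0" and f: "bsupp_integrable n f"
  shows "smooth n (radial_conv n g e f)"
proof -
  have "Ck n k (radial_conv n g e f)" for k
    using assms
  proof (induction k arbitrary: g f)
    case 0
    then show ?case by (auto intro!: radial_conv_continuous simp: bsupp_integrable_def)
  next
    case (Suc k)
    note g' = smooth1_deriv(2)[OF Suc.prems(1)] deriv_zero_neg[OF Suc.prems(1,2)]
    show ?case
    proof (rule Ck_SucI[where g = "\<lambda>i x. (-2) * x i * radial_conv n (deriv g) e f x + 2 * radial_conv n (deriv g) e (\<lambda>y. y i * f y) x"])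
      show "continuous_map (Rtop n) euclideanreal (radial_conv n g e f)"
        using Suc.prems by (auto intro!: radial_conv_continuous simp: bsupp_integrable_def)
      fix i x assume i: "i < n" and x: "x \<in> Rn n"
      have bi: "bsupp_integrable n (\<lambda>y. y i * f y)" by (rule bsupp_integrable_coord[OF Suc.prems(3) i])
      have i1: "integrable (leb n) (\<lambda>y. deriv g (e - sq_dist n x y) * f y)"
        and i2: "integrable (leb n) (\<lambda>y. deriv g (e - sq_dist n x y) * (y i * f y))"
        using radial_conv_integrable[OF g'] Suc.prems(3) bi by (auto simp: bsupp_integrable_def)
      have "(\<integral>y. deriv g (e - sq_dist n x y) * (-2 * (x i - y i)) * f y \<partial>leb n)
          = (\<integral>y. (-2) * x i * (deriv g (e - sq_dist n x y) * f y) + 2 * (deriv g (e - sq_dist n x y) * (y i * f y)) \<partial>leb n)"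
        by (rule Bochner_Integration.integral_cong[OF refl]) (simp add: algebra_simps)
      also have "\<dots> = (-2) * x i * radial_conv n (deriv g) e f x + 2 * radial_conv n (deriv g) e (\<lambda>y. y i * f y) x"
        unfolding radial_conv_def using i1 i2 by (subst Bochner_Integration.integral_add) auto
      finally show "((\<lambda>t. radial_conv n g e f (x(i := t))) has_real_derivative
          (-2) * x i * radial_conv n (deriv g) e f x + 2 * radial_conv n (deriv g) e (\<lambda>y. y i * f y) x) (at (x i))"
        using radial_conv_deriv[OF Suc.prems x i, of e] by simp
    next
      fix i assume i: "i < n"
      show "Ck n k (\<lambda>x. (-2) * x i * radial_conv n (deriv g) e f x + 2 * radial_conv n (deriv g) e (\<lambda>y. y i * f y) x)"
        by (intro Ck_add Ck_mult Ck_const Ck_coord i Suc.IH g' Suc.prems(3) bsupp_integrable_coord)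
    qed
  qed
  then show ?thesis by (simp add: smooth_def)
qed


subsection \<open>Mollification\<close>

lemma open_measure_pos:
  assumes U: "openin (Rtop n) U" "U \<noteq> {}" shows "0 < emeasure (leb n) U"
proof -
  obtain x where x: "x \<in> U" using U by auto
  then obtain r where r: "r > 0" "\<And>y. y \<in> Rn n \<Longrightarrow> Rn_dist n x y < r \<Longrightarrow> y \<in> U"
    using U unfolding openin_Rtop_iff by blast
  define d where "d = r / (real n + 1)"
  have d: "0 < d" using r by (simp add: d_def add_nonneg_pos)
  have "(\<Pi>\<^sub>E i\<in>{..<n}. {x i - d..x i + d}) \<subseteq> U"
  proof
    fix y assume y: "y \<in> (\<Pi>\<^sub>E i\<in>{..<n}. {x i - d..x i + d})"
    have yi: "\<bar>x i - y i\<bar> \<le> d" if "i < n" for i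
    proof -
      have "y i \<in> {x i - d..x i + d}" using y that by (simp add: PiE_Rn)
      then show ?thesis unfolding atLeastAtMost_iff by linarith
    qed
    have "Rn_dist n x y \<le> (\<Sum>i<n. \<bar>x i - y i\<bar>)"
      unfolding Rn_dist_def Rn_norm_def by (rule L2_set_le_sum_abs)
    also have "\<dots> \<le> (\<Sum>i<n. d)" using yi by (intro sum_mono) auto
    also have "\<dots> < r" using r(1) by (simp add: d_def field_simps)
    finally show "y \<in> U" using r(2) y by (simp add: PiE_Rn)
  qed
  then have "emeasure (leb n) (\<Pi>\<^sub>E i\<in>{..<n}. {x i - d..x i + d}) \<le> emeasure (leb n) U"
    by (rule emeasure_mono) (rule openin_measurable[OF U(1)])
  moreover have "emeasure (leb n) (\<Pi>\<^sub>E i\<in>{..<n}. {x i - d..x i + d}) = ennreal ((2 * d) ^ n)"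
    using d by (subst emeasure_leb_box) auto
  ultimately show ?thesis using d by (metis ennreal_less_zero_iff mult_pos_pos order_less_le_trans zero_less_numeral zero_less_power)
qed

definition bump :: "nat \<Rightarrow> real \<Rightarrow> (nat \<Rightarrow> real) \<Rightarrow> (nat \<Rightarrow> real) \<Rightarrow> real" where
  "bump n e x y = flat 1 (e - sq_dist n x y)"

lemma bump_commute: "bump n e x y = bump n e y x"
  by (simp add: bump_def sq_dist_commute)

lemma bump_nonneg [simp]: "0 \<le> bump n e x y"
  by (simp add: bump_def flat1_nonneg)

lemma csmooth_bump: "csmooth n (clball n x e) (bump n e x)"
  unfolding csmooth_def bump_def
proof (intro conjI compactin_clball ballI)
  show "smooth n (\<lambda>y. flat 1 (e - sq_dist n x y))"
    by (intro smooth_comp[OF flat_smooth1] smooth_diff smooth_const smooth_sq_dist)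
qed (auto simp: clball_def flat1_zero)

definition bump_mass :: "nat \<Rightarrow> real \<Rightarrow> real" where
  "bump_mass n e = (\<integral>y. bump n e (origin n) y \<partial>leb n)"

lemma bump_integral: "(\<integral>y. bump n e x y \<partial>leb n) = bump_mass n e"
  using integral_shift[OF csmooth_meas[OF csmooth_bump[of n x e]], of x] by (simp add: bump_mass_def bump_def sq_dist_shift)

lemma origin_Rn [simp]: "origin n \<in> Rn n"
  by (simp add: origin_def)

lemma bump_mass_pos: assumes "0 < e" shows "0 < bump_mass n e"
proof -
  have i: "integrable (leb n) (bump n e (origin n))" by (rule csmooth_integrable[OF csmooth_bump])
  have "bump_mass n e \<noteq> 0"
  proof
    assume "bump_mass n e = 0"
    then have "AE y in leb n. bump n e (origin n) y = 0"
      using i unfolding bump_mass_def by (subst (asm) integral_nonneg_eq_0_iff_AE) auto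
    then have "AE y in leb n. y \<notin> {y \<in> Rn n. sq_dist n (origin n) y < e}"
      by eventually_elim (auto simp: bump_def flat1)
    then have "emeasure (leb n) {y \<in> Rn n. sq_dist n (origin n) y < e} = 0"
      using openin_measurable[OF openin_sq_dist] by (subst AE_iff_measurable[symmetric]) (auto simp: set_eq_iff)
    moreover have "0 < emeasure (leb n) {y \<in> Rn n. sq_dist n (origin n) y < e}"
      using assms by (intro open_measure_pos openin_sq_dist) (auto intro!: exI[of _ "origin n"])
    ultimately show False by simp
  qed
  moreover have "0 \<le> bump_mass n e" unfolding bump_mass_def by (rule integral_nonneg_AE) auto
  ultimately show ?thesis by simp
qed

definition moll_kernel :: "nat \<Rightarrow> real \<Rightarrow> (nat \<Rightarrow> real) \<Rightarrow> (nat \<Rightarrow> real) \<Rightarrow> real" where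
  "moll_kernel n e x y = 1 / bump_mass n e * bump n e x y"

definition moll :: "nat \<Rightarrow> real \<Rightarrow> ((nat \<Rightarrow> real) \<Rightarrow> real) \<Rightarrow> (nat \<Rightarrow> real) \<Rightarrow> real" where
  "moll n e f x = (\<integral>y. moll_kernel n e x y * f y \<partial>leb n)"

lemma moll_kernel_commute: "moll_kernel n e x y = moll_kernel n e y x"
  by (simp add: moll_kernel_def bump_commute)

lemma moll_kernel_nonneg: "0 < e \<Longrightarrow> 0 \<le> moll_kernel n e x y"
  using bump_mass_pos[of e n] by (simp add: moll_kernel_def)

lemma csmooth_moll_kernel: "csmooth n (clball n x e) (moll_kernel n e x)"
  unfolding moll_kernel_def by (intro csmooth_mult csmooth_bump smooth_const)

lemma moll_kernel_integral: "0 < e \<Longrightarrow> (\<integral>y. moll_kernel n e x y \<partial>leb n) = 1"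
  using bump_mass_pos[of e n] csmooth_integrable[OF csmooth_bump] by (simp add: moll_kernel_def bump_integral)

lemma moll_kernel_nn_integral: "0 < e \<Longrightarrow> (\<integral>\<^sup>+y. ennreal (moll_kernel n e x y) \<partial>leb n) = 1"
  by (subst nn_integral_eq_integral) (auto simp: moll_kernel_integral moll_kernel_nonneg csmooth_integrable[OF csmooth_moll_kernel])

definition moll_profile :: "nat \<Rightarrow> real \<Rightarrow> real \<Rightarrow> real" where
  "moll_profile n e t = 1 / bump_mass n e * flat 1 t"

lemma moll_profile: "smooth1 (moll_profile n e)" "t < 0 \<Longrightarrow> moll_profile n e t = 0" "moll_kernel n e x y = moll_profile n e (e - sq_dist n x y)"
proof -
  have "smooth1 (\<lambda>_::real. 1 / bump_mass n e)" by (simp add: smooth1_def kdiff_const)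
  then show "smooth1 (moll_profile n e)" unfolding moll_profile_def[abs_def] by (intro smooth1_mult flat_smooth1)
qed (simp_all add: moll_profile_def moll_kernel_def bump_def flat1_zero)

lemma moll_radial_conv: "moll n e f = radial_conv n (moll_profile n e) e f"
  by (auto simp: moll_def radial_conv_def moll_profile(3))

lemma moll_smooth: "bsupp_integrable n f \<Longrightarrow> smooth n (moll n e f)"
  unfolding moll_radial_conv by (rule radial_conv_smooth[OF moll_profile(1,2)])

lemma moll_integrable: "integrable (leb n) f \<Longrightarrow> integrable (leb n) (\<lambda>y. moll_kernel n e x y * f y)"
  unfolding moll_profile(3) by (rule radial_conv_integrable[OF moll_profile(1,2)])

lemma moll_add:
  assumes "integrable (leb n) f" "integrable (leb n) g"
  shows "moll n e (\<lambda>x. f x + g x) x = moll n e f x + moll n e g x"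
  unfolding moll_def using moll_integrable[OF assms(1)] moll_integrable[OF assms(2)]
  by (simp add: distrib_left)

lemma moll_diff:
  assumes "integrable (leb n) f" "integrable (leb n) g"
  shows "moll n e (\<lambda>x. f x - g x) x = moll n e f x - moll n e g x"
  unfolding moll_def using moll_integrable[OF assms(1)] moll_integrable[OF assms(2)]
  by (simp add: right_diff_distrib)

lemma moll_cmult: "moll n e (\<lambda>x. c * f x) x = c * moll n e f x"
  unfolding moll_def by (simp add: mult.left_commute)

lemma moll_sum:
  assumes "\<And>i. i \<in> A \<Longrightarrow> integrable (leb n) (f i)"
  shows "moll n e (\<lambda>x. \<Sum>i\<in>A. f i x) x = (\<Sum>i\<in>A. moll n e (f i) x)"
  using assms
proof (induction A rule: infinite_finite_induct)
  case (insert a A)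
  then show ?case by (simp add: moll_add Bochner_Integration.integrable_sum)
qed (auto simp: moll_def)

lemma moll_cong:
  assumes "\<And>y. y \<in> clball n x e \<Longrightarrow> f y = g y" shows "moll n e f x = moll n e g x"
  unfolding moll_def
proof (rule Bochner_Integration.integral_cong[OF refl])
  fix y assume "y \<in> space (leb n)"
  then show "moll_kernel n e x y * f y = moll_kernel n e x y * g y"
    using assms csmooth_zero[OF csmooth_moll_kernel, of y n x e] by (cases "y \<in> clball n x e") auto
qed

lemma partial_moll_kernel:
  assumes "i < n" "y \<in> Rn n"
  shows "partial_deriv i (moll_kernel n e x) y = deriv (moll_profile n e) (e - sq_dist n x y) * (2 * (x i - y i))"
proof -
  have "smooth n (\<lambda>y. e - sq_dist n x y)" by (intro smooth_diff smooth_const smooth_sq_dist)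
  moreover have "((\<lambda>t. e - sq_dist n x (y(i := t))) has_real_derivative 0 - partial_deriv i (sq_dist n x) y) (at (y i))"
    by (intro DERIV_diff DERIV_const smooth_deriv'[OF smooth_sq_dist assms(2,1)])
  then have "partial_deriv i (\<lambda>y. e - sq_dist n x y) y = - 2 * (y i - x i)"
    using assms by (subst partial_deriv_eqI) (auto simp: partial_sq_dist)
  ultimately show ?thesis
    using partial_comp[OF moll_profile(1), of n "\<lambda>y. e - sq_dist n x y" i y n e] assms
    by (simp add: moll_profile(3)[abs_def])
qed

text \<open>The kernel at \<open>x\<close> is itself a test function of \<open>\<Omega>\<close>, and
  its derivatives in \<open>x\<close> and in \<open>y\<close> differ by the sign. The truncations
  \<open>f1\<close> and \<open>g1\<close>, needed for global integrability, only have to agree with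
  \<open>f\<close> and \<open>g\<close> where the kernel lives.\<close>

lemma moll_partial:
  assumes w: "weak_partial n \<Omega> i f g" and i: "i < n" and x: "x \<in> Rn n" and xO: "clball n x e \<subseteq> \<Omega>"
    and f1: "bsupp_integrable n f1" and fe: "\<And>y. y \<in> clball n x e \<Longrightarrow> f1 y = f y" and ge: "\<And>y. y \<in> clball n x e \<Longrightarrow> g1 y = g y"
  shows "partial_deriv i (moll n e f1) x = moll n e g1 x"
proof -
  have t: "test_function n \<Omega> (moll_kernel n e x)" unfolding test_function_csmooth using csmooth_moll_kernel xO by blast
  note pk = csmooth_zero[OF csmooth_partial[OF csmooth_moll_kernel[of n x e] i]]
  have "partial_deriv i (moll n e f1) x = (\<integral>y. deriv (moll_profile n e) (e - sq_dist n x y) * (-2 * (x i - y i)) * f1 y \<partial>leb n)"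
    unfolding moll_radial_conv by (rule partial_deriv_eqI, rule radial_conv_deriv[OF moll_profile(1,2) f1 x i])
  also have "\<dots> = (\<integral>y. - (indicator \<Omega> y *\<^sub>R (f y * partial_deriv i (moll_kernel n e x) y)) \<partial>leb n)"
  proof (rule Bochner_Integration.integral_cong[OF refl])
    fix y assume "y \<in> space (leb n)"
    then have y: "y \<in> Rn n" by simp
    show "deriv (moll_profile n e) (e - sq_dist n x y) * (-2 * (x i - y i)) * f1 y = - (indicator \<Omega> y *\<^sub>R (f y * partial_deriv i (moll_kernel n e x) y))"
    proof (cases "y \<in> clball n x e")
      case True
      then have "f1 y = f y" "indicator \<Omega> y = (1::real)" using fe xO by auto
      then show ?thesis by (simp add: partial_moll_kernel[OF i y] algebra_simps)
    next
      case False then show ?thesis using pk[OF y] partial_moll_kernel[OF i y, of e x] by auto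
    qed
  qed
  also have "\<dots> = - (LINT y:\<Omega>|leb n. f y * partial_deriv i (moll_kernel n e x) y)"
    by (simp add: set_lebesgue_integral_def)
  also have "\<dots> = (LINT y:\<Omega>|leb n. g y * moll_kernel n e x y)"
    using w t by (simp add: weak_partial_def)
  also have "\<dots> = moll n e g1 x" unfolding moll_def set_lebesgue_integral_def
  proof (rule Bochner_Integration.integral_cong[OF refl])
    fix y assume "y \<in> space (leb n)"
    then show "indicator \<Omega> y *\<^sub>R (g y * moll_kernel n e x y) = moll_kernel n e x y * g1 y"
      using ge xO csmooth_zero[OF csmooth_moll_kernel, of y n x e] by (cases "y \<in> clball n x e") auto
  qed
  finally show ?thesis .
qed

lemma moll_kernel_meas_pair: "(\<lambda>(x, y). moll_kernel n e x y) \<in> borel_measurable (leb n \<Otimes>\<^sub>M leb n)"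
proof -
  have [measurable]: "flat 1 \<in> borel_measurable borel" by (intro borel_measurable_continuous_onI smooth1_cont flat_smooth1)
  have [measurable]: "(\<lambda>p. snd p i - fst p i) \<in> borel_measurable (leb n \<Otimes>\<^sub>M leb n)" if "i < n" for i
    using measurable_compose[OF measurable_fst coord_meas[OF that]] measurable_compose[OF measurable_snd coord_meas[OF that]]
    by (intro borel_measurable_diff) auto
  have "(\<lambda>p. \<Sum>i<n. (snd p i - fst p i)\<^sup>2) \<in> borel_measurable (leb n \<Otimes>\<^sub>M leb n)"
    by (intro borel_measurable_sum borel_measurable_power) auto
  then have [measurable]: "(\<lambda>p. sq_dist n (fst p) (snd p)) \<in> borel_measurable (leb n \<Otimes>\<^sub>M leb n)" by (simp add: sq_dist_def)
  have "(\<lambda>p. 1 / bump_mass n e * flat 1 (e - sq_dist n (fst p) (snd p))) \<in> borel_measurable (leb n \<Otimes>\<^sub>M leb n)"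
    by measurable
  then show ?thesis by (simp add: moll_kernel_def bump_def case_prod_beta')
qed

text \<open>The kernel is symmetric, so it has integral 1 in either variable.\<close>

lemma moll_kernel_Fubini:
  assumes e: "0 < e" and h: "h \<in> borel_measurable (leb n)"
  shows "(\<integral>\<^sup>+x. (\<integral>\<^sup>+y. ennreal (moll_kernel n e x y) * h y \<partial>leb n) \<partial>leb n) = (\<integral>\<^sup>+y. h y \<partial>leb n)"
proof -
  have "(\<lambda>p. ennreal (moll_kernel n e (snd p) (fst p)) * h (fst p)) \<in> borel_measurable (leb n \<Otimes>\<^sub>M leb n)"
    using measurable_compose[OF measurable_pair_swap' moll_kernel_meas_pair[of n e]] measurable_compose[OF measurable_fst h]
    by (intro borel_measurable_times_ennreal) (auto simp: case_prod_beta')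
  then have m: "case_prod (\<lambda>y x. ennreal (moll_kernel n e x y) * h y) \<in> borel_measurable (leb n \<Otimes>\<^sub>M leb n)"
    by (simp add: case_prod_beta')
  have "(\<integral>\<^sup>+x. (\<integral>\<^sup>+y. ennreal (moll_kernel n e x y) * h y \<partial>leb n) \<partial>leb n) = (\<integral>\<^sup>+y. (\<integral>\<^sup>+x. ennreal (moll_kernel n e x y) * h y \<partial>leb n) \<partial>leb n)"
    by (rule pair_sigma_finite.Fubini'[OF pair_sigma_finite.intro[OF sigma_finite_leb sigma_finite_leb] m])
  also have "\<dots> = (\<integral>\<^sup>+y. (\<integral>\<^sup>+x. ennreal (moll_kernel n e y x) \<partial>leb n) * h y \<partial>leb n)"
  proof (rule nn_integral_cong)
    fix y
    have "(\<lambda>x. ennreal (moll_kernel n e y x)) \<in> borel_measurable (leb n)" using csmooth_meas[OF csmooth_moll_kernel[of n y e]] by measurable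
    then show "(\<integral>\<^sup>+x. ennreal (moll_kernel n e x y) * h y \<partial>leb n) = (\<integral>\<^sup>+x. ennreal (moll_kernel n e y x) \<partial>leb n) * h y"
      by (subst nn_integral_multc[symmetric]) (simp_all add: moll_kernel_commute[of n e _ y])
  qed
  finally show ?thesis using e by (simp add: moll_kernel_nn_integral)
qed

lemma moll_meas:
  assumes "integrable (leb n) f" shows "moll n e f \<in> borel_measurable (leb n)"
  unfolding moll_radial_conv by (intro continuous_map_measurable radial_conv_continuous moll_profile(1,2) assms)

text \<open>Hoelder's inequality after splitting the kernel into its powers \<open>1/q\<close> and
  \<open>1/s\<close> with conjugate exponents; the second factor has norm 1.\<close>

lemma moll_Jensen:
  assumes e: "0 < e" and q: "1 \<le> q" and f: "memLq (leb n) q f" "integrable (leb n) f"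
  shows "\<bar>moll n e f x\<bar> powr q \<le> (\<integral>y. moll_kernel n e x y * \<bar>f y\<bar> powr q \<partial>leb n)"
proof (cases "q = 1")
  case True
  have "\<bar>moll n e f x\<bar> \<le> (\<integral>y. norm (moll_kernel n e x y * f y) \<partial>leb n)"
    unfolding moll_def using integral_norm_bound[of "leb n" "\<lambda>y. moll_kernel n e x y * f y"] by simp
  then show ?thesis using True moll_kernel_nonneg[OF e] by (simp add: abs_mult)
next
  case False
  then have q1: "1 < q" using q by simp
  define s where "s = q / (q - 1)"
  have s: "0 < s" "1 / 1 = 1 / q + 1 / s" using q1 by (auto simp: s_def field_simps)
  note k0 = moll_kernel_nonneg[OF e, of n x]
  have [measurable]: "moll_kernel n e x \<in> borel_measurable (leb n)" "f \<in> borel_measurable (leb n)"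
    using csmooth_meas[OF csmooth_moll_kernel] f by auto
  have i: "integrable (leb n) (\<lambda>y. moll_kernel n e x y * \<bar>f y\<bar> powr q)"
    by (rule moll_integrable) (use f in \<open>simp add: memLq_def\<close>)
  define F where "F y = moll_kernel n e x y powr (1 / q) * \<bar>f y\<bar>" for y
  define G where "G y = moll_kernel n e x y powr (1 / s)" for y
  have [measurable]: "F \<in> borel_measurable (leb n)" "G \<in> borel_measurable (leb n)"
    unfolding F_def G_def by measurable
  have eF: "\<bar>F y\<bar> powr q = moll_kernel n e x y * \<bar>f y\<bar> powr q" for y
    using k0[of y] q1 by (simp add: F_def abs_mult powr_mult powr_powr)
  have eG: "\<bar>G y\<bar> powr s = moll_kernel n e x y" for y
    using k0[of y] s by (simp add: G_def powr_powr)
  have F: "memLq (leb n) q F" unfolding memLq_def eF using i by simp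
  have G: "memLq (leb n) s G" unfolding memLq_def eG using csmooth_integrable[OF csmooth_moll_kernel] by simp
  have FG: "F y * G y = moll_kernel n e x y * \<bar>f y\<bar>" for y
  proof -
    have "F y * G y = (moll_kernel n e x y powr (1 / q) * moll_kernel n e x y powr (1 / s)) * \<bar>f y\<bar>" by (simp add: F_def G_def)
    also have "moll_kernel n e x y powr (1 / q) * moll_kernel n e x y powr (1 / s) = moll_kernel n e x y powr 1"
      using s(2) by (simp flip: powr_add)
    finally show ?thesis using k0[of y] by simp
  qed
  have NG: "normLq (leb n) s G = 1" unfolding normLq_def eG using e by (simp add: moll_kernel_integral)
  have "\<bar>moll n e f x\<bar> \<le> (\<integral>y. norm (moll_kernel n e x y * f y) \<partial>leb n)"
    unfolding moll_def using integral_norm_bound[of "leb n" "\<lambda>y. moll_kernel n e x y * f y"] by simp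
  also have "\<dots> = (\<integral>y. F y * G y \<partial>leb n)" using k0 by (simp add: FG abs_mult)
  also have "\<dots> \<le> normLq (leb n) 1 (\<lambda>y. F y * G y)"
    using integral_abs_le_normLq(2)[OF Hoelder(1)[OF _ s(1) _ s(2) F G]] q1 by simp
  also have "\<dots> \<le> normLq (leb n) q F * normLq (leb n) s G"
    by (rule Hoelder(2)[OF _ s(1) _ s(2) F G]) (use q1 in auto)
  finally have "\<bar>moll n e f x\<bar> powr q \<le> normLq (leb n) q F powr q"
    using q1 NG by (intro powr_mono2) auto
  then show ?thesis using q1 by (simp add: normLq_powr eF)
qed

lemma moll_memLq:
  assumes e: "0 < e" and q: "1 \<le> q" and f: "memLq (leb n) q f" "integrable (leb n) f"
  shows "memLq (leb n) q (moll n e f)" "normLq (leb n) q (moll n e f) \<le> normLq (leb n) q f"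
proof -
  have [measurable]: "moll n e f \<in> borel_measurable (leb n)" "f \<in> borel_measurable (leb n)"
    using moll_meas[OF f(2)] f by auto
  have "(\<integral>\<^sup>+x. ennreal (\<bar>moll n e f x\<bar> powr q) \<partial>leb n) \<le> (\<integral>\<^sup>+x. (\<integral>\<^sup>+y. ennreal (moll_kernel n e x y) * ennreal (\<bar>f y\<bar> powr q) \<partial>leb n) \<partial>leb n)"
  proof (rule nn_integral_mono)
    fix x
    have "(\<integral>\<^sup>+y. ennreal (moll_kernel n e x y) * ennreal (\<bar>f y\<bar> powr q) \<partial>leb n) = (\<integral>\<^sup>+y. ennreal (moll_kernel n e x y * \<bar>f y\<bar> powr q) \<partial>leb n)"
      using moll_kernel_nonneg[OF e] by (simp add: ennreal_mult)
    also have "\<dots> = ennreal (\<integral>y. moll_kernel n e x y * \<bar>f y\<bar> powr q \<partial>leb n)"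
      using moll_integrable[of n "\<lambda>y. \<bar>f y\<bar> powr q"] f(1) moll_kernel_nonneg[OF e]
      by (intro nn_integral_eq_integral) (auto simp: memLq_def)
    finally show "ennreal (\<bar>moll n e f x\<bar> powr q) \<le> (\<integral>\<^sup>+y. ennreal (moll_kernel n e x y) * ennreal (\<bar>f y\<bar> powr q) \<partial>leb n)"
      using moll_Jensen[OF assms, of x] by (simp add: ennreal_leI)
  qed
  also have "\<dots> = (\<integral>\<^sup>+y. ennreal (\<bar>f y\<bar> powr q) \<partial>leb n)" by (rule moll_kernel_Fubini[OF e]) measurable
  also have "\<dots> = ennreal (\<integral>y. \<bar>f y\<bar> powr q \<partial>leb n)"
    using f(1) by (intro nn_integral_eq_integral) (auto simp: memLq_def)
  finally have le: "(\<integral>\<^sup>+x. ennreal (\<bar>moll n e f x\<bar> powr q) \<partial>leb n) \<le> ennreal (\<integral>y. \<bar>f y\<bar> powr q \<partial>leb n)" .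
  have i: "integrable (leb n) (\<lambda>x. \<bar>moll n e f x\<bar> powr q)"
    by (rule integrableI_nonneg) (use le_less_trans[OF le] in auto)
  then show "memLq (leb n) q (moll n e f)" by (simp add: memLq_def)
  have "ennreal (\<integral>x. \<bar>moll n e f x\<bar> powr q \<partial>leb n) \<le> ennreal (\<integral>y. \<bar>f y\<bar> powr q \<partial>leb n)"
    using le i by (subst nn_integral_eq_integral[symmetric]) auto
  then have "(\<integral>x. \<bar>moll n e f x\<bar> powr q \<partial>leb n) \<le> (\<integral>y. \<bar>f y\<bar> powr q \<partial>leb n)"
    by (simp add: ennreal_le_iff integral_nonneg_AE)
  then show "normLq (leb n) q (moll n e f) \<le> normLq (leb n) q f"
    unfolding normLq_def using q by (intro powr_mono2) auto
qed

definition moll_scale :: "nat \<Rightarrow> real" where "moll_scale m = 1 / (real m + 1)"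

lemma moll_scale_pos [simp]: "0 < moll_scale m" by (simp add: moll_scale_def add_nonneg_pos)

lemma moll_scale_tendsto: "moll_scale \<longlonglongrightarrow> 0"
  unfolding moll_scale_def using LIMSEQ_inverse_real_of_nat by (simp add: inverse_eq_divide add.commute)

lemma moll_scale_less: "0 < d \<Longrightarrow> \<forall>\<^sub>F m in sequentially. moll_scale m < d"
  using order_tendstoD(2)[OF moll_scale_tendsto] by blast

definition moll_converges :: "nat \<Rightarrow> real \<Rightarrow> ((nat \<Rightarrow> real) \<Rightarrow> real) \<Rightarrow> bool" where
  "moll_converges n q f \<longleftrightarrow> (\<lambda>m. normLq (leb n) q (\<lambda>x. moll n (moll_scale m) f x - f x)) \<longlonglongrightarrow> 0"

text \<open>Mollification does not increase the norm, so convergence passes to limits in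
  \<open>L^q\<close>: the error for \<open>f\<close> exceeds that for \<open>h\<close> by at most
  twice the distance of the two.\<close>

lemma moll_converges_approx:
  assumes q: "1 \<le> q" and f: "memLq (leb n) q f" "integrable (leb n) f"
    and h: "\<And>d. 0 < d \<Longrightarrow> \<exists>h. memLq (leb n) q h \<and> integrable (leb n) h \<and> normLq (leb n) q (\<lambda>x. f x - h x) \<le> d \<and> moll_converges n q h"
  shows "moll_converges n q f"
  unfolding moll_converges_def
proof (rule LIMSEQ_I)
  fix r :: real assume r: "0 < r"
  obtain h where h: "memLq (leb n) q h" "integrable (leb n) h" "normLq (leb n) q (\<lambda>x. f x - h x) \<le> r / 4" "moll_converges n q h"
    using h[of "r / 4"] r by auto
  obtain N where N: "\<And>m. m \<ge> N \<Longrightarrow> norm (normLq (leb n) q (\<lambda>x. moll n (moll_scale m) h x - h x) - 0) < r / 4"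
    using LIMSEQ_D[OF h(4)[unfolded moll_converges_def], of "r / 4"] r by auto
  have "norm (normLq (leb n) q (\<lambda>x. moll n (moll_scale m) f x - f x) - 0) < r" if m: "m \<ge> N" for m
  proof -
    note mf = moll_memLq[OF moll_scale_pos q f, of m] and mh = moll_memLq[OF moll_scale_pos q h(1,2), of m]
    have d: "memLq (leb n) q (\<lambda>x. f x - h x)" "integrable (leb n) (\<lambda>x. f x - h x)"
      using f h by (auto intro: memLq_diff q)
    note md = moll_memLq[OF moll_scale_pos q d, of m]
    have eq: "(\<lambda>x. moll n (moll_scale m) f x - f x) = (\<lambda>x. (moll n (moll_scale m) (\<lambda>x. f x - h x) x - (f x - h x)) + (moll n (moll_scale m) h x - h x))"
      using moll_diff[OF f(2) h(2)] by auto
    have "normLq (leb n) q (\<lambda>x. moll n (moll_scale m) f x - f x) \<le> normLq (leb n) q (\<lambda>x. moll n (moll_scale m) (\<lambda>x. f x - h x) x - (f x - h x)) + normLq (leb n) q (\<lambda>x. moll n (moll_scale m) h x - h x)"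
      unfolding eq by (intro Minkowski(2) memLq_diff q md(1) mh(1) h(1) d(1))
    also have "normLq (leb n) q (\<lambda>x. moll n (moll_scale m) (\<lambda>x. f x - h x) x - (f x - h x)) \<le> normLq (leb n) q (moll n (moll_scale m) (\<lambda>x. f x - h x)) + normLq (leb n) q (\<lambda>x. f x - h x)"
      by (intro normLq_diff_le q md(1) d(1))
    finally have "normLq (leb n) q (\<lambda>x. moll n (moll_scale m) f x - f x) < r" using md(2) h(3) N[OF m] r by auto
    then show ?thesis by simp
  qed
  then show "\<exists>N. \<forall>m\<ge>N. norm (normLq (leb n) q (\<lambda>x. moll n (moll_scale m) f x - f x) - 0) < r" by blast
qed

lemma moll_converges_add:
  assumes q: "1 \<le> q" and f: "memLq (leb n) q f" "integrable (leb n) f" "moll_converges n q f"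
    and g: "memLq (leb n) q g" "integrable (leb n) g" "moll_converges n q g"
  shows "moll_converges n q (\<lambda>x. f x + g x)"
  unfolding moll_converges_def
proof (rule tendsto_sandwich[OF _ _ tendsto_const])
  show "(\<lambda>m. normLq (leb n) q (\<lambda>x. moll n (moll_scale m) f x - f x) + normLq (leb n) q (\<lambda>x. moll n (moll_scale m) g x - g x)) \<longlonglongrightarrow> 0"
    using tendsto_add[OF f(3)[unfolded moll_converges_def] g(3)[unfolded moll_converges_def]] by simp
  have eq: "(\<lambda>x. moll n (moll_scale m) (\<lambda>x. f x + g x) x - (f x + g x)) = (\<lambda>x. (moll n (moll_scale m) f x - f x) + (moll n (moll_scale m) g x - g x))" for m
    using moll_add[OF f(2) g(2)] by auto
  show "\<forall>\<^sub>F m in sequentially. normLq (leb n) q (\<lambda>x. moll n (moll_scale m) (\<lambda>x. f x + g x) x - (f x + g x))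
      \<le> normLq (leb n) q (\<lambda>x. moll n (moll_scale m) f x - f x) + normLq (leb n) q (\<lambda>x. moll n (moll_scale m) g x - g x)"
    unfolding eq by (intro always_eventually allI Minkowski(2) q memLq_diff moll_memLq(1) f g moll_scale_pos)
qed auto

lemma moll_converges_cmult:
  assumes "1 \<le> q" "moll_converges n q f" shows "moll_converges n q (\<lambda>x. c * f x)"
proof -
  have "normLq (leb n) q (\<lambda>x. moll n (moll_scale m) (\<lambda>x. c * f x) x - c * f x) = \<bar>c\<bar> * normLq (leb n) q (\<lambda>x. moll n (moll_scale m) f x - f x)" for m
    using normLq_cmult[of q "leb n" c "\<lambda>x. moll n (moll_scale m) f x - f x"] assms(1) by (simp add: moll_cmult right_diff_distrib)
  then show ?thesis using tendsto_mult_left[OF assms(2)[unfolded moll_converges_def], of "\<bar>c\<bar>"] by (simp add: moll_converges_def)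
qed

lemma moll_converges_zero: "0 < q \<Longrightarrow> moll_converges n q (\<lambda>x. 0)"
  by (simp add: moll_converges_def moll_def)

lemma moll_converges_sum:
  assumes q: "1 \<le> q" and f: "\<And>i. i \<in> A \<Longrightarrow> memLq (leb n) q (f i)" "\<And>i. i \<in> A \<Longrightarrow> integrable (leb n) (f i)" "\<And>i. i \<in> A \<Longrightarrow> moll_converges n q (f i)"
  shows "moll_converges n q (\<lambda>x. \<Sum>i\<in>A. f i x)"
  using f
proof (induction A rule: infinite_finite_induct)
  case (insert a A)
  then show ?case using q by (simp, intro moll_converges_add) (auto intro!: memLq_sum Bochner_Integration.integrable_sum)
qed (use q in \<open>auto intro: moll_converges_zero\<close>)

text \<open>At a point of an open set the mollified indicator is eventually exactly 1, which settles
  the inside by dominated convergence. Outside, the mass is controlled because mollification does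
  not increase the total mass.\<close>

lemma moll_converges_open:
  assumes U: "openin (Rtop n) U" "emeasure (leb n) U < \<infinity>"
  shows "moll_converges n 1 (indicator U)"
proof -
  have Us [measurable]: "U \<in> sets (leb n)" by (rule openin_measurable[OF U(1)])
  have f: "memLq (leb n) 1 (indicator U)" "integrable (leb n) (indicator U :: _ \<Rightarrow> real)"
    using memLq_indicator(1)[OF Us U(2), of 1] U(2) by auto
  note mf = moll_memLq[OF moll_scale_pos _ f]
  have k1: "integrable (leb n) (\<lambda>y. moll_kernel n (moll_scale m) x y)" for m x by (rule csmooth_integrable[OF csmooth_moll_kernel])
  have b: "0 \<le> moll n (moll_scale m) (indicator U) x \<and> moll n (moll_scale m) (indicator U) x \<le> 1" for m x
  proof
    show "0 \<le> moll n (moll_scale m) (indicator U) x" unfolding moll_def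
      by (intro integral_nonneg_AE AE_I2) (auto simp: moll_kernel_nonneg)
    have "moll n (moll_scale m) (indicator U) x \<le> (\<integral>y. moll_kernel n (moll_scale m) x y \<partial>leb n)" unfolding moll_def
      by (intro integral_mono moll_integrable f k1) (auto simp: indicator_def moll_kernel_nonneg)
    then show "moll n (moll_scale m) (indicator U) x \<le> 1" by (simp add: moll_kernel_integral)
  qed
  have ev: "\<forall>\<^sub>F m in sequentially. moll n (moll_scale m) (indicator U) x = 1" if x: "x \<in> U" for x
  proof -
    obtain d where d: "d > 0" "\<And>y. y \<in> Rn n \<Longrightarrow> Rn_dist n x y < d \<Longrightarrow> y \<in> U"
      using U(1) x unfolding openin_Rtop_iff by blast
    have "\<forall>\<^sub>F m in sequentially. moll_scale m < d\<^sup>2" using d by (intro moll_scale_less) simp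
    then show ?thesis
    proof eventually_elim
      case (elim m)
      have "moll n (moll_scale m) (indicator U) x = moll n (moll_scale m) (\<lambda>_. 1) x"
      proof (rule moll_cong)
        fix y assume "y \<in> clball n x (moll_scale m)"
        then have "y \<in> Rn n" "Rn_dist n x y < d" using elim d sq_dist_less_iff[of d n x y] by (auto simp: clball_def)
        then show "indicator U y = (1::real)" using d by auto
      qed
      then show ?case by (simp add: moll_def moll_kernel_integral)
    qed
  qed
  have m0: "moll n (moll_scale m) (indicator U) \<in> borel_measurable (leb n)" for m using moll_meas[OF f(2)] .
  note [measurable] = m0
  define a where "a m x = indicator U x * (1 - moll n (moll_scale m) (indicator U) x)" for m x
  have ai: "integrable (leb n) (a m)" for m
  proof (rule Bochner_Integration.integrable_bound[OF f(2)])
    show "AE x in leb n. norm (a m x) \<le> norm (indicator U x :: real)"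
      using b by (intro AE_I2) (auto simp: a_def indicator_def)
  qed (simp add: a_def[abs_def])
  have "(\<lambda>m. \<integral>x. a m x \<partial>leb n) \<longlonglongrightarrow> (\<integral>x. 0 \<partial>leb n)"
  proof (rule integral_dominated_convergence[where w = "indicator U"])
    show "AE x in leb n. (\<lambda>m. a m x) \<longlonglongrightarrow> 0"
    proof (intro AE_I2 tendsto_eventually)
      fix x show "\<forall>\<^sub>F m in sequentially. a m x = 0"
        using ev[of x] by (cases "x \<in> U") (auto simp: a_def elim: eventually_mono)
    qed
    show "AE x in leb n. norm (a m x) \<le> indicator U x" for m
      using b by (intro AE_I2) (auto simp: a_def indicator_def)
  qed (use f ai in auto)
  then have lim: "(\<lambda>m. 2 * (\<integral>x. a m x \<partial>leb n)) \<longlonglongrightarrow> 0" using tendsto_mult_left[of _ 0 sequentially 2] by simp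
  show ?thesis unfolding moll_converges_def
  proof (rule tendsto_sandwich[OF _ _ tendsto_const lim])
    have "normLq (leb n) 1 (\<lambda>x. moll n (moll_scale m) (indicator U) x - indicator U x) \<le> 2 * (\<integral>x. a m x \<partial>leb n)" for m
    proof -
      have mi: "integrable (leb n) (moll n (moll_scale m) (indicator U))"
        using mf(1)[of m] integral_abs_le_normLq(1) by auto
      \<comment> \<open>Both sides vanish or agree by cases: outside \<open>U\<close> the error is
        the mollified value, inside it is its deficit \<open>a\<close>. Integrated, the first two
        terms contribute at most 0, which leaves twice the integral of \<open>a\<close>.\<close>
      have pt: "\<bar>moll n (moll_scale m) (indicator U) x - indicator U x\<bar> = moll n (moll_scale m) (indicator U) x - indicator U x + 2 * a m x" for x
        using b[of m x] by (auto simp: a_def indicator_def)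
      have "normLq (leb n) 1 (\<lambda>x. moll n (moll_scale m) (indicator U) x - indicator U x) = (\<integral>x. \<bar>moll n (moll_scale m) (indicator U) x - indicator U x\<bar> \<partial>leb n)"
        by (simp add: normLq_def)
      also have "\<dots> = (\<integral>x. moll n (moll_scale m) (indicator U) x \<partial>leb n) - (\<integral>x. indicator U x \<partial>leb n) + 2 * (\<integral>x. a m x \<partial>leb n)"
        unfolding pt using mi f(2) ai by simp
      also have "(\<integral>x. moll n (moll_scale m) (indicator U) x \<partial>leb n) = normLq (leb n) 1 (moll n (moll_scale m) (indicator U))"
        using b by (simp add: normLq_def)
      also have "(\<integral>x. indicator U x \<partial>leb n) = normLq (leb n) 1 (indicator U)"
        by (simp add: normLq_def)
      finally show ?thesis using mf(2)[of m] by simp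
    qed
    then show "\<forall>\<^sub>F m in sequentially. normLq (leb n) 1 (\<lambda>x. moll n (moll_scale m) (indicator U) x - indicator U x) \<le> 2 * (\<integral>x. a m x \<partial>leb n)"
      by simp
  qed auto
qed

text \<open>Coordinate projections are continuous, so every measurable box is generated by open
  sets. This provides the generator for the induction in
  \<open>moll_converges_indicator_1\<close>.\<close>

lemma sets_leb_open: "sets (leb n) \<subseteq> sigma_sets (Rn n) {U. openin (Rtop n) U}"
proof -
  define N where "N = sigma (Rn n) {U. openin (Rtop n) U}"
  have sub: "{U. openin (Rtop n) U} \<subseteq> Pow (Rn n)" using openin_subset[of "Rtop n"] by auto
  have sN: "sets N = sigma_sets (Rn n) {U. openin (Rtop n) U}" "space N = Rn n"
    unfolding N_def using sub by (auto simp: sets_measure_of space_measure_of)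
  have "(\<lambda>x. x) \<in> measurable N (leb n)"
    unfolding leb_def
  proof (rule measurable_PiM_single')
    fix i assume i: "i \<in> {..<n}"
    have "(\<lambda>x. x i) \<in> borel_measurable N"
    proof (rule borel_measurableI)
      fix S :: "real set" assume "open S"
      then have "openin (Rtop n) {x \<in> topspace (Rtop n). x i \<in> S}"
        using i by (intro openin_continuous_map_preimage[OF continuous_map_coord]) auto
      then have "{x \<in> Rn n. x i \<in> S} \<in> sets N" unfolding sN by (auto intro: sigma_sets.Basic)
      moreover have "(\<lambda>x. x i) -` S \<inter> space N = {x \<in> Rn n. x i \<in> S}" by (auto simp: sN)
      ultimately show "(\<lambda>x. x i) -` S \<inter> space N \<in> sets N" by simp
    qed
    then show "(\<lambda>x. x i) \<in> measurable N lborel" by simp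
  qed (auto simp: sN Rn_def)
  then have "A \<in> sets N" if "A \<in> sets (leb n)" for A
    using measurable_sets[of "\<lambda>x. x" N "leb n" A] that sets.sets_into_space[OF that] by (simp add: sN Int_absorb2)
  then show ?thesis using sN by auto
qed

text \<open>Dynkin's argument: open sets are stable under intersection, and the sets with the
  claimed property are closed under complements and disjoint countable unions. Intersecting with an
  open set of finite measure keeps all indicators integrable.\<close>

lemma moll_converges_indicator_1:
  assumes A: "A \<in> sets (leb n)" and B: "openin (Rtop n) B" "emeasure (leb n) B < \<infinity>"
  shows "moll_converges n 1 (indicator (A \<inter> B))"
proof -
  have Bs [measurable]: "B \<in> sets (leb n)" by (rule openin_measurable[OF B(1)])
  have fin: "emeasure (leb n) (C \<inter> B) < \<infinity>" if "C \<in> sets (leb n)" for C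
    using emeasure_mono[of "C \<inter> B" B "leb n"] B(2) Bs by (auto intro: le_less_trans)
  have LLi: "memLq (leb n) 1 (indicator (C \<inter> B))" "integrable (leb n) (indicator (C \<inter> B) :: _ \<Rightarrow> real)" if "C \<in> sets (leb n)" for C
    using memLq_indicator(1)[of "C \<inter> B" "leb n" 1] fin[OF that] that by auto
  have sigma: "sigma_sets (Rn n) {U. openin (Rtop n) U} \<subseteq> sets (leb n)"
    using sets.sigma_sets_subset[of "{U. openin (Rtop n) U}" "leb n"] openin_measurable by auto
  have As: "A \<in> sigma_sets (Rn n) {U. openin (Rtop n) U}" using A sets_leb_open by blast
  have "Int_stable {U. openin (Rtop n) U}" by (auto simp: Int_stable_def)
  moreover have "{U. openin (Rtop n) U} \<subseteq> Pow (Rn n)" using openin_subset[of "Rtop n"] by auto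
  ultimately show ?thesis using As
  proof (induction rule: sigma_sets_induct_disjoint)
    case (basic U)
    then have "openin (Rtop n) (U \<inter> B)" using B by auto
    then show ?case using basic fin[OF openin_measurable] by (intro moll_converges_open) auto
  next
    case empty
    then show ?case using moll_converges_zero[of 1 n] by (simp add: indicator_def[abs_def])
  next
    case (compl A)
    then have As: "A \<in> sets (leb n)" using sigma by auto
    \<comment> \<open>The complement is taken inside \<open>B\<close>, where its indicator is a
      difference of two indicators with known convergence.\<close>
    have eq: "indicator ((Rn n - A) \<inter> B) x = indicator B x + (-1) * (indicator (A \<inter> B) x :: real)" for x
      using openin_subset[OF B(1)] by (auto simp: indicator_def)
    have "moll_converges n 1 (\<lambda>x. indicator B x + (-1) * indicator (A \<inter> B) x)"
      using LLi[OF As] LLi[OF Bs] moll_converges_open[OF B] moll_converges_cmult[OF _ compl(2), of "-1"] memLq_cmult[OF LLi(1)[OF As], of "-1"]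
      by (intro moll_converges_add) auto
    then show ?case unfolding eq[abs_def] .
  next
    case (union A)
    have As: "A i \<in> sets (leb n)" for i using union(2) sigma by auto
    have Us: "(\<Union>i. A i) \<in> sets (leb n)" using As by auto
    show ?case
    proof (rule moll_converges_approx[OF order_refl LLi[OF Us]])
      fix d :: real assume d: "0 < d"
      have fs: "indicator (\<Union>i<N. A i \<inter> B) x = (\<Sum>i<N. indicator (A i \<inter> B) x :: real)" for N x
        by (rule indicator_UN_disjoint) (use union(1) in \<open>auto simp: disjoint_family_on_def\<close>)
      have "(\<lambda>N. measure (leb n) (\<Union>i<N. A i \<inter> B)) \<longlonglongrightarrow> measure (leb n) (\<Union>N. \<Union>i<N. A i \<inter> B)"
      proof (rule Lim_measure_incseq)
        show "range (\<lambda>N. \<Union>i<N. A i \<inter> B) \<subseteq> sets (leb n)" using As by auto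
        show "incseq (\<lambda>N. \<Union>i<N. A i \<inter> B)" by (force simp: incseq_def)
        have "emeasure (leb n) (\<Union>N. \<Union>i<N. A i \<inter> B) \<le> emeasure (leb n) B" by (intro emeasure_mono) auto
        then show "emeasure (leb n) (\<Union>N. \<Union>i<N. A i \<inter> B) \<noteq> \<infinity>" using B(2) by auto
      qed
      moreover have "(\<Union>N. \<Union>i<N. A i \<inter> B) = (\<Union>i. A i) \<inter> B" by (auto intro: exI[of _ "Suc _"])
      ultimately have "(\<lambda>N. measure (leb n) (\<Union>i<N. A i \<inter> B)) \<longlonglongrightarrow> measure (leb n) ((\<Union>i. A i) \<inter> B)" by simp
      from LIMSEQ_D[OF this d] obtain N where N: "norm (measure (leb n) (\<Union>i<N. A i \<inter> B) - measure (leb n) ((\<Union>i. A i) \<inter> B)) < d" by blast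
      define h where "h x = (\<Sum>i<N. indicator (A i \<inter> B) x :: real)" for x
      have hL: "memLq (leb n) 1 h" "integrable (leb n) h" "moll_converges n 1 h"
        unfolding h_def using LLi[OF As] union(3)
        by (auto intro!: memLq_sum moll_converges_sum Bochner_Integration.integrable_sum)
      have hi: "h x = indicator (\<Union>i<N. A i \<inter> B) x" for x by (simp only: fs h_def)
      have BR: "X \<inter> B \<inter> Rn n = X \<inter> B" for X using openin_subset[OF B(1)] by auto
      have Ns: "(\<Union>i<N. A i \<inter> B) \<in> sets (leb n)" using As by auto
      have iN: "integrable (leb n) (indicator (\<Union>i<N. A i \<inter> B) :: _ \<Rightarrow> real)" using hL(2) by (simp add: hi[abs_def])
      have "normLq (leb n) 1 (\<lambda>x. indicator ((\<Union>i. A i) \<inter> B) x - h x) = (\<integral>x. indicator ((\<Union>i. A i) \<inter> B) x - indicator (\<Union>i<N. A i \<inter> B) x \<partial>leb n)"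
        unfolding normLq_def hi by (auto simp: indicator_def intro!: Bochner_Integration.integral_cong)
      also have "\<dots> = measure (leb n) ((\<Union>i. A i) \<inter> B) - measure (leb n) (\<Union>i<N. A i \<inter> B)"
        using LLi(2)[OF Us] iN Us Ns by (subst Bochner_Integration.integral_diff) (auto simp: BR)
      also have "\<dots> \<le> d" using N by (simp add: abs_le_iff)
      finally show "\<exists>h. memLq (leb n) 1 h \<and> integrable (leb n) h \<and> normLq (leb n) 1 (\<lambda>x. indicator ((\<Union>i. A i) \<inter> B) x - h x) \<le> d \<and> moll_converges n 1 h"
        using hL by blast
    qed
  qed
qed

text \<open>The error lies between -1 and 1, so its \<open>q\<close>-th power is bounded by its
  absolute value and the case \<open>q = 1\<close> suffices.\<close>

lemma moll_converges_indicator: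
  assumes q: "1 \<le> q" and A: "A \<in> sets (leb n)" "A \<subseteq> B" and B: "openin (Rtop n) B" "emeasure (leb n) B < \<infinity>"
  shows "moll_converges n q (indicator A)"
proof -
  have fin: "emeasure (leb n) A < \<infinity>"
    using emeasure_mono[OF A(2) openin_measurable[OF B(1)]] B(2) by (auto intro: le_less_trans)
  have f: "memLq (leb n) 1 (indicator A)" "memLq (leb n) q (indicator A)" "integrable (leb n) (indicator A :: _ \<Rightarrow> real)"
    using memLq_indicator(1)[OF A(1) fin] q A(1) fin by auto
  have c1: "moll_converges n 1 (indicator A)" using moll_converges_indicator_1[OF A(1) B] A(2) by (simp add: Int_absorb2)
  have k1: "integrable (leb n) (\<lambda>y. moll_kernel n (moll_scale m) x y)" for m x by (rule csmooth_integrable[OF csmooth_moll_kernel])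
  have b: "0 \<le> moll n (moll_scale m) (indicator A) x \<and> moll n (moll_scale m) (indicator A) x \<le> 1" for m x
  proof
    show "0 \<le> moll n (moll_scale m) (indicator A) x" unfolding moll_def
      by (intro integral_nonneg_AE AE_I2) (auto simp: moll_kernel_nonneg)
    have "moll n (moll_scale m) (indicator A) x \<le> (\<integral>y. moll_kernel n (moll_scale m) x y \<partial>leb n)" unfolding moll_def
      by (intro integral_mono moll_integrable f k1) (auto simp: indicator_def moll_kernel_nonneg)
    then show "moll n (moll_scale m) (indicator A) x \<le> 1" by (simp add: moll_kernel_integral)
  qed
  define d where "d m x = moll n (moll_scale m) (indicator A) x - indicator A x" for m x
  have d1: "\<bar>d m x\<bar> \<le> 1" for m x using b[of m x] by (auto simp: d_def indicator_def)
  have L: "memLq (leb n) q' (d m)" if "1 \<le> q'" "memLq (leb n) q' (indicator A)" for q' m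
    unfolding d_def using moll_memLq(1)[OF moll_scale_pos that f(3)] that by (intro memLq_diff) auto
  have le: "normLq (leb n) q (d m) \<le> normLq (leb n) 1 (d m) powr (1 / q)" for m
  proof -
    have "\<bar>d m x\<bar> powr q \<le> \<bar>d m x\<bar> powr 1" for x using q d1 by (intro powr_mono') auto
    then have "(\<integral>x. \<bar>d m x\<bar> powr q \<partial>leb n) \<le> (\<integral>x. \<bar>d m x\<bar> powr 1 \<partial>leb n)"
      using L[OF q f(2), of m] L[OF _ f(1), of m]
      by (intro integral_mono) (auto simp: memLq_def)
    then have "(\<integral>x. \<bar>d m x\<bar> powr q \<partial>leb n) powr (1 / q) \<le> (\<integral>x. \<bar>d m x\<bar> powr 1 \<partial>leb n) powr (1 / q)"
      using q by (intro powr_mono2 integral_nonneg_AE) auto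
    then show ?thesis by (simp add: normLq_def)
  qed
  have "(\<lambda>m. normLq (leb n) 1 (d m) powr (1 / q)) \<longlonglongrightarrow> 0 powr (1 / q)"
    using q c1 unfolding moll_converges_def d_def by (intro tendsto_powr' tendsto_const) auto
  then have "(\<lambda>m. normLq (leb n) 1 (d m) powr (1 / q)) \<longlonglongrightarrow> 0" by simp
  then have "(\<lambda>m. normLq (leb n) q (d m)) \<longlonglongrightarrow> 0"
    by (rule tendsto_sandwich[OF _ _ tendsto_const, rotated -1]) (use le in auto)
  then show ?thesis by (simp add: moll_converges_def d_def[abs_def])
qed

lemma moll_converges_cong:
  assumes "\<And>x. x \<in> Rn n \<Longrightarrow> f x = g x" shows "moll_converges n q f \<longleftrightarrow> moll_converges n q g"
proof -
  have "moll n e f x = moll n e g x" for e x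
    by (rule moll_cong) (use assms in \<open>auto simp: clball_def\<close>)
  then have "normLq (leb n) q (\<lambda>x. moll n e f x - f x) = normLq (leb n) q (\<lambda>x. moll n e g x - g x)" for e
    by (intro normLq_cong) (use assms in auto)
  then show ?thesis by (simp add: moll_converges_def)
qed

text \<open>Density of simple functions. Those chosen here are bounded by \<open>2 |f|\<close>,
  which gives both the dominating function \<open>3^q |f|^q\<close> and the bounded support of all
  level sets of nonzero values.\<close>

theorem moll_converges_memLq:
  assumes q: "1 \<le> q" and f: "memLq (leb n) q f" "bsupp_integrable n f"
  shows "moll_converges n q f"
proof -
  obtain K where K: "compactin (Rtop n) K" "\<forall>x\<in>Rn n - K. f x = 0" and fi: "integrable (leb n) f"
    using f(2) by (auto simp: bsupp_integrable_def)
  obtain s where s: "K \<subseteq> clball n (origin n) s" using compactin_subset_clball[OF K(1)] by blast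
  define B where "B = {x \<in> Rn n. sq_dist n (origin n) x < s + 1}"
  have Bo: "openin (Rtop n) B" unfolding B_def by (rule openin_sq_dist)
  have Bs: "B \<in> sets (leb n)" by (rule openin_measurable[OF Bo])
  have Bf: "emeasure (leb n) B < \<infinity>" by (rule emeasure_bounded_finite[OF Bs, of "origin n" "s + 1"]) (auto simp: B_def clball_def)
  have KB: "K \<subseteq> B" using s by (auto simp: B_def clball_def)
  have fm: "f \<in> borel_measurable (leb n)" using f by (simp add: memLq_def)
  obtain S where S': "\<forall>i. simple_function (leb n) (S i)" "\<forall>x\<in>space (leb n). (\<lambda>i. S i x) \<longlonglongrightarrow> f x"
     "\<forall>i. \<forall>x\<in>space (leb n). dist (S i x) 0 \<le> 2 * dist (f x) 0"
    using borel_measurable_implies_sequence_metric[OF fm, of 0] by blast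
  have S: "\<And>i. simple_function (leb n) (S i)" "\<And>x. x \<in> space (leb n) \<Longrightarrow> (\<lambda>i. S i x) \<longlonglongrightarrow> f x"
     "\<And>i x. x \<in> space (leb n) \<Longrightarrow> norm (S i x) \<le> 2 * norm (f x)"
    using S' by (simp_all add: dist_norm)
  have Sm [measurable]: "S i \<in> borel_measurable (leb n)" for i using S(1) by (rule borel_measurable_simple_function)
  have SL: "memLq (leb n) q (S i)" for i
    by (rule memLq_mono(1)[OF _ memLq_cmult[OF f(1), of 2] Sm]) (use q S(3) in \<open>auto intro!: AE_I2 simp: abs_mult\<close>)
  have Si: "integrable (leb n) (S i)" for i
    by (rule Bochner_Integration.integrable_bound[of _ "\<lambda>x. 2 * f x"]) (use fi S(3) in \<open>auto intro!: AE_I2 simp: abs_mult\<close>)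
  have Sc: "moll_converges n q (S i)" for i
  proof -
    define I where "I = S i ` space (leb n)"
    have fI: "finite I" unfolding I_def by (rule simple_functionD[OF S(1)])
    define A where "A v = S i -` {v} \<inter> space (leb n)" for v
    have As: "A v \<in> sets (leb n)" for v unfolding A_def by measurable
    have AB: "A v \<subseteq> B" if "v \<noteq> 0" for v
    proof
      fix x assume "x \<in> A v"
      then have x: "x \<in> Rn n" "S i x = v" by (auto simp: A_def)
      then have "f x \<noteq> 0" using S(3)[of x i] that by auto
      then show "x \<in> B" using K(2) x KB by auto
    qed
    have Af: "emeasure (leb n) (A v) < \<infinity>" if "v \<noteq> 0" for v
      using emeasure_mono[OF AB[OF that] Bs] Bf by (auto intro: le_less_trans)
    have "moll_converges n q (\<lambda>x. \<Sum>v\<in>I - {0}. v * indicator (A v) x)"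
    proof (rule moll_converges_sum[OF q])
      fix v assume "v \<in> I - {0}"
      then have v: "v \<noteq> 0" by simp
      show "memLq (leb n) q (\<lambda>x. v * indicator (A v) x)" using memLq_indicator(1)[OF As Af[OF v]] q by (intro memLq_cmult) auto
      show "integrable (leb n) (\<lambda>x. v * indicator (A v) x)" using As Af[OF v] by auto
      show "moll_converges n q (\<lambda>x. v * indicator (A v) x)" by (intro moll_converges_cmult q moll_converges_indicator[OF q As AB[OF v] Bo Bf])
    qed
    moreover have eq: "S i x = (\<Sum>v\<in>I - {0}. v * indicator (A v) x)" if x: "x \<in> space (leb n)" for x
    proof -
      have "(\<Sum>v\<in>I - {0}. v * indicator (A v) x) = (\<Sum>v\<in>I. v * indicator (A v) x)"
        using fI by (intro sum.mono_neutral_left) auto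
      also have "\<dots> = (\<Sum>v\<in>I. if v = S i x then v else 0)"
        by (rule sum.cong) (use x in \<open>auto simp: A_def indicator_def\<close>)
      also have "\<dots> = S i x" using fI x by (simp add: I_def)
      finally show ?thesis by simp
    qed
    ultimately show ?thesis
      using moll_converges_cong[of n "S i" "\<lambda>x. \<Sum>v\<in>I - {0}. v * indicator (A v) x" q] by simp
  qed
  have "(\<lambda>i. \<integral>x. \<bar>f x - S i x\<bar> powr q \<partial>leb n) \<longlonglongrightarrow> (\<integral>x. 0 \<partial>leb n)"
  proof (rule integral_dominated_convergence[where w = "\<lambda>x. 3 powr q * \<bar>f x\<bar> powr q"])
    show "integrable (leb n) (\<lambda>x. 3 powr q * \<bar>f x\<bar> powr q)" using f(1) by (auto simp: memLq_def)
    show "AE x in leb n. (\<lambda>i. \<bar>f x - S i x\<bar> powr q) \<longlonglongrightarrow> 0"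
    proof (rule AE_I2)
      fix x assume x: "x \<in> space (leb n)"
      have "(\<lambda>i. \<bar>f x - S i x\<bar> powr q) \<longlonglongrightarrow> \<bar>f x - f x\<bar> powr q"
        using q S(2)[OF x] by (intro tendsto_powr' tendsto_intros) auto
      then show "(\<lambda>i. \<bar>f x - S i x\<bar> powr q) \<longlonglongrightarrow> 0" by simp
    qed
    show "AE x in leb n. norm (\<bar>f x - S i x\<bar> powr q) \<le> 3 powr q * \<bar>f x\<bar> powr q" for i
    proof (rule AE_I2)
      fix x assume x: "x \<in> space (leb n)"
      have "\<bar>f x - S i x\<bar> \<le> 3 * \<bar>f x\<bar>" using S(3)[OF x, of i] by auto
      then have "\<bar>f x - S i x\<bar> powr q \<le> (3 * \<bar>f x\<bar>) powr q" using q by (intro powr_mono2) auto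
      then show "norm (\<bar>f x - S i x\<bar> powr q) \<le> 3 powr q * \<bar>f x\<bar> powr q" by (simp add: powr_mult)
    qed
  qed (use fm in auto)
  then have "(\<lambda>i. (\<integral>x. \<bar>f x - S i x\<bar> powr q \<partial>leb n) powr (1 / q)) \<longlonglongrightarrow> 0 powr (1 / q)"
    using q by (intro tendsto_powr' tendsto_const) (auto intro!: always_eventually integral_nonneg_AE)
  then have lim: "(\<lambda>i. normLq (leb n) q (\<lambda>x. f x - S i x)) \<longlonglongrightarrow> 0" by (simp add: normLq_def)
  show ?thesis
  proof (rule moll_converges_approx[OF q f(1) fi])
    fix d :: real assume "0 < d"
    then obtain i where "normLq (leb n) q (\<lambda>x. f x - S i x) < d"
      using LIMSEQ_D[OF lim, of d] by auto
    then show "\<exists>h. memLq (leb n) q h \<and> integrable (leb n) h \<and> normLq (leb n) q (\<lambda>x. f x - h x) \<le> d \<and> moll_converges n q h"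
      using SL Si Sc by (intro exI[of _ "S i"]) auto
  qed
qed


subsection \<open>The fundamental lemma of the calculus of variations\<close>

lemma bsupp_integrable_restrict:
  assumes "locally_integrable n \<Omega> f" "compactin (Rtop n) K" "K \<subseteq> \<Omega>"
  shows "bsupp_integrable n (\<lambda>x. indicator K x * f x)"
  using assms unfolding bsupp_integrable_def locally_integrable_def set_integrable_def by (auto intro!: exI[of _ K])

text \<open>\<open>\<Omega>\<close> is exhausted by compact sets \<open>K m\<close>. Near
  \<open>K m\<close> the function is truncated to \<open>K (Suc m)\<close>; its mollification at a
  point of \<open>K m\<close> is an integral against a test function, hence 0, while it converges to
  the truncated function in \<open>L^1\<close>.\<close>

lemma fundamental_lemma:
  assumes O: "openin (Rtop n) \<Omega>" and f: "locally_integrable n \<Omega> f"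
    and z: "\<And>\<phi>. test_function n \<Omega> \<phi> \<Longrightarrow> (LINT x:\<Omega>|leb n. f x * \<phi> x) = 0"
  shows "AE x in leb n. x \<in> \<Omega> \<longrightarrow> f x = 0"
proof -
  define K where "K m = {x \<in> Rn n. Rn_dist n (origin n) x \<le> real m \<and> (\<forall>y\<in>Rn n - \<Omega>. 1 / (real m + 1) \<le> Rn_dist n x y)}" for m
  have cont: "continuous_map (Rtop n) euclideanreal (Rn_dist n y)" for y
    unfolding Rn_dist_sq_dist[abs_def] by (intro continuous_intros continuous_map_sq_dist)
  have cont': "continuous_map (Rtop n) euclideanreal (\<lambda>x. Rn_dist n x y)" for y
    using cont[of y] by (simp add: Rn_dist_commute[of n _ y])
  have KO: "K m \<subseteq> \<Omega>" for m
  proof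
    fix x assume x: "x \<in> K m"
    show "x \<in> \<Omega>"
    proof (rule ccontr)
      assume "x \<notin> \<Omega>"
      then have "1 / (real m + 1) \<le> Rn_dist n x x" using x unfolding K_def by blast
      then show False by (simp add: field_simps)
    qed
  qed
  have Kc: "compactin (Rtop n) (K m)" for m
  proof -
    define C where "C y = {x \<in> topspace (Rtop n). Rn_dist n x y \<in> {1 / (real m + 1)..}}" for y
    have "closedin (Rtop n) (C y)" for y
      unfolding C_def by (rule closedin_continuous_map_preimage[OF cont']) auto
    then have "closedin (Rtop n) (\<Inter>(insert (topspace (Rtop n)) (C ` (Rn n - \<Omega>))))"
      by (intro closedin_Inter) (auto simp del: topspace_Rtop)
    moreover have "compactin (Rtop n) (clball n (origin n) ((real m)\<^sup>2))" by (rule compactin_clball)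
    ultimately have "compactin (Rtop n) (\<Inter>(insert (topspace (Rtop n)) (C ` (Rn n - \<Omega>))) \<inter> clball n (origin n) ((real m)\<^sup>2))"
      by (rule closed_Int_compactin)
    moreover have "K m = \<Inter>(insert (topspace (Rtop n)) (C ` (Rn n - \<Omega>))) \<inter> clball n (origin n) ((real m)\<^sup>2)"
      unfolding K_def clball_def C_def by (auto simp: sq_dist_le_iff)
    ultimately show ?thesis by simp
  qed
  have cover: "\<exists>m. x \<in> K m" if x: "x \<in> \<Omega>" for x
  proof -
    have xR: "x \<in> Rn n" using openin_subset[OF O] x by auto
    obtain d where d: "d > 0" "\<And>y. y \<in> Rn n \<Longrightarrow> Rn_dist n x y < d \<Longrightarrow> y \<in> \<Omega>"
      using O x unfolding openin_Rtop_iff by blast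
    obtain m1 where m1: "1 / (real m1 + 1) < d" using reals_Archimedean[OF d(1)] by (auto simp: inverse_eq_divide add.commute)
    obtain m2 where m2: "Rn_dist n (origin n) x \<le> real m2" using real_arch_simple by blast
    define m where "m = max m1 m2"
    have "1 / (real m + 1) \<le> 1 / (real m1 + 1)" by (rule divide_left_mono) (auto simp: m_def)
    then have "x \<in> K m" unfolding K_def using xR m1 m2 d by (force simp: m_def)
    then show ?thesis by blast
  qed
  have "AE x in leb n. x \<in> K m \<longrightarrow> f x = 0" for m
  proof -
    define f1 where "f1 x = indicator (K (Suc m)) x * f x" for x
    have b: "bsupp_integrable n f1" unfolding f1_def by (rule bsupp_integrable_restrict[OF f Kc KO])
    have fi: "integrable (leb n) f1" using b by (simp add: bsupp_integrable_def)
    have L: "memLq (leb n) 1 f1" using fi by (auto simp: memLq_def)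
    have c: "moll_converges n 1 f1" by (rule moll_converges_memLq[OF order_refl L b])
    have Km: "K m \<in> sets (leb n)" by (rule compactin_finite_measure[OF Kc])
    \<comment> \<open>The gap between the required distances to the complement for
      \<open>K m\<close> and \<open>K (Suc m)\<close>: balls of radius below \<open>r\<close> about
      points of \<open>K m\<close> stay in \<open>K (Suc m)\<close>. Being at most 1, it also
      respects the growing bound on the norm.\<close>
    define r where "r = 1 / (real m + 1) - 1 / (real m + 2)"
    have "1 / (real m + 2) < 1 / (real m + 1)" by (rule divide_strict_left_mono) auto
    moreover have "1 / (real m + 1) \<le> 1" "0 \<le> 1 / (real m + 2)" by auto
    ultimately have r: "0 < r" "r \<le> 1" unfolding r_def by linarith+
    have "\<forall>\<^sub>F k in sequentially. moll_scale k < r\<^sup>2" using r by (intro moll_scale_less) simp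
    then have ev: "\<forall>\<^sub>F k in sequentially. normLq (leb n) 1 (\<lambda>x. indicator (K m) x * f1 x) \<le> normLq (leb n) 1 (\<lambda>x. moll n (moll_scale k) f1 x - f1 x)"
    proof eventually_elim
      case (elim k)
      have z0: "moll n (moll_scale k) f1 x = 0" if x: "x \<in> K m" for x
      proof -
        have sub: "clball n x (moll_scale k) \<subseteq> K (Suc m)"
        proof
          fix w assume w: "w \<in> clball n x (moll_scale k)"
          then have wd: "Rn_dist n x w < r" using elim r sq_dist_less_iff[of r n x w] by (auto simp: clball_def)
          have "Rn_dist n (origin n) w \<le> Rn_dist n (origin n) x + Rn_dist n x w" by (rule Rn_dist_triangle)
          then have 1: "Rn_dist n (origin n) w \<le> real (Suc m)" using x wd r by (simp add: K_def)
          have 2: "1 / (real (Suc m) + 1) \<le> Rn_dist n w y" if "y \<in> Rn n - \<Omega>" for y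
          proof -
            have "1 / (real m + 1) \<le> Rn_dist n x y" using x that by (simp add: K_def)
            also have "\<dots> \<le> Rn_dist n x w + Rn_dist n w y" by (rule Rn_dist_triangle)
            finally show ?thesis using wd by (simp add: r_def add.commute)
          qed
          show "w \<in> K (Suc m)" using w 1 2 unfolding K_def by (auto simp: clball_def)
        qed
        then have "test_function n \<Omega> (moll_kernel n (moll_scale k) x)"
          unfolding test_function_csmooth using csmooth_moll_kernel[of n x "moll_scale k"] KO[of "Suc m"] by blast
        then have "(LINT y:\<Omega>|leb n. f y * moll_kernel n (moll_scale k) x y) = 0" by (rule z)
        moreover have "moll n (moll_scale k) f1 x = (LINT y:\<Omega>|leb n. f y * moll_kernel n (moll_scale k) x y)"
          unfolding moll_def set_lebesgue_integral_def
        proof (rule Bochner_Integration.integral_cong[OF refl])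
          fix y assume "y \<in> space (leb n)"
          then show "moll_kernel n (moll_scale k) x y * f1 y = indicator \<Omega> y *\<^sub>R (f y * moll_kernel n (moll_scale k) x y)"
            using sub KO[of "Suc m"] csmooth_zero[OF csmooth_moll_kernel, of y n x "moll_scale k"]
            by (cases "y \<in> clball n x (moll_scale k)") (auto simp: f1_def indicator_def)
        qed
        ultimately show ?thesis by simp
      qed
      have "normLq (leb n) 1 (\<lambda>x. indicator (K m) x * f1 x) = normLq (leb n) 1 (\<lambda>x. indicator (K m) x * (moll n (moll_scale k) f1 x - f1 x))"
        by (rule normLq_cong) (use z0 in \<open>auto simp: indicator_def\<close>)
      also have "\<dots> \<le> normLq (leb n) 1 (\<lambda>x. moll n (moll_scale k) f1 x - f1 x)"
      proof (rule memLq_mono(2))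
        show "memLq (leb n) 1 (\<lambda>x. moll n (moll_scale k) f1 x - f1 x)" by (intro memLq_diff moll_memLq(1) L fi) auto
        then show "(\<lambda>x. indicator (K m) x * (moll n (moll_scale k) f1 x - f1 x)) \<in> borel_measurable (leb n)"
          using Km by (auto simp: memLq_def)
      qed (auto simp: indicator_def)
      finally show ?case .
    qed
    have "normLq (leb n) 1 (\<lambda>x. indicator (K m) x * f1 x) \<le> 0"
      by (rule tendsto_lowerbound[OF c[unfolded moll_converges_def] ev]) simp
    then have "normLq (leb n) 1 (\<lambda>x. indicator (K m) x * f1 x) = 0" using normLq_nonneg by (simp add: order_antisym)
    moreover have "memLq (leb n) 1 (\<lambda>x. indicator (K m) x * f1 x)"
      by (rule memLq_mono(1)[OF _ L]) (use L Km in \<open>auto simp: memLq_def indicator_def\<close>)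
    ultimately have "AE x in leb n. indicator (K m) x * f1 x = 0" by (intro normLq_zero_AE) auto
    moreover have sub: "K m \<subseteq> K (Suc m)"
    proof
      fix x assume x: "x \<in> K m"
      have "1 / (real (Suc m) + 1) \<le> 1 / (real m + 1)" by (rule divide_left_mono) auto
      then show "x \<in> K (Suc m)" using x unfolding K_def by (force intro: order_trans)
    qed
    ultimately show ?thesis by (auto elim!: eventually_mono simp: f1_def indicator_def)
  qed
  then have "AE x in leb n. \<forall>m. x \<in> K m \<longrightarrow> f x = 0" by (subst AE_all_countable) simp
  then show ?thesis by eventually_elim (use cover in blast)
qed

text \<open>The gradient normalised in \<open>sobolev_const\<close> and the one approximated by test
  functions in \<open>H10\<close> are chosen independently; this identifies them almost
  everywhere.\<close>

lemma weak_partial_unique: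
  assumes O: "openin (Rtop n) \<Omega>" and g: "weak_partial n \<Omega> i f g" and h: "weak_partial n \<Omega> i f h"
  shows "AE x in leb n. x \<in> \<Omega> \<longrightarrow> g x = h x"
proof -
  have "AE x in leb n. x \<in> \<Omega> \<longrightarrow> g x - h x = 0"
  proof (rule fundamental_lemma[OF O])
    show "locally_integrable n \<Omega> (\<lambda>x. g x - h x)"
      using g h unfolding weak_partial_def locally_integrable_def by (auto intro!: set_integral_diff)
    fix \<phi> assume t: "test_function n \<Omega> \<phi>"
    obtain K where K: "K \<subseteq> \<Omega>" "csmooth n K \<phi>" using t by (auto simp: test_function_csmooth)
    have int: "set_integrable (leb n) \<Omega> (\<lambda>x. k x * \<phi> x)" if "locally_integrable n \<Omega> k" for k
    proof -
      have ki: "integrable (leb n) (\<lambda>x. indicator K x * k x)"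
        using bsupp_integrable_restrict[OF that csmooth_compact[OF K(2)] K(1)] by (simp add: bsupp_integrable_def)
      obtain B where B: "B \<ge> 0" "\<forall>x\<in>Rn n. \<bar>\<phi> x\<bar> \<le> B" using csmooth_bounded[OF K(2)] by blast
      have "integrable (leb n) (\<lambda>x. \<phi> x * (indicator K x * k x))"
      proof (rule Bochner_Integration.integrable_bound[of _ "\<lambda>x. B * (indicator K x * k x)"])
        show "AE x in leb n. norm (\<phi> x * (indicator K x * k x)) \<le> norm (B * (indicator K x * k x))"
          using B by (intro AE_I2) (auto simp: abs_mult intro!: mult_right_mono)
      qed (use ki csmooth_meas[OF K(2)] in auto)
      then show ?thesis unfolding set_integrable_def
        by (rule Bochner_Integration.integrable_cong[THEN iffD1, rotated -1])
           (use K csmooth_zero[OF K(2)] in \<open>auto simp: indicator_def\<close>)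
    qed
    have ig: "set_integrable (leb n) \<Omega> (\<lambda>x. g x * \<phi> x)" and ih: "set_integrable (leb n) \<Omega> (\<lambda>x. h x * \<phi> x)"
      using int g h by (auto simp: weak_partial_def)
    have "(LINT x:\<Omega>|leb n. (g x - h x) * \<phi> x) = (LINT x:\<Omega>|leb n. g x * \<phi> x) - (LINT x:\<Omega>|leb n. h x * \<phi> x)"
      using set_integral_diff(2)[OF ig ih] by (simp add: left_diff_distrib)
    also have "\<dots> = 0"
    proof -
      define A where "A = (LINT x:\<Omega>|leb n. f x * partial_deriv i \<phi> x)"
      have "A = - (LINT x:\<Omega>|leb n. g x * \<phi> x)" "A = - (LINT x:\<Omega>|leb n. h x * \<phi> x)"
        using g h t unfolding weak_partial_def A_def by blast+
      then show ?thesis by simp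
    qed
    finally show "(LINT x:\<Omega>|leb n. (g x - h x) * \<phi> x) = 0" .
  qed
  then show ?thesis by eventually_elim auto
qed

subsection \<open>The Sobolev constant\<close>

lemma grad_norm_cmult:
  assumes "smooth n f" "x \<in> Rn n" shows "grad_norm n (\<lambda>x. c * f x) x = \<bar>c\<bar> * grad_norm n f x"
proof -
  have "(\<Sum>i<n. (partial_deriv i (\<lambda>x. c * f x) x)\<^sup>2) = c\<^sup>2 * (\<Sum>i<n. (partial_deriv i f x)\<^sup>2)"
    unfolding sum_distrib_left by (rule sum.cong) (use assms in \<open>auto simp: partial_cmult power_mult_distrib\<close>)
  then show ?thesis by (simp add: grad_norm_def real_sqrt_mult)
qed

text \<open>The set whose supremum is \<open>sobolev_const\<close>. It is named because the supremum
  of a set of reals carries information only after the set is shown to be bounded above.\<close>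

definition sobolev_set :: "nat \<Rightarrow> (nat \<Rightarrow> real) set \<Rightarrow> real set" where
  "sobolev_set n \<Omega> = {Lp_norm n (exp_p' n) \<Omega> w | w g.
     w \<in> H10 n \<Omega> \<and> weak_gradient n \<Omega> w g \<and>
     Lp_norm n 2 \<Omega> (\<lambda>x. Rn_norm n (\<lambda>i. g i x)) = 1}"

lemma csmooth_H10:
  assumes f: "csmooth n K f" "K \<subseteq> \<Omega>" and O: "\<Omega> \<in> sets (leb n)"
  shows "f \<in> H10 n \<Omega>"
proof -
  have "weak_gradient n \<Omega> f (\<lambda>i. partial_deriv i f)"
    unfolding weak_gradient_def using csmooth_weak_partial[OF f(1) _ O] by auto
  moreover have "\<forall>i<n. partial_deriv i f \<in> Lp n 2 \<Omega>"
    using memLq_imp_Lp[OF csmooth_memLq[OF csmooth_partial[OF f(1)]] O] by auto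
  moreover have "test_function n \<Omega> f" using f unfolding test_function_csmooth by blast
  moreover have "Lp_norm n 2 \<Omega> (\<lambda>x. h x - h x) = 0" for h by (simp add: Lp_norm_def)
  ultimately have "\<exists>g \<phi>. weak_gradient n \<Omega> f g \<and> (\<forall>i<n. g i \<in> Lp n 2 \<Omega>) \<and>
     (\<forall>m::nat. test_function n \<Omega> (\<phi> m)) \<and> (\<lambda>m. Lp_norm n 2 \<Omega> (\<lambda>x. \<phi> m x - f x)) \<longlonglongrightarrow> 0 \<and>
     (\<forall>i<n. (\<lambda>m. Lp_norm n 2 \<Omega> (\<lambda>x. partial_deriv i (\<phi> m) x - g i x)) \<longlonglongrightarrow> 0)"
    by (intro exI[of _ "\<lambda>i. partial_deriv i f"] exI[of _ "\<lambda>m. f"]) simp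
  then show ?thesis unfolding H10_def using csmooth_sobolev[OF f(1) _ O, of 2 1] by simp
qed

lemma sobolev_set_scaled:
  assumes n: "3 \<le> n" and f: "csmooth n K f" "K \<subseteq> \<Omega>" and O: "\<Omega> \<in> sets (leb n)"
    and g: "0 < normLq (leb n) 2 (grad_norm n f)"
  shows "normLq (leb n) (exp_p' n) f / normLq (leb n) 2 (grad_norm n f) \<in> sobolev_set n \<Omega>"
proof -
  define c where "c = 1 / normLq (leb n) 2 (grad_norm n f)"
  have c: "0 < c" using g by (simp add: c_def)
  have w: "csmooth n K (\<lambda>x. c * f x)" by (intro csmooth_mult[OF f(1)] smooth_const)
  have H: "(\<lambda>x. c * f x) \<in> H10 n \<Omega>" by (rule csmooth_H10[OF w f(2) O])
  have wg: "weak_gradient n \<Omega> (\<lambda>x. c * f x) (\<lambda>i. partial_deriv i (\<lambda>x. c * f x))"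
    unfolding weak_gradient_def using csmooth_weak_partial[OF w _ O] by auto
  have "Lp_norm n 2 \<Omega> (\<lambda>x. Rn_norm n (\<lambda>i. partial_deriv i (\<lambda>x. c * f x) x)) = Lp_norm n 2 \<Omega> (grad_norm n (\<lambda>x. c * f x))"
    by (simp add: Rn_norm_def L2_set_def grad_norm_def[abs_def])
  also have "\<dots> = normLq (leb n) 2 (grad_norm n (\<lambda>x. c * f x))"
  proof (rule Lp_norm_eq_normLq)
    fix x assume "x \<in> Rn n" "x \<notin> \<Omega>"
    then have "partial_deriv i (\<lambda>x. c * f x) x = 0" if "i < n" for i
      using csmooth_zero[OF csmooth_partial[OF w that]] f(2) by auto
    then show "grad_norm n (\<lambda>x. c * f x) x = 0" by (simp add: grad_norm_def)
  qed simp
  also have "\<dots> = normLq (leb n) 2 (\<lambda>x. c * grad_norm n f x)"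
    by (rule normLq_cong) (use c in \<open>simp add: grad_norm_cmult[OF csmooth_smooth[OF f(1)]]\<close>)
  also have "\<dots> = c * normLq (leb n) 2 (grad_norm n f)" using c by (subst normLq_cmult) auto
  also have "\<dots> = 1" using g by (simp add: c_def)
  finally have one: "Lp_norm n 2 \<Omega> (\<lambda>x. Rn_norm n (\<lambda>i. partial_deriv i (\<lambda>x. c * f x) x)) = 1" .
  have "Lp_norm n (exp_p' n) \<Omega> (\<lambda>x. c * f x) = normLq (leb n) (exp_p' n) (\<lambda>x. c * f x)"
    by (rule Lp_norm_eq_normLq) (use exp_p_props[OF n] csmooth_zero[OF w] f(2) in auto)
  also have "\<dots> = normLq (leb n) (exp_p' n) f / normLq (leb n) 2 (grad_norm n f)"
    using exp_p_props[OF n] c by (simp add: normLq_cmult) (simp add: c_def)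
  finally have "normLq (leb n) (exp_p' n) f / normLq (leb n) 2 (grad_norm n f) = Lp_norm n (exp_p' n) \<Omega> (\<lambda>x. c * f x)" by simp
  then show ?thesis unfolding sobolev_set_def using H wg one by blast
qed

text \<open>A non-integrable function has integral 0, so a nonzero norm already implies
  integrability. For a nonnegative function measurability is recovered from that of its
  power.\<close>

lemma memLq_of_normLq_pos:
  assumes q: "0 < q" and nz: "normLq M q f \<noteq> 0" and nn: "\<And>x. 0 \<le> f x"
  shows "memLq M q f"
proof -
  have i: "integrable M (\<lambda>x. \<bar>f x\<bar> powr q)"
    by (rule ccontr) (use nz in \<open>simp add: normLq_def not_integrable_integral_eq\<close>)
  then have "(\<lambda>x. (\<bar>f x\<bar> powr q) powr (1 / q)) \<in> borel_measurable M" by measurable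
  then have "f \<in> borel_measurable M" using q nn by (simp add: powr_powr)
  then show ?thesis using i by (simp add: memLq_def)
qed

lemma normLq_grad_norm_le:
  assumes "csmooth n K f" shows "normLq (leb n) 2 (grad_norm n f) \<le> (\<Sum>i<n. normLq (leb n) 2 (partial_deriv i f))"
proof -
  have L: "memLq (leb n) 2 (\<lambda>x. \<bar>partial_deriv i f x\<bar>)" if "i \<in> {..<n}" for i
    using that by (intro memLq_abs csmooth_memLq[OF csmooth_partial[OF assms]]) auto
  have "normLq (leb n) 2 (grad_norm n f) \<le> normLq (leb n) 2 (\<lambda>x. \<Sum>i<n. \<bar>partial_deriv i f x\<bar>)"
  proof (rule memLq_mono(2)[OF _ memLq_sum[OF _ L]])
    show "AE x in leb n. \<bar>grad_norm n f x\<bar> \<le> \<bar>\<Sum>i<n. \<bar>partial_deriv i f x\<bar>\<bar>"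
      using L2_set_le_sum_abs[of _ "{..<n}"] by (auto simp: grad_norm_def L2_set_def sum_nonneg)
  qed (use grad_norm_meas[OF csmooth_smooth[OF assms]] in auto)
  also have "\<dots> \<le> (\<Sum>i<n. normLq (leb n) 2 (\<lambda>x. \<bar>partial_deriv i f x\<bar>))" by (rule normLq_sum_le[OF _ L]) auto
  finally show ?thesis by (simp add: normLq_abs)
qed

text \<open>Only finiteness matters here. The approximating test functions obey the inequality for
  smooth functions, their gradients have norms eventually below \<open>n + 1\<close>, since each
  component of the limit has norm at most 1, and Fatou along an almost everywhere convergent
  subsequence carries the bound to \<open>w\<close>.\<close>

lemma sobolev_set_bounded:
  assumes n: "3 \<le> n" and O: "openin (Rtop n) \<Omega>"
  shows "bdd_above (sobolev_set n \<Omega>)"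
proof (rule bdd_aboveI)
  fix v assume "v \<in> sobolev_set n \<Omega>"
  then obtain w g' where v: "v = Lp_norm n (exp_p' n) \<Omega> w" and w: "w \<in> H10 n \<Omega>" "weak_gradient n \<Omega> w g'"
    and one: "Lp_norm n 2 \<Omega> (\<lambda>x. Rn_norm n (\<lambda>i. g' i x)) = 1" by (auto simp: sobolev_set_def)
  note ep = exp_p_props[OF n]
  have Os: "\<Omega> \<in> sets (leb n)" by (rule openin_measurable[OF O])
  obtain g \<phi> where g: "weak_gradient n \<Omega> w g" "\<And>i. i < n \<Longrightarrow> g i \<in> Lp n 2 \<Omega>"
    and t: "\<And>m. test_function n \<Omega> (\<phi> m)"
    and l1: "(\<lambda>m. Lp_norm n 2 \<Omega> (\<lambda>x. \<phi> m x - w x)) \<longlonglongrightarrow> 0"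
    and l2: "\<And>i. i < n \<Longrightarrow> (\<lambda>m. Lp_norm n 2 \<Omega> (\<lambda>x. partial_deriv i (\<phi> m) x - g i x)) \<longlonglongrightarrow> 0"
    and w2: "w \<in> Lp n 2 \<Omega>"
    using w(1) by (auto simp: H10_def)
  obtain K where K: "\<And>m. K m \<subseteq> \<Omega>" "\<And>m. csmooth n (K m) (\<phi> m)"
    using t unfolding test_function_csmooth by metis
  define G where "G x = indicator \<Omega> x * Rn_norm n (\<lambda>i. g' i x)" for x
  have G1: "normLq (leb n) 2 G = 1" using one by (simp add: Lp_norm_normLq G_def[abs_def])
  have GL: "memLq (leb n) 2 G" by (rule memLq_of_normLq_pos) (auto simp: G1, simp add: G_def Rn_norm_def indicator_def)
  define h where "h i x = indicator \<Omega> x * g i x" for i x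
  have hL: "memLq (leb n) 2 (h i)" if "i < n" for i
    using g(2)[OF that] Lp_memLq[OF _ Os, of 2 "g i"] by (simp add: h_def[abs_def])
  have h1: "normLq (leb n) 2 (h i) \<le> 1" if i: "i < n" for i
  proof -
    have "AE x in leb n. x \<in> \<Omega> \<longrightarrow> g i x = g' i x"
      by (rule weak_partial_unique[OF O]) (use g(1) w(2) i in \<open>auto simp: weak_gradient_def\<close>)
    then have "AE x in leb n. \<bar>h i x\<bar> \<le> \<bar>G x\<bar>"
    proof eventually_elim
      case (elim x)
      have "\<bar>g' i x\<bar> \<le> Rn_norm n (\<lambda>i. g' i x)"
        unfolding Rn_norm_def using member_le_L2_set[of "{..<n}" i "\<lambda>i. \<bar>g' i x\<bar>"] i by (simp add: L2_set_def)
      then show ?case using elim by (auto simp: h_def G_def indicator_def)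
    qed
    from memLq_mono(2)[OF _ GL _ this] show ?thesis using hL[OF i] G1 by (simp add: memLq_def)
  qed
  have conv: "(\<lambda>m. normLq (leb n) 2 (partial_deriv i (\<phi> m))) \<longlonglongrightarrow> normLq (leb n) 2 (h i)" if i: "i < n" for i
  proof (rule normLq_tendsto[OF _ csmooth_memLq[OF csmooth_partial[OF K(2) i]] hL[OF i]])
    have "Lp_norm n 2 \<Omega> (\<lambda>x. partial_deriv i (\<phi> m) x - g i x) = normLq (leb n) 2 (\<lambda>x. partial_deriv i (\<phi> m) x - h i x)" for m
      unfolding Lp_norm_normLq[OF zero_less_numeral]
      by (rule normLq_cong) (use csmooth_zero[OF csmooth_partial[OF K(2) i]] K(1) in \<open>auto simp: h_def indicator_def\<close>)
    then show "(\<lambda>m. normLq (leb n) 2 (\<lambda>x. partial_deriv i (\<phi> m) x - h i x)) \<longlonglongrightarrow> 0" using l2[OF i] by simp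
  qed auto
  have "(\<lambda>m. \<Sum>i<n. normLq (leb n) 2 (partial_deriv i (\<phi> m))) \<longlonglongrightarrow> (\<Sum>i<n. normLq (leb n) 2 (h i))"
    by (intro tendsto_sum conv) auto
  moreover have "(\<Sum>i<n. normLq (leb n) 2 (h i)) < real n + 1"
  proof -
    have "(\<Sum>i<n. normLq (leb n) 2 (h i)) \<le> (\<Sum>i<n. 1)" using h1 by (intro sum_mono) auto
    then show ?thesis by simp
  qed
  ultimately have "\<forall>\<^sub>F m in sequentially. (\<Sum>i<n. normLq (leb n) 2 (partial_deriv i (\<phi> m))) < real n + 1"
    by (rule order_tendstoD(2))
  then obtain N where N: "\<And>m. m \<ge> N \<Longrightarrow> (\<Sum>i<n. normLq (leb n) 2 (partial_deriv i (\<phi> m))) < real n + 1"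
    by (auto simp: eventually_sequentially)
  define \<gamma> where "\<gamma> = 2 * (real n - 1) / (real n - 2)"
  have \<gamma>: "0 \<le> \<gamma>" using n by (simp add: \<gamma>_def)
  define C where "C = \<gamma> * (real n + 1)"
  have bound: "normLq (leb n) (exp_p' n) (\<phi> m) \<le> C" if "m \<ge> N" for m
  proof -
    have "normLq (leb n) (exp_p' n) (\<phi> m) \<le> \<gamma> * normLq (leb n) 2 (grad_norm n (\<phi> m))"
      unfolding \<gamma>_def by (rule sobolev_csmooth[OF n K(2)])
    also have "\<dots> \<le> C" unfolding C_def
      using normLq_grad_norm_le[OF K(2), of m] N[OF that] \<gamma> by (intro mult_left_mono) auto
    finally show ?thesis .
  qed
  define W where "W x = indicator \<Omega> x * w x" for x
  have WL: "memLq (leb n) 2 W" using w2 Lp_memLq[OF _ Os, of 2 w] by (simp add: W_def[abs_def])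
  have "Lp_norm n 2 \<Omega> (\<lambda>x. \<phi> m x - w x) = normLq (leb n) 2 (\<lambda>x. \<phi> m x - W x)" for m
    unfolding Lp_norm_normLq[OF zero_less_numeral]
    by (rule normLq_cong) (use csmooth_zero[OF K(2)] K(1) in \<open>auto simp: W_def indicator_def\<close>)
  then have l3: "(\<lambda>m. normLq (leb n) 2 (\<lambda>x. \<phi> m x - W x)) \<longlonglongrightarrow> 0" using l1 by simp
  have "\<exists>r. strict_mono (r :: nat \<Rightarrow> nat) \<and> (AE x in leb n. (\<lambda>m. \<phi> (r m) x) \<longlonglongrightarrow> W x)"
    by (rule memLq_subseq_AE[OF _ memLq_diff[OF _ csmooth_memLq[OF K(2)] WL] l3]) auto
  then obtain r :: "nat \<Rightarrow> nat" where r: "strict_mono r" "AE x in leb n. (\<lambda>m. \<phi> (r m) x) \<longlonglongrightarrow> W x" by blast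
  have "normLq (leb n) (exp_p' n) W \<le> C"
  proof (rule Fatou_memLq(2)[where f = "\<lambda>m. \<phi> (r (m + N))"])
    show "memLq (leb n) (exp_p' n) (\<phi> (r (m + N)))" for m by (rule csmooth_memLq[OF K(2) ep(4)])
    show "normLq (leb n) (exp_p' n) (\<phi> (r (m + N))) \<le> C" for m
      using bound strict_mono_imp_increasing[OF r(1), of "m + N"] by auto
    show "AE x in leb n. (\<lambda>m. \<phi> (r (m + N)) x) \<longlonglongrightarrow> W x"
      using r(2) by eventually_elim (rule LIMSEQ_ignore_initial_segment)
  qed (use ep WL in \<open>auto simp: memLq_def\<close>)
  then show "v \<le> C" by (simp add: v Lp_norm_normLq ep W_def[abs_def])
qed

lemma sobolev_const_bound:
  assumes n: "3 \<le> n" and O: "openin (Rtop n) \<Omega>" and f: "csmooth n K f" "K \<subseteq> \<Omega>"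
  shows "normLq (leb n) (exp_p' n) f \<le> sobolev_const n \<Omega> * normLq (leb n) 2 (grad_norm n f)"
proof (cases "normLq (leb n) 2 (grad_norm n f) = 0")
  \<comment> \<open>A function with vanishing gradient norm cannot be rescaled to gradient norm 1;
    the inequality with the explicit constant shows that its norm is 0.\<close>
  case True
  then show ?thesis using sobolev_csmooth[OF n f(1)] by simp
next
  case False
  then have g: "0 < normLq (leb n) 2 (grad_norm n f)" using normLq_nonneg[of "leb n" 2 "grad_norm n f"] by linarith
  have "normLq (leb n) (exp_p' n) f / normLq (leb n) 2 (grad_norm n f) \<le> sobolev_const n \<Omega>"
    unfolding sobolev_const_def sobolev_set_def[symmetric]
    by (rule cSup_upper[OF sobolev_set_scaled[OF n f openin_measurable[OF O] g] sobolev_set_bounded[OF n O]])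
  then show ?thesis using g by (simp add: field_simps)
qed

text \<open>The supremum needs a nonnegative member. A mollifier kernel supported in
  \<open>\<Omega>\<close> provides one: if its gradient norm were 0, the Sobolev inequality would
  make it vanish, although its integral is 1.\<close>

lemma sobolev_const_nonneg:
  assumes n: "3 \<le> n" and O: "openin (Rtop n) \<Omega>" "\<Omega> \<noteq> {}"
  shows "0 \<le> sobolev_const n \<Omega>"
proof -
  obtain x where x: "x \<in> \<Omega>" using O by auto
  have xR: "x \<in> Rn n" using openin_subset[OF O(1)] x by auto
  obtain d where d: "d > 0" "\<And>y. y \<in> Rn n \<Longrightarrow> Rn_dist n x y < d \<Longrightarrow> y \<in> \<Omega>"
    using O(1) x unfolding openin_Rtop_iff by blast
  define e where "e = (d / 2)\<^sup>2"
  have e: "0 < e" using d by (simp add: e_def)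
  have sub: "clball n x e \<subseteq> \<Omega>"
  proof
    fix y assume y: "y \<in> clball n x e"
    then have "Rn_dist n x y \<le> d / 2" using d sq_dist_le_iff[of "d / 2" n x y] by (auto simp: clball_def e_def)
    then show "y \<in> \<Omega>" using d y by (auto simp: clball_def)
  qed
  note f = csmooth_moll_kernel[of n x e]
  have "normLq (leb n) 2 (grad_norm n (moll_kernel n e x)) \<noteq> 0"
  proof
    assume "normLq (leb n) 2 (grad_norm n (moll_kernel n e x)) = 0"
    then have "normLq (leb n) (exp_p' n) (moll_kernel n e x) \<le> 0" using sobolev_csmooth[OF n f] by simp
    then have "normLq (leb n) (exp_p' n) (moll_kernel n e x) = 0" using normLq_nonneg[of "leb n" "exp_p' n" "moll_kernel n e x"] by linarith
    then have "AE y in leb n. moll_kernel n e x y = 0"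
      using exp_p_props[OF n] by (intro normLq_zero_AE csmooth_memLq[OF f]) auto
    then have "(\<integral>y. moll_kernel n e x y \<partial>leb n) = 0" by (rule integral_eq_zero_AE)
    then show False using e by (simp add: moll_kernel_integral)
  qed
  then have g: "0 < normLq (leb n) 2 (grad_norm n (moll_kernel n e x))" using normLq_nonneg[of "leb n" 2 "grad_norm n (moll_kernel n e x)"] by linarith
  have "normLq (leb n) (exp_p' n) (moll_kernel n e x) / normLq (leb n) 2 (grad_norm n (moll_kernel n e x)) \<le> sobolev_const n \<Omega>"
    unfolding sobolev_const_def sobolev_set_def[symmetric]
    by (rule cSup_upper[OF sobolev_set_scaled[OF n f sub openin_measurable[OF O(1)] g] sobolev_set_bounded[OF n O(1)]])
  moreover have "0 \<le> normLq (leb n) (exp_p' n) (moll_kernel n e x) / normLq (leb n) 2 (grad_norm n (moll_kernel n e x))" using g by simp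
  ultimately show ?thesis by linarith
qed

subsection \<open>Cutoff functions\<close>

lemma smooth1_deriv_const:
  assumes g: "smooth1 g" and U: "open U" "\<And>t. t \<in> U \<Longrightarrow> g t = c" and t: "t \<in> U"
  shows "deriv g t = 0"
proof -
  have "((\<lambda>t. c) has_real_derivative deriv g t) (at t)"
    using has_field_derivative_transform_within_open[OF smooth1_deriv(1)[OF g, of t], of U "\<lambda>_. c"] U t by auto
  then show ?thesis using DERIV_unique[OF _ DERIV_const] by blast
qed

lemma smooth1_deriv_bounded:
  assumes g: "smooth1 g" and c: "\<And>t. t < a \<Longrightarrow> g t = c1" "\<And>t. t > b \<Longrightarrow> g t = c2"
  shows "\<exists>K. \<forall>t. \<bar>deriv g t\<bar> \<le> K"
proof -
  have "compact (deriv g ` {a..b})" by (intro compact_continuous_image smooth1_cont smooth1_deriv g) auto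
  then obtain B where B: "\<forall>t\<in>{a..b}. \<bar>deriv g t\<bar> \<le> B"
    using compact_imp_bounded by (force simp: bounded_real)
  have "\<bar>deriv g t\<bar> \<le> max B 0" for t
  proof -
    consider "t \<in> {a..b}" | "t \<in> {..<a}" | "t \<in> {b<..}" by force
    then show ?thesis
    proof cases
      case 1 then show ?thesis using B by (simp add: max.coboundedI1)
    next
      case 2
      have "deriv g t = 0" by (rule smooth1_deriv_const[OF g _ _ 2, of c1]) (auto simp: c)
      then show ?thesis by simp
    next
      case 3
      have "deriv g t = 0" by (rule smooth1_deriv_const[OF g _ _ 3, of c2]) (auto simp: c)
      then show ?thesis by simp
    qed
  qed
  then show ?thesis by blast
qed

definition cutoff :: "real \<Rightarrow> (real \<Rightarrow> real) \<Rightarrow> bool" where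
  "cutoff K h \<longleftrightarrow> smooth1 h \<and> (\<forall>t. 0 \<le> h t \<and> h t \<le> 1 \<and> \<bar>deriv h t\<bar> \<le> K \<and> \<bar>deriv (deriv h) t\<bar> \<le> K)"

lemma cutoffI:
  assumes g: "smooth1 g" and b: "\<And>t. 0 \<le> g t \<and> g t \<le> 1" and c: "\<And>t. t < a \<Longrightarrow> g t = c1" "\<And>t. t > b \<Longrightarrow> g t = c2"
  shows "\<exists>K. cutoff K g"
proof -
  obtain K1 where K1: "\<And>t. \<bar>deriv g t\<bar> \<le> K1" using smooth1_deriv_bounded[OF g c] by blast
  have "deriv g t = 0" if "t < a" for t by (rule smooth1_deriv_const[OF g, of "{..<a}" c1]) (use c that in auto)
  moreover have "deriv g t = 0" if "t > b" for t by (rule smooth1_deriv_const[OF g, of "{b<..}" c2]) (use c that in auto)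
  ultimately obtain K2 where K2: "\<And>t. \<bar>deriv (deriv g) t\<bar> \<le> K2"
    using smooth1_deriv_bounded[OF smooth1_deriv(2)[OF g], of a 0 b 0] by blast
  have "\<bar>deriv g t\<bar> \<le> max K1 K2 \<and> \<bar>deriv (deriv g) t\<bar> \<le> max K1 K2" for t
    using K1[of t] K2[of t] by auto
  then show ?thesis using g b unfolding cutoff_def by blast
qed

lemma cutoff_mono: "cutoff K h \<Longrightarrow> K \<le> K' \<Longrightarrow> cutoff K' h"
  unfolding cutoff_def by (meson order_trans)

text \<open>The variable stands for \<open>|x - z|^2 / r^2\<close>. \<open>h3\<close> cuts out the
  annulus for the Carleman inequality and varies only on the layers \<open>[1/4, 1/2]\<close> and
  \<open>[10, 12]\<close>. \<open>h1\<close> and \<open>h2\<close> serve the energy estimate: each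
  is 1 on a neighbourhood of one of the layers, and \<open>h1\<close> is supported inside the inner
  ball \<open>t < 1\<close>, \<open>h2\<close> inside \<open>t <= 15\<close>. One \<open>K\<close>
  bounds all derivatives and does not depend on the dimension.\<close>

definition cutoffs :: "real \<Rightarrow> (real \<Rightarrow> real) \<Rightarrow> (real \<Rightarrow> real) \<Rightarrow> (real \<Rightarrow> real) \<Rightarrow> bool" where
  "cutoffs K h1 h2 h3 \<longleftrightarrow> 1 \<le> K \<and> cutoff K h1 \<and> cutoff K h2 \<and> cutoff K h3 \<and>
     (\<forall>t\<le>3/4. h1 t = 1) \<and> (\<forall>t\<ge>7/8. h1 t = 0) \<and> (\<forall>t\<le>13. h2 t = 1) \<and> (\<forall>t\<ge>15. h2 t = 0) \<and>
     (\<forall>t\<le>1/4. h3 t = 0) \<and> (\<forall>t\<ge>12. h3 t = 0) \<and> (\<forall>t\<in>{1/2..10}. h3 t = 1)"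

lemma cutoffs_exist: "\<exists>K h1 h2 h3. cutoffs K h1 h2 h3"
proof -
  obtain S where S: "smooth1 S" "\<And>t. 0 \<le> S t \<and> S t \<le> 1" "\<And>t. t \<le> 0 \<Longrightarrow> S t = 0" "\<And>t. t \<ge> 1 \<Longrightarrow> S t = 1"
    using smooth_step_exists by blast
  \<comment> \<open>The affine arguments of the step function take the values 1 and 0 at the ends of
    the transitions: at \<open>3/4\<close> and \<open>7/8\<close> for \<open>h1\<close>, at 13 and
    15 for \<open>h2\<close>; for \<open>h3\<close> the first rises from \<open>1/4\<close> to
    \<open>1/2\<close> and the second falls from 10 to 12.\<close>
  define h1 where "h1 t = S ((-8) * t + 7)" for t
  define h2 where "h2 t = S ((-1/2) * t + 15/2)" for t
  define h3 where "h3 t = S (4 * t + (-1)) * S ((-1/2) * t + 6)" for t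
  have s1: "smooth1 h1" unfolding h1_def[abs_def] by (rule smooth1_affine[OF S(1)])
  have s2: "smooth1 h2" unfolding h2_def[abs_def] by (rule smooth1_affine[OF S(1)])
  have s3: "smooth1 h3" unfolding h3_def[abs_def] by (rule smooth1_mult[OF smooth1_affine[OF S(1)] smooth1_affine[OF S(1)]])
  obtain K1 where K1: "cutoff K1 h1" using cutoffI[OF s1, of 0 1 2 0] S by (auto simp: h1_def)
  obtain K2 where K2: "cutoff K2 h2" using cutoffI[OF s2, of 0 1 16 0] S by (auto simp: h2_def)
  have "0 \<le> h3 t \<and> h3 t \<le> 1" for t unfolding h3_def using S(2) by (simp add: mult_le_one)
  moreover have "h3 t = 0" if "t < 0" for t using that S(3)[of "4 * t + (-1)"] by (simp add: h3_def)
  moreover have "h3 t = 0" if "t > 12" for t using that S(3)[of "(-1/2) * t + 6"] by (simp add: h3_def)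
  ultimately obtain K3 where K3: "cutoff K3 h3" using cutoffI[OF s3, of 0 0 12 0] by blast
  define K where "K = max 1 (max K1 (max K2 K3))"
  have "K1 \<le> K" "K2 \<le> K" "K3 \<le> K" "1 \<le> K" by (auto simp: K_def)
  then have "cutoffs K h1 h2 h3" unfolding cutoffs_def
    using cutoff_mono[OF K1] cutoff_mono[OF K2] cutoff_mono[OF K3] S(3,4)
    by (auto simp: h1_def h2_def h3_def)
  then show ?thesis by blast
qed

definition radial_cutoff :: "nat \<Rightarrow> (real \<Rightarrow> real) \<Rightarrow> (nat \<Rightarrow> real) \<Rightarrow> real \<Rightarrow> (nat \<Rightarrow> real) \<Rightarrow> real" where
  "radial_cutoff n h z r x = h (sq_dist n z x / r\<^sup>2)"

lemma smooth_scaled_sq_dist: "smooth n (\<lambda>x. sq_dist n z x / r\<^sup>2)"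
  using smooth_mult[OF smooth_const[of n "1 / r\<^sup>2"] smooth_sq_dist[of n z]] by simp

lemma smooth_radial_cutoff: "smooth1 h \<Longrightarrow> smooth n (radial_cutoff n h z r)"
  unfolding radial_cutoff_def[abs_def] by (rule smooth_comp[OF _ smooth_scaled_sq_dist])

lemma partial_scaled_sq_dist:
  assumes "i < n" "x \<in> Rn n" shows "partial_deriv i (\<lambda>x. sq_dist n z x / r\<^sup>2) x = 2 * (x i - z i) / r\<^sup>2"
  using partial_cmult[OF smooth_sq_dist assms(2,1), of "1 / r\<^sup>2" z] partial_sq_dist[OF assms(1), of z x] by simp

lemma partial_radial_cutoff:
  assumes h: "smooth1 h" and i: "i < n" and x: "x \<in> Rn n"
  shows "partial_deriv i (radial_cutoff n h z r) x = radial_cutoff n (deriv h) z r x * (2 * (x i - z i) / r\<^sup>2)"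
  unfolding radial_cutoff_def[abs_def] partial_comp[OF h smooth_scaled_sq_dist i x] partial_scaled_sq_dist[OF i x] ..

lemma grad_norm_radial_cutoff:
  assumes h: "smooth1 h" and x: "x \<in> Rn n" and r: "0 < r"
  shows "(grad_norm n (radial_cutoff n h z r) x)\<^sup>2 = (radial_cutoff n (deriv h) z r x)\<^sup>2 * (4 * (sq_dist n z x / r\<^sup>2) / r\<^sup>2)"
proof -
  have "(grad_norm n (radial_cutoff n h z r) x)\<^sup>2 = (\<Sum>i<n. (radial_cutoff n (deriv h) z r x)\<^sup>2 * (4 / r ^ 4) * (x i - z i)\<^sup>2)"
    unfolding grad_norm_sq
  proof (rule sum.cong[OF refl])
    fix i assume "i \<in> {..<n}"
    then have i: "i < n" by simp
    have aux: "(c * (2 * d / r\<^sup>2))\<^sup>2 = c\<^sup>2 * (4 / r ^ 4) * d\<^sup>2" for c d :: real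
      by (simp add: power2_eq_square power4_eq_xxxx mult_ac)
    show "(partial_deriv i (radial_cutoff n h z r) x)\<^sup>2 = (radial_cutoff n (deriv h) z r x)\<^sup>2 * (4 / r ^ 4) * (x i - z i)\<^sup>2"
      unfolding partial_radial_cutoff[OF h i x] by (rule aux)
  qed
  also have "\<dots> = (radial_cutoff n (deriv h) z r x)\<^sup>2 * (4 / r ^ 4) * sq_dist n z x"
    by (simp add: sq_dist_def sum_distrib_left)
  also have "\<dots> = (radial_cutoff n (deriv h) z r x)\<^sup>2 * (4 * (sq_dist n z x / r\<^sup>2) / r\<^sup>2)"
    by (simp add: power2_eq_square power4_eq_xxxx)
  finally show ?thesis .
qed

lemma partial_const [simp]: "partial_deriv i (\<lambda>x. c) x = 0"
  by (rule partial_deriv_eqI) auto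

lemma laplacian_radial_cutoff:
  assumes h: "smooth1 h" and x: "x \<in> Rn n" and r: "0 < r"
  shows "laplacian n (radial_cutoff n h z r) x = radial_cutoff n (deriv (deriv h)) z r x * (4 * (sq_dist n z x / r\<^sup>2) / r\<^sup>2)
      + radial_cutoff n (deriv h) z r x * (2 * real n / r\<^sup>2)"
proof -
  note h' = smooth1_deriv(2)[OF h]
  have "partial_deriv i (partial_deriv i (radial_cutoff n h z r)) x =
      radial_cutoff n (deriv (deriv h)) z r x * (4 / r ^ 4) * (x i - z i)\<^sup>2 + radial_cutoff n (deriv h) z r x * (2 / r\<^sup>2)" if i: "i < n" for i
  proof -
    have sl: "smooth n (\<lambda>x. 2 * (x i - z i) / r\<^sup>2)"
      using smooth_mult[OF smooth_const[of n "2 / r\<^sup>2"] smooth_diff[OF smooth_coord[OF i] smooth_const[of n "z i"]]] by simp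
    have pl: "partial_deriv i (\<lambda>x. 2 * (x i - z i) / r\<^sup>2) x = 2 / r\<^sup>2"
    proof (rule partial_deriv_eqI)
      have "((\<lambda>t. 2 * (t - z i) / r\<^sup>2) has_real_derivative 2 * (1 - 0) / r\<^sup>2) (at (x i))"
        by (intro DERIV_cdivide DERIV_cmult DERIV_diff DERIV_ident DERIV_const)
      then show "((\<lambda>t. 2 * ((x(i := t)) i - z i) / r\<^sup>2) has_real_derivative 2 / r\<^sup>2) (at (x i))" by simp
    qed
    have "partial_deriv i (partial_deriv i (radial_cutoff n h z r)) x = partial_deriv i (\<lambda>x. radial_cutoff n (deriv h) z r x * (2 * (x i - z i) / r\<^sup>2)) x"
      by (rule partial_cong[OF _ x i]) (rule partial_radial_cutoff[OF h i])
    also have "\<dots> = radial_cutoff n (deriv h) z r x * (2 / r\<^sup>2) + radial_cutoff n (deriv (deriv h)) z r x * (2 * (x i - z i) / r\<^sup>2) * (2 * (x i - z i) / r\<^sup>2)"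
      unfolding partial_mult[OF smooth_radial_cutoff[OF h'] sl x i] pl partial_radial_cutoff[OF h' i x] ..
    also have "\<dots> = radial_cutoff n (deriv h) z r x * (2 / r\<^sup>2) + radial_cutoff n (deriv (deriv h)) z r x * (4 / r ^ 4) * (x i - z i)\<^sup>2"
    proof -
      have aux: "c * (2 * d / r\<^sup>2) * (2 * d / r\<^sup>2) = c * (4 / r ^ 4) * d\<^sup>2" for c d :: real
        by (simp add: power2_eq_square power4_eq_xxxx mult_ac)
      show ?thesis by (simp only: aux)
    qed
    finally show ?thesis by simp
  qed
  then have "laplacian n (radial_cutoff n h z r) x = (\<Sum>i<n. radial_cutoff n (deriv (deriv h)) z r x * (4 / r ^ 4) * (x i - z i)\<^sup>2 + radial_cutoff n (deriv h) z r x * (2 / r\<^sup>2))"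
    unfolding laplacian_def by (intro sum.cong) auto
  also have "\<dots> = radial_cutoff n (deriv (deriv h)) z r x * (4 / r ^ 4) * sq_dist n z x + radial_cutoff n (deriv h) z r x * (2 * real n / r\<^sup>2)"
    by (simp add: sq_dist_def sum_distrib_left sum.distrib)
  finally show ?thesis by (simp add: power2_eq_square power4_eq_xxxx)
qed

text \<open>Where the derivative of \<open>h\<close> is not 0 the variable is at most 15, and
  \<open>4 * 15 <= 8^2\<close>. No dependence on \<open>n\<close>: the gradient of the squared
  distance has length twice the distance.\<close>

lemma grad_norm_radial_cutoff_le:
  assumes h: "cutoff K h" "\<And>t. t > 15 \<Longrightarrow> deriv h t = 0" and x: "x \<in> Rn n" and r: "0 < r"
  shows "grad_norm n (radial_cutoff n h z r) x \<le> 8 * K / r"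
proof -
  have K: "\<bar>deriv h t\<bar> \<le> K" for t using h by (simp add: cutoff_def)
  then have K0: "0 \<le> K" by (meson abs_ge_zero order_trans)
  define q where "q = sq_dist n z x / r\<^sup>2"
  have q0: "0 \<le> q" using r by (simp add: q_def)
  have "(grad_norm n (radial_cutoff n h z r) x)\<^sup>2 = (deriv h q)\<^sup>2 * (4 * q / r\<^sup>2)"
    using grad_norm_radial_cutoff[OF _ x r, of h z] h by (simp add: cutoff_def radial_cutoff_def q_def)
  also have "\<dots> \<le> K\<^sup>2 * (64 / r\<^sup>2)"
  proof (cases "q > 15")
    case False
    have "(deriv h q)\<^sup>2 \<le> K\<^sup>2" using K[of q] by (simp add: abs_le_square_iff[symmetric])
    moreover have "4 * q / r\<^sup>2 \<le> 64 / r\<^sup>2" using False r by (intro divide_right_mono) auto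
    ultimately show ?thesis using q0 by (intro mult_mono) auto
  qed (simp add: h(2))
  also have "\<dots> = (8 * K / r)\<^sup>2" by (simp add: power2_eq_square)
  finally show ?thesis by (rule power2_le_imp_le) (use K0 r in simp)
qed

text \<open>The term \<open>2 n\<close> is the Laplacian of the squared distance. Through it the
  dimension enters the constant of the three-ball inequality, linearly.\<close>

lemma laplacian_radial_cutoff_le:
  assumes h: "cutoff K h" "\<And>t. t > 15 \<Longrightarrow> h t = 0" and x: "x \<in> Rn n" and r: "0 < r"
  shows "\<bar>laplacian n (radial_cutoff n h z r) x\<bar> \<le> K * (60 + 2 * real n) / r\<^sup>2"
proof -
  have K: "\<bar>deriv h t\<bar> \<le> K" "\<bar>deriv (deriv h) t\<bar> \<le> K" for t using h by (auto simp: cutoff_def)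
  have sm: "smooth1 h" using h by (simp add: cutoff_def)
  have K0: "0 \<le> K" using K(1) by (meson abs_ge_zero order_trans)
  define q where "q = sq_dist n z x / r\<^sup>2"
  have q0: "0 \<le> q" using r by (simp add: q_def)
  have d1: "deriv h t = 0" if "t > 15" for t by (rule smooth1_deriv_const[OF sm, of "{15<..}" 0]) (use h that in auto)
  have d2: "deriv (deriv h) t = 0" if "t > 15" for t
    by (rule smooth1_deriv_const[OF smooth1_deriv(2)[OF sm], of "{15<..}" 0]) (use d1 that in auto)
  have b: "\<bar>deriv (deriv h) q * (4 * q)\<bar> \<le> K * 60"
  proof (cases "q > 15")
    case False then show ?thesis unfolding abs_mult using K q0 K0 by (intro mult_mono) auto
  qed (use d2 K0 in simp)
  have "laplacian n (radial_cutoff n h z r) x = (deriv (deriv h) q * (4 * q) + deriv h q * (2 * real n)) / r\<^sup>2"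
    using laplacian_radial_cutoff[OF sm x r, of z] by (simp add: radial_cutoff_def q_def add_divide_distrib)
  then have "\<bar>laplacian n (radial_cutoff n h z r) x\<bar> = \<bar>deriv (deriv h) q * (4 * q) + deriv h q * (2 * real n)\<bar> / r\<^sup>2"
    by simp
  also have "\<dots> \<le> (K * 60 + K * (2 * real n)) / r\<^sup>2"
  proof (rule divide_right_mono)
    have "\<bar>deriv h q * (2 * real n)\<bar> \<le> K * (2 * real n)" unfolding abs_mult using K K0 by (intro mult_mono) auto
    then show "\<bar>deriv (deriv h) q * (4 * q) + deriv h q * (2 * real n)\<bar> \<le> K * 60 + K * (2 * real n)" using b by linarith
  qed simp
  finally show ?thesis by (simp add: algebra_simps)
qed

lemma csmooth_radial_cutoff:
  assumes h: "smooth1 h" "\<And>t. t > a \<Longrightarrow> h t = 0" and r: "0 < r"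
  shows "csmooth n (clball n z (a * r\<^sup>2)) (radial_cutoff n h z r)"
  unfolding csmooth_def
proof (intro conjI smooth_radial_cutoff h compactin_clball ballI)
  fix x assume "x \<in> Rn n - clball n z (a * r\<^sup>2)"
  then have "sq_dist n z x / r\<^sup>2 > a" using r by (simp add: clball_def field_simps not_le)
  then show "radial_cutoff n h z r x = 0" by (simp add: radial_cutoff_def h)
qed

lemma laplacian_mult:
  assumes f: "smooth n f" and g: "smooth n g" and x: "x \<in> Rn n"
  shows "laplacian n (\<lambda>x. f x * g x) x = f x * laplacian n g x + 2 * (\<Sum>i<n. partial_deriv i f x * partial_deriv i g x) + g x * laplacian n f x"
proof -
  have "partial_deriv i (partial_deriv i (\<lambda>x. f x * g x)) x =
      f x * partial_deriv i (partial_deriv i g) x + 2 * (partial_deriv i f x * partial_deriv i g x) + g x * partial_deriv i (partial_deriv i f) x"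
    if i: "i < n" for i
  proof -
    note f' = smooth_partial[OF f i] and g' = smooth_partial[OF g i]
    have "partial_deriv i (partial_deriv i (\<lambda>x. f x * g x)) x = partial_deriv i (\<lambda>x. f x * partial_deriv i g x + partial_deriv i f x * g x) x"
      by (rule partial_cong[OF _ x i]) (rule partial_mult[OF f g _ i])
    then show ?thesis
      by (simp add: partial_add[OF smooth_mult[OF f g'] smooth_mult[OF f' g] x i] partial_mult[OF f g' x i] partial_mult[OF f' g x i])
  qed
  then show ?thesis by (simp add: laplacian_def sum_distrib_left sum.distrib)
qed


subsection \<open>The energy estimate\<close>

text \<open>Pointwise \<open>|grad (\<zeta> v)|^2 = v^2 |grad \<zeta>|^2 + grad (\<zeta>^2 v) . grad
  v\<close>, and the last product is integrated by parts. No derivative of \<open>v\<close> other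
  than its Laplacian remains on the right.\<close>

lemma energy_identity:
  assumes c: "csmooth n K \<zeta>" and v: "smooth n v"
  shows "(normLq (leb n) 2 (grad_norm n (\<lambda>x. \<zeta> x * v x)))\<^sup>2 =
    (\<integral>x. (v x * grad_norm n \<zeta> x)\<^sup>2 \<partial>leb n) - (\<integral>x. \<zeta> x * v x * (\<zeta> x * laplacian n v x) \<partial>leb n)"
proof -
  note sc = csmooth_smooth[OF c]
  have w: "csmooth n K (\<lambda>x. \<zeta> x * v x)" by (rule csmooth_mult2[OF c v])
  define \<psi> where "\<psi> x = \<zeta> x * (\<zeta> x * v x)" for x
  have p: "csmooth n K \<psi>" unfolding \<psi>_def[abs_def] by (rule csmooth_mult[OF w sc])
  have i1: "integrable (leb n) (\<lambda>x. (v x * partial_deriv i \<zeta> x)\<^sup>2)" if "i < n" for i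
    using csmooth_memLq[OF csmooth_mult[OF csmooth_partial[OF c that] v], of 2] by (simp add: memLq_2)
  have i2: "integrable (leb n) (\<lambda>x. partial_deriv i \<psi> x * partial_deriv i v x)" if "i < n" for i
    by (rule csmooth_integrable[OF csmooth_mult2[OF csmooth_partial[OF p that] smooth_partial[OF v that]]])
  have i3: "integrable (leb n) (\<lambda>x. \<psi> x * partial_deriv i (partial_deriv i v) x)" if "i < n" for i
    by (rule csmooth_integrable[OF csmooth_mult2[OF p smooth_partial[OF smooth_partial[OF v that] that]]])
  have pt: "(partial_deriv i (\<lambda>x. \<zeta> x * v x) x)\<^sup>2 = (v x * partial_deriv i \<zeta> x)\<^sup>2 + partial_deriv i \<psi> x * partial_deriv i v x"
    if i: "i < n" and x: "x \<in> Rn n" for i x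
    unfolding \<psi>_def partial_mult[OF sc csmooth_smooth[OF w] x i] partial_mult[OF sc v x i]
    by (simp add: power2_eq_square algebra_simps)
  have "(normLq (leb n) 2 (grad_norm n (\<lambda>x. \<zeta> x * v x)))\<^sup>2 = (\<integral>x. (\<Sum>i<n. (v x * partial_deriv i \<zeta> x)\<^sup>2 + partial_deriv i \<psi> x * partial_deriv i v x) \<partial>leb n)"
    unfolding normLq_2 grad_norm_sq by (intro Bochner_Integration.integral_cong sum.cong) (auto simp: pt)
  also have "\<dots> = (\<Sum>i<n. (\<integral>x. (v x * partial_deriv i \<zeta> x)\<^sup>2 \<partial>leb n) + (\<integral>x. partial_deriv i \<psi> x * partial_deriv i v x \<partial>leb n))"
    using i1 i2 by (simp add: Bochner_Integration.integral_sum)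
  also have "\<dots> = (\<Sum>i<n. (\<integral>x. (v x * partial_deriv i \<zeta> x)\<^sup>2 \<partial>leb n) - (\<integral>x. \<psi> x * partial_deriv i (partial_deriv i v) x \<partial>leb n))"
    using integration_by_parts[OF p smooth_partial[OF v]] by (intro sum.cong) auto
  also have "\<dots> = (\<integral>x. (\<Sum>i<n. (v x * partial_deriv i \<zeta> x)\<^sup>2) \<partial>leb n) - (\<integral>x. (\<Sum>i<n. \<psi> x * partial_deriv i (partial_deriv i v) x) \<partial>leb n)"
    using i1 i3 by (simp add: Bochner_Integration.integral_sum sum_subtractf)
  also have "(\<lambda>x. \<Sum>i<n. (v x * partial_deriv i \<zeta> x)\<^sup>2) = (\<lambda>x. (v x * grad_norm n \<zeta> x)\<^sup>2)"
    by (simp add: power_mult_distrib grad_norm_sq sum_distrib_left)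
  also have "(\<lambda>x. \<Sum>i<n. \<psi> x * partial_deriv i (partial_deriv i v) x) = (\<lambda>x. \<zeta> x * v x * (\<zeta> x * laplacian n v x))"
    by (simp add: laplacian_def sum_distrib_left \<psi>_def mult_ac)
  finally show ?thesis .
qed

text \<open>Either \<open>N <= A\<close>, or \<open>A^2 <= A N\<close> and one factor
  \<open>N\<close> can be cancelled.\<close>

lemma absorb_quadratic:
  fixes N A s e :: real
  assumes "0 \<le> N" "0 \<le> A" "0 \<le> s" "0 \<le> e" "N\<^sup>2 \<le> 2 * A\<^sup>2 + 2 * s * N * e"
  shows "N \<le> 2 * A + 2 * s * e"
proof (cases "N \<le> A")
  case True
  moreover have "0 \<le> s * e" using assms by simp
  ultimately show ?thesis using assms by linarith
next
  case False
  then have N: "0 < N" using assms by linarith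
  have "A\<^sup>2 \<le> A * N" using False assms by (simp add: power2_eq_square mult_left_mono)
  then have "N * N \<le> N * (2 * A + 2 * s * e)" using assms(5) by (simp add: power2_eq_square algebra_simps)
  then show ?thesis using N by simp
qed

text \<open>The equation is allowed an error \<open>e\<close>, as it will be applied to
  mollifications. The error is paired with \<open>\<zeta> v\<close> by duality of \<open>p\<close>
  and \<open>p'\<close>; the Sobolev inequality turns the second factor into the gradient norm that
  is being estimated, so the error enters linearly.\<close>

lemma caccioppoli:
  assumes n: "3 \<le> n" and O: "openin (Rtop n) \<Omega>" "\<Omega> \<noteq> {}"
    and V: "memLq (leb n) (real n / 2) V" and kap: "2 * (sobolev_const n \<Omega>)\<^sup>2 * normLq (leb n) (real n / 2) V < 1"
    and c: "csmooth n K \<zeta>" "K \<subseteq> \<Omega>" "\<And>x. \<bar>\<zeta> x\<bar> \<le> 1" and v: "smooth n v"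
    and e: "memLq (leb n) (exp_p n) e" "\<And>x. x \<in> K \<Longrightarrow> laplacian n v x = V x * v x + e x"
  shows "normLq (leb n) 2 (grad_norm n (\<lambda>x. \<zeta> x * v x)) \<le> 2 * normLq (leb n) 2 (\<lambda>x. v x * grad_norm n \<zeta> x) + 2 * sobolev_const n \<Omega> * normLq (leb n) (exp_p n) e"
proof -
  note ep = exp_p_props[OF n]
  define \<sigma> where "\<sigma> = sobolev_const n \<Omega>"
  define \<kappa> where "\<kappa> = normLq (leb n) (real n / 2) V"
  define w where "w x = \<zeta> x * v x" for x
  define N where "N = normLq (leb n) 2 (grad_norm n w)"
  define A where "A = normLq (leb n) 2 (\<lambda>x. v x * grad_norm n \<zeta> x)"
  define P where "P = normLq (leb n) (exp_p' n) w"
  define \<epsilon> where "\<epsilon> = normLq (leb n) (exp_p n) e"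
  have nn: "0 \<le> N" "0 \<le> A" "0 \<le> P" "0 \<le> \<epsilon>" "0 \<le> \<kappa>" by (auto simp: N_def A_def P_def \<epsilon>_def \<kappa>_def)
  have s0: "0 \<le> \<sigma>" unfolding \<sigma>_def by (rule sobolev_const_nonneg[OF n O])
  have w: "csmooth n K w" unfolding w_def[abs_def] by (rule csmooth_mult2[OF c(1) v])
  have PN: "P \<le> \<sigma> * N" unfolding P_def \<sigma>_def N_def by (rule sobolev_const_bound[OF n O(1) w c(2)])
  have wL: "memLq (leb n) (exp_p' n) w" by (rule csmooth_memLq[OF w ep(4)])
  have Vw: "memLq (leb n) (exp_p n) (\<lambda>x. V x * w x)" "normLq (leb n) (exp_p n) (\<lambda>x. V x * w x) \<le> \<kappa> * P"
    using Hoelder[OF _ ep(4) ep(3) ep(7) V wL] n by (auto simp: \<kappa>_def P_def)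
  have cm: "\<zeta> \<in> borel_measurable (leb n)" by (rule csmooth_meas[OF c(1)])
  have ce: "memLq (leb n) (exp_p n) (\<lambda>x. \<zeta> x * e x)" "normLq (leb n) (exp_p n) (\<lambda>x. \<zeta> x * e x) \<le> \<epsilon>"
  proof -
    have "AE x in leb n. \<bar>\<zeta> x * e x\<bar> \<le> \<bar>e x\<bar>"
      using c(3) by (intro AE_I2) (simp add: abs_mult mult_left_le_one_le)
    from memLq_mono[OF ep(3) e(1) _ this] show "memLq (leb n) (exp_p n) (\<lambda>x. \<zeta> x * e x)" "normLq (leb n) (exp_p n) (\<lambda>x. \<zeta> x * e x) \<le> \<epsilon>"
      using cm e(1) by (auto simp: memLq_def \<epsilon>_def)
  qed
  define g where "g x = V x * w x + \<zeta> x * e x" for x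
  have g: "memLq (leb n) (exp_p n) g" "normLq (leb n) (exp_p n) g \<le> \<kappa> * P + \<epsilon>"
    using Minkowski[OF ep(1) Vw(1) ce(1)] Vw(2) ce(2) by (auto simp: g_def[abs_def])
  have gw: "memLq (leb n) 1 (\<lambda>x. g x * w x)" "normLq (leb n) 1 (\<lambda>x. g x * w x) \<le> normLq (leb n) (exp_p n) g * P"
    using Hoelder[OF ep(3,4) _ ep(8) g(1) wL] by (auto simp: P_def)
  have eq: "(\<integral>x. \<zeta> x * v x * (\<zeta> x * laplacian n v x) \<partial>leb n) = (\<integral>x. g x * w x \<partial>leb n)"
  proof (rule Bochner_Integration.integral_cong[OF refl])
    fix x assume x: "x \<in> space (leb n)"
    show "\<zeta> x * v x * (\<zeta> x * laplacian n v x) = g x * w x"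
    proof (cases "x \<in> K")
      case True then show ?thesis using e(2)[OF True] by (simp add: g_def w_def algebra_simps)
    next
      case False then show ?thesis using csmooth_zero[OF c(1)] x by (simp add: w_def)
    qed
  qed
  have A2: "A\<^sup>2 = (\<integral>x. (v x * grad_norm n \<zeta> x)\<^sup>2 \<partial>leb n)" unfolding A_def by (rule normLq_2)
  have "N\<^sup>2 = A\<^sup>2 - (\<integral>x. g x * w x \<partial>leb n)"
    using energy_identity[OF c(1) v] unfolding eq A2 N_def w_def[abs_def] .
  also have "\<dots> \<le> A\<^sup>2 + (\<kappa> * P + \<epsilon>) * P"
    using integral_abs_le_normLq(2)[OF gw(1)] gw(2) mult_right_mono[OF g(2) nn(3)] by linarith
  also have "\<dots> = A\<^sup>2 + \<kappa> * P\<^sup>2 + \<epsilon> * P" by (simp add: algebra_simps power2_eq_square)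
  also have "\<dots> \<le> A\<^sup>2 + \<kappa> * (\<sigma> * N)\<^sup>2 + \<epsilon> * (\<sigma> * N)"
    using PN nn by (intro add_mono mult_left_mono power_mono) auto
  also have "\<kappa> * (\<sigma> * N)\<^sup>2 = (\<sigma>\<^sup>2 * \<kappa>) * N\<^sup>2" by (simp add: power_mult_distrib mult_ac)
  also have "(\<sigma>\<^sup>2 * \<kappa>) * N\<^sup>2 \<le> (1 / 2) * N\<^sup>2"
    using kap by (intro mult_right_mono) (auto simp: \<sigma>_def \<kappa>_def)
  finally have "N\<^sup>2 \<le> 2 * A\<^sup>2 + 2 * \<sigma> * N * \<epsilon>" by (simp add: mult_ac)
  then have "N \<le> 2 * A + 2 * \<sigma> * \<epsilon>" using nn s0 by (intro absorb_quadratic)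
  then show ?thesis by (simp add: N_def A_def \<sigma>_def \<epsilon>_def w_def[abs_def])
qed

subsection \<open>Local integrability of solutions\<close>

text \<open>The difference of such a number and an element of \<open>N + (n-2)/2\<close> is an
  integer plus \<open>1/2\<close>, hence at least \<open>1/2\<close> in absolute value, with
  equality for the same \<open>m\<close>. The exponents form a progression of step 1 that starts at
  \<open>(n-1)/2\<close>.\<close>

lemma exponents_mem:
  assumes "3 \<le> n" shows "real m + (real n - 1) / 2 \<in> carleman_exponents n"
proof -
  define l where "l = real m + (real n - 1) / 2"
  define A where "A = range (\<lambda>m::nat. real m + (real n - 2) / 2)"
  have "1 / 2 \<le> dist l a" if "a \<in> A" for a
  proof -
    from that obtain k :: nat where k: "a = real k + (real n - 2) / 2" by (auto simp: A_def)
    have "l - a = real_of_int (int m - int k) + 1 / 2" by (simp add: l_def k field_simps)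
    moreover have "int m - int k \<ge> 0 \<or> int m - int k \<le> -1" by linarith
    then have "real_of_int (int m - int k) \<ge> 0 \<or> real_of_int (int m - int k) \<le> -1"
      by (metis of_int_0_le_iff of_int_le_iff of_int_minus of_int_1)
    ultimately show ?thesis unfolding dist_real_def by linarith
  qed
  moreover have Ane: "A \<noteq> {}" by (simp add: A_def)
  ultimately have "1 / 2 \<le> (INF a\<in>A. dist l a)" by (intro cINF_greatest) auto
  then have "1 / 2 \<le> infdist l A" using Ane by (simp add: infdist_def)
  moreover have "real m + (real n - 2) / 2 \<in> A" by (auto simp: A_def)
  then have "infdist l A \<le> dist l (real m + (real n - 2) / 2)" by (rule infdist_le)
  then have "infdist l A \<le> 1 / 2" by (simp add: l_def dist_real_def field_simps)
  moreover have "0 < l" using assms by (simp add: l_def add_nonneg_pos)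
  ultimately show ?thesis by (simp add: carleman_exponents_def l_def[symmetric] A_def[symmetric])
qed

lemma partial_cong_open:
  assumes U: "openin (Rtop n) U" and z: "\<And>x. x \<in> U \<Longrightarrow> f x = g x" and x: "x \<in> U" "i < n"
  shows "partial_deriv i f x = partial_deriv i g x"
proof -
  have xR: "x \<in> Rn n" using openin_subset[OF U] x by auto
  obtain e where e: "e > 0" "\<And>y. y \<in> Rn n \<Longrightarrow> Rn_dist n x y < e \<Longrightarrow> y \<in> U"
    using U x unfolding openin_Rtop_iff by blast
  have "f (x(i := t)) = g (x(i := t))" if "dist t (x i) < e" for t
  proof (rule z, rule e(2))
    have "sq_dist n x (x(i := t)) = (\<Sum>j<n. if j = i then (t - x i)\<^sup>2 else 0)"
      unfolding sq_dist_def by (rule sum.cong) auto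
    also have "\<dots> = (t - x i)\<^sup>2" using x by simp
    finally show "Rn_dist n x (x(i := t)) < e" using that by (simp add: Rn_dist_sq_dist dist_real_def)
  qed (use xR x in auto)
  then have "\<forall>\<^sub>F t in nhds (x i). f (x(i := t)) = g (x(i := t))"
    unfolding eventually_nhds_metric using e(1) by blast
  then show ?thesis unfolding partial_deriv_def by (rule deriv_cong_ev) simp
qed

lemma clball_subset:
  assumes x: "x \<in> clball n z a" and s: "sqrt a + sqrt e \<le> sqrt t"
  shows "clball n x e \<subseteq> clball n z t"
proof
  fix y assume y: "y \<in> clball n x e"
  have "Rn_dist n z y \<le> Rn_dist n z x + Rn_dist n x y" by (rule Rn_dist_triangle)
  also have "\<dots> \<le> sqrt a + sqrt e" using x y by (auto simp: Rn_dist_sq_dist clball_def intro!: add_mono)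
  finally have "sqrt (sq_dist n z y) \<le> sqrt t" using s unfolding Rn_dist_sq_dist by (rule order_trans)
  then have "sq_dist n z y \<le> t" by (simp only: real_sqrt_le_iff)
  then show "y \<in> clball n z t" using y by (simp add: clball_def)
qed

lemma moll_scale_sqrt_less: "0 < d \<Longrightarrow> \<forall>\<^sub>F m in sequentially. sqrt (moll_scale m) < d"
  using moll_scale_less[of "d\<^sup>2"] by (auto elim!: eventually_mono intro: real_less_lsqrt)

text \<open>On a set of finite measure \<open>L^q\<close> is contained in \<open>L^1\<close>, by
  \<open>|f| <= |f|^q + 1\<close>.\<close>

lemma bsupp_integrable_restrict_Lp:
  assumes q: "1 \<le> q" and f: "f \<in> Lp n q \<Omega>" and O: "\<Omega> \<in> sets (leb n)" and A: "compactin (Rtop n) A" "A \<subseteq> \<Omega>"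
  shows "memLq (leb n) q (\<lambda>x. indicator A x * f x)" "bsupp_integrable n (\<lambda>x. indicator A x * f x)"
proof -
  note As = compactin_finite_measure[OF A(1)]
  have q0: "0 < q" using q by simp
  have L0: "memLq (leb n) q (\<lambda>x. indicator \<Omega> x * f x)" using f Lp_memLq[OF q0 O, of f] by simp
  have eq: "indicator A x * f x = indicator A x * (indicator \<Omega> x * f x)" for x using A(2) by (auto simp: indicator_def)
  have m: "(\<lambda>x. indicator A x * f x) \<in> borel_measurable (leb n)"
    using L0 As(1) unfolding eq by (auto simp: memLq_def)
  show L: "memLq (leb n) q (\<lambda>x. indicator A x * f x)"
    by (rule memLq_mono(1)[OF q0 L0 m]) (use A(2) in \<open>auto simp: indicator_def\<close>)
  have "integrable (leb n) (\<lambda>x. indicator A x * f x)"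
  proof (rule Bochner_Integration.integrable_bound[of _ "\<lambda>x. \<bar>indicator A x * f x\<bar> powr q + indicator A x"])
    show "AE x in leb n. norm (indicator A x * f x) \<le> norm (\<bar>indicator A x * f x\<bar> powr q + indicator A x)"
    proof (rule AE_I2)
      fix x
      have "\<bar>f x\<bar> \<le> \<bar>f x\<bar> powr q + 1"
      proof (cases "\<bar>f x\<bar> \<le> 1")
        case False
        then have "\<bar>f x\<bar> powr 1 \<le> \<bar>f x\<bar> powr q" using q by (intro powr_mono) auto
        then show ?thesis by simp
      qed (simp add: add_increasing)
      then show "norm (indicator A x * f x) \<le> norm (\<bar>indicator A x * f x\<bar> powr q + indicator A x)"
        by (auto simp: indicator_def)
    qed
  qed (use L m As in \<open>auto simp: memLq_def\<close>)
  then show "bsupp_integrable n (\<lambda>x. indicator A x * f x)" using A(1) unfolding bsupp_integrable_def by (auto intro!: exI[of _ A])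
qed

lemma memLq_bmult:
  assumes q: "0 < q" and f: "memLq M q f" and c: "c \<in> borel_measurable M" "\<And>x. x \<in> space M \<Longrightarrow> \<bar>c x\<bar> \<le> B"
  shows "memLq M q (\<lambda>x. c x * f x)" "normLq M q (\<lambda>x. c x * f x) \<le> B * normLq M q f"
proof -
  have m: "(\<lambda>x. c x * f x) \<in> borel_measurable M" using f c by (auto simp: memLq_def)
  have ae: "AE x in M. \<bar>c x * f x\<bar> \<le> \<bar>\<bar>B\<bar> * f x\<bar>"
    using c(2) by (intro AE_I2) (force simp: abs_mult intro!: mult_right_mono)
  note * = memLq_mono[OF q memLq_cmult[OF f, of "\<bar>B\<bar>"] m ae]
  show "memLq M q (\<lambda>x. c x * f x)" by (rule *(1))
  show "normLq M q (\<lambda>x. c x * f x) \<le> B * normLq M q f"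
  proof (cases "space M = {}")
    case True
    have "(LINT x|M. k x) = 0" for k :: "'a \<Rightarrow> real" by (intro integral_eq_zero_AE AE_I2) (simp add: True)
    then show ?thesis by (simp add: normLq_def)
  next
    case False
    then obtain x where "x \<in> space M" by auto
    then have "0 \<le> B" using c(2)[of x] by linarith
    then show ?thesis using *(2) q by (simp add: normLq_cmult)
  qed
qed

text \<open>Sobolev embedding of second order, extracted from the Carleman inequality. With the pole
  outside the support of the cutoff the weight is bounded above and below, and the
  \<open>L^p'\<close> norm of a smooth function is controlled by the \<open>L^p\<close> norm of its
  Laplacian. Applied to cut-off mollifications, this bound is uniform and survives in the
  limit.\<close>

theorem solution_locally_Lp':
  assumes n: "3 \<le> n" and C: "carleman_const n \<theta>" and th: "0 \<le> \<theta>" and O: "openin (Rtop n) \<Omega>"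
    and u: "u \<in> sobolev n 2 (exp_p n) \<Omega>" and z: "z \<in> Rn n" and st: "0 < s" "s < t" "clball n z t \<subseteq> \<Omega>"
  shows "memLq (leb n) (exp_p' n) (\<lambda>x. indicator (clball n z s) x * u x)"
proof -
  note ep = exp_p_props[OF n]
  define p where "p = exp_p n"
  have p: "1 \<le> p" "0 < p" using ep by (auto simp: p_def)
  have Os: "\<Omega> \<in> sets (leb n)" by (rule openin_measurable[OF O])
  have u0: "u \<in> Lp n p \<Omega>" using u by (simp add: numeral_2_eq_2 p_def)
  have "\<exists>g h. g \<in> Lp n p \<Omega> \<and> h \<in> Lp n p \<Omega> \<and> weak_partial n \<Omega> i u g \<and> weak_partial n \<Omega> i g h" if "i < n" for i
    using u that unfolding numeral_2_eq_2 p_def by (simp, blast)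
  then obtain g h where gh: "\<And>i. i < n \<Longrightarrow> g i \<in> Lp n p \<Omega>" "\<And>i. i < n \<Longrightarrow> h i \<in> Lp n p \<Omega>"
    "\<And>i. i < n \<Longrightarrow> weak_partial n \<Omega> i u (g i)" "\<And>i. i < n \<Longrightarrow> weak_partial n \<Omega> i (g i) (h i)" by metis
  define A where "A = clball n z t"
  have A: "compactin (Rtop n) A" "A \<subseteq> \<Omega>" using st compactin_clball by (auto simp: A_def)
  define U where "U x = indicator A x * u x" for x
  define G where "G i x = indicator A x * g i x" for i x
  define H where "H i x = indicator A x * h i x" for i x
  have UL: "memLq (leb n) p U" "bsupp_integrable n U" unfolding U_def[abs_def] using bsupp_integrable_restrict_Lp[OF p(1) u0 Os A] by auto
  have GL: "memLq (leb n) p (G i)" "bsupp_integrable n (G i)" if "i < n" for i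
    unfolding G_def[abs_def] using bsupp_integrable_restrict_Lp[OF p(1) gh(1)[OF that] Os A] by auto
  have HL: "memLq (leb n) p (H i)" "bsupp_integrable n (H i)" if "i < n" for i
    unfolding H_def[abs_def] using bsupp_integrable_restrict_Lp[OF p(1) gh(2)[OF that] Os A] by auto
  have Ui: "integrable (leb n) U" and Gi: "\<And>i. i < n \<Longrightarrow> integrable (leb n) (G i)" and Hi: "\<And>i. i < n \<Longrightarrow> integrable (leb n) (H i)"
    using UL GL HL by (auto simp: bsupp_integrable_def)
  define v where "v m = moll n (moll_scale m) U" for m
  have vs: "smooth n (v m)" for m unfolding v_def by (rule moll_smooth[OF UL(2)])
  have cv: "moll_converges n p U" by (rule moll_converges_memLq[OF p(1) UL])
  have vL: "memLq (leb n) p (v m)" "normLq (leb n) p (v m) \<le> normLq (leb n) p U" for m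
    unfolding v_def using moll_memLq[OF moll_scale_pos p(1) UL(1) Ui] by auto
  \<comment> \<open>Squared radii: the cutoff is 1 up to \<open>s\<close> and supported up to
    \<open>t1\<close>; up to \<open>t2\<close> derivatives commute with fine mollification;
    \<open>u\<close> is truncated at \<open>t\<close>.\<close>
  define t1 where "t1 = (2 * s + t) / 3"
  define t2 where "t2 = (s + 2 * t) / 3"
  have tt: "s < t1" "t1 < t2" "t2 < t" "0 < t1" "0 < t2" using st by (auto simp: t1_def t2_def)
  define \<delta> where "\<delta> = sqrt t - sqrt t2"
  have \<delta>: "0 < \<delta>" using tt by (simp add: \<delta>_def)
  obtain S where S: "smooth1 S" "\<And>t. 0 \<le> S t \<and> S t \<le> 1" "\<And>t. t \<le> 0 \<Longrightarrow> S t = 0" "\<And>t. t \<ge> 1 \<Longrightarrow> S t = 1"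
    using smooth_step_exists by blast
  define hh where "hh \<tau> = S ((- 1 / (t1 - s)) * \<tau> + t1 / (t1 - s))" for \<tau>
  have hh_arg: "(- 1 / (t1 - s)) * \<tau> + t1 / (t1 - s) = (t1 - \<tau>) / (t1 - s)" for \<tau> by (simp add: diff_divide_distrib)
  have hs: "smooth1 hh" unfolding hh_def[abs_def] by (rule smooth1_affine[OF S(1)])
  have h0: "hh \<tau> = 0" if "\<tau> > t1" for \<tau>
    unfolding hh_def hh_arg by (rule S(3)) (use that tt in \<open>simp add: divide_le_0_iff\<close>)
  have h1: "hh \<tau> = 1" if "\<tau> \<le> s" for \<tau>
    unfolding hh_def hh_arg by (rule S(4)) (use that tt in \<open>simp add: le_divide_eq\<close>)
  define \<zeta> where "\<zeta> = radial_cutoff n hh z 1"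
  define K where "K = clball n z t1"
  have zc: "csmooth n K \<zeta>" using csmooth_radial_cutoff[OF hs h0, where r = 1 and n = n and z = z] by (simp add: \<zeta>_def K_def)
  have zb: "\<bar>\<zeta> x\<bar> \<le> 1" for x using S(2) by (simp add: \<zeta>_def radial_cutoff_def hh_def)
  have z1: "\<zeta> x = 1" if "x \<in> clball n z s" for x using that h1 by (simp add: \<zeta>_def radial_cutoff_def clball_def)
  note zs = csmooth_smooth[OF zc]
  have "\<exists>B. \<forall>x\<in>Rn n. \<bar>partial_deriv i \<zeta> x\<bar> \<le> B" if "i < n" for i using csmooth_bounded[OF csmooth_partial[OF zc that]] by blast
  then obtain B where B: "\<And>i x. i < n \<Longrightarrow> x \<in> Rn n \<Longrightarrow> \<bar>partial_deriv i \<zeta> x\<bar> \<le> B i" by metis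
  obtain B' where B': "\<And>x. x \<in> Rn n \<Longrightarrow> \<bar>laplacian n \<zeta> x\<bar> \<le> B'" using csmooth_bounded[OF csmooth_laplacian[OF zc]] by blast
  define W where "W m x = \<zeta> x * v m x" for m x
  have Wc: "csmooth n K (W m)" for m unfolding W_def[abs_def] by (rule csmooth_mult2[OF zc vs])
  \<comment> \<open>A bound for the \<open>L^p\<close> norm of the Laplacian of the product that
    does not involve the mollification parameter: one summand for each term of the product rule,
    with bounds for the derivatives of the cutoff.\<close>
  define D where "D = (\<Sum>i<n. normLq (leb n) p (H i)) + 2 * (\<Sum>i<n. B i * normLq (leb n) p (G i)) + B' * normLq (leb n) p U"
  have "\<forall>\<^sub>F m in sequentially. sqrt (moll_scale m) < \<delta>" by (rule moll_scale_sqrt_less[OF \<delta>])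
  then have ev: "\<forall>\<^sub>F m in sequentially. normLq (leb n) p (laplacian n (W m)) \<le> D"
  proof eventually_elim
    case (elim m)
    define T where "T = {x \<in> Rn n. sq_dist n z x < t2}"
    have To: "openin (Rtop n) T" unfolding T_def by (rule openin_sq_dist)
    have sub: "clball n x (moll_scale m) \<subseteq> A" if "x \<in> T" for x
      unfolding A_def by (rule clball_subset[of _ _ _ t2]) (use that elim in \<open>auto simp: T_def clball_def \<delta>_def\<close>)
    have d1: "partial_deriv i (v m) x = moll n (moll_scale m) (G i) x" if i: "i < n" and x: "x \<in> T" for i x
      unfolding v_def
      by (rule moll_partial[OF gh(3)[OF i] i _ _ UL(2)]) (use x sub[OF x] A(2) in \<open>auto simp: T_def U_def G_def\<close>)
    have d2: "partial_deriv i (partial_deriv i (v m)) x = moll n (moll_scale m) (H i) x" if i: "i < n" and x: "x \<in> T" for i x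
    proof -
      have "partial_deriv i (partial_deriv i (v m)) x = partial_deriv i (moll n (moll_scale m) (G i)) x"
        by (rule partial_cong_open[OF To _ x i]) (rule d1[OF i])
      also have "\<dots> = moll n (moll_scale m) (H i) x"
        by (rule moll_partial[OF gh(4)[OF i] i _ _ GL(2)[OF i]]) (use x sub[OF x] A(2) in \<open>auto simp: T_def G_def H_def\<close>)
      finally show ?thesis .
    qed
    define F1 where "F1 x = \<zeta> x * (\<Sum>i<n. moll n (moll_scale m) (H i) x)" for x
    define F2 where "F2 x = 2 * (\<Sum>i<n. partial_deriv i \<zeta> x * moll n (moll_scale m) (G i) x)" for x
    define F3 where "F3 x = laplacian n \<zeta> x * v m x" for x
    have eq: "laplacian n (W m) x = (F1 x + F2 x) + F3 x" if x: "x \<in> Rn n" for x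
    proof (cases "x \<in> K")
      case True
      then have xT: "x \<in> T" using tt by (auto simp: K_def T_def clball_def)
      have "laplacian n (W m) x = \<zeta> x * laplacian n (v m) x + 2 * (\<Sum>i<n. partial_deriv i \<zeta> x * partial_deriv i (v m) x) + v m x * laplacian n \<zeta> x"
        unfolding W_def[abs_def] by (rule laplacian_mult[OF zs vs x])
      then show ?thesis using d1[OF _ xT] d2[OF _ xT] by (simp add: F1_def F2_def F3_def laplacian_def)
    next
      case False
      then show ?thesis using csmooth_zero[OF csmooth_laplacian[OF Wc] x False] csmooth_zero[OF zc x False] csmooth_zero[OF csmooth_laplacian[OF zc] x False]
        csmooth_zero[OF csmooth_partial[OF zc] x False] by (simp add: F1_def F2_def F3_def)
    qed
    have mH: "memLq (leb n) p (moll n (moll_scale m) (H i))" "normLq (leb n) p (moll n (moll_scale m) (H i)) \<le> normLq (leb n) p (H i)" if "i < n" for i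
      using moll_memLq[OF moll_scale_pos p(1) HL(1)[OF that] Hi[OF that]] by auto
    have mG: "memLq (leb n) p (moll n (moll_scale m) (G i))" "normLq (leb n) p (moll n (moll_scale m) (G i)) \<le> normLq (leb n) p (G i)" if "i < n" for i
      using moll_memLq[OF moll_scale_pos p(1) GL(1)[OF that] Gi[OF that]] by auto
    have sH: "memLq (leb n) p (\<lambda>x. \<Sum>i<n. moll n (moll_scale m) (H i) x)" by (rule memLq_sum[OF p(1)]) (use mH in auto)
    have 1: "memLq (leb n) p F1" "normLq (leb n) p F1 \<le> (\<Sum>i<n. normLq (leb n) p (H i))"
    proof -
      note * = memLq_bmult[OF p(2) sH csmooth_meas[OF zc], of 1]
      show "memLq (leb n) p F1" unfolding F1_def[abs_def] by (rule *(1)) (rule zb)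
      have "normLq (leb n) p F1 \<le> normLq (leb n) p (\<lambda>x. \<Sum>i<n. moll n (moll_scale m) (H i) x)" using *(2) zb by (simp add: F1_def[abs_def])
      also have "\<dots> \<le> (\<Sum>i<n. normLq (leb n) p (moll n (moll_scale m) (H i)))" by (rule normLq_sum_le[OF p(1)]) (use mH in auto)
      also have "\<dots> \<le> (\<Sum>i<n. normLq (leb n) p (H i))" using mH by (intro sum_mono) auto
      finally show "normLq (leb n) p F1 \<le> (\<Sum>i<n. normLq (leb n) p (H i))" .
    qed
    have g1: "memLq (leb n) p (\<lambda>x. partial_deriv i \<zeta> x * moll n (moll_scale m) (G i) x)"
      "normLq (leb n) p (\<lambda>x. partial_deriv i \<zeta> x * moll n (moll_scale m) (G i) x) \<le> B i * normLq (leb n) p (G i)" if i: "i < n" for i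
    proof -
      note * = memLq_bmult[OF p(2) mG(1)[OF i] csmooth_meas[OF csmooth_partial[OF zc i]], of "B i"]
      show "memLq (leb n) p (\<lambda>x. partial_deriv i \<zeta> x * moll n (moll_scale m) (G i) x)" by (rule *(1)) (simp add: B i)
      have B0: "0 \<le> B i" using B[OF i z] by linarith
      have "normLq (leb n) p (\<lambda>x. partial_deriv i \<zeta> x * moll n (moll_scale m) (G i) x) \<le> B i * normLq (leb n) p (moll n (moll_scale m) (G i))"
        by (rule *(2)) (simp add: B i)
      also have "\<dots> \<le> B i * normLq (leb n) p (G i)" by (rule mult_left_mono[OF mG(2)[OF i] B0])
      finally show "normLq (leb n) p (\<lambda>x. partial_deriv i \<zeta> x * moll n (moll_scale m) (G i) x) \<le> B i * normLq (leb n) p (G i)" .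
    qed
    have 2: "memLq (leb n) p F2" "normLq (leb n) p F2 \<le> 2 * (\<Sum>i<n. B i * normLq (leb n) p (G i))"
    proof -
      have sG: "memLq (leb n) p (\<lambda>x. \<Sum>i<n. partial_deriv i \<zeta> x * moll n (moll_scale m) (G i) x)" by (rule memLq_sum[OF p(1)]) (use g1 in auto)
      then show "memLq (leb n) p F2" unfolding F2_def[abs_def] by (rule memLq_cmult)
      have "normLq (leb n) p (\<lambda>x. \<Sum>i<n. partial_deriv i \<zeta> x * moll n (moll_scale m) (G i) x) \<le> (\<Sum>i<n. normLq (leb n) p (\<lambda>x. partial_deriv i \<zeta> x * moll n (moll_scale m) (G i) x))"
        by (rule normLq_sum_le[OF p(1)]) (use g1 in auto)
      also have "\<dots> \<le> (\<Sum>i<n. B i * normLq (leb n) p (G i))" using g1 by (intro sum_mono) auto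
      finally show "normLq (leb n) p F2 \<le> 2 * (\<Sum>i<n. B i * normLq (leb n) p (G i))"
        unfolding F2_def[abs_def] using p(2) by (subst normLq_cmult) auto
    qed
    have 3: "memLq (leb n) p F3" "normLq (leb n) p F3 \<le> B' * normLq (leb n) p U"
    proof -
      note * = memLq_bmult[OF p(2) vL(1) csmooth_meas[OF csmooth_laplacian[OF zc]], of B']
      show "memLq (leb n) p F3" unfolding F3_def[abs_def] by (rule *(1)) (simp add: B')
      have B0: "0 \<le> B'" using B'[OF z] by linarith
      have "normLq (leb n) p F3 \<le> B' * normLq (leb n) p (v m)" unfolding F3_def[abs_def] by (rule *(2)) (simp add: B')
      also have "\<dots> \<le> B' * normLq (leb n) p U" by (rule mult_left_mono[OF vL(2) B0])
      finally show "normLq (leb n) p F3 \<le> B' * normLq (leb n) p U" .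
    qed
    have "normLq (leb n) p (laplacian n (W m)) = normLq (leb n) p (\<lambda>x. (F1 x + F2 x) + F3 x)" by (rule normLq_cong) (simp add: eq)
    also have "\<dots> \<le> normLq (leb n) p (\<lambda>x. F1 x + F2 x) + normLq (leb n) p F3"
      by (rule Minkowski(2)[OF p(1) Minkowski(1)[OF p(1) 1(1) 2(1)] 3(1)])
    also have "normLq (leb n) p (\<lambda>x. F1 x + F2 x) \<le> normLq (leb n) p F1 + normLq (leb n) p F2" by (rule Minkowski(2)[OF p(1) 1(1) 2(1)])
    finally show ?case using 1(2) 2(2) 3(2) by (simp add: D_def)
  qed
  define R where "R = sqrt t1 + 1"
  have R: "1 \<le> R" using tt by (simp add: R_def)
  \<comment> \<open>The new pole. Its distance \<open>2 R\<close> to the centre places the support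
    at distances between \<open>R\<close> and \<open>3 R\<close>; as \<open>R >= 1\<close>, the
    weight there is at most 1.\<close>
  define c where "c = z(0 := z 0 + 2 * R)"
  have n0: "0 < n" using n by simp
  have dc: "Rn_dist n z c = 2 * R"
  proof -
    have "sq_dist n z c = (\<Sum>j<n. if j = 0 then (2 * R)\<^sup>2 else 0)" unfolding sq_dist_def c_def by (rule sum.cong) auto
    also have "\<dots> = (2 * R)\<^sup>2" using n0 by simp
    finally have "Rn_dist n z c = \<bar>2 * R\<bar>" unfolding Rn_dist_sq_dist by (simp only: real_sqrt_abs)
    then show ?thesis using R by simp
  qed
  have dx: "R \<le> Rn_dist n c x \<and> Rn_dist n c x \<le> 3 * R" if "x \<in> K" for x
  proof -
    have "Rn_dist n z x \<le> sqrt t1" using that by (simp add: K_def clball_def Rn_dist_sq_dist)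
    then show ?thesis using Rn_dist_triangle[of n z c x] Rn_dist_triangle[of n c x z] dc
      Rn_dist_commute[of n x c] Rn_dist_commute[of n z c] Rn_dist_commute[of n x z] by (simp add: R_def)
  qed
  define l where "l = real 0 + (real n - 1) / 2"
  have l: "l \<in> carleman_exponents n" "0 \<le> l" unfolding l_def using exponents_mem[OF n, of 0] n by auto
  have R0: "0 < R" using R by simp
  have Wb: "normLq (leb n) (exp_p' n) (W m) \<le> (3 * R) powr l * (\<theta> * normLq (leb n) p (laplacian n (W m)))" for m
  proof -
    have wL: "memLq (leb n) (exp_p' n) (\<lambda>x. weight n c l x * W m x)" by (rule weight_csmooth_memLq[OF Wc R0 _ l(2) ep(4)]) (use dx in auto)
    have "normLq (leb n) (exp_p' n) (W m) \<le> normLq (leb n) (exp_p' n) (\<lambda>x. (3 * R) powr l * (weight n c l x * W m x))"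
    proof (rule memLq_mono(2)[OF ep(4) memLq_cmult[OF wL] csmooth_meas[OF Wc]], rule AE_I2)
      fix x assume x: "x \<in> space (leb n)"
      show "\<bar>W m x\<bar> \<le> \<bar>(3 * R) powr l * (weight n c l x * W m x)\<bar>"
      proof (cases "x \<in> K")
        case True
        have "(3 * R) powr (- l) \<le> weight n c l x" using dx[OF True] R0 l(2) by (intro weight_ge) auto
        then have "(3 * R) powr l * (3 * R) powr (- l) \<le> (3 * R) powr l * weight n c l x" by (intro mult_left_mono) auto
        then have "1 \<le> (3 * R) powr l * weight n c l x" using R0 by (simp flip: powr_add)
        then have "1 * \<bar>W m x\<bar> \<le> ((3 * R) powr l * weight n c l x) * \<bar>W m x\<bar>" by (rule mult_right_mono) simp
        then show ?thesis by (simp add: abs_mult)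
      next
        case False then show ?thesis using csmooth_zero[OF Wc] x by simp
      qed
    qed
    also have "\<dots> = (3 * R) powr l * normLq (leb n) (exp_p' n) (\<lambda>x. weight n c l x * W m x)" using ep(4) by (subst normLq_cmult) auto
    also have "normLq (leb n) (exp_p' n) (\<lambda>x. weight n c l x * W m x) \<le> \<theta> * normLq (leb n) p (\<lambda>x. weight n c l x * laplacian n (W m) x)"
      unfolding p_def by (rule carleman_smooth[OF C l(1) n Wc R0]) (use dx in auto)
    also have "normLq (leb n) p (\<lambda>x. weight n c l x * laplacian n (W m) x) \<le> normLq (leb n) p (laplacian n (W m))"
    proof (rule memLq_mono(2)[OF p(2) csmooth_memLq[OF csmooth_laplacian[OF Wc] p(2)]])
      show "(\<lambda>x. weight n c l x * laplacian n (W m) x) \<in> borel_measurable (leb n)" using csmooth_meas[OF csmooth_laplacian[OF Wc]] by measurable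
      show "AE x in leb n. \<bar>weight n c l x * laplacian n (W m) x\<bar> \<le> \<bar>laplacian n (W m) x\<bar>"
      proof (rule AE_I2)
        fix x assume x: "x \<in> space (leb n)"
        show "\<bar>weight n c l x * laplacian n (W m) x\<bar> \<le> \<bar>laplacian n (W m) x\<bar>"
        proof (cases "x \<in> K")
          case True
          have "weight n c l x \<le> 1 powr (- l)" using dx[OF True] R l(2) by (intro weight_le) auto
          then show ?thesis by (simp add: abs_mult mult_left_le_one_le)
        next
          case False then show ?thesis using csmooth_zero[OF csmooth_laplacian[OF Wc]] x by simp
        qed
      qed
    qed
    finally show ?thesis using th by (simp add: mult_left_mono)
  qed
  define E where "E = (3 * R) powr l * (\<theta> * D)"
  obtain N where N: "\<And>m. m \<ge> N \<Longrightarrow> normLq (leb n) (exp_p' n) (W m) \<le> E"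
  proof -
    from ev obtain N where N: "\<And>m. m \<ge> N \<Longrightarrow> normLq (leb n) p (laplacian n (W m)) \<le> D" by (auto simp: eventually_sequentially)
    have "normLq (leb n) (exp_p' n) (W m) \<le> E" if "m \<ge> N" for m
      using Wb[of m] mult_left_mono[OF mult_left_mono[OF N[OF that] th], of "(3 * R) powr l"] by (simp add: E_def)
    then show ?thesis by (rule that)
  qed
  have "\<exists>r. strict_mono (r :: nat \<Rightarrow> nat) \<and> (AE x in leb n. (\<lambda>m. v (r m) x) \<longlonglongrightarrow> U x)"
    by (rule memLq_subseq_AE[OF p(1) memLq_diff[OF p(1) vL(1) UL(1)]]) (use cv in \<open>simp add: moll_converges_def v_def\<close>)
  then obtain r :: "nat \<Rightarrow> nat" where r: "strict_mono r" "AE x in leb n. (\<lambda>m. v (r m) x) \<longlonglongrightarrow> U x" by blast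
  \<comment> \<open>The mollifications converge only in \<open>L^p\<close>; Fatou along an almost
    everywhere convergent subsequence transfers the uniform bound in \<open>L^p'\<close>.\<close>
  have zU: "memLq (leb n) (exp_p' n) (\<lambda>x. \<zeta> x * U x)"
  proof (rule Fatou_memLq(1)[where f = "\<lambda>m. W (r (m + N))" and C = E])
    show "memLq (leb n) (exp_p' n) (W (r (m + N)))" for m by (rule csmooth_memLq[OF Wc ep(4)])
    show "normLq (leb n) (exp_p' n) (W (r (m + N))) \<le> E" for m
      using N strict_mono_imp_increasing[OF r(1), of "m + N"] by auto
    show "AE x in leb n. (\<lambda>m. W (r (m + N)) x) \<longlonglongrightarrow> \<zeta> x * U x"
      using r(2) unfolding W_def
      by eventually_elim (intro tendsto_mult tendsto_const LIMSEQ_ignore_initial_segment)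
    show "(\<lambda>x. \<zeta> x * U x) \<in> borel_measurable (leb n)"
      using csmooth_meas[OF zc] UL(1) by (auto simp: memLq_def)
  qed (use ep in auto)
  show ?thesis
  proof (rule memLq_mono(1)[OF ep(4) zU])
    have eqm: "indicator (clball n z s) x * u x = indicator (clball n z s) x * U x" for x
      using st by (auto simp: indicator_def U_def A_def clball_def)
    show "(\<lambda>x. indicator (clball n z s) x * u x) \<in> borel_measurable (leb n)"
      unfolding eqm using UL(1) by (auto simp: memLq_def)
    show "AE x in leb n. \<bar>indicator (clball n z s) x * u x\<bar> \<le> \<bar>\<zeta> x * U x\<bar>"
      unfolding eqm using z1 by (intro AE_I2) (auto simp: indicator_def)
  qed
qed

subsection \<open>The three-ball inequality\<close>

text \<open>\<open>I\<close> is a set of values of the squared distance in units of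
  \<open>r^2\<close>: \<open>{..<1}\<close>, \<open>{..<9}\<close> and \<open>{..15}\<close>
  describe the balls of radius \<open>r\<close>, \<open>3 r\<close> and
  \<open>sqrt 15 r\<close>.\<close>

definition annulus :: "nat \<Rightarrow> (nat \<Rightarrow> real) \<Rightarrow> real \<Rightarrow> real set \<Rightarrow> (nat \<Rightarrow> real) set" where
  "annulus n z r I = {x \<in> Rn n. sq_dist n z x / r\<^sup>2 \<in> I}"

definition restr :: "nat \<Rightarrow> (nat \<Rightarrow> real) \<Rightarrow> real \<Rightarrow> real set \<Rightarrow> ((nat \<Rightarrow> real) \<Rightarrow> real) \<Rightarrow> (nat \<Rightarrow> real) \<Rightarrow> real" where
  "restr n z r I v x = indicator (annulus n z r I) x * v x"

lemma annulus_sets: "I \<in> sets borel \<Longrightarrow> annulus n z r I \<in> sets (leb n)"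
proof -
  assume I: "I \<in> sets borel"
  have "(\<lambda>x. sq_dist n z x / r\<^sup>2) \<in> borel_measurable (leb n)" by measurable
  from measurable_sets[OF this I] have "(\<lambda>x. sq_dist n z x / r\<^sup>2) -` I \<inter> Rn n \<in> sets (leb n)" by simp
  moreover have "(\<lambda>x. sq_dist n z x / r\<^sup>2) -` I \<inter> Rn n = annulus n z r I" by (auto simp: annulus_def)
  ultimately show ?thesis by simp
qed

lemma annulus_clball: "I \<subseteq> {..a} \<Longrightarrow> 0 < r \<Longrightarrow> annulus n z r I \<subseteq> clball n z (a * r\<^sup>2)"
  by (auto simp: annulus_def clball_def field_simps)

lemma restr_meas: "I \<in> sets borel \<Longrightarrow> v \<in> borel_measurable (leb n) \<Longrightarrow> restr n z r I v \<in> borel_measurable (leb n)"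
  unfolding restr_def[abs_def] by (intro borel_measurable_times borel_measurable_indicator annulus_sets)

lemma restr_memLq_smooth:
  assumes v: "smooth n v" and I: "I \<in> sets borel" "I \<subseteq> {..a}" and r: "0 < r" and q: "0 < q"
  shows "memLq (leb n) q (restr n z r I v)"
proof -
  define X where "X = clball n z (a * r\<^sup>2)"
  have "compact (v ` X)" using image_compactin[OF compactin_clball smooth_cont[OF v], of z "a * r\<^sup>2"] by (simp add: X_def)
  then obtain B where B: "\<forall>x\<in>X. \<bar>v x\<bar> \<le> B" using compact_imp_bounded by (force simp: bounded_real)
  note sub = annulus_clball[OF I(2) r, of n z, folded X_def]
  have fin: "emeasure (leb n) (annulus n z r I) < \<infinity>"
    by (rule emeasure_bounded_finite[OF annulus_sets[OF I(1)] sub[unfolded X_def]])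
  show ?thesis
  proof (rule memLq_mono(1)[OF q memLq_cmult[OF memLq_indicator(1)[OF annulus_sets[OF I(1)] fin q], of B]])
    show "restr n z r I v \<in> borel_measurable (leb n)" by (rule restr_meas[OF I(1) smooth_measurable[OF v]])
    show "AE x in leb n. \<bar>restr n z r I v x\<bar> \<le> \<bar>B * indicator (annulus n z r I) x\<bar>"
      using B sub by (intro AE_I2) (force simp: restr_def indicator_def)
  qed
qed

text \<open>Hoelder against the indicator of the ball costs the \<open>n\<close>-th root of its
  volume. The ball of radius \<open>sqrt 15 r\<close> lies in a cube of side \<open>8 r\<close>, so
  this root is at most \<open>8 r\<close> in every dimension.\<close>

lemma vol_Hoelder:
  assumes n: "3 \<le> n" and r: "0 < r" and st: "0 < s" "0 < t" "1 / s = 1 / t + 1 / real n"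
    and f: "memLq (leb n) t f" "\<And>x. x \<in> Rn n \<Longrightarrow> x \<notin> clball n z (15 * r\<^sup>2) \<Longrightarrow> f x = 0"
  shows "memLq (leb n) s f" "normLq (leb n) s f \<le> 8 * r * normLq (leb n) t f"
proof -
  define X where "X = clball n z (15 * r\<^sup>2)"
  have X: "X \<in> sets (leb n)" "emeasure (leb n) X < \<infinity>" unfolding X_def by (rule compactin_finite_measure[OF compactin_clball])+
  have n0: "0 < real n" using n by simp
  note ind = memLq_indicator[OF X n0]
  have "emeasure (leb n) X \<le> emeasure (leb n) (clball n z ((4 * r)\<^sup>2))"
  proof (rule emeasure_mono[OF _ clball_sets])
    have "15 * r\<^sup>2 \<le> (4 * r)\<^sup>2" by (simp add: power_mult_distrib)
    then show "X \<subseteq> clball n z ((4 * r)\<^sup>2)" unfolding X_def clball_def by (auto intro: order_trans)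
  qed
  also have "\<dots> \<le> ennreal ((2 * sqrt ((4 * r)\<^sup>2)) ^ n)" by (rule emeasure_clball_le) simp
  also have "2 * sqrt ((4 * r)\<^sup>2) = 8 * r" using r by (simp only: real_sqrt_abs)
  finally have "emeasure (leb n) X \<le> ennreal ((8 * r) ^ n)" .
  then have "measure (leb n) X \<le> (8 * r) ^ n" using r by (simp add: measure_def enn2real_leI)
  then have "measure (leb n) X powr (1 / real n) \<le> ((8 * r) ^ n) powr (1 / real n)" by (intro powr_mono2) auto
  also have "(8 * r) ^ n = (8 * r) powr real n" by (rule powr_realpow[symmetric]) (use r in simp)
  also have "((8 * r) powr real n) powr (1 / real n) = 8 * r" unfolding powr_powr using r n0 by simp
  finally have ni: "normLq (leb n) (real n) (indicator X) \<le> 8 * r" using ind(2) by simp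
  have eq: "f x = f x * indicator X x" if "x \<in> Rn n" for x using f(2)[OF that] by (auto simp: X_def indicator_def)
  note H = Hoelder[OF st(2) n0 st(1) st(3) f(1) ind(1)]
  show "memLq (leb n) s f" using H(1) memLq_cong[of "leb n" f "\<lambda>x. f x * indicator X x" s] eq by simp
  have "normLq (leb n) s f = normLq (leb n) s (\<lambda>x. f x * indicator X x)" 
  proof (rule normLq_cong)
    fix x assume "x \<in> space (leb n)"
    then have "f x = f x * indicator X x" by (intro eq) simp
    then show "\<bar>f x\<bar> = \<bar>f x * indicator X x\<bar>" by (rule arg_cong)
  qed
  also have "\<dots> \<le> normLq (leb n) t f * (8 * r)" using H(2) mult_left_mono[OF ni normLq_nonneg[of "leb n" t f]] by linarith
  finally show "normLq (leb n) s f \<le> 8 * r * normLq (leb n) t f" by (simp add: mult.commute)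
qed

lemma partial_CS: "\<bar>\<Sum>i<n. partial_deriv i f x * partial_deriv i g x\<bar> \<le> grad_norm n f x * grad_norm n g x"
proof -
  have "(\<Sum>i<n. partial_deriv i f x * partial_deriv i g x)\<^sup>2 \<le> (\<Sum>i<n. (partial_deriv i f x)\<^sup>2) * (\<Sum>i<n. (partial_deriv i g x)\<^sup>2)"
    by (rule Cauchy_Schwarz_ineq_sum)
  then have "sqrt ((\<Sum>i<n. partial_deriv i f x * partial_deriv i g x)\<^sup>2) \<le> grad_norm n f x * grad_norm n g x"
    unfolding grad_norm_def real_sqrt_mult[symmetric] by (simp only: real_sqrt_le_iff)
  then show ?thesis by simp
qed

text \<open>The difference between the Laplacian of \<open>\<zeta> v\<close> and
  \<open>\<zeta>\<close> times the Laplacian of \<open>v\<close>.\<close>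

definition commutator :: "nat \<Rightarrow> ((nat \<Rightarrow> real) \<Rightarrow> real) \<Rightarrow> ((nat \<Rightarrow> real) \<Rightarrow> real) \<Rightarrow> (nat \<Rightarrow> real) \<Rightarrow> real" where
  "commutator n \<zeta> v x = 2 * (\<Sum>i<n. partial_deriv i \<zeta> x * partial_deriv i v x) + v x * laplacian n \<zeta> x"

lemma smooth_commutator: "smooth n \<zeta> \<Longrightarrow> smooth n v \<Longrightarrow> smooth n (commutator n \<zeta> v)"
  unfolding commutator_def[abs_def]
  by (intro smooth_add smooth_mult smooth_const smooth_sum smooth_partial smooth_laplacian) auto

text \<open>The layer \<open>J\<close> lies in an open set on which \<open>h\<close> is 1, so there
  the gradient of \<open>v\<close> is that of \<open>h v\<close>, and the energy estimate with
  cutoff \<open>h\<close> replaces it by the \<open>L^2\<close> norm of \<open>v\<close> on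
  \<open>I\<close>. For the inner layer \<open>I\<close> is contained in the unit ball, which is
  what makes the first term of the three-ball inequality small when the inner norm is.\<close>

lemma annulus_bound:
  assumes n: "3 \<le> n" and O: "openin (Rtop n) \<Omega>" "\<Omega> \<noteq> {}"
    and V: "memLq (leb n) (real n / 2) V" and kap: "2 * (sobolev_const n \<Omega>)\<^sup>2 * normLq (leb n) (real n / 2) V < 1"
    and r: "0 < r" and X: "clball n z (15 * r\<^sup>2) \<subseteq> \<Omega>" and v: "smooth n v"
    and e: "memLq (leb n) (exp_p n) e" "\<And>x. x \<in> clball n z (15 * r\<^sup>2) \<Longrightarrow> laplacian n v x = V x * v x + e x"
    and K: "1 \<le> K" and h: "cutoff K h" "\<And>t. t > 15 \<Longrightarrow> h t = 0" "open U" "\<And>t. t \<in> U \<Longrightarrow> h t = 1"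
    and J: "J \<in> sets borel" "J \<subseteq> U" "J \<subseteq> I" and I: "I \<in> sets borel" "I \<subseteq> {..15}" "\<And>t. t \<notin> I \<Longrightarrow> deriv h t = 0"
    and h3: "cutoff K h3" "\<And>t. t > 15 \<Longrightarrow> h3 t = 0"
  shows "normLq (leb n) (exp_p n) (restr n z r J (commutator n (radial_cutoff n h3 z r) v))
    \<le> 864 * real n * K\<^sup>2 / r * normLq (leb n) 2 (restr n z r I v) + 256 * K * sobolev_const n \<Omega> * normLq (leb n) (exp_p n) e"
proof -
  note ep = exp_p_props[OF n]
  define X' where "X' = clball n z (15 * r\<^sup>2)"
  define \<zeta> where "\<zeta> = radial_cutoff n h z r"
  define \<zeta>3 where "\<zeta>3 = radial_cutoff n h3 z r"
  define \<sigma> where "\<sigma> = sobolev_const n \<Omega>"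
  define \<epsilon> where "\<epsilon> = normLq (leb n) (exp_p n) e"
  define a where "a = normLq (leb n) 2 (restr n z r I v)"
  define T where "T = commutator n \<zeta>3 v"
  have hs: "smooth1 h" "smooth1 h3" using h(1) h3(1) by (auto simp: cutoff_def)
  have \<zeta>: "csmooth n X' \<zeta>" unfolding X'_def \<zeta>_def by (rule csmooth_radial_cutoff[OF hs(1) h(2) r])
  have \<zeta>3: "smooth n \<zeta>3" unfolding \<zeta>3_def by (rule smooth_radial_cutoff[OF hs(2)])
  have \<zeta>b: "\<bar>\<zeta> x\<bar> \<le> 1" for x using h(1) by (simp add: \<zeta>_def radial_cutoff_def cutoff_def)
  define w where "w x = \<zeta> x * v x" for x
  have wc: "csmooth n X' w" unfolding w_def[abs_def] by (rule csmooth_mult2[OF \<zeta> v])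
  have cac: "normLq (leb n) 2 (grad_norm n w) \<le> 2 * normLq (leb n) 2 (\<lambda>x. v x * grad_norm n \<zeta> x) + 2 * \<sigma> * \<epsilon>"
    unfolding w_def[abs_def] \<sigma>_def \<epsilon>_def
    by (rule caccioppoli[OF n O V kap \<zeta> _ \<zeta>b v e]) (use X in \<open>auto simp: X'_def\<close>)
  have dz: "deriv h t = 0" if "t > 15" for t using I(2,3) that by force
  have d3: "deriv h3 t = 0" if "t > 15" for t by (rule smooth1_deriv_const[OF hs(2), of "{15<..}" 0]) (use h3 that in auto)
  have aL: "memLq (leb n) 2 (restr n z r I v)" by (rule restr_memLq_smooth[OF v I(1,2) r]) simp
  have "normLq (leb n) 2 (\<lambda>x. v x * grad_norm n \<zeta> x) \<le> normLq (leb n) 2 (\<lambda>x. 8 * K / r * restr n z r I v x)"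
  proof (rule memLq_mono(2)[OF _ memLq_cmult[OF aL]])
    show "(\<lambda>x. v x * grad_norm n \<zeta> x) \<in> borel_measurable (leb n)"
      using smooth_measurable[OF v] grad_norm_meas[OF csmooth_smooth[OF \<zeta>]] by measurable
    show "AE x in leb n. \<bar>v x * grad_norm n \<zeta> x\<bar> \<le> \<bar>8 * K / r * restr n z r I v x\<bar>"
    proof (rule AE_I2)
      fix x assume "x \<in> space (leb n)"
      then have x: "x \<in> Rn n" by simp
      show "\<bar>v x * grad_norm n \<zeta> x\<bar> \<le> \<bar>8 * K / r * restr n z r I v x\<bar>"
      proof (cases "sq_dist n z x / r\<^sup>2 \<in> I")
        case True
        have "grad_norm n \<zeta> x \<le> 8 * K / r" unfolding \<zeta>_def by (rule grad_norm_radial_cutoff_le[OF h(1) dz x r])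
        then have "\<bar>grad_norm n \<zeta> x\<bar> * \<bar>v x\<bar> \<le> 8 * K / r * \<bar>v x\<bar>" by (intro mult_right_mono) auto
        then show ?thesis using True x K r by (simp add: restr_def annulus_def abs_mult mult.commute)
      next
        case False
        then have "(grad_norm n \<zeta> x)\<^sup>2 = 0" unfolding \<zeta>_def grad_norm_radial_cutoff[OF hs(1) x r] by (simp add: radial_cutoff_def I(3))
        then show ?thesis by simp
      qed
    qed
  qed simp
  also have "\<dots> = 8 * K / r * a" using K r by (subst normLq_cmult) (auto simp: a_def)
  finally have N: "normLq (leb n) 2 (grad_norm n w) \<le> 2 * (8 * K / r * a) + 2 * \<sigma> * \<epsilon>" using cac by linarith
  define c1 where "c1 = 16 * K / r"
  define c2 where "c2 = K * (60 + 2 * real n) / r\<^sup>2"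
  have c: "0 \<le> c1" "0 \<le> c2" using K r by (auto simp: c1_def c2_def)
  \<comment> \<open>An \<open>L^2\<close> function dominating the commutator on \<open>J\<close>:
    \<open>c1\<close> is twice the gradient bound of the cutoff and \<open>c2\<close> is the bound
    for its Laplacian. \<open>vol_Hoelder\<close> then passes from \<open>L^2\<close> to
    \<open>L^p\<close>.\<close>
  define F where "F x = c1 * grad_norm n w x + c2 * \<bar>restr n z r I v x\<bar>" for x
  have FL: "memLq (leb n) 2 (\<lambda>x. c1 * grad_norm n w x)" "memLq (leb n) 2 (\<lambda>x. c2 * \<bar>restr n z r I v x\<bar>)"
    by (intro memLq_cmult csmooth_memLq_grad_norm[OF wc] memLq_abs aL)+
  have F2: "memLq (leb n) 2 F" "normLq (leb n) 2 F \<le> c1 * normLq (leb n) 2 (grad_norm n w) + c2 * a"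
    using Minkowski[OF _ FL] c unfolding F_def[abs_def] by (auto simp: normLq_cmult normLq_abs a_def)
  have Fz: "F x = 0" if x: "x \<in> Rn n" "x \<notin> clball n z (15 * r\<^sup>2)" for x
  proof -
    have "x \<notin> annulus n z r I" using annulus_clball[OF I(2) r, of n z] x by auto
    moreover have "grad_norm n w x = 0" using csmooth_zero[OF csmooth_partial[OF wc] x(1)] x(2) by (simp add: grad_norm_def X'_def)
    ultimately show ?thesis by (simp add: F_def restr_def)
  qed
  have ps: "1 / exp_p n = 1 / 2 + 1 / real n" using ep by simp
  note vol = vol_Hoelder[OF n r ep(3) _ ps F2(1) Fz]
  have pt: "\<bar>restr n z r J T x\<bar> \<le> \<bar>F x\<bar>" if x: "x \<in> Rn n" for x
  proof (cases "sq_dist n z x / r\<^sup>2 \<in> J")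
    case True
    then have qU: "sq_dist n z x / r\<^sup>2 \<in> U" "sq_dist n z x / r\<^sup>2 \<in> I" using J by auto
    have "deriv h (sq_dist n z x / r\<^sup>2) = 0" by (rule smooth1_deriv_const[OF hs(1) h(3) h(4) qU(1)])
    then have "partial_deriv i w x = partial_deriv i v x" if "i < n" for i
      unfolding w_def[abs_def] partial_mult[OF csmooth_smooth[OF \<zeta>] v x that]
      using partial_radial_cutoff[OF hs(1) that x, of z r] h(4)[OF qU(1)] by (simp add: \<zeta>_def radial_cutoff_def)
    then have gw: "grad_norm n w x = grad_norm n v x" by (simp add: grad_norm_def)
    have g3: "grad_norm n \<zeta>3 x \<le> 8 * K / r" unfolding \<zeta>3_def by (rule grad_norm_radial_cutoff_le[OF h3(1) d3 x r])
    have l3: "\<bar>laplacian n \<zeta>3 x\<bar> \<le> c2" unfolding \<zeta>3_def c2_def by (rule laplacian_radial_cutoff_le[OF h3 x r])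
    have "\<bar>T x\<bar> \<le> 2 * \<bar>\<Sum>i<n. partial_deriv i \<zeta>3 x * partial_deriv i v x\<bar> + \<bar>v x\<bar> * \<bar>laplacian n \<zeta>3 x\<bar>"
      unfolding T_def commutator_def using abs_triangle_ineq[of "2 * (\<Sum>i<n. partial_deriv i \<zeta>3 x * partial_deriv i v x)" "v x * laplacian n \<zeta>3 x"]
      by (simp add: abs_mult)
    also have "\<dots> \<le> 2 * (grad_norm n \<zeta>3 x * grad_norm n v x) + \<bar>v x\<bar> * c2"
      by (intro add_mono mult_left_mono partial_CS l3) auto
    also have "\<dots> \<le> 2 * (8 * K / r * grad_norm n v x) + \<bar>v x\<bar> * c2"
      by (intro add_mono mult_left_mono mult_right_mono g3) auto
    also have "\<dots> = F x" using x qU(2) gw by (simp add: F_def c1_def restr_def annulus_def mult.commute)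
    finally show ?thesis using True x by (simp add: restr_def annulus_def)
  next
    case False then show ?thesis by (simp add: restr_def annulus_def)
  qed
  have "normLq (leb n) (exp_p n) (restr n z r J T) \<le> normLq (leb n) (exp_p n) F"
  proof (rule memLq_mono(2)[OF ep(3) vol(1)])
    show "restr n z r J T \<in> borel_measurable (leb n)"
      unfolding T_def by (rule restr_meas[OF J(1) smooth_measurable[OF smooth_commutator[OF \<zeta>3 v]]])
  qed (use pt in auto)
  also have "\<dots> \<le> 8 * r * normLq (leb n) 2 F" by (rule vol(2)) simp
  also have "\<dots> \<le> 8 * r * (c1 * (2 * (8 * K / r * a) + 2 * \<sigma> * \<epsilon>) + c2 * a)"
    using F2(2) N c r by (intro mult_left_mono order_trans[OF F2(2)] add_mono) auto
  also have "\<dots> = (2048 * K\<^sup>2 + 8 * K * (60 + 2 * real n)) / r * a + 256 * K * \<sigma> * \<epsilon>"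
    using r by (simp add: c1_def c2_def power2_eq_square field_simps)
  also have "\<dots> \<le> 864 * real n * K\<^sup>2 / r * a + 256 * K * \<sigma> * \<epsilon>"
  proof -
    \<comment> \<open>After every \<open>K\<close> is raised to its square, the coefficient is
      \<open>2528 + 16 n\<close>, which is at most \<open>864 n\<close> from \<open>n = 3\<close>
      on.\<close>
    have K2: "K \<le> K\<^sup>2" using K by (simp add: power2_eq_square)
    have "8 * K * (60 + 2 * real n) \<le> 8 * K\<^sup>2 * (60 + 2 * real n)" using K2 by (intro mult_right_mono) auto
    then have "2048 * K\<^sup>2 + 8 * K * (60 + 2 * real n) \<le> K\<^sup>2 * (2528 + 16 * real n)" by (simp add: algebra_simps)
    also have "\<dots> \<le> K\<^sup>2 * (864 * real n)" using n by (intro mult_left_mono) auto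
    finally have "(2048 * K\<^sup>2 + 8 * K * (60 + 2 * real n)) / r \<le> 864 * real n * K\<^sup>2 / r"
      using r by (intro divide_right_mono) (auto simp: mult_ac)
    then show ?thesis by (intro add_right_mono mult_right_mono) (auto simp: a_def)
  qed
  finally show ?thesis by (simp add: T_def \<zeta>3_def a_def \<sigma>_def \<epsilon>_def)
qed

text \<open>The constant \<open>C'\<close> may depend on \<open>l\<close>, \<open>r\<close> and the
  potential, since it only multiplies the mollification error; it is fixed before \<open>v\<close>
  and \<open>e\<close>, so that it stays the same while the error tends to 0.\<close>

lemma smooth_three_ball:
  assumes n: "3 \<le> n" and O: "openin (Rtop n) \<Omega>" "\<Omega> \<noteq> {}"
    and C: "carleman_const n \<theta>" and th: "1 \<le> \<theta>" and l: "l \<in> carleman_exponents n"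
    and V: "memLq (leb n) (real n / 2) V" and kap: "2 * (sobolev_const n \<Omega>)\<^sup>2 * normLq (leb n) (real n / 2) V < 1"
    and thk: "\<theta> * normLq (leb n) (real n / 2) V < 1"
    and r: "0 < r" and X: "clball n z (15 * r\<^sup>2) \<subseteq> \<Omega>" and cut: "cutoffs K h1 h2 h3"
  shows "\<exists>C'. \<forall>v e. smooth n v \<longrightarrow> memLq (leb n) (exp_p n) e \<longrightarrow>
      (\<forall>x\<in>clball n z (15 * r\<^sup>2). laplacian n v x = V x * v x + e x) \<longrightarrow>
      normLq (leb n) 2 (restr n z r {1/2..<9} v) \<le>
        6912 * real n * K\<^sup>2 * (\<theta> / (1 - \<theta> * normLq (leb n) (real n / 2) V)) *
          (6 powr l * normLq (leb n) 2 (restr n z r {..<1} v) + (3 / sqrt 10) powr l * normLq (leb n) 2 (restr n z r {..15} v))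
        + C' * normLq (leb n) (exp_p n) e"
proof -
  note ep = exp_p_props[OF n]
  define \<sigma> where "\<sigma> = sobolev_const n \<Omega>"
  define \<kappa> where "\<kappa> = normLq (leb n) (real n / 2) V"
  define \<Theta> where "\<Theta> = \<theta> / (1 - \<theta> * \<kappa>)"
  have tk: "0 < 1 - \<theta> * \<kappa>" using thk by (simp add: \<kappa>_def)
  have l0: "0 \<le> l" using l by (simp add: carleman_exponents_def)
  \<comment> \<open>\<open>\<alpha>\<close> and \<open>\<beta>\<close> bound the Carleman weight on
    the two layers, whose points have distance at least \<open>r / 2\<close> and at least
    \<open>sqrt 10 r\<close> from the pole.\<close>
  define \<alpha> where "\<alpha> = (r / 2) powr (- l)"
  define \<beta> where "\<beta> = (sqrt 10 * r) powr (- l)"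
  have ab: "0 \<le> \<alpha>" "0 \<le> \<beta>" by (auto simp: \<alpha>_def \<beta>_def)
  define D where "D = 864 * real n * K\<^sup>2 / r"
  define S where "S = 256 * K * \<sigma>"
  define X' where "X' = clball n z (15 * r\<^sup>2)"
  from cut have K: "1 \<le> K" and h: "cutoff K h1" "cutoff K h2" "cutoff K h3"
    and hv: "\<And>t. t \<le> 3/4 \<Longrightarrow> h1 t = 1" "\<And>t. t \<ge> 7/8 \<Longrightarrow> h1 t = 0" "\<And>t. t \<le> 13 \<Longrightarrow> h2 t = 1" "\<And>t. t \<ge> 15 \<Longrightarrow> h2 t = 0"
     "\<And>t. t \<le> 1/4 \<Longrightarrow> h3 t = 0" "\<And>t. t \<ge> 12 \<Longrightarrow> h3 t = 0" "\<And>t. t \<in> {1/2..10} \<Longrightarrow> h3 t = 1"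
    by (auto simp: cutoffs_def)
  have hs: "smooth1 h1" "smooth1 h2" "smooth1 h3" using h by (auto simp: cutoff_def)
  define \<zeta> where "\<zeta> = radial_cutoff n h3 z r"
  have \<zeta>s: "smooth n \<zeta>" unfolding \<zeta>_def by (rule smooth_radial_cutoff[OF hs(3)])
  define A where "A = annulus n z r {1/4..12}"
  have Ac: "compactin (Rtop n) A"
  proof -
    have "closedin (Rtop n) {x \<in> topspace (Rtop n). sq_dist n z x / r\<^sup>2 \<in> {1/4..12}}"
      by (rule closedin_continuous_map_preimage[OF smooth_cont[OF smooth_scaled_sq_dist]]) auto
    then have "closedin (Rtop n) A" by (simp add: A_def annulus_def)
    then have "compactin (Rtop n) (A \<inter> clball n z (12 * r\<^sup>2))" by (rule closed_Int_compactin[OF _ compactin_clball])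
    moreover have "A \<inter> clball n z (12 * r\<^sup>2) = A" using annulus_clball[of "{1/4..12}" 12 r n z] r by (auto simp: A_def)
    ultimately show ?thesis by simp
  qed
  have AX: "A \<subseteq> X'"
    using annulus_clball[of "{1/4..12}" 15 r n z] r by (auto simp: A_def X'_def)
  have \<zeta>c: "csmooth n A \<zeta>" unfolding csmooth_def
  proof (intro conjI \<zeta>s Ac ballI)
    fix x assume "x \<in> Rn n - A"
    then have "\<not> (1/4 \<le> sq_dist n z x / r\<^sup>2 \<and> sq_dist n z x / r\<^sup>2 \<le> 12)" by (auto simp: A_def annulus_def)
    then show "\<zeta> x = 0" using hv(5,6)[of "sq_dist n z x / r\<^sup>2"] by (auto simp: \<zeta>_def radial_cutoff_def)
  qed
  have dist: "Rn_dist n z x = r * sqrt (sq_dist n z x / r\<^sup>2)" for x using r by (simp add: Rn_dist_sq_dist real_sqrt_divide)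
  have dge: "r * sqrt s \<le> Rn_dist n z x" if "s \<le> sq_dist n z x / r\<^sup>2" for s x
    unfolding dist using that r by (intro mult_left_mono real_sqrt_le_mono) auto
  have dle: "Rn_dist n z x \<le> r * sqrt s" if "sq_dist n z x / r\<^sup>2 \<le> s" for s x
    unfolding dist using that r by (intro mult_left_mono real_sqrt_le_mono) auto
  have sq14: "sqrt (1/4) = 1/2" by (rule real_sqrt_unique) (auto simp: power2_eq_square)
  have sq9: "sqrt 9 = (3::real)" by (rule real_sqrt_unique) auto
  have dA: "r / 2 \<le> Rn_dist n z x" if "x \<in> A" for x
    using dge[of "1/4" x] that sq14 by (simp add: A_def annulus_def)
  have r2: "0 < r / 2" using r by simp
  define J1 where "J1 = {1/4..1/2::real}"
  define J2 where "J2 = {10..12::real}"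
  have dh1: "deriv h1 t = 0" if "t \<notin> {..<1}" for t
    by (rule smooth1_deriv_const[OF hs(1), of "{7/8<..}" 0]) (use hv that in auto)
  have dh2: "deriv h2 t = 0" if "t \<notin> {..15}" for t
    by (rule smooth1_deriv_const[OF hs(2), of "{15<..}" 0]) (use hv that in auto)
  have dh3: "deriv h3 t = 0" if "t \<notin> J1 \<union> J2" for t
  proof -
    consider "t < 1/4" | "1/2 < t \<and> t < 10" | "12 < t" using \<open>t \<notin> J1 \<union> J2\<close> by (fastforce simp: J1_def J2_def)
    then show ?thesis
    proof cases
      case 1 then show ?thesis by (intro smooth1_deriv_const[OF hs(3), of "{..<1/4}" 0]) (use hv in auto)
    next
      case 2 then show ?thesis by (intro smooth1_deriv_const[OF hs(3), of "{1/2<..<10}" 1]) (use hv in auto)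
    next
      case 3 then show ?thesis by (intro smooth1_deriv_const[OF hs(3), of "{12<..}" 0]) (use hv in auto)
    qed
  qed
  \<comment> \<open>The layers are closed, so the complement is open and the second derivative of
    \<open>h3\<close> vanishes there together with the first.\<close>
  have Jc: "closed (J1 \<union> J2)" by (auto simp: J1_def J2_def)
  have ddh3: "deriv (deriv h3) t = 0" if "t \<notin> J1 \<union> J2" for t
    by (rule smooth1_deriv_const[OF smooth1_deriv(2)[OF hs(3)], of "- (J1 \<union> J2)" 0, OF open_Compl[OF Jc]]) (use dh3 that in auto)
  have comm0: "commutator n \<zeta> v x = 0" if x: "x \<in> Rn n" "sq_dist n z x / r\<^sup>2 \<notin> J1 \<union> J2" for v x
  proof -
    have "partial_deriv i \<zeta> x = 0" if "i < n" for i
      unfolding \<zeta>_def partial_radial_cutoff[OF hs(3) that x(1)] using dh3[OF x(2)] by (simp add: radial_cutoff_def)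
    moreover have "laplacian n \<zeta> x = 0" unfolding \<zeta>_def laplacian_radial_cutoff[OF hs(3) x(1) r] using dh3[OF x(2)] ddh3[OF x(2)] by (simp add: radial_cutoff_def)
    ultimately show ?thesis by (simp add: commutator_def)
  qed
  have jj: "annulus n z r J1 \<inter> annulus n z r J2 = {}" proof -
    have "J1 \<inter> J2 = {}" by (auto simp: J1_def J2_def)
    then show ?thesis by (auto simp: annulus_def)
  qed
  \<comment> \<open>Collects the coefficients of the error: directly from the equation on the
    support of the cutoff, and from the energy estimates on both layers.\<close>
  define C' where "C' = 8 * r * (3 * r) powr l * \<Theta> * (\<alpha> * (1 + S) + \<beta> * S)"
  show ?thesis
  proof (intro exI[of _ C'] allI impI)
    fix v e assume v: "smooth n v" and e: "memLq (leb n) (exp_p n) e" and ee: "\<forall>x\<in>clball n z (15 * r\<^sup>2). laplacian n v x = V x * v x + e x"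
    define \<epsilon> where "\<epsilon> = normLq (leb n) (exp_p n) e"
    define a where "a = normLq (leb n) 2 (restr n z r {..<1} v)"
    define b where "b = normLq (leb n) 2 (restr n z r {..15} v)"
    define T where "T = commutator n \<zeta> v"
    have Ts: "smooth n T" unfolding T_def by (rule smooth_commutator[OF \<zeta>s v])
    have t1: "normLq (leb n) (exp_p n) (restr n z r J1 T) \<le> D * a + S * \<epsilon>"
      unfolding T_def \<zeta>_def D_def S_def a_def \<epsilon>_def \<sigma>_def
      by (rule annulus_bound[OF n O V kap r X v e _ K h(1), where U = "{..<3/4}"])
         (use ee hv dh1 h(3) in \<open>auto simp: J1_def\<close>)
    have t2: "normLq (leb n) (exp_p n) (restr n z r J2 T) \<le> D * b + S * \<epsilon>"
      unfolding T_def \<zeta>_def D_def S_def b_def \<epsilon>_def \<sigma>_def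
      by (rule annulus_bound[OF n O V kap r X v e _ K h(2), where U = "{..<13}"])
         (use ee hv dh2 h(3) in \<open>auto simp: J2_def\<close>)
    define W where "W x = \<zeta> x * v x" for x
    have Wc: "csmooth n A W" unfolding W_def[abs_def] by (rule csmooth_mult2[OF \<zeta>c v])
    define P where "P = normLq (leb n) (exp_p' n) (\<lambda>x. weight n z l x * W x)"
    have wWL: "memLq (leb n) (exp_p' n) (\<lambda>x. weight n z l x * W x)" by (rule weight_csmooth_memLq[OF Wc r2 dA l0 ep(4)])
    have P1: "P \<le> \<theta> * normLq (leb n) (exp_p n) (\<lambda>x. weight n z l x * laplacian n W x)"
      unfolding P_def by (rule carleman_smooth[OF C l n Wc r2 dA])
    define G1 where "G1 x = V x * (weight n z l x * W x)" for x
    define G2 where "G2 x = weight n z l x * (\<zeta> x * e x)" for x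
    define G3 where "G3 x = weight n z l x * restr n z r J1 T x" for x
    define G4 where "G4 x = weight n z l x * restr n z r J2 T x" for x
    have wm: "weight n z l \<in> borel_measurable (leb n)" by measurable
    have G1: "memLq (leb n) (exp_p n) G1" "normLq (leb n) (exp_p n) G1 \<le> \<kappa> * P"
      using Hoelder[OF _ ep(4) ep(3) ep(7) V wWL] n by (auto simp: \<kappa>_def P_def G1_def[abs_def])
    have G2: "memLq (leb n) (exp_p n) G2" "normLq (leb n) (exp_p n) G2 \<le> \<alpha> * \<epsilon>"
    proof -
      have m: "G2 \<in> borel_measurable (leb n)" unfolding G2_def[abs_def] using wm e csmooth_meas[OF \<zeta>c] by (auto simp: memLq_def)
      have ae: "AE x in leb n. \<bar>G2 x\<bar> \<le> \<bar>\<alpha> * e x\<bar>"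
      proof (rule AE_I2)
        fix x assume "x \<in> space (leb n)"
        show "\<bar>G2 x\<bar> \<le> \<bar>\<alpha> * e x\<bar>"
        proof (cases "x \<in> A")
          case True
          have "weight n z l x \<le> \<alpha>" unfolding \<alpha>_def by (rule weight_le[OF l0 r2 dA[OF True]])
          moreover have "\<bar>\<zeta> x * e x\<bar> \<le> \<bar>e x\<bar>" using h(3) by (simp add: \<zeta>_def radial_cutoff_def cutoff_def abs_mult mult_left_le_one_le)
          ultimately show ?thesis unfolding G2_def abs_mult[of "weight n z l x"] abs_mult[of \<alpha>] using ab by (intro mult_mono) auto
        next
          case False then show ?thesis using csmooth_zero[OF \<zeta>c] \<open>x \<in> space (leb n)\<close> by (simp add: G2_def)
        qed
      qed
      note * = memLq_mono[OF ep(3) memLq_cmult[OF e] m ae]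
      show "memLq (leb n) (exp_p n) G2" by (rule *(1))
      show "normLq (leb n) (exp_p n) G2 \<le> \<alpha> * \<epsilon>" using *(2) ab ep(3) by (simp add: normLq_cmult \<epsilon>_def)
    qed
    have wJ: "memLq (leb n) (exp_p n) (\<lambda>x. weight n z l x * restr n z r J T x)"
         "normLq (leb n) (exp_p n) (\<lambda>x. weight n z l x * restr n z r J T x) \<le> (r * sqrt s) powr (- l) * normLq (leb n) (exp_p n) (restr n z r J T)"
      if J: "J \<in> sets borel" "J \<subseteq> {s..15}" and s: "0 < s" for J s
    proof -
      have JL: "memLq (leb n) (exp_p n) (restr n z r J T)" by (rule restr_memLq_smooth[OF Ts J(1) _ r ep(3), of 15]) (use J in auto)
      have m: "(\<lambda>x. weight n z l x * restr n z r J T x) \<in> borel_measurable (leb n)" using JL wm by (auto simp: memLq_def)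
      have ae: "AE x in leb n. \<bar>weight n z l x * restr n z r J T x\<bar> \<le> \<bar>(r * sqrt s) powr (- l) * restr n z r J T x\<bar>"
      proof (rule AE_I2)
        fix x
        show "\<bar>weight n z l x * restr n z r J T x\<bar> \<le> \<bar>(r * sqrt s) powr (- l) * restr n z r J T x\<bar>"
        proof (cases "x \<in> annulus n z r J")
          case True
          then have "weight n z l x \<le> (r * sqrt s) powr (- l)"
            using J s r by (intro weight_le[OF l0] dge) (auto simp: annulus_def)
          then show ?thesis by (simp add: abs_mult mult_right_mono)
        qed (simp add: restr_def)
      qed
      note * = memLq_mono[OF ep(3) memLq_cmult[OF JL] m ae]
      show "memLq (leb n) (exp_p n) (\<lambda>x. weight n z l x * restr n z r J T x)" by (rule *(1))
      show "normLq (leb n) (exp_p n) (\<lambda>x. weight n z l x * restr n z r J T x) \<le> (r * sqrt s) powr (- l) * normLq (leb n) (exp_p n) (restr n z r J T)"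
        using *(2) ep(3) by (simp add: normLq_cmult)
    qed
    have r14: "r * sqrt (1/4) = r / 2" using sq14 by simp
    have G3: "memLq (leb n) (exp_p n) G3" "normLq (leb n) (exp_p n) G3 \<le> \<alpha> * normLq (leb n) (exp_p n) (restr n z r J1 T)"
      using wJ[of J1 "1/4", unfolded r14] unfolding \<alpha>_def G3_def[abs_def] by (auto simp: J1_def)
    have r10: "r * sqrt 10 = sqrt 10 * r" by (simp add: mult.commute)
    have G4: "memLq (leb n) (exp_p n) G4" "normLq (leb n) (exp_p n) G4 \<le> \<beta> * normLq (leb n) (exp_p n) (restr n z r J2 T)"
      using wJ[of J2 10, unfolded r10] unfolding \<beta>_def G4_def[abs_def] by (auto simp: J2_def)
    have lapW: "weight n z l x * laplacian n W x = (G1 x + G2 x) + (G3 x + G4 x)" if x: "x \<in> Rn n" for x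
    proof (cases "x \<in> A")
      case True
      then have xX: "x \<in> clball n z (15 * r\<^sup>2)" using AX by (auto simp: X'_def)
      have "laplacian n W x = \<zeta> x * laplacian n v x + T x"
        unfolding W_def[abs_def] T_def commutator_def using laplacian_mult[OF \<zeta>s v x] by simp
      also have "T x = restr n z r J1 T x + restr n z r J2 T x"
        using comm0[OF x, of v] jj x by (auto simp: restr_def T_def indicator_def annulus_def)
      finally have lw: "laplacian n W x = \<zeta> x * laplacian n v x + (restr n z r J1 T x + restr n z r J2 T x)" .
      show ?thesis unfolding lw G1_def G2_def G3_def G4_def W_def ee[rule_format, OF xX] by (simp add: algebra_simps)
    next
      case False
      then have "sq_dist n z x / r\<^sup>2 \<notin> {1/4..12}" using x by (simp add: A_def annulus_def)
      moreover have "J1 \<subseteq> {1/4..12}" "J2 \<subseteq> {1/4..12}" by (auto simp: J1_def J2_def)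
      ultimately have "x \<notin> annulus n z r J1" "x \<notin> annulus n z r J2" unfolding annulus_def by blast+
      then show ?thesis using csmooth_zero[OF csmooth_laplacian[OF Wc] x False] csmooth_zero[OF Wc x False] csmooth_zero[OF \<zeta>c x False]
        by (simp add: G1_def G2_def G3_def G4_def restr_def)
    qed
    have "normLq (leb n) (exp_p n) (\<lambda>x. weight n z l x * laplacian n W x) = normLq (leb n) (exp_p n) (\<lambda>x. (G1 x + G2 x) + (G3 x + G4 x))"
      by (rule normLq_cong) (simp add: lapW)
    also have "\<dots> \<le> normLq (leb n) (exp_p n) (\<lambda>x. G1 x + G2 x) + normLq (leb n) (exp_p n) (\<lambda>x. G3 x + G4 x)"
      by (intro Minkowski ep(1) G1(1) G2(1) G3(1) G4(1))
    also have "\<dots> \<le> (normLq (leb n) (exp_p n) G1 + normLq (leb n) (exp_p n) G2) + (normLq (leb n) (exp_p n) G3 + normLq (leb n) (exp_p n) G4)"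
      by (intro add_mono Minkowski ep(1) G1(1) G2(1) G3(1) G4(1))
    also have "\<dots> \<le> (\<kappa> * P + \<alpha> * \<epsilon>) + (\<alpha> * (D * a + S * \<epsilon>) + \<beta> * (D * b + S * \<epsilon>))"
      using G1(2) G2(2) G3(2) G4(2) mult_left_mono[OF t1 ab(1)] mult_left_mono[OF t2 ab(2)] by linarith
    finally have "P \<le> \<theta> * ((\<kappa> * P + \<alpha> * \<epsilon>) + (\<alpha> * (D * a + S * \<epsilon>) + \<beta> * (D * b + S * \<epsilon>)))"
      using P1 th by (smt (verit) mult_left_mono)
    then have "(1 - \<theta> * \<kappa>) * P \<le> \<theta> * (\<alpha> * \<epsilon> + \<alpha> * (D * a + S * \<epsilon>) + \<beta> * (D * b + S * \<epsilon>))"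
      by (simp add: algebra_simps)
    then have P: "P \<le> \<Theta> * (\<alpha> * \<epsilon> + \<alpha> * (D * a + S * \<epsilon>) + \<beta> * (D * b + S * \<epsilon>))"
      using tk by (simp add: \<Theta>_def field_simps)
    \<comment> \<open>On this annulus the cutoff is 1 and the distance to the pole is at most
      \<open>3 r\<close>, so the weight is at least \<open>(3 r)^(-l)\<close>. Relative to the
      layers this leaves the ratios \<open>3 r / (r / 2) = 6\<close> and
      \<open>3 / sqrt 10 < 1\<close>.\<close>
    define Y where "Y = restr n z r {1/2..<9} v"
    have Ym: "Y \<in> borel_measurable (leb n)" unfolding Y_def by (rule restr_meas[OF _ smooth_measurable[OF v]]) auto
    have ae: "AE x in leb n. \<bar>Y x\<bar> \<le> \<bar>(3 * r) powr l * (weight n z l x * W x)\<bar>"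
    proof (rule AE_I2)
      fix x
      show "\<bar>Y x\<bar> \<le> \<bar>(3 * r) powr l * (weight n z l x * W x)\<bar>"
      proof (cases "x \<in> annulus n z r {1/2..<9}")
        case True
        then have q: "1/2 \<le> sq_dist n z x / r\<^sup>2" "sq_dist n z x / r\<^sup>2 < 9" by (auto simp: annulus_def)
        have d0: "0 < Rn_dist n z x" using dge[OF q(1)] r by (smt (verit) mult_pos_pos real_sqrt_gt_0_iff zero_less_divide_1_iff)
        have "Rn_dist n z x \<le> 3 * r" using dle[of x 9] q(2) sq9 by simp
        then have "(3 * r) powr (- l) \<le> weight n z l x" using d0 by (intro weight_ge[OF l0]) auto
        then have "(3 * r) powr l * (3 * r) powr (- l) \<le> (3 * r) powr l * weight n z l x" by (intro mult_left_mono) auto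
        then have "1 \<le> (3 * r) powr l * weight n z l x" using r by (simp flip: powr_add)
        then have "1 * \<bar>v x\<bar> \<le> ((3 * r) powr l * weight n z l x) * \<bar>v x\<bar>" by (rule mult_right_mono) simp
        moreover have "W x = v x" using hv(7)[of "sq_dist n z x / r\<^sup>2"] q by (simp add: W_def \<zeta>_def radial_cutoff_def)
        moreover have "Y x = v x" using True by (simp add: Y_def restr_def)
        ultimately show ?thesis by (simp add: abs_mult)
      next
        case False then show ?thesis by (simp add: Y_def restr_def)
      qed
    qed
    note Y1 = memLq_mono[OF ep(4) memLq_cmult[OF wWL] Ym ae]
    have YP: "normLq (leb n) (exp_p' n) Y \<le> (3 * r) powr l * P" using Y1(2) ep(4) by (simp add: normLq_cmult P_def)
    have Yz: "Y x = 0" if "x \<in> Rn n" "x \<notin> clball n z (15 * r\<^sup>2)" for x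
    proof -
      have "{1/2..<9} \<subseteq> {..15::real}" by auto
      then have "x \<notin> annulus n z r {1/2..<9}" using that annulus_clball[OF _ r, of "{1/2..<9}" 15 n z] by blast
      then show ?thesis by (simp add: Y_def restr_def)
    qed
    have "normLq (leb n) 2 Y \<le> 8 * r * normLq (leb n) (exp_p' n) Y"
      by (rule vol_Hoelder(2)[OF n r _ ep(4) ep(6) Y1(1) Yz]) simp
    also have "\<dots> \<le> 8 * r * ((3 * r) powr l * P)" using YP r by (intro mult_left_mono) auto
    also have "\<dots> \<le> 8 * r * ((3 * r) powr l * (\<Theta> * (\<alpha> * \<epsilon> + \<alpha> * (D * a + S * \<epsilon>) + \<beta> * (D * b + S * \<epsilon>))))"
      using P r by (intro mult_left_mono) auto
    also have "\<dots> = 8 * r * D * \<Theta> * (((3 * r) powr l * \<alpha>) * a + ((3 * r) powr l * \<beta>) * b) + C' * \<epsilon>"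
      unfolding C'_def by (simp add: algebra_simps)
    also have "(3 * r) powr l * \<alpha> = 6 powr l"
    proof -
      have "3 * r = 6 * (r / 2)" by simp
      then have "(3 * r) powr l = 6 powr l * (r / 2) powr l" using r by (metis powr_mult)
      then show ?thesis using r by (simp add: \<alpha>_def powr_minus field_simps)
    qed
    also have "(3 * r) powr l * \<beta> = (3 / sqrt 10) powr l"
    proof -
      have "3 * r = (3 / sqrt 10) * (sqrt 10 * r)" by simp
      then have "(3 * r) powr l = (3 / sqrt 10) powr l * (sqrt 10 * r) powr l" using r by (metis powr_mult)
      then show ?thesis using r by (simp add: \<beta>_def powr_minus field_simps)
    qed
    also have "8 * r * D = 6912 * real n * K\<^sup>2" using r by (simp add: D_def)
    finally show "normLq (leb n) 2 (restr n z r {1/2..<9} v) \<le>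
        6912 * real n * K\<^sup>2 * (\<theta> / (1 - \<theta> * normLq (leb n) (real n / 2) V)) *
          (6 powr l * normLq (leb n) 2 (restr n z r {..<1} v) + (3 / sqrt 10) powr l * normLq (leb n) 2 (restr n z r {..15} v))
        + C' * normLq (leb n) (exp_p n) e"
      unfolding Y_def \<Theta>_def \<kappa>_def a_def b_def \<epsilon>_def .
  qed
qed

lemma weak_partial_locally_integrable:
  "weak_partial n \<Omega> i f g \<Longrightarrow> locally_integrable n \<Omega> f" "weak_partial n \<Omega> i f g \<Longrightarrow> locally_integrable n \<Omega> g"
  by (auto simp: weak_partial_def)

text \<open>On bounded sets \<open>L^p'\<close> controls \<open>L^2\<close>, so each of the three
  norms passes to the limit of the mollifications.\<close>

lemma restr_tendsto:
  assumes n: "3 \<le> n" and r: "0 < r" and I: "I \<in> sets borel" "I \<subseteq> {..15}"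
    and v: "\<And>m. memLq (leb n) (exp_p' n) (v m)" and u: "memLq (leb n) (exp_p' n) u"
    and lim: "(\<lambda>m. normLq (leb n) (exp_p' n) (\<lambda>x. v m x - u x)) \<longlonglongrightarrow> 0"
  shows "(\<lambda>m. normLq (leb n) 2 (restr n z r I (v m))) \<longlonglongrightarrow> normLq (leb n) 2 (restr n z r I u)"
proof -
  note ep = exp_p_props[OF n]
  have z0: "restr n z r I w x = 0" if "x \<in> Rn n" "x \<notin> clball n z (15 * r\<^sup>2)" for w x
    using that annulus_clball[OF I(2) r, of n z] by (auto simp: restr_def indicator_def)
  have rL: "memLq (leb n) (exp_p' n) (restr n z r I w)" "normLq (leb n) (exp_p' n) (restr n z r I w) \<le> normLq (leb n) (exp_p' n) w"
    if w: "memLq (leb n) (exp_p' n) w" for w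
  proof -
    have "AE x in leb n. \<bar>restr n z r I w x\<bar> \<le> \<bar>w x\<bar>" by (auto simp: restr_def indicator_def)
    note * = memLq_mono[OF ep(4) w restr_meas[OF I(1) memLq_meas[OF w]] this]
    show "memLq (leb n) (exp_p' n) (restr n z r I w)" "normLq (leb n) (exp_p' n) (restr n z r I w) \<le> normLq (leb n) (exp_p' n) w" by (rule *)+
  qed
  have vol: "memLq (leb n) 2 (restr n z r I w)" "normLq (leb n) 2 (restr n z r I w) \<le> 8 * r * normLq (leb n) (exp_p' n) w"
    if w: "memLq (leb n) (exp_p' n) w" for w
  proof -
    note * = vol_Hoelder[OF n r _ ep(4) ep(6) rL(1)[OF w] z0]
    show "memLq (leb n) 2 (restr n z r I w)" by (rule *(1)) auto
    have "normLq (leb n) 2 (restr n z r I w) \<le> 8 * r * normLq (leb n) (exp_p' n) (restr n z r I w)" by (rule *(2)) auto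
    also have "\<dots> \<le> 8 * r * normLq (leb n) (exp_p' n) w" using rL(2)[OF w] r by (intro mult_left_mono) auto
    finally show "normLq (leb n) 2 (restr n z r I w) \<le> 8 * r * normLq (leb n) (exp_p' n) w" .
  qed
  show ?thesis
  proof (rule normLq_tendsto[OF _ vol(1)[OF v] vol(1)[OF u]])
    have "1 \<le> exp_p' n" using ep(2) by simp
    then have d: "memLq (leb n) (exp_p' n) (\<lambda>x. v m x - u x)" for m by (intro memLq_diff v u)
    have eq: "(\<lambda>x. restr n z r I (v m) x - restr n z r I u x) = restr n z r I (\<lambda>x. v m x - u x)" for m
      by (rule ext) (simp add: restr_def right_diff_distrib)
    have lim': "(\<lambda>m. 8 * r * normLq (leb n) (exp_p' n) (\<lambda>x. v m x - u x)) \<longlonglongrightarrow> 0"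
      using tendsto_mult_left[OF lim, of "8 * r"] by simp
    show "(\<lambda>m. normLq (leb n) 2 (\<lambda>x. restr n z r I (v m) x - restr n z r I u x)) \<longlonglongrightarrow> 0"
      unfolding eq
    proof (rule tendsto_sandwich[OF _ _ tendsto_const lim'])
      show "\<forall>\<^sub>F m in sequentially. normLq (leb n) 2 (restr n z r I (\<lambda>x. v m x - u x)) \<le> 8 * r * normLq (leb n) (exp_p' n) (\<lambda>x. v m x - u x)"
        using vol(2)[OF d] by (rule always_eventually[OF allI])
    qed simp
  qed simp
qed

text \<open>The limit of \<open>smooth_three_ball\<close> along mollifications of the truncated
  solution. Knowing that the truncation is in \<open>L^p'\<close> is essential: it puts the product
  with the potential into \<open>L^p\<close>, where mollification converges.\<close>

theorem three_ball:
  assumes n: "3 \<le> n" and O: "openin (Rtop n) \<Omega>" "\<Omega> \<noteq> {}"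
    and C: "carleman_const n \<theta>" and th: "1 \<le> \<theta>" and l: "l \<in> carleman_exponents n"
    and V0: "V0 \<in> potentials n \<Omega> \<theta>" and u: "u \<in> sobolev n 2 (exp_p n) \<Omega>"
    and F: "weak_laplacian n \<Omega> u F" "AE z in leb n. z \<in> \<Omega> \<longrightarrow> - F z + V0 z * u z = 0"
    and r: "0 < r" and z: "z \<in> Rn n" and X: "clball n z (16 * r\<^sup>2) \<subseteq> \<Omega>" and cut: "cutoffs K h1 h2 h3"
  shows "normLq (leb n) 2 (restr n z r {1/2..<9} u) \<le> 6912 * real n * K\<^sup>2 * theta_V n \<Omega> \<theta> V0 *
          (6 powr l * normLq (leb n) 2 (restr n z r {..<1} u) + (3 / sqrt 10) powr l * normLq (leb n) 2 (restr n z r {..15} u))"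
proof -
  note ep = exp_p_props[OF n]
  have n2: "0 < real n / 2" using n by simp
  have Os: "\<Omega> \<in> sets (leb n)" by (rule openin_measurable[OF O(1)])
  define V where "V x = indicator \<Omega> x * V0 x" for x
  have V: "memLq (leb n) (real n / 2) V" using V0 Lp_memLq[OF n2 Os, of V0] by (simp add: potentials_def V_def[abs_def])
  have kV: "normLq (leb n) (real n / 2) V = kappa n \<Omega> V0" unfolding kappa_def Lp_norm_normLq[OF n2] V_def[abs_def] ..
  define \<kappa> where "\<kappa> = kappa n \<Omega> V0"
  have kap: "2 * (sobolev_const n \<Omega>)\<^sup>2 * normLq (leb n) (real n / 2) V < 1" "\<theta> * normLq (leb n) (real n / 2) V < 1"
    using V0 by (auto simp: potentials_def kV)
  \<comment> \<open>Room between 15 and 16: the solution has exponent \<open>p'\<close> and is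
    truncated up to \<open>31/2\<close>, derivatives commute with fine mollification up to
    \<open>61/4\<close>, and the equation is needed up to 15.\<close>
  define Y where "Y = clball n z ((31/2) * r\<^sup>2)"
  have YO: "Y \<subseteq> \<Omega>"
  proof -
    have "(31/2) * r\<^sup>2 \<le> 16 * r\<^sup>2" by (intro mult_right_mono) auto
    then have "Y \<subseteq> clball n z (16 * r\<^sup>2)" unfolding Y_def clball_def by (blast intro: order_trans)
    then show ?thesis using X by blast
  qed
  have Yc: "compactin (Rtop n) Y" unfolding Y_def by (rule compactin_clball)
  have Ys: "Y \<in> sets (leb n)" by (rule compactin_finite_measure[OF Yc])
  have "15 * r\<^sup>2 \<le> (31/2) * r\<^sup>2" by (intro mult_right_mono) auto
  then have X15: "clball n z (15 * r\<^sup>2) \<subseteq> Y" unfolding Y_def clball_def by (blast intro: order_trans)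
  define U where "U x = indicator Y x * u x" for x
  have u0: "u \<in> Lp n (exp_p n) \<Omega>" using u by (simp add: numeral_2_eq_2)
  have Ub: "bsupp_integrable n U" unfolding U_def[abs_def] by (rule bsupp_integrable_restrict_Lp(2)[OF ep(1) u0 Os Yc YO])
  have Ui: "integrable (leb n) U" using Ub by (simp add: bsupp_integrable_def)
  have UL: "memLq (leb n) (exp_p' n) U" unfolding U_def[abs_def] Y_def
    by (rule solution_locally_Lp'[OF n C _ O(1) u z _ _ X]) (use th r in auto)
  have p'1: "1 \<le> exp_p' n" using ep(2) by simp
  have pn: "1 / exp_p n = 1 / (real n / 2) + 1 / exp_p' n" by (rule ep(7))
  define G where "G x = V x * U x" for x
  have GL: "memLq (leb n) (exp_p n) G" unfolding G_def[abs_def] by (rule Hoelder(1)[OF n2 ep(4) ep(3) pn V UL])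
  have Gb: "bsupp_integrable n G"
  proof -
    have "G \<in> Lp n (exp_p n) Y" by (rule memLq_imp_Lp[OF GL Ys])
    from bsupp_integrable_restrict_Lp(2)[OF ep(1) this Ys Yc] have "bsupp_integrable n (\<lambda>x. indicator Y x * G x)" by simp
    moreover have "(\<lambda>x. indicator Y x * G x) = G" by (auto simp: G_def U_def indicator_def)
    ultimately show ?thesis by simp
  qed
  have Gi: "integrable (leb n) G" using Gb by (simp add: bsupp_integrable_def)
  define v where "v m = moll n (moll_scale m) U" for m
  have vs: "smooth n (v m)" for m unfolding v_def by (rule moll_smooth[OF Ub])
  have vL: "memLq (leb n) (exp_p' n) (v m)" for m unfolding v_def by (rule moll_memLq(1)[OF moll_scale_pos p'1 UL Ui])
  have v_lim: "(\<lambda>m. normLq (leb n) (exp_p' n) (\<lambda>x. v m x - U x)) \<longlonglongrightarrow> 0"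
    using moll_converges_memLq[OF p'1 UL Ub] by (simp add: moll_converges_def v_def)
  have G_lim: "(\<lambda>m. normLq (leb n) (exp_p n) (\<lambda>x. moll n (moll_scale m) G x - G x)) \<longlonglongrightarrow> 0"
    using moll_converges_memLq[OF ep(1) GL Gb] by (simp add: moll_converges_def)
  have mGL: "memLq (leb n) (exp_p n) (moll n (moll_scale m) G)" for m by (rule moll_memLq(1)[OF moll_scale_pos ep(1) GL Gi])
  obtain g h where gh: "\<And>i. i < n \<Longrightarrow> weak_partial n \<Omega> i u (g i)" "\<And>i. i < n \<Longrightarrow> weak_partial n \<Omega> i (g i) (h i)"
    and Fh: "F = (\<lambda>x. \<Sum>i<n. h i x)"
    using F(1) unfolding weak_laplacian_def weak_gradient_def by auto
  define gY where "gY i x = indicator Y x * g i x" for i x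
  define hY where "hY i x = indicator Y x * h i x" for i x
  have gYb: "bsupp_integrable n (gY i)" if "i < n" for i unfolding gY_def[abs_def]
    by (rule bsupp_integrable_restrict[OF weak_partial_locally_integrable(2)[OF gh(1)[OF that]] Yc YO])
  have hYi: "integrable (leb n) (hY i)" if "i < n" for i
    using bsupp_integrable_restrict[OF weak_partial_locally_integrable(2)[OF gh(2)[OF that]] Yc YO] by (simp add: bsupp_integrable_def hY_def[abs_def])
  have hG: "AE x in leb n. (\<Sum>i<n. hY i x) = G x"
    using F(2)
  proof eventually_elim
    case (elim x)
    have "(\<Sum>i<n. hY i x) = indicator Y x * F x" by (simp add: hY_def Fh sum_distrib_left)
    then show ?case using elim YO by (auto simp: G_def V_def U_def indicator_def)
  qed
  define \<delta> where "\<delta> = sqrt ((31/2) * r\<^sup>2) - sqrt ((61/4) * r\<^sup>2)"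
  have \<delta>: "0 < \<delta>" using r by (simp add: \<delta>_def)
  have lapv: "laplacian n (v m) x = moll n (moll_scale m) G x" if m: "sqrt (moll_scale m) < \<delta>" and x: "x \<in> clball n z (15 * r\<^sup>2)" for m x
  proof -
    define T where "T = {x \<in> Rn n. sq_dist n z x < (61/4) * r\<^sup>2}"
    have To: "openin (Rtop n) T" unfolding T_def by (rule openin_sq_dist)
    have "15 * r\<^sup>2 < (61/4) * r\<^sup>2" using r by simp
    then have xT: "x \<in> T" using x unfolding T_def clball_def by (blast intro: le_less_trans)
    have sub: "clball n y (moll_scale m) \<subseteq> Y" if "y \<in> T" for y
      unfolding Y_def by (rule clball_subset[of _ _ _ "(61/4) * r\<^sup>2"]) (use that m in \<open>auto simp: T_def clball_def \<delta>_def\<close>)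
    have d1: "partial_deriv i (v m) y = moll n (moll_scale m) (gY i) y" if i: "i < n" and y: "y \<in> T" for i y
      unfolding v_def
      by (rule moll_partial[OF gh(1)[OF i] i _ _ Ub]) (use y sub[OF y] YO in \<open>auto simp: T_def U_def gY_def\<close>)
    have d2: "partial_deriv i (partial_deriv i (v m)) x = moll n (moll_scale m) (hY i) x" if i: "i < n" for i
    proof -
      have "partial_deriv i (partial_deriv i (v m)) x = partial_deriv i (moll n (moll_scale m) (gY i)) x"
        by (rule partial_cong_open[OF To _ xT i]) (rule d1[OF i])
      also have "\<dots> = moll n (moll_scale m) (hY i) x"
        by (rule moll_partial[OF gh(2)[OF i] i _ _ gYb[OF i]]) (use xT sub[OF xT] YO in \<open>auto simp: T_def gY_def hY_def\<close>)
      finally show ?thesis .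
    qed
    have "laplacian n (v m) x = moll n (moll_scale m) (\<lambda>x. \<Sum>i<n. hY i x) x"
      unfolding laplacian_def using d2 hYi by (subst moll_sum) auto
    also have "\<dots> = moll n (moll_scale m) G x" unfolding moll_def
    proof (rule integral_cong_AE)
      have "integrable (leb n) (\<lambda>x. \<Sum>i<n. hY i x)" using hYi by (intro Bochner_Integration.integrable_sum) auto
      from moll_integrable[OF this] show "(\<lambda>y. moll_kernel n (moll_scale m) x y * (\<Sum>i<n. hY i y)) \<in> borel_measurable (leb n)" by simp
      from moll_integrable[OF Gi] show "(\<lambda>y. moll_kernel n (moll_scale m) x y * G y) \<in> borel_measurable (leb n)" by simp
      show "AE y in leb n. moll_kernel n (moll_scale m) x y * (\<Sum>i<n. hY i y) = moll_kernel n (moll_scale m) x y * G y"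
        using hG by eventually_elim simp
    qed
    finally show ?thesis .
  qed
  \<comment> \<open>The Laplacian of the mollification is the mollification of \<open>V U\<close>.
    Comparing it with \<open>V\<close> times the mollification leaves two terms, both tending to 0
    in \<open>L^p\<close>; for the second, Hoelder with \<open>V\<close> is used.\<close>
  define e where "e m x = restr n z r {..15} (\<lambda>x. (moll n (moll_scale m) G x - G x) + V x * (U x - v m x)) x" for m x
  have reg15: "annulus n z r {..15} = clball n z (15 * r\<^sup>2)" using r by (auto simp: annulus_def clball_def field_simps)
  have e0L: "memLq (leb n) (exp_p n) (\<lambda>x. moll n (moll_scale m) G x - G x)" for m by (rule memLq_diff[OF ep(1) mGL GL])
  have dL: "memLq (leb n) (exp_p' n) (\<lambda>x. U x - v m x)" for m by (rule memLq_diff[OF p'1 UL vL])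
  note HV = Hoelder[OF n2 ep(4) ep(3) pn V dL]
  have eL: "memLq (leb n) (exp_p n) (e m)" "normLq (leb n) (exp_p n) (e m) \<le> normLq (leb n) (exp_p n) (\<lambda>x. moll n (moll_scale m) G x - G x) + \<kappa> * normLq (leb n) (exp_p' n) (\<lambda>x. v m x - U x)" for m
  proof -
    note M = Minkowski[OF ep(1) e0L HV(1), of m m]
    have "AE x in leb n. \<bar>e m x\<bar> \<le> \<bar>(moll n (moll_scale m) G x - G x) + V x * (U x - v m x)\<bar>"
      by (auto simp: e_def restr_def indicator_def)
    from memLq_mono[OF ep(3) M(1) _ this] have *: "memLq (leb n) (exp_p n) (e m)"
      "normLq (leb n) (exp_p n) (e m) \<le> normLq (leb n) (exp_p n) (\<lambda>x. (moll n (moll_scale m) G x - G x) + V x * (U x - v m x))"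
      using restr_meas[of "{..15}", OF _ memLq_meas[OF M(1)], of z r] unfolding e_def[abs_def] by auto
    show "memLq (leb n) (exp_p n) (e m)" by (rule *(1))
    show "normLq (leb n) (exp_p n) (e m) \<le> normLq (leb n) (exp_p n) (\<lambda>x. moll n (moll_scale m) G x - G x) + \<kappa> * normLq (leb n) (exp_p' n) (\<lambda>x. v m x - U x)"
      using *(2) M(2) HV(2)[of m] normLq_diff_commute[of "leb n" "exp_p' n" U "v m"] by (simp add: kV \<kappa>_def)
  qed
  have e_lim: "(\<lambda>m. normLq (leb n) (exp_p n) (e m)) \<longlonglongrightarrow> 0"
  proof (rule tendsto_sandwich[OF _ _ tendsto_const])
    show "(\<lambda>m. normLq (leb n) (exp_p n) (\<lambda>x. moll n (moll_scale m) G x - G x) + \<kappa> * normLq (leb n) (exp_p' n) (\<lambda>x. v m x - U x)) \<longlonglongrightarrow> 0"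
      using tendsto_add[OF G_lim tendsto_mult_left[OF v_lim, of \<kappa>]] by simp
  qed (use eL in auto)
  obtain C' where C': "\<And>v e. smooth n v \<Longrightarrow> memLq (leb n) (exp_p n) e \<Longrightarrow>
      (\<forall>x\<in>clball n z (15 * r\<^sup>2). laplacian n v x = V x * v x + e x) \<Longrightarrow>
      normLq (leb n) 2 (restr n z r {1/2..<9} v) \<le>
        6912 * real n * K\<^sup>2 * (\<theta> / (1 - \<theta> * normLq (leb n) (real n / 2) V)) *
          (6 powr l * normLq (leb n) 2 (restr n z r {..<1} v) + (3 / sqrt 10) powr l * normLq (leb n) 2 (restr n z r {..15} v))
        + C' * normLq (leb n) (exp_p n) e"
    using smooth_three_ball[OF n O C th l V kap r _ cut, of z] X15 YO by blast
  have ev: "\<forall>\<^sub>F m in sequentially. normLq (leb n) 2 (restr n z r {1/2..<9} (v m)) \<le>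
        6912 * real n * K\<^sup>2 * (\<theta> / (1 - \<theta> * normLq (leb n) (real n / 2) V)) *
          (6 powr l * normLq (leb n) 2 (restr n z r {..<1} (v m)) + (3 / sqrt 10) powr l * normLq (leb n) 2 (restr n z r {..15} (v m)))
        + C' * normLq (leb n) (exp_p n) (e m)"
    using moll_scale_sqrt_less[OF \<delta>]
  proof eventually_elim
    case (elim m)
    show ?case
    proof (rule C'[OF vs eL(1)], rule ballI)
      fix x assume x: "x \<in> clball n z (15 * r\<^sup>2)"
      have "e m x = (moll n (moll_scale m) G x - G x) + V x * (U x - v m x)" using x by (simp add: e_def restr_def reg15)
      then show "laplacian n (v m) x = V x * v m x + e m x" unfolding lapv[OF elim x] by (simp add: G_def algebra_simps)
    qed
  qed
  have lims: "(\<lambda>m. normLq (leb n) 2 (restr n z r I (v m))) \<longlonglongrightarrow> normLq (leb n) 2 (restr n z r I u)" if I: "I \<in> sets borel" "I \<subseteq> {..15}" for I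
  proof -
    have "restr n z r I u = restr n z r I U"
      using annulus_clball[OF I(2) r, of n z] X15 by (auto simp: restr_def U_def indicator_def fun_eq_iff)
    then show ?thesis using restr_tendsto[OF n r I vL UL v_lim, of z] by simp
  qed
  have "normLq (leb n) 2 (restr n z r {1/2..<9} u) \<le> 6912 * real n * K\<^sup>2 * (\<theta> / (1 - \<theta> * normLq (leb n) (real n / 2) V)) *
          (6 powr l * normLq (leb n) 2 (restr n z r {..<1} u) + (3 / sqrt 10) powr l * normLq (leb n) 2 (restr n z r {..15} u)) + C' * 0"
    by (rule tendsto_le[OF sequentially_bot _ _ ev]) (intro tendsto_intros lims e_lim; auto)+
  then show ?thesis by (simp add: theta_V_def kV)
qed


subsection \<open>Choosing the exponent\<close>

text \<open>The 40th power of \<open>3 / sqrt 10\<close> is \<open>(9/10)^20\<close>, which is below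
  \<open>1/6\<close>. Both terms of the three-ball inequality are thereby expressed in powers of
  6.\<close>

lemma exp_ratio: "(3 / sqrt 10) powr l \<le> 6 powr (- l / 40)" if l: "0 \<le> l"
proof -
  define c where "c = 3 / sqrt (10::real)"
  have c0: "0 < c" by (simp add: c_def)
  have c2: "c\<^sup>2 = 9 / 10" by (simp add: c_def power_divide)
  have "c ^ 40 = (c\<^sup>2) ^ 20" by (simp flip: power_mult)
  also have "\<dots> \<le> 1 / 6" unfolding c2 by (simp add: power_divide)
  finally have "c ^ 40 \<le> 1 / 6" .
  then have "(c ^ 40) powr (l / 40) \<le> (1 / 6) powr (l / 40)" using l c0 by (intro powr_mono2) auto
  moreover have "c ^ 40 = c powr 40" using c0 by (simp add: powr_numeral)
  then have "(c ^ 40) powr (l / 40) = c powr l" by (simp add: powr_powr)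
  moreover have "(1 / 6) powr (l / 40) = 6 powr (- l / 40)" by (simp add: powr_divide powr_minus_divide)
  ultimately show ?thesis by (simp add: c_def)
qed

text \<open>With \<open>6^L = a^(-1/2)\<close> the growing term becomes \<open>a^(1/2)\<close> and
  the decaying one is at most a constant times \<open>a^(1/80)\<close>. Admissible exponents start
  at \<open>(n-1)/2\<close>; if \<open>L\<close> is smaller, then \<open>a >= 6^(-n)\<close>, and a
  power of order \<open>1/n\<close> is needed to keep the right-hand side above 1. This is the
  origin of the exponent \<open>1 / (80 n)\<close>.\<close>

lemma optimize_exponent:
  fixes X a A :: real
  assumes n: "3 \<le> n" and X: "X \<le> 1" and a: "0 \<le> a" "a \<le> 1" and A: "1 \<le> A"
    and le: "\<And>m::nat. X \<le> a + A * (6 powr (real m + (real n - 1) / 2) * a + (3 / sqrt 10) powr (real m + (real n - 1) / 2))"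
  shows "X \<le> 4 * A * a powr (1 / (80 * real n))"
proof (cases "a = 0")
  case True
  \<comment> \<open>For \<open>a = 0\<close> the growing term is absent and the exponent can be sent
    to infinity.\<close>
  have "(\<lambda>m. A * (3 / sqrt 10) powr (real m + (real n - 1) / 2)) \<longlonglongrightarrow> A * 0"
  proof (intro tendsto_mult tendsto_const)
    have s: "3 / sqrt (10::real) < 1"
      using real_sqrt_less_mono[of 9 10] real_sqrt_unique[of 3 9] by (simp add: divide_less_eq)
    have "(\<lambda>m. (3 / sqrt (10::real)) ^ m * (3 / sqrt 10) powr ((real n - 1) / 2)) \<longlonglongrightarrow> 0 * (3 / sqrt 10) powr ((real n - 1) / 2)"
      by (intro tendsto_mult tendsto_const LIMSEQ_realpow_zero) (use s in auto)
    then show "(\<lambda>m. (3 / sqrt (10::real)) powr (real m + (real n - 1) / 2)) \<longlonglongrightarrow> 0" by (simp add: powr_add powr_realpow)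
  qed
  then have "X \<le> A * 0" by (rule LIMSEQ_le_const) (use le True in auto)
  then show ?thesis using True by simp
next
  case False
  then have a0: "0 < a" using a by simp
  define k where "k = 1 / (80 * real n)"
  define L where "L = - log 6 a / 2"
  have aL: "6 powr L = a powr (- 1 / 2)"
  proof -
    have "6 powr L = (6 powr (log 6 a)) powr (- 1 / 2)" unfolding powr_powr by (simp add: L_def)
    then show ?thesis using a0 by simp
  qed
  have k: "0 < k" "k \<le> 1 / 80" using n by (auto simp: k_def field_simps)
  show ?thesis
  proof (cases "L \<ge> (real n - 1) / 2")
    case True
    \<comment> \<open>Rounding down to the progression gives \<open>L - 1 <= l <= L\<close>: the
      upper bound serves the growing term, the lower one costs the factor
      \<open>6^(1/40) <= 2\<close> in the decaying one.\<close>
    define m where "m = nat \<lfloor>L - (real n - 1) / 2\<rfloor>"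
    define l where "l = real m + (real n - 1) / 2"
    have fl: "real m = of_int \<lfloor>L - (real n - 1) / 2\<rfloor>" using True by (simp add: m_def)
    have l1: "l \<le> L" using of_int_floor_le[of "L - (real n - 1) / 2"] unfolding l_def fl by linarith
    have l2: "L - 1 \<le> l" using floor_correct[of "L - (real n - 1) / 2"] unfolding l_def fl by linarith
    have l0: "0 \<le> l" using n by (simp add: l_def)
    have "6 powr l * a \<le> 6 powr L * a" using l1 a by (intro mult_right_mono powr_mono) auto
    also have "\<dots> = a powr (- 1 / 2) * a powr 1" using aL a0 by simp
    also have "\<dots> = a powr (- 1 / 2 + 1)" by (rule powr_add[symmetric])
    also have "\<dots> = a powr (1 / 2)" by simp
    also have "\<dots> \<le> a powr k" using k a a0 by (intro powr_mono') auto
    finally have t1: "6 powr l * a \<le> a powr k" .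
    have "(3 / sqrt 10) powr l \<le> 6 powr (- l / 40)" by (rule exp_ratio[OF l0])
    also have "\<dots> \<le> 6 powr (1 / 40 + - L / 40)" using l2 by (intro powr_mono) (auto simp: field_simps)
    also have "\<dots> = 6 powr (1 / 40) * (6 powr L) powr (- 1 / 40)" unfolding powr_add powr_powr by simp
    also have "(6 powr L) powr (- 1 / 40) = a powr (1 / 80)" unfolding aL powr_powr by simp
    also have "6 powr (1 / 40) * a powr (1 / 80) \<le> 2 * a powr k"
    proof (rule mult_mono)
      have "(6::real) powr (1 / 40) \<le> (2 powr 40) powr (1 / 40)" by (intro powr_mono2) auto
      then show "(6::real) powr (1 / 40) \<le> 2" by (simp add: powr_powr)
      show "a powr (1 / 80) \<le> a powr k" using k a a0 by (intro powr_mono') auto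
    qed auto
    finally have t2: "(3 / sqrt 10) powr l \<le> 2 * a powr k" .
    have "a powr 1 \<le> a powr k" using k a a0 by (intro powr_mono') auto
    then have t0: "a \<le> a powr k" using a0 by simp
    have "X \<le> a + A * (6 powr l * a + (3 / sqrt 10) powr l)" unfolding l_def by (rule le)
    also have "\<dots> \<le> A * a powr k + A * (a powr k + 2 * a powr k)"
    proof (intro add_mono mult_left_mono t1 t2)
      have "1 * a powr k \<le> A * a powr k" using A by (intro mult_right_mono) auto
      then show "a \<le> A * a powr k" using t0 by linarith
    qed (use A in auto)
    finally show ?thesis by (simp add: k_def algebra_simps)
  next
    \<comment> \<open>Here \<open>a\<close> is not small: \<open>a^k >= 6^(-1/80) >= 1/2\<close>,
      and \<open>X <= 1\<close> suffices.\<close>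
    case False
    then have "6 powr L \<le> 6 powr (real n / 2)" by (intro powr_mono) auto
    then have "(6 powr (real n / 2)) powr (-2) \<le> (6 powr L) powr (-2)" by (intro powr_mono2') auto
    then have "6 powr (- real n) \<le> a" using a0 by (simp add: aL powr_powr)
    then have "(6 powr (- real n)) powr k \<le> a powr k" using k by (intro powr_mono2) auto
    moreover have "(6 powr (- real n)) powr k = 6 powr (- 1 / 80)" unfolding powr_powr using n by (simp add: k_def)
    moreover have "(1 / 2 :: real) \<le> 6 powr (- 1 / 80)"
    proof -
      have "(6::real) powr (1 / 80) \<le> (2 powr 80) powr (1 / 80)" by (intro powr_mono2) auto
      then have "(6::real) powr (1 / 80) \<le> 2" by (simp add: powr_powr)
      then have "1 / 2 \<le> 1 / (6::real) powr (1 / 80)" by (intro divide_left_mono) auto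
      also have "1 / (6::real) powr (1 / 80) = 6 powr (- (1 / 80))" by (rule powr_minus_divide[symmetric])
      finally show ?thesis by simp
    qed
    ultimately have "1 / 2 \<le> a powr k" by linarith
    then have "1 * (1 / 2) \<le> A * a powr k" using A by (intro mult_mono) auto
    then show ?thesis using X by (simp add: k_def)
  qed
qed

subsection \<open>Chains of balls\<close>

text \<open>The points reachable from \<open>x\<close> and the remaining ones have open
  \<open>d\<close>-neighbourhoods that cover \<open>X\<close>. A common point of these
  neighbourhoods in \<open>X\<close> would itself be a link of a chain from one part to the other,
  so they separate \<open>X\<close>.\<close>

lemma connected_chain:
  assumes X: "connectedin (Rtop n) X" and d: "0 < d" and xy: "x \<in> X" "y \<in> X"
  shows "(x, y) \<in> {(a, b). a \<in> X \<and> b \<in> X \<and> Rn_dist n a b < d}\<^sup>*"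
proof (rule ccontr)
  define R where "R = {(a, b). a \<in> X \<and> b \<in> X \<and> Rn_dist n a b < d}"
  assume n: "(x, y) \<notin> {(a, b). a \<in> X \<and> b \<in> X \<and> Rn_dist n a b < d}\<^sup>*"
  define A where "A = {a \<in> X. (x, a) \<in> R\<^sup>*}"
  define E where "E S = (\<Union>a\<in>S. Rn_ball n a d)" for S
  have XR: "X \<subseteq> Rn n" using X by (simp add: connectedin)
  have o: "openin (Rtop n) (E S)" for S unfolding E_def using openin_Rn_ball[OF d] by auto
  have self: "a \<in> Rn_ball n a d" if "a \<in> X" for a using that XR d by (auto simp: Rn_ball_def)
  have near: "b \<in> A" if "a \<in> A" "b \<in> X" "Rn_dist n a b < d" for a b
    using that unfolding A_def by (auto simp: R_def intro: rtrancl_into_rtrancl)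
  have "E A \<inter> E (X - A) \<inter> X = {}"
  proof (rule ccontr)
    assume "E A \<inter> E (X - A) \<inter> X \<noteq> {}"
    then obtain q a b where q: "q \<in> X" "a \<in> A" "Rn_dist n a q < d" "b \<in> X - A" "Rn_dist n b q < d"
      by (auto simp: E_def Rn_ball_def)
    then have "q \<in> A" using near by blast
    then have "b \<in> A" using near[of q b] q by (simp add: Rn_dist_commute)
    then show False using q by simp
  qed
  moreover have "X \<subseteq> E A \<union> E (X - A)" using self by (auto simp: E_def)
  moreover have "x \<in> E A \<inter> X" using self xy(1) by (auto simp: E_def A_def)
  moreover have "y \<in> E (X - A) \<inter> X" using self xy(2) n by (auto simp: E_def A_def R_def)
  ultimately show False using X o unfolding connectedin by blast
qed

text \<open>In a shortest chain two points of the same cell have indices differing by at most 1,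
  since they could otherwise be joined directly. The points with even index thus lie in distinct
  cells, and there are \<open>m div 2 + 1\<close> of them.\<close>

lemma short_chain:
  assumes xy: "(x, y) \<in> {(a, b). a \<in> X \<and> b \<in> X \<and> P a b}\<^sup>*"
    and fin: "finite S" and cell: "\<And>a. a \<in> X \<Longrightarrow> cell a \<in> S"
    and same: "\<And>a b. a \<in> X \<Longrightarrow> b \<in> X \<Longrightarrow> cell a = cell b \<Longrightarrow> P a b"
  shows "\<exists>m f. m \<le> 2 * card S \<and> f 0 = x \<and> f m = y \<and> (\<forall>i<m. f i \<in> X \<and> f (Suc i) \<in> X \<and> P (f i) (f (Suc i)))"
proof -
  define R where "R = {(a, b). a \<in> X \<and> b \<in> X \<and> P a b}"
  have ex: "\<exists>m. (x, y) \<in> R ^^ m" using xy by (simp add: R_def rtrancl_power)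
  define m where "m = (LEAST m. (x, y) \<in> R ^^ m)"
  have m: "(x, y) \<in> R ^^ m" unfolding m_def using ex by (rule LeastI_ex)
  have least: "m \<le> k" if "(x, y) \<in> R ^^ k" for k unfolding m_def using that by (rule Least_le)
  from m obtain f where f: "f 0 = x" "f m = y" "\<And>i. i < m \<Longrightarrow> (f i, f (Suc i)) \<in> R"
    unfolding relpow_fun_conv by blast
  have seg: "(f i, f j) \<in> R ^^ (j - i)" if "i \<le> j" "j \<le> m" for i j
    unfolding relpow_fun_conv by (rule exI[of _ "\<lambda>k. f (i + k)"]) (use that f in auto)
  have "m \<le> 2 * card S"
  proof (cases "m = 0")
    case False
    have fX: "f i \<in> X" if "i \<le> m" for i
    proof (cases "i = m")
      case True
      then show ?thesis using f(3)[of "m - 1"] False by (simp add: R_def)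
    next
      case False
      then show ?thesis using f(3)[of i] that by (simp add: R_def)
    qed
    have far: "cell (f i) \<noteq> cell (f j)" if ij: "i + 2 \<le> j" "j \<le> m" for i j
    proof
      assume "cell (f i) = cell (f j)"
      then have "(f i, f j) \<in> R" using same fX ij by (simp add: R_def)
      then have "(f i, f j) \<in> R ^^ 1" by simp
      moreover have "(x, f i) \<in> R ^^ i" using seg[of 0 i] f(1) ij by simp
      moreover have "(f j, y) \<in> R ^^ (m - j)" using seg[of j m] f(2) ij by simp
      ultimately have "(x, y) \<in> R ^^ (i + 1 + (m - j))" unfolding relpow_add by blast
      then have "m \<le> i + 1 + (m - j)" by (rule least)
      then show False using ij by linarith
    qed
    have "inj_on (\<lambda>k. cell (f (2 * k))) {0..m div 2}"
    proof (rule inj_onI)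
      fix a b assume ab: "a \<in> {0..m div 2}" "b \<in> {0..m div 2}" "cell (f (2 * a)) = cell (f (2 * b))"
      show "a = b"
      proof (rule ccontr)
        assume "a \<noteq> b"
        then consider "2 * a + 2 \<le> 2 * b" | "2 * b + 2 \<le> 2 * a" by linarith
        moreover have "2 * a \<le> m" "2 * b \<le> m" using ab by auto
        ultimately show False
          using far[of "2 * a" "2 * b"] far[of "2 * b" "2 * a"] ab(3) by cases auto
      qed
    qed
    moreover have "(\<lambda>k. cell (f (2 * k))) ` {0..m div 2} \<subseteq> S" using cell fX by auto
    ultimately have "card {0..m div 2} \<le> card S" using fin by (rule card_inj_on_le)
    then have "m div 2 + 1 \<le> card S" by simp
    then show ?thesis by linarith
  qed simp
  then show ?thesis using f by (intro exI[of _ m] exI[of _ f]) (auto simp: R_def)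
qed

text \<open>The exponents of \<open>P\<close> add up to a partial sum of the geometric series in
  \<open>\<beta>\<close>. Using its limit as the exponent makes the induction close:
  \<open>1 + \<beta> / (1 - \<beta>) = 1 / (1 - \<beta>)\<close>.\<close>

lemma iterate_bound:
  fixes a :: "nat \<Rightarrow> real"
  assumes P: "1 \<le> P" and b: "0 < \<beta>" "\<beta> < 1" and a: "\<And>i. 0 \<le> a i" "\<And>i. i < m \<Longrightarrow> a (Suc i) \<le> P * a i powr \<beta>"
  shows "a m \<le> P powr (1 / (1 - \<beta>)) * a 0 powr (\<beta> ^ m)"
  using a(2)
proof (induction m)
  case 0
  have "1 \<le> P powr (1 / (1 - \<beta>))" using P b by (intro ge_one_powr_ge_zero) auto
  then have "1 * a 0 \<le> P powr (1 / (1 - \<beta>)) * a 0" by (rule mult_right_mono) (rule a(1))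
  then show ?case using a(1)[of 0] by simp
next
  case (Suc m)
  have "a (Suc m) \<le> P * a m powr \<beta>" by (rule Suc.prems) simp
  also have "\<dots> \<le> P * (P powr (1 / (1 - \<beta>)) * a 0 powr (\<beta> ^ m)) powr \<beta>"
    using Suc a(1) b P by (intro mult_left_mono powr_mono2) auto
  also have "\<dots> = P powr 1 * (P powr (1 / (1 - \<beta>) * \<beta>) * a 0 powr (\<beta> ^ m * \<beta>))"
    using P by (simp add: powr_mult powr_powr)
  also have "\<dots> = P powr (1 + 1 / (1 - \<beta>) * \<beta>) * a 0 powr (\<beta> ^ Suc m)" by (simp add: powr_add mult_ac)
  also have "1 + 1 / (1 - \<beta>) * \<beta> = 1 / (1 - \<beta>)" using b by (simp add: field_simps)
  finally show ?case .
qed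

text \<open>Compares the exponent \<open>1 / (80 n^2)\<close> of one step with the universal
  \<open>1 / 80\<close> in \<open>\<eta>(r)\<close>: in logarithms the loss is at most a factor
  \<open>n\<close>, because \<open>n^2 <= 80^(n-1)\<close>.\<close>

lemma log_bound:
  assumes "1 \<le> n" shows "ln (80 * (real n)\<^sup>2) \<le> real n * ln 80"
proof -
  have "(real n)\<^sup>2 \<le> 80 ^ (n - 1)"
    using assms
  proof (induction n rule: dec_induct)
    case (step n)
    have "(real (Suc n))\<^sup>2 \<le> (2 * real n)\<^sup>2" using step by (intro power_mono) auto
    also have "\<dots> \<le> 80 * (real n)\<^sup>2" by (simp add: power_mult_distrib)
    also have "\<dots> \<le> 80 * 80 ^ (n - 1)" using step by simp
    also have "\<dots> = 80 ^ (Suc n - 1)" using step by (cases n) auto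
    finally show ?case .
  qed simp
  then have "80 * (real n)\<^sup>2 \<le> 80 * 80 ^ (n - 1)" by simp
  also have "\<dots> = 80 ^ n" using assms by (cases n) auto
  finally have "ln (80 * (real n)\<^sup>2) \<le> ln (80 ^ n)" using assms by (subst ln_le_cancel_iff) auto
  then show ?thesis by (simp add: ln_realpow)
qed

text \<open>Pays for the factor \<open>n\<close> of \<open>log_bound\<close>. For
  \<open>A >= 10\<close> the number of cells per axis is at most \<open>3 A / 5\<close> instead of
  the \<open>2 A\<close> allowed, and the gain \<open>(10/3)^n\<close> exceeds \<open>4 n\<close>
  from \<open>n = 3\<close> on.\<close>

lemma count_bound:
  fixes A :: real assumes n: "3 \<le> n" and A: "10 \<le> A"
  shows "2 * (A / 2 + 1) ^ n * real n \<le> 2 ^ (n - 1) * A ^ n"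
proof -
  have *: "4 * real n \<le> (10 / 3) ^ n" using n
  proof (induction n rule: dec_induct)
    case base show ?case by (simp add: power3_eq_cube)
  next
    case (step n)
    have "4 * real (Suc n) \<le> 10 / 3 * (4 * real n)" using step by simp
    also have "\<dots> \<le> 10 / 3 * (10 / 3) ^ n" using step by (intro mult_left_mono) auto
    finally show ?case by simp
  qed
  have "(A / 2 + 1) ^ n \<le> (3 / 5 * A) ^ n" using A by (intro power_mono) auto
  then have "2 * (A / 2 + 1) ^ n * real n \<le> 2 * (3 / 5 * A) ^ n * real n" by (intro mult_right_mono) auto
  also have "\<dots> = (1 / 2) * (4 * real n) * ((3 / 5) ^ n * A ^ n)" unfolding power_mult_distrib by simp
  also have "\<dots> \<le> (1 / 2) * (10 / 3) ^ n * ((3 / 5) ^ n * A ^ n)"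
    using * A by (intro mult_right_mono mult_left_mono) auto
  also have "\<dots> = (1 / 2) * (10 / 3 * (3 / 5)) ^ n * A ^ n" unfolding power_mult_distrib by (simp only: mult_ac)
  also have "\<dots> = (1 / 2) * 2 ^ n * A ^ n" by simp
  also have "(1 / 2) * (2::real) ^ n = 2 ^ (n - 1)" using n by (cases n) auto
  finally show ?thesis .
qed

lemma root_le_2: "1 \<le> n \<Longrightarrow> real n powr (1 / real n) \<le> 2"
proof -
  assume n: "1 \<le> n"
  have "real n \<le> 2 ^ n" using of_nat_less_two_power[of n, where 'a = real] by simp
  then have "real n powr (1 / real n) \<le> (2 ^ n) powr (1 / real n)" using n by (intro powr_mono2) auto
  also have "(2::real) ^ n = 2 powr real n" by (simp add: powr_realpow)
  also have "(2 powr real n) powr (1 / real n) = 2" unfolding powr_powr using n by simp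
  finally show ?thesis .
qed

text \<open>Raising the three-ball inequality to the power \<open>1 / n\<close> makes its constant independent of the dimension;
  the exponent deteriorates, but only polynomially in \<open>n\<close>.\<close>

lemma dimension_free:
  fixes X a B :: real
  assumes n: "3 \<le> n" and X: "0 \<le> X" "X \<le> 1" and a: "0 \<le> a" and B: "1 \<le> B"
    and le: "X \<le> (B * real n) * a powr (1 / (80 * real n))"
  shows "X \<le> 2 * B * a powr (1 / (80 * (real n)\<^sup>2))"
proof (cases "X = 0")
  case False
  then have X0: "0 < X" using X by simp
  define t where "t = 1 / real n"
  have t: "0 < t" "t \<le> 1" using n by (auto simp: t_def)
  \<comment> \<open>The root goes in the right direction because \<open>X <= 1\<close>.\<close>
  have "X powr 1 \<le> X powr t" using t X by (intro powr_mono') auto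
  then have "X \<le> X powr t" using X0 by simp
  also have "\<dots> \<le> ((B * real n) * a powr (1 / (80 * real n))) powr t" using le t X by (intro powr_mono2) auto
  also have "\<dots> = B powr t * real n powr t * a powr (1 / (80 * (real n)\<^sup>2))"
    using B n a by (simp add: powr_mult powr_powr t_def power2_eq_square mult_ac)
  also have "\<dots> \<le> B * 2 * a powr (1 / (80 * (real n)\<^sup>2))"
  proof (intro mult_right_mono mult_mono)
    have "B powr t \<le> B powr 1" using B t by (intro powr_mono) auto
    then show "B powr t \<le> B" using B by simp
    show "real n powr t \<le> 2" unfolding t_def by (rule root_le_2) (use n in simp)
  qed (use B in auto)
  finally show ?thesis by (simp add: mult_ac)
qed (use B in simp)


subsection \<open>The main estimate\<close>

lemma annulus_ball: "0 < r \<Longrightarrow> 0 < c \<Longrightarrow> annulus n z r {..<c\<^sup>2} = Rn_ball n z (c * r)"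
  by (auto simp: annulus_def Rn_ball_sq_dist power_mult_distrib divide_less_eq)

lemma Lp_norm_ball:
  assumes "0 < r" "0 < c" shows "Lp_norm n 2 (Rn_ball n z (c * r)) u = normLq (leb n) 2 (restr n z r {..<c\<^sup>2} u)"
  unfolding restr_def[abs_def] annulus_ball[OF assms] by (rule Lp_norm_normLq) simp

text \<open>The cube contains the segment from \<open>x\<close> by \<open>3 r\<close> in both
  directions of the first axis, so its side is at least \<open>6 r\<close>; this makes the number of
  cells per axis large enough for \<open>count_bound\<close>. The side is also the
  \<open>n\<close>-th root of the volume.\<close>

lemma cube_side:
  assumes n: "3 \<le> n" and Q: "closed_cube n Q" and O: "\<Omega> \<subseteq> Q" and r: "0 < r" and x: "x \<in> Rn n" "clball n x (16 * r\<^sup>2) \<subseteq> \<Omega>"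
  shows "\<exists>a s. 6 * r \<le> s \<and> (\<forall>y\<in>\<Omega>. \<forall>i<n. a i \<le> y i \<and> y i \<le> a i + s) \<and> measure (leb n) Q powr (1 / real n) = s"
proof -
  obtain a s where s: "0 < s" and Qeq: "Q = {x \<in> Rn n. \<forall>i<n. a i \<le> x i \<and> x i \<le> a i + s}"
    using Q by (auto simp: closed_cube_def)
  have n0: "0 < n" using n by simp
  have mem: "x(0 := x 0 + t) \<in> Q" if "\<bar>t\<bar> \<le> 4 * r" for t
  proof -
    have "sq_dist n x (x(0 := x 0 + t)) = (\<Sum>j<n. if j = 0 then t\<^sup>2 else 0)" unfolding sq_dist_def by (rule sum.cong) auto
    also have "\<dots> = t\<^sup>2" using n0 by simp
    also have "\<dots> \<le> (4 * r)\<^sup>2" using that r by (metis abs_le_square_iff abs_of_nonneg less_eq_real_def mult_nonneg_nonneg zero_le_numeral)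
    finally have "x(0 := x 0 + t) \<in> clball n x (16 * r\<^sup>2)" using x(1) n0 by (simp add: clball_def power_mult_distrib)
    then show ?thesis using x(2) O by blast
  qed
  have "x 0 + 3 * r \<le> a 0 + s" "a 0 \<le> x 0 - 3 * r"
    using mem[of "3 * r"] mem[of "- 3 * r"] r n0 unfolding Qeq by auto
  then have s6: "6 * r \<le> s" by linarith
  have "Q = (\<Pi>\<^sub>E i\<in>{..<n}. {a i..a i + s})" unfolding Qeq
    by (rule set_eqI) (simp only: PiE_Rn mem_Collect_eq atLeastAtMost_iff)
  then have "emeasure (leb n) Q = ennreal (s ^ n)" using s by (simp add: emeasure_leb_box)
  then have "measure (leb n) Q = s ^ n" using s by (simp add: measure_def)
  also have "\<dots> = s powr real n" by (rule powr_realpow[OF s, symmetric])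
  finally have "measure (leb n) Q powr (1 / real n) = s" using s n by (simp add: powr_powr)
  then show ?thesis using s6 O unfolding Qeq by blast
qed

theorem theorem4p2:
  shows "\<exists>k \<alpha> :: real. k \<ge> 1 \<and> 0 < \<alpha> \<and> \<alpha> < 1 \<and>
    (\<forall>(n::nat) \<Omega> r\<^sub>0 Q \<theta>.
       n \<ge> 3 \<and> bounded_lipschitz_domain n \<Omega> \<and>
       0 < r\<^sub>0 \<and> r\<^sub>0 \<le> 1 \<and>
       (\<forall>r. 0 < r \<and> r < r\<^sub>0 \<longrightarrow>
          inner_part n \<Omega> r \<noteq> {} \<and> connectedin (powertop_real {..<n}) (inner_part n \<Omega> r)) \<and>
       smallest_cube n \<Omega> Q \<and>
       \<theta> \<ge> 1 \<and> carleman_const n \<theta> \<longrightarrow>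
       (\<forall>r x y V u.
          0 < r \<and> r < r\<^sub>0 / 4 \<and>
          x \<in> inner_part n \<Omega> (4 * r) \<and> y \<in> inner_part n \<Omega> (4 * r) \<and>
          V \<in> potentials n \<Omega> \<theta> \<and>
          u \<in> sobolev n 2 (exp_p n) \<Omega> \<and>
          (\<exists>F. weak_laplacian n \<Omega> u F \<and>
               (AE z in leb n. z \<in> \<Omega> \<longrightarrow> - F z + V z * u z = 0)) \<and>
          Lp_norm n 2 \<Omega> u = 1 \<longrightarrow>
          Lp_norm n 2 (Rn_ball n y r) u
            \<le> (q_const n \<Omega> \<theta> k V / r) powr (1 / (1 - \<alpha>)) *
               Lp_norm n 2 (Rn_ball n x r) u
                 powr eta n \<alpha> r\<^sub>0 (measure (leb n) Q powr (1 / real n)) r))"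
proof -
  obtain K h1 h2 h3 where cut: "cutoffs K h1 h2 h3" using cutoffs_exist by blast
  then have K: "1 \<le> K" by (simp add: cutoffs_def)
  \<comment> \<open>\<open>55296 = 2 * 4 * 6912\<close>: the constant of \<open>three_ball\<close>,
    the factor 4 of \<open>optimize_exponent\<close> and the factor 2 of
    \<open>dimension_free\<close>.\<close>
  define k where "k = 55296 * K\<^sup>2"
  \<comment> \<open>An upper bound for the exponent of one step in any dimension, chosen as the
    numerical part of \<open>1 / (80 n^2)\<close>.\<close>
  define \<alpha> where "\<alpha> = (1 / 80 :: real)"
  have K2: "1 \<le> K\<^sup>2" using K by simp
  have k1: "1 \<le> k" using K2 by (simp add: k_def)
  have main: "Lp_norm n 2 (Rn_ball n y r) u \<le> (q_const n \<Omega> \<theta> k V / r) powr (1 / (1 - \<alpha>)) *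
               Lp_norm n 2 (Rn_ball n x r) u powr eta n \<alpha> r\<^sub>0 (measure (leb n) Q powr (1 / real n)) r"
    if n: "n \<ge> 3" and dom: "bounded_lipschitz_domain n \<Omega>" and r0: "0 < r\<^sub>0" "r\<^sub>0 \<le> 1"
      and con: "\<And>r. 0 < r \<Longrightarrow> r < r\<^sub>0 \<Longrightarrow> connectedin (powertop_real {..<n}) (inner_part n \<Omega> r)"
      and Q: "smallest_cube n \<Omega> Q" and th: "\<theta> \<ge> 1" and C: "carleman_const n \<theta>"
      and r: "0 < r" "r < r\<^sub>0 / 4" and xy: "x \<in> inner_part n \<Omega> (4 * r)" "y \<in> inner_part n \<Omega> (4 * r)"
      and V: "V \<in> potentials n \<Omega> \<theta>" and u: "u \<in> sobolev n 2 (exp_p n) \<Omega>"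
      and F: "weak_laplacian n \<Omega> u F" "AE z in leb n. z \<in> \<Omega> \<longrightarrow> - F z + V z * u z = 0"
      and u1: "Lp_norm n 2 \<Omega> u = 1"
    for n \<Omega> r\<^sub>0 Q \<theta> r x y V u F
  proof -
    have O: "openin (Rtop n) \<Omega>" "\<Omega> \<noteq> {}" using dom by (auto simp: bounded_lipschitz_domain_def)
    have OR: "\<Omega> \<subseteq> Rn n" using openin_subset[OF O(1)] by simp
    have Os: "\<Omega> \<in> sets (leb n)" by (rule openin_measurable[OF O(1)])
    define X where "X = inner_part n \<Omega> (4 * r)"
    have Xcl: "clball n z (16 * r\<^sup>2) \<subseteq> \<Omega>" if "z \<in> X" for z
      using inner_part_clball[of z n \<Omega> "4 * r"] that r by (simp add: X_def power_mult_distrib)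
    have XR: "z \<in> Rn n" if "z \<in> X" for z using that OR by (auto simp: X_def inner_part_def)
    have n0: "0 < real n" using n by simp
    define \<kappa> where "\<kappa> = kappa n \<Omega> V"
    have kap0: "0 \<le> \<kappa>" using n by (simp add: \<kappa>_def kappa_def Lp_norm_def)
    have kap: "2 * (sobolev_const n \<Omega>)\<^sup>2 * \<kappa> < 1" "\<theta> * \<kappa> < 1" using V by (auto simp: potentials_def \<kappa>_def)
    define \<Theta> where "\<Theta> = theta_V n \<Omega> \<theta> V"
    have Th: "1 \<le> \<Theta>"
    proof -
      have "1 - \<theta> * \<kappa> \<le> \<theta>" using th kap0 mult_nonneg_nonneg[of \<theta> \<kappa>] by linarith
      then show ?thesis using kap(2) by (simp add: \<Theta>_def theta_V_def \<kappa>_def[symmetric] le_divide_eq)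
    qed
    have kap1: "0 \<le> kappa1 n \<Omega> V"
      unfolding kappa1_def using sobolev_const_nonneg[OF n O] kap0
      by (intro add_nonneg_nonneg mult_nonneg_nonneg divide_nonneg_nonneg) (auto simp: I_const_def \<kappa>_def)
    \<comment> \<open>The constant of one chain step. As \<open>kappa1\<close> is nonnegative and
      \<open>r\<close> is below 1, it is at most \<open>q / r\<close>.\<close>
    define P where "P = k * \<Theta>"
    have P1: "1 \<le> P" unfolding P_def using mult_mono[OF k1 Th] k1 by simp
    have qP: "P \<le> q_const n \<Omega> \<theta> k V / r"
    proof -
      have "P * 1 \<le> P * (1 + kappa1 n \<Omega> V)" using kap1 P1 by (intro mult_left_mono) auto
      then have "P \<le> q_const n \<Omega> \<theta> k V" by (simp add: q_const_def P_def \<Theta>_def)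
      moreover have "q_const n \<Omega> \<theta> k V * r \<le> q_const n \<Omega> \<theta> k V * 1"
        using calculation P1 r r0 by (intro mult_left_mono) auto
      then have "q_const n \<Omega> \<theta> k V \<le> q_const n \<Omega> \<theta> k V / r" using r by (simp add: le_divide_eq)
      ultimately show ?thesis by linarith
    qed
    define \<beta> where "\<beta> = 1 / (80 * (real n)\<^sup>2)"
    have nsq: "1 \<le> (real n)\<^sup>2" using n by simp
    have "80 \<le> 80 * (real n)\<^sup>2" using nsq by simp
    then have "\<beta> \<le> \<alpha>" unfolding \<beta>_def \<alpha>_def using n0 by (intro divide_left_mono) auto
    moreover have "0 < \<beta>" using n0 by (simp add: \<beta>_def)
    ultimately have \<beta>: "0 < \<beta>" "\<beta> \<le> \<alpha>" "\<beta> < 1" by (auto simp: \<alpha>_def)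
    define U where "U x = indicator \<Omega> x * u x" for x
    have NU: "normLq (leb n) 2 U = 1" using u1 by (simp add: Lp_norm_normLq U_def[abs_def])
    have Um: "U \<in> borel_measurable (leb n)"
    proof -
      have "u \<in> Lp n (exp_p n) \<Omega>" using u by (simp add: numeral_2_eq_2)
      then show ?thesis using Lp_memLq[OF exp_p_props(3)[OF n] Os, of u] by (simp add: memLq_def U_def[abs_def])
    qed
    \<comment> \<open>The normalisation yields square integrability: the norm of a non-integrable
      function would be 0 by convention, not 1.\<close>
    have UL: "memLq (leb n) 2 U"
    proof -
      have "integrable (leb n) (\<lambda>x. \<bar>U x\<bar> powr 2)"
        by (rule ccontr) (use NU in \<open>simp add: normLq_def not_integrable_integral_eq\<close>)
      then show ?thesis using Um by (simp add: memLq_def)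
    qed
    have rsL: "memLq (leb n) 2 (restr n z r I u)" "normLq (leb n) 2 (restr n z r I u) \<le> 1"
      if z: "z \<in> X" and I: "I \<in> sets borel" "I \<subseteq> {..15}" for z I
    proof -
      have "annulus n z r I \<subseteq> \<Omega>"
      proof -
        have "15 * r\<^sup>2 \<le> 16 * r\<^sup>2" by (intro mult_right_mono) auto
        then have "clball n z (15 * r\<^sup>2) \<subseteq> clball n z (16 * r\<^sup>2)" unfolding clball_def by (blast intro: order_trans)
        then show ?thesis using annulus_clball[OF I(2) r(1), of n z] Xcl[OF z] by blast
      qed
      then have eq: "restr n z r I u = restr n z r I U" by (auto simp: restr_def U_def indicator_def fun_eq_iff)
      have "AE w in leb n. \<bar>restr n z r I U w\<bar> \<le> \<bar>U w\<bar>" by (auto simp: restr_def indicator_def)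
      note * = memLq_mono[OF _ UL restr_meas[OF I(1) Um] this]
      show "memLq (leb n) 2 (restr n z r I u)" "normLq (leb n) 2 (restr n z r I u) \<le> 1" unfolding eq using * NU by auto
    qed
    have [simp]: "{..<1::real} \<subseteq> {..15}" "{..<9::real} \<subseteq> {..15}" "{1/2..<9::real} \<subseteq> {..15}" by auto
    define N1 where "N1 z = normLq (leb n) 2 (restr n z r {..<1} u)" for z
    have N1: "Lp_norm n 2 (Rn_ball n z r) u = N1 z" for z using Lp_norm_ball[OF r(1), of 1 n z u] by (simp add: N1_def)
    have N1b: "0 \<le> N1 z" "z \<in> X \<Longrightarrow> N1 z \<le> 1" for z using rsL(2)[of z "{..<1}"] by (auto simp: N1_def)
    \<comment> \<open>The ball of radius \<open>r\<close> about \<open>w\<close> lies in the ball of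
      radius \<open>3 r\<close> about \<open>z\<close>, whose norm \<open>N9\<close> is estimated by
      the three-ball inequality centred at \<open>z\<close>.\<close>
    have step: "N1 w \<le> P * N1 z powr \<beta>" if z: "z \<in> X" and w: "w \<in> X" and zw: "Rn_dist n z w < 2 * r" for z w
    proof -
      define N9 where "N9 = normLq (leb n) 2 (restr n z r {..<9} u)"
      have L9: "memLq (leb n) 2 (restr n z r {..<9} u)" "N9 \<le> 1" using rsL[OF z, of "{..<9}"] by (auto simp: N9_def)
      have "N1 w \<le> N9" unfolding N1_def N9_def
      proof (rule memLq_mono(2)[OF _ L9(1)])
        show "restr n w r {..<1} u \<in> borel_measurable (leb n)" using rsL(1)[OF w, of "{..<1}"] by (simp add: memLq_def)
        have "Rn_ball n w r \<subseteq> Rn_ball n z (3 * r)"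
        proof
          fix v assume v: "v \<in> Rn_ball n w r"
          then show "v \<in> Rn_ball n z (3 * r)" using Rn_dist_triangle[of n z v w] zw by (auto simp: Rn_ball_def)
        qed
        then have "annulus n w r {..<1} \<subseteq> annulus n z r {..<9}" using annulus_ball[OF r(1), of 1 n w] annulus_ball[OF r(1), of 3 n z] by simp
        then show "AE x in leb n. \<bar>restr n w r {..<1} u x\<bar> \<le> \<bar>restr n z r {..<9} u x\<bar>"
          by (intro AE_I2) (auto simp: restr_def indicator_def)
      qed simp
      moreover have "N9 \<le> 2 * (27648 * K\<^sup>2 * \<Theta>) * N1 z powr (1 / (80 * (real n)\<^sup>2))"
      proof (rule dimension_free[OF n])
        show "1 \<le> 27648 * K\<^sup>2 * \<Theta>" using mult_mono[OF K2 Th] by simp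
        define A where "A = 6912 * real n * K\<^sup>2 * \<Theta>"
        have "1 * 1 \<le> (6912 * real n) * (K\<^sup>2 * \<Theta>)" using n mult_mono[OF K2 Th] by (intro mult_mono) auto
        then have A1: "1 \<le> A" by (simp add: A_def mult_ac)
        have "N9 \<le> 4 * A * N1 z powr (1 / (80 * real n))"
        proof (rule optimize_exponent[OF n L9(2) _ _ A1])
          fix m :: nat
          define l where "l = real m + (real n - 1) / 2"
          \<comment> \<open>The three-ball inequality controls only \<open>1/2 <= t < 9\<close>; the
            rest of the ball is inside \<open>t < 1\<close>. This accounts for the additional
            summand in \<open>optimize_exponent\<close>.\<close>
          have "N9 \<le> normLq (leb n) 2 (\<lambda>x. \<bar>restr n z r {..<1} u x\<bar> + \<bar>restr n z r {1/2..<9} u x\<bar>)"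
            unfolding N9_def
          proof (rule memLq_mono(2))
            show "memLq (leb n) 2 (\<lambda>x. \<bar>restr n z r {..<1} u x\<bar> + \<bar>restr n z r {1/2..<9} u x\<bar>)"
              using rsL(1)[OF z, of "{..<1}"] rsL(1)[OF z, of "{1/2..<9}"] by (intro Minkowski(1) memLq_abs) auto
            show "restr n z r {..<9} u \<in> borel_measurable (leb n)" using L9(1) by (simp add: memLq_def)
            have "{..<9::real} \<subseteq> {..<1} \<union> {1/2..<9}" by auto
            then have "annulus n z r {..<9} \<subseteq> annulus n z r {..<1} \<union> annulus n z r {1/2..<9}" unfolding annulus_def by blast
            then show "AE x in leb n. \<bar>restr n z r {..<9} u x\<bar> \<le> \<bar>\<bar>restr n z r {..<1} u x\<bar> + \<bar>restr n z r {1/2..<9} u x\<bar>\<bar>"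
              by (intro AE_I2) (auto simp: restr_def indicator_def)
          qed simp
          also have "\<dots> \<le> N1 z + normLq (leb n) 2 (restr n z r {1/2..<9} u)"
            using Minkowski(2)[of 2 "leb n" "\<lambda>x. \<bar>restr n z r {..<1} u x\<bar>" "\<lambda>x. \<bar>restr n z r {1/2..<9} u x\<bar>"]
              memLq_abs[OF rsL(1)[OF z, of "{..<1}"]] memLq_abs[OF rsL(1)[OF z, of "{1/2..<9}"]] by (auto simp: normLq_abs N1_def)
          also have "normLq (leb n) 2 (restr n z r {1/2..<9} u) \<le> A * (6 powr l * N1 z + (3 / sqrt 10) powr l * normLq (leb n) 2 (restr n z r {..15} u))"
            unfolding A_def \<Theta>_def N1_def
            by (rule three_ball[OF n O C th _ V u F r(1) XR[OF z] Xcl[OF z] cut]) (unfold l_def, rule exponents_mem[OF n])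
          also have "\<dots> \<le> A * (6 powr l * N1 z + (3 / sqrt 10) powr l * 1)"
            using A1 rsL(2)[OF z, of "{..15}"] by (intro mult_left_mono add_left_mono) auto
          finally show "N9 \<le> N1 z + A * (6 powr (real m + (real n - 1) / 2) * N1 z + (3 / sqrt 10) powr (real m + (real n - 1) / 2))"
            by (simp add: l_def)
        qed (use N1b z in auto)
        then show "N9 \<le> (27648 * K\<^sup>2 * \<Theta> * real n) * N1 z powr (1 / (80 * real n))" by (simp add: A_def mult_ac)
      qed (use L9(2) N1b in \<open>auto simp: N9_def\<close>)
      ultimately show ?thesis by (simp add: P_def k_def \<beta>_def)
    qed
    define D where "D = measure (leb n) Q powr (1 / real n)"
    have OQ: "\<Omega> \<subseteq> Q" and Qc: "closed_cube n Q"
      using Q closure_of_subset[of \<Omega> "Rtop n"] OR by (auto simp: smallest_cube_def)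
    have xX: "x \<in> X" and yX: "y \<in> X" using xy by (auto simp: X_def)
    obtain a where D6: "6 * r \<le> D" and a: "\<And>y i. y \<in> \<Omega> \<Longrightarrow> i < n \<Longrightarrow> a i \<le> y i \<and> y i \<le> a i + D"
      using cube_side[OF n Qc OQ r(1) XR[OF xX] Xcl[OF xX]] unfolding D_def by blast
    define A where "A = D * sqrt (real n) / r"
    have A10: "10 \<le> A"
    proof -
      have "sqrt ((5/3)\<^sup>2) \<le> sqrt (real n)" using n by (intro real_sqrt_le_mono) (simp add: power2_eq_square)
      then have s: "5 / 3 \<le> sqrt (real n)" by (simp only: real_sqrt_abs)
      have "(6 * r) * (5 / 3) \<le> D * sqrt (real n)" using D6 r s by (intro mult_mono) auto
      then show ?thesis using r by (simp add: A_def le_divide_eq)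
    qed
    \<comment> \<open>Cubes of side \<open>2 r / sqrt n\<close>, hence of diameter
      \<open>2 r\<close>. The half-open cells given by the floor make the distance of two points of
      one cell strictly smaller than \<open>2 r\<close>.\<close>
    define cell where "cell z = (\<lambda>i\<in>{..<n}. \<lfloor>(z i - a i) * sqrt (real n) / (2 * r)\<rfloor>)" for z
    define S where "S = (\<Pi>\<^sub>E i\<in>{..<n}. {0..\<lfloor>A / 2\<rfloor>})"
    have finS: "finite S" unfolding S_def by (rule finite_PiE) auto
    have cardS: "real (card S) \<le> (A / 2 + 1) ^ n"
    proof -
      have "card S = (nat (\<lfloor>A / 2\<rfloor> + 1)) ^ n" unfolding S_def by (simp add: card_PiE)
      moreover have "real (nat (\<lfloor>A / 2\<rfloor> + 1)) \<le> A / 2 + 1" using A10 of_int_floor_le[of "A / 2"] by (simp add: of_nat_nat)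
      ultimately show ?thesis by (simp add: power_mono)
    qed
    have sn: "0 < sqrt (real n)" using n by simp
    have cellS: "cell z \<in> S" if "z \<in> X" for z
    proof -
      have zO: "z \<in> \<Omega>" using that by (simp add: X_def inner_part_def)
      have "\<lfloor>(z i - a i) * sqrt (real n) / (2 * r)\<rfloor> \<in> {0..\<lfloor>A / 2\<rfloor>}" if i: "i < n" for i
      proof -
        have "0 \<le> (z i - a i) * sqrt (real n) / (2 * r)" using a[OF zO i] r by simp
        moreover have "(z i - a i) * sqrt (real n) / (2 * r) \<le> D * sqrt (real n) / (2 * r)"
          using a[OF zO i] r by (intro divide_right_mono mult_right_mono) auto
        then have "(z i - a i) * sqrt (real n) / (2 * r) \<le> A / 2" by (simp add: A_def)
        ultimately show ?thesis by (auto intro: floor_mono)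
      qed
      then show ?thesis by (auto simp: S_def cell_def)
    qed
    have same: "Rn_dist n z w < 2 * r" if zw: "z \<in> X" "w \<in> X" "cell z = cell w" for z w
    proof -
      have "\<bar>w i - z i\<bar> < 2 * r / sqrt (real n)" if i: "i < n" for i
      proof -
        have "cell z i = cell w i" using zw by simp
        then have "\<lfloor>(z i - a i) * sqrt (real n) / (2 * r)\<rfloor> = \<lfloor>(w i - a i) * sqrt (real n) / (2 * r)\<rfloor>"
          using i by (simp add: cell_def)
        then have "\<bar>(w i - a i) * sqrt (real n) / (2 * r) - (z i - a i) * sqrt (real n) / (2 * r)\<bar> < 1" by linarith
        moreover have "(w i - a i) * sqrt (real n) / (2 * r) - (z i - a i) * sqrt (real n) / (2 * r) = (w i - z i) * (sqrt (real n) / (2 * r))"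
          by (simp add: diff_divide_distrib[symmetric] algebra_simps)
        ultimately have "\<bar>w i - z i\<bar> * (sqrt (real n) / (2 * r)) < 1" using sn r by (simp add: abs_mult)
        then show ?thesis using sn r by (simp add: field_simps)
      qed
      then have "(w i - z i)\<^sup>2 < (2 * r / sqrt (real n))\<^sup>2" if "i < n" for i
        using that by (metis abs_ge_zero power2_abs power_strict_mono zero_less_numeral)
      then have "sq_dist n z w < (\<Sum>i<n. (2 * r / sqrt (real n))\<^sup>2)" unfolding sq_dist_def using n by (intro sum_strict_mono) (auto simp: lessThan_empty_iff)
      also have "\<dots> = (2 * r)\<^sup>2" using n by (simp add: power_divide)
      finally show ?thesis using r sq_dist_less_iff[of "2 * r" n z w] by simp
    qed
    have "connectedin (Rtop n) X" unfolding X_def using con[of "4 * r"] r by simp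
    then have "(x, y) \<in> {(a, b). a \<in> X \<and> b \<in> X \<and> Rn_dist n a b < 2 * r}\<^sup>*"
      by (rule connected_chain) (use r xX yX in auto)
    then have "\<exists>m f. m \<le> 2 * card S \<and> f 0 = x \<and> f m = y \<and>
        (\<forall>i<m. f i \<in> X \<and> f (Suc i) \<in> X \<and> Rn_dist n (f i) (f (Suc i)) < 2 * r)"
      by (rule short_chain[OF _ finS]) (use cellS same in auto)
    then obtain m f where mf: "m \<le> 2 * card S \<and> f 0 = x \<and> f m = y \<and>
        (\<forall>i<m. f i \<in> X \<and> f (Suc i) \<in> X \<and> Rn_dist n (f i) (f (Suc i)) < 2 * r)" by (elim exE) (rule that)
    then have m: "m \<le> 2 * card S" and f: "f 0 = x" "f m = y"
      "\<And>i. i < m \<Longrightarrow> f i \<in> X \<and> f (Suc i) \<in> X \<and> Rn_dist n (f i) (f (Suc i)) < 2 * r" by auto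
    have chain: "N1 y \<le> P powr (1 / (1 - \<beta>)) * N1 x powr (\<beta> ^ m)"
      using iterate_bound[OF P1 \<beta>(1,3), of "\<lambda>i. N1 (f i)" m] f step N1b by auto
    have pre: "P powr (1 / (1 - \<beta>)) \<le> (q_const n \<Omega> \<theta> k V / r) powr (1 / (1 - \<alpha>))"
    proof -
      have "P powr (1 / (1 - \<beta>)) \<le> P powr (1 / (1 - \<alpha>))"
        using P1 \<beta> by (intro powr_mono divide_left_mono) (auto simp: \<alpha>_def)
      also have "\<dots> \<le> (q_const n \<Omega> \<theta> k V / r) powr (1 / (1 - \<alpha>))"
        using P1 qP by (intro powr_mono2) (auto simp: \<alpha>_def)
      finally show ?thesis .
    qed
    \<comment> \<open>In logarithms: \<open>m\<close> times \<open>ln (80 n^2)\<close> is at most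
      \<open>m n ln 80\<close>, and \<open>m n\<close> is at most \<open>2^(n-1) A^n\<close> with
      \<open>A = D sqrt n / r\<close>, which is below the exponent in
      \<open>\<eta>(r)\<close>.\<close>
    have eta_le: "eta n \<alpha> r\<^sub>0 D r \<le> \<beta> ^ m"
    proof -
      have "real m * real n \<le> 2 * real (card S) * real n" using m n by (intro mult_right_mono) auto
      also have "\<dots> \<le> 2 * (A / 2 + 1) ^ n * real n" using cardS by (intro mult_right_mono mult_left_mono) auto
      also have "\<dots> \<le> 2 ^ (n - 1) * A ^ n" by (rule count_bound[OF n A10])
      finally have mn: "real m * real n \<le> 2 ^ (n - 1) * A ^ n" .
      have l80: "0 \<le> ln (80::real)" by simp
      have "real m * ln (80 * (real n)\<^sup>2) \<le> real m * (real n * ln 80)" using log_bound[of n] n by (intro mult_left_mono) auto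
      also have "\<dots> = (real m * real n) * ln 80" by simp
      also have "\<dots> \<le> (2 ^ (n - 1) * A ^ n) * ln 80" using mn l80 by (rule mult_right_mono)
      also have "\<dots> = 2 ^ (n - 1) * ln 80 * (D * sqrt (real n)) ^ n / r ^ n" by (simp add: A_def power_divide)
      also have "\<dots> \<le> 2 ^ (n - 1) * ln 80 * ((r\<^sub>0 / 4) ^ n + (D * sqrt (real n)) ^ n) / r ^ n"
        using r r0 l80 by (intro divide_right_mono mult_left_mono) auto
      also have "\<dots> = h_const n \<alpha> r\<^sub>0 D / r ^ n"
      proof -
        have "\<bar>ln \<alpha>\<bar> = ln 80" using l80 by (simp add: \<alpha>_def ln_div)
        then show ?thesis by (simp add: h_const_def)
      qed
      finally have "- (h_const n \<alpha> r\<^sub>0 D / r ^ n) \<le> - (real m * ln (80 * (real n)\<^sup>2))" by simp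
      then have "eta n \<alpha> r\<^sub>0 D r \<le> exp (- (real m * ln (80 * (real n)\<^sup>2)))" by (simp add: eta_def)
      also have "\<dots> = \<beta> ^ m"
      proof -
        have "exp (- (real m * ln (80 * (real n)\<^sup>2))) = exp (- ln (80 * (real n)\<^sup>2)) ^ m"
          by (simp add: exp_of_nat_mult[symmetric])
        also have "exp (- ln (80 * (real n)\<^sup>2)) = \<beta>" using n by (simp add: exp_minus \<beta>_def inverse_eq_divide)
        finally show ?thesis .
      qed
      finally show ?thesis .
    qed
    \<comment> \<open>The norm on the ball about \<open>x\<close> is at most 1, so a smaller
      exponent gives a larger power.\<close>
    have "N1 x powr (\<beta> ^ m) \<le> N1 x powr eta n \<alpha> r\<^sub>0 D r"
      using eta_le N1b xX by (intro powr_mono') auto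
    then have "N1 y \<le> (q_const n \<Omega> \<theta> k V / r) powr (1 / (1 - \<alpha>)) * N1 x powr eta n \<alpha> r\<^sub>0 D r"
      using chain mult_mono[OF pre] by (smt (verit) powr_ge_zero)
    then show ?thesis by (simp add: N1 D_def)
  qed
  show ?thesis
  proof (rule exI[of _ k], rule exI[of _ \<alpha>], intro conjI allI impI)
    show "1 \<le> k" by (rule k1)
    show "0 < \<alpha>" "\<alpha> < 1" by (auto simp: \<alpha>_def)
  qed (use main in blast)
qed

end
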